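(* There exists a CR structure $J$ on $S^3$, not equivalent to the standard CR structure of $S^3$, such that (with $\theta$ an associated contact form) the CR Yamabe equation $$L_{J,\theta}u = 2u^3$$ has a set of solutions $\{u_k\}_{k\in\mathbf{N}}$ with $\max_{S^3} u_k\to\infty$ as $k\to\infty$.
   Context: A CR structure on a three-dimensional manifold $M$ is a complex line subbundle $\mathscr{H}$ of $TM\otimes\mathbf{C}$ with $\mathscr{H}\cap\overline{\mathscr{H}}=0$. Its Levi distribution is $H(M)=\mathrm{Re}(\mathscr{H}\oplus\overline{\mathscr{H}})$, which carries the complex structure $J(Z+\overline{Z})=i(Z-\overline{Z})$ for $Z\in\mathscr{H}$; for fixed $H(M)$, a CR structure is equivalently a complex structure $J$ on $H(M)$. An associated contact form is a contact form $\theta$ with $\theta|_{H(M)}=0$; it is unique up to multiplication by a nowhere zero function. The standard CR structure on $S^3\subset\mathbf{C}^2$ (with coordinates $w_1,w_2$) is the one induced by the embedding, generated by $W=\overline{w_2}\frac{\partial}{\partial w_1}-\overline{w_1}\frac{\partial}{\partial w_2}$. Two CR structures are equivalent if there is a diffeomorphism carrying one to the other. Given $(J,\theta)$, choose a local generator $Z_1$ of $\mathscr{H}$, write $Z_{\overline 1}=\overline{Z_1}$, and let $T$ be the Reeb field ($\theta(T)=1$, $d\theta(T,\cdot)=0$). Let $(\theta^1,\theta^{\overline 1},\theta)$ be the coframe dual to $(Z_1,Z_{\overline 1},T)$, and let $d\theta=ih_{1\overline 1}\theta^1\wedge\theta^{\overline 1}$ with $h^{1\overline1}=1/h_{1\overline1}$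 and $h_{1\overline 1}>0$. The Tanaka-Webster connection form $\omega_1^1$ is determined by $d\theta^1=\theta^1\wedge\omega_1^1+A^1_{\overline 1}\,\theta\wedge\theta^{\overline 1}$ and $dh_{1\overline 1}=h_{1\overline 1}(\omega_1^1+\omega_{\overline 1}^{\overline 1})$, where $\omega_{\overline 1}^{\overline 1}=\overline{\omega_1^1}$. The Webster curvature $R$ is the scalar obtained by contracting the curvature of this connection twice with the metric, that is $d\omega_1^1\equiv R\,h_{1\overline 1}\theta^1\wedge\theta^{\overline 1} \pmod\theta$. The sublaplacian $\Delta_J$ is the divergence (with respect to the volume form $\theta\wedge d\theta$) of the subriemannian gradient; explicitly $$\Delta_J u=h^{1\overline 1}\left(Z_1Z_{\overline 1}u+Z_{\overline 1}Z_1u-\omega_1^1(Z_{\overline 1})Z_1u-\omega_{\overline 1}^{\overline 1}(Z_1)Z_{\overline 1}u\right).$$ The conformal sublaplacian is $L_{J,\theta}=-4\Delta_J+R$. If $u$ is nowhere zero, the contact form $u^2\theta$ has Webster curvature $u^{-3}L_{J,\theta}u$, so that a nowhere zero solution of $L_{J,\theta}u=2u^3$ gives a contact form of constant Webster curvature $2$. *)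

theory Defs
  imports "HOL-Analysis.Analysis"
begin

section \<open>Smooth calculus on the three-sphere\<close>

text \<open>
  \<open>S\<^sup>3\<close> is the unit sphere of \<open>\<real>\<^sup>4 = \<complex>\<^sup>2\<close>, with \<open>w\<^sub>1 = x\<^sub>1 + i x\<^sub>2\<close> and
  \<open>w\<^sub>2 = x\<^sub>3 + i x\<^sub>4\<close>. Objects on \<open>S\<^sup>3\<close> are total functions on \<open>\<real>\<^sup>4\<close> of which only the
  values on the sphere matter: whatever is differentiated is first replaced by its extension
  \<open>f (sgn x) = f (x / \<bar>x\<bar>)\<close>, constant along rays. The sphere being a retract of
  \<open>\<real>\<^sup>4 - {0}\<close> under the submersion \<open>sgn\<close>, a function on a relatively open set \<open>U\<close> of the sphere
  is smooth iff this extension is smooth on the open cone over \<open>U\<close>, and tangential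
  derivatives do not depend on the choice of the extension.
\<close>

abbreviation S3 :: "(real^4) set" where
  "S3 \<equiv> sphere 0 1"

primrec Ck_on :: "nat \<Rightarrow> ('a::real_normed_vector \<Rightarrow> 'b::real_normed_vector) \<Rightarrow> 'a set \<Rightarrow> bool" where
  "Ck_on 0 f V \<longleftrightarrow> continuous_on V f"
| "Ck_on (Suc n) f V \<longleftrightarrow> (\<forall>x\<in>V. f differentiable (at x)) \<and>
     (\<forall>v. Ck_on n (\<lambda>x. frechet_derivative f (at x) v) V)"

text \<open>To be used with open \<open>V\<close>.\<close>

definition smooth_on :: "('a::real_normed_vector \<Rightarrow> 'b::real_normed_vector) \<Rightarrow> 'a set \<Rightarrow> bool" where
  "smooth_on f V \<longleftrightarrow> (\<forall>n. Ck_on n f V)"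

definition open_S3 :: "(real^4) set \<Rightarrow> bool" where
  "open_S3 U \<longleftrightarrow> openin (top_of_set S3) U"

definition smooth_S3 :: "(real^4 \<Rightarrow> 'b::real_normed_vector) \<Rightarrow> (real^4) set \<Rightarrow> bool" where
  "smooth_S3 f U \<longleftrightarrow> smooth_on (\<lambda>x. f (sgn x)) {x. x \<noteq> 0 \<and> sgn x \<in> U}"

definition cvec :: "real^'n \<Rightarrow> complex^'n" where
  "cvec v = (\<chi> i. complex_of_real (v $ i))"

definition cnjv :: "complex^'n \<Rightarrow> complex^'n" where
  "cnjv v = (\<chi> i. cnj (v $ i))"

text \<open>
  Complex-bilinear pairing of a covector with a vector (both given by their components in the
  standard coordinates of \<open>\<real>\<^sup>4\<close>).
\<close>

definition pairing :: "complex^'n \<Rightarrow> complex^'n \<Rightarrow> complex" where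
  "pairing \<alpha> v = (\<Sum>i\<in>UNIV. \<alpha> $ i * v $ i)"

text \<open>Complexified tangent space of \<open>S\<^sup>3\<close> at \<open>p\<close>.\<close>

definition CT :: "real^4 \<Rightarrow> (complex^4) set" where
  "CT p = {v. pairing (cvec p) v = 0}"

text \<open>Derivative of \<open>f\<close> at \<open>p\<close> in the direction of a complex tangent vector, extended
  complex-linearly in the direction.\<close>

definition dirD :: "(real^4 \<Rightarrow> complex) \<Rightarrow> real^4 \<Rightarrow> complex^4 \<Rightarrow> complex" where
  "dirD f p v = (\<Sum>j\<in>UNIV. v $ j * frechet_derivative (\<lambda>x. f (sgn x)) (at p) (axis j 1))"

definition dirD_vec :: "(real^4 \<Rightarrow> complex^4) \<Rightarrow> real^4 \<Rightarrow> complex^4 \<Rightarrow> complex^4" where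
  "dirD_vec F p v = (\<chi> i. dirD (\<lambda>x. F x $ i) p v)"

definition vf_apply :: "(real^4 \<Rightarrow> complex^4) \<Rightarrow> (real^4 \<Rightarrow> complex) \<Rightarrow> (real^4 \<Rightarrow> complex)" where
  "vf_apply Z f = (\<lambda>p. dirD f p (Z p))"

text \<open>
  A complex 1-form on (an open set of) \<open>S\<^sup>3\<close> is the restriction of \<open>\<Sum>\<^sub>i \<alpha>\<^sub>i dx\<^sub>i\<close>, represented by
  its coefficients; coefficients that pair equally with tangent vectors give the same form. As
  the exterior derivative commutes with restriction to the sphere, \<open>ext_d \<alpha> p\<close> on \<open>CT p\<close> depends
  only on the form. Conventions: \<open>d\<alpha>(X,Y) = X(\<alpha>(Y)) - Y(\<alpha>(X)) - \<alpha>([X,Y])\<close> and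
  \<open>(\<alpha>\<and>\<beta>)(X,Y) = \<alpha>(X)\<beta>(Y) - \<alpha>(Y)\<beta>(X)\<close>, without factors of one half.
\<close>

definition ext_d :: "(real^4 \<Rightarrow> complex^4) \<Rightarrow> real^4 \<Rightarrow> complex^4 \<Rightarrow> complex^4 \<Rightarrow> complex" where
  "ext_d \<alpha> p v w = pairing (dirD_vec \<alpha> p v) w - pairing (dirD_vec \<alpha> p w) v"

definition wedge :: "complex^4 \<Rightarrow> complex^4 \<Rightarrow> complex^4 \<Rightarrow> complex^4 \<Rightarrow> complex" where
  "wedge \<alpha> \<beta> v w = pairing \<alpha> v * pairing \<beta> w - pairing \<alpha> w * pairing \<beta> v"

definition diffeo_S3 :: "(real^4 \<Rightarrow> real^4) \<Rightarrow> bool" where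
  "diffeo_S3 \<phi> \<longleftrightarrow> smooth_S3 \<phi> S3 \<and> \<phi> ` S3 \<subseteq> S3 \<and>
     (\<exists>\<psi>. smooth_S3 \<psi> S3 \<and> \<psi> ` S3 \<subseteq> S3 \<and> (\<forall>p\<in>S3. \<psi> (\<phi> p) = p \<and> \<phi> (\<psi> p) = p))"

section \<open>CR structures and contact forms\<close>

definition local_generator ::
  "(real^4 \<Rightarrow> (complex^4) set) \<Rightarrow> (real^4) set \<Rightarrow> (real^4 \<Rightarrow> complex^4) \<Rightarrow> bool" where
  "local_generator H U Z \<longleftrightarrow> open_S3 U \<and> smooth_S3 Z U \<and>
     (\<forall>p\<in>U. Z p \<in> CT p \<and> Z p \<noteq> 0 \<and> H p = vec.span {Z p})"

text \<open>
  A CR structure is given by its bundle \<open>H\<close>; the complex structure \<open>J\<close> on the Levi distribution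
  is recovered by \<open>J (Z + cnj Z) = i (Z - cnj Z)\<close>, so \<open>(J, \<theta>)\<close> is rendered as \<open>(H, \<theta>)\<close>.
\<close>

definition CR_structure :: "(real^4 \<Rightarrow> (complex^4) set) \<Rightarrow> bool" where
  "CR_structure H \<longleftrightarrow>
     (\<forall>p\<in>S3. \<exists>U Z. p \<in> U \<and> local_generator H U Z) \<and>
     (\<forall>p\<in>S3. H p \<inter> cnjv ` H p = {0})"

definition CR_equivalent ::
  "(real^4 \<Rightarrow> (complex^4) set) \<Rightarrow> (real^4 \<Rightarrow> (complex^4) set) \<Rightarrow> bool" where
  "CR_equivalent H H' \<longleftrightarrow>
     (\<exists>\<phi>. diffeo_S3 \<phi> \<and> (\<forall>p\<in>S3. dirD_vec (\<lambda>x. cvec (\<phi> x)) p ` H p = H' (\<phi> p)))"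

definition w1 :: "real^4 \<Rightarrow> complex" where "w1 p = Complex (p $ 1) (p $ 2)"
definition w2 :: "real^4 \<Rightarrow> complex" where "w2 p = Complex (p $ 3) (p $ 4)"

text \<open>\<open>\<partial>/\<partial>w\<^sub>1 = 1/2 (\<partial>\<^sub>1 - i \<partial>\<^sub>2)\<close> and \<open>\<partial>/\<partial>w\<^sub>2 = 1/2 (\<partial>\<^sub>3 - i \<partial>\<^sub>4)\<close>.\<close>

definition del_w1 :: "complex^4" where "del_w1 = axis 1 (1/2) - axis 2 (\<i>/2)"
definition del_w2 :: "complex^4" where "del_w2 = axis 3 (1/2) - axis 4 (\<i>/2)"

definition std_CR :: "real^4 \<Rightarrow> (complex^4) set" where
  "std_CR p = vec.span {cnj (w2 p) *s del_w1 - cnj (w1 p) *s del_w2}"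

definition Levi_distribution :: "(real^4 \<Rightarrow> (complex^4) set) \<Rightarrow> real^4 \<Rightarrow> (real^4) set" where
  "Levi_distribution H p = {v. \<exists>Z\<in>H p. \<exists>W\<in>H p. cvec v = Z + cnjv W}"

text \<open>A real 1-form is given by real coefficients. The last clause is \<open>(\<theta> \<and> d\<theta>)\<^sub>p \<noteq> 0\<close>.\<close>

definition contact_form :: "(real^4 \<Rightarrow> real^4) \<Rightarrow> bool" where
  "contact_form \<theta> \<longleftrightarrow> smooth_S3 \<theta> S3 \<and>
     (\<forall>p\<in>S3. \<exists>u\<in>CT p. \<exists>v\<in>CT p. \<exists>w\<in>CT p.
        pairing (cvec (\<theta> p)) u * ext_d (\<lambda>x. cvec (\<theta> x)) p v w
      + pairing (cvec (\<theta> p)) v * ext_d (\<lambda>x. cvec (\<theta> x)) p w u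
      + pairing (cvec (\<theta> p)) w * ext_d (\<lambda>x. cvec (\<theta> x)) p u v \<noteq> 0)"

definition associated_contact_form ::
  "(real^4 \<Rightarrow> (complex^4) set) \<Rightarrow> (real^4 \<Rightarrow> real^4) \<Rightarrow> bool" where
  "associated_contact_form H \<theta> \<longleftrightarrow> contact_form \<theta> \<and>
     (\<forall>p\<in>S3. \<forall>v\<in>Levi_distribution H p. \<theta> p \<bullet> v = 0)"

text \<open>
  The requirement \<open>h > 0\<close> in \<open>d\<theta> = i h \<theta>\<^sup>1 \<and> cnj \<theta>\<^sup>1\<close>. It fixes the sign of an associated
  contact form, and does not depend on the generator.
\<close>

definition Levi_positive ::
  "(real^4 \<Rightarrow> (complex^4) set) \<Rightarrow> (real^4 \<Rightarrow> real^4) \<Rightarrow> bool" where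
  "Levi_positive H \<theta> \<longleftrightarrow> (\<forall>p\<in>S3. \<forall>Z\<in>H p. Z \<noteq> 0 \<longrightarrow>
     (\<exists>h>0. ext_d (\<lambda>x. cvec (\<theta> x)) p Z (cnjv Z) = \<i> * complex_of_real h))"

section \<open>Tanaka-Webster connection, Webster curvature and conformal sublaplacian\<close>

definition Reeb_field ::
  "(real^4 \<Rightarrow> real^4) \<Rightarrow> (real^4) set \<Rightarrow> (real^4 \<Rightarrow> real^4) \<Rightarrow> bool" where
  "Reeb_field \<theta> U T \<longleftrightarrow> smooth_S3 T U \<and>
     (\<forall>p\<in>U. cvec (T p) \<in> CT p \<and> \<theta> p \<bullet> T p = 1 \<and>
        (\<forall>v\<in>CT p. ext_d (\<lambda>x. cvec (\<theta> x)) p (cvec (T p)) v = 0))"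

text \<open>
  \<open>Z\<close> is a generator of \<open>H\<close> on \<open>U\<close>, \<open>h\<close> is \<open>h\<^sub>1\<^sub>1\<close> (second index barred), \<open>\<theta>1\<close> the form dual to
  \<open>Z\<close> in the frame \<open>(Z, cnj Z, T)\<close>, \<open>\<omega>\<close> the connection form and \<open>A\<close> the torsion coefficient.
  The conjugate of a form has the conjugate coefficients. The forms dual to \<open>cnj Z\<close> and \<open>T\<close> are
  \<open>cnj \<theta>1\<close> and \<open>\<theta>\<close>.
\<close>

definition Tanaka_Webster ::
  "(real^4 \<Rightarrow> (complex^4) set) \<Rightarrow> (real^4 \<Rightarrow> real^4) \<Rightarrow> (real^4) set \<Rightarrow> (real^4 \<Rightarrow> complex^4) \<Rightarrow>
   (real^4 \<Rightarrow> complex^4) \<Rightarrow> (real^4 \<Rightarrow> real) \<Rightarrow> (real^4 \<Rightarrow> complex^4) \<Rightarrow> bool" where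
  "Tanaka_Webster H \<theta> U Z \<theta>1 h \<omega> \<longleftrightarrow>
     local_generator H U Z \<and> smooth_S3 \<theta>1 U \<and> smooth_S3 h U \<and> smooth_S3 \<omega> U \<and>
     (\<exists>T. Reeb_field \<theta> U T \<and>
        (\<forall>p\<in>U. pairing (\<theta>1 p) (Z p) = 1 \<and> pairing (\<theta>1 p) (cnjv (Z p)) = 0 \<and>
               pairing (\<theta>1 p) (cvec (T p)) = 0)) \<and>
     (\<forall>p\<in>U. h p > 0 \<and>
        (\<forall>v\<in>CT p. \<forall>w\<in>CT p. ext_d (\<lambda>x. cvec (\<theta> x)) p v w
            = \<i> * complex_of_real (h p) * wedge (\<theta>1 p) (cnjv (\<theta>1 p)) v w)) \<and>
     (\<exists>A. smooth_S3 A U \<and> (\<forall>p\<in>U. \<forall>v\<in>CT p. \<forall>w\<in>CT p.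
        ext_d \<theta>1 p v w = wedge (\<theta>1 p) (\<omega> p) v w
            + A p * wedge (cvec (\<theta> p)) (cnjv (\<theta>1 p)) v w)) \<and>
     (\<forall>p\<in>U. \<forall>v\<in>CT p. dirD (\<lambda>x. complex_of_real (h x)) p v
        = complex_of_real (h p) * (pairing (\<omega> p) v + pairing (cnjv (\<omega> p)) v))"

text \<open>
  The two scalars below do not depend on the local generator: if \<open>Z\<close> is replaced by \<open>f Z\<close>, then
  \<open>h\<close> becomes \<open>\<bar>f\<bar>\<^sup>2 h\<close> and \<open>\<omega>\<close> becomes \<open>\<omega> + df/f\<close>. Both are real. The term \<open>\<beta> \<and> \<theta>\<close>
  expresses the congruence modulo \<open>\<theta>\<close>.
\<close>

definition Webster_curvature ::
  "(real^4 \<Rightarrow> (complex^4) set) \<Rightarrow> (real^4 \<Rightarrow> real^4) \<Rightarrow> real^4 \<Rightarrow> real" where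
  "Webster_curvature H \<theta> p = (THE R. \<exists>U Z \<theta>1 h \<omega> \<beta>. p \<in> U \<and> Tanaka_Webster H \<theta> U Z \<theta>1 h \<omega> \<and>
     (\<forall>v\<in>CT p. \<forall>w\<in>CT p. ext_d \<omega> p v w
        = complex_of_real R * complex_of_real (h p) * wedge (\<theta>1 p) (cnjv (\<theta>1 p)) v w
        + wedge \<beta> (cvec (\<theta> p)) v w))"

definition sublaplacian ::
  "(real^4 \<Rightarrow> (complex^4) set) \<Rightarrow> (real^4 \<Rightarrow> real^4) \<Rightarrow> (real^4 \<Rightarrow> real) \<Rightarrow> real^4 \<Rightarrow> real" where
  "sublaplacian H \<theta> u p = (THE r. \<exists>U Z \<theta>1 h \<omega>. p \<in> U \<and> Tanaka_Webster H \<theta> U Z \<theta>1 h \<omega> \<and>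
     (let Zb = (\<lambda>x. cnjv (Z x)); uc = (\<lambda>x. complex_of_real (u x)) in
      complex_of_real r = 1 / complex_of_real (h p) *
        (vf_apply Z (vf_apply Zb uc) p + vf_apply Zb (vf_apply Z uc) p
         - pairing (\<omega> p) (Zb p) * vf_apply Z uc p
         - pairing (cnjv (\<omega> p)) (Z p) * vf_apply Zb uc p)))"

definition conformal_sublaplacian ::
  "(real^4 \<Rightarrow> (complex^4) set) \<Rightarrow> (real^4 \<Rightarrow> real^4) \<Rightarrow> (real^4 \<Rightarrow> real) \<Rightarrow> real^4 \<Rightarrow> real" where
  "conformal_sublaplacian H \<theta> u p = - 4 * sublaplacian H \<theta> u p + Webster_curvature H \<theta> p * u p"

definition CR_Yamabe_solution ::
  "(real^4 \<Rightarrow> (complex^4) set) \<Rightarrow> (real^4 \<Rightarrow> real^4) \<Rightarrow> (real^4 \<Rightarrow> real) \<Rightarrow> bool" where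
  "CR_Yamabe_solution H \<theta> u \<longleftrightarrow> smooth_S3 u S3 \<and>
     (\<forall>p\<in>S3. conformal_sublaplacian H \<theta> u p = 2 * u p ^ 3)"

end

theory Submission
  imports Defs
begin

text \<open>
  Rotating \<open>w\<^sub>1\<close> and \<open>w\<^sub>2\<close> gives an action of a torus on the sphere, with generators \<open>\<partial>\<^sub>1\<close> and
  \<open>\<partial>\<^sub>2\<close>; its orbits are the tori on which \<open>s = \<bar>w\<^sub>1\<bar>\<^sup>2\<close> is constant, with \<open>s\<close> in \<open>[0, 1]\<close>. Away
  from the two circles \<open>w\<^sub>1 w\<^sub>2 = 0\<close>, the vector field \<open>2 s (1 - s) \<partial>\<^sub>s - i (g \<partial>\<^sub>1 - f \<partial>\<^sub>2)\<close> spans an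
  invariant CR structure for suitable functions \<open>f\<close>, \<open>g\<close> of \<open>s\<close>, and the plane curve \<open>(f, g)\<close> can
  be chosen with much freedom. The standard structure belongs to the segment \<open>(s, 1 - s)\<close>. The
  structure \<open>H0\<close> belongs to the circular arc \<open>(sin (kk s), cos (kk s))\<close> with \<open>kk = 9 \<pi> / 2\<close>,
  which has the same end points but winds around the origin. For it \<open>f d\<phi>\<^sub>1 + g d\<phi>\<^sub>2\<close>, with the
  angles \<open>\<phi>\<^sub>j\<close> of \<open>w\<^sub>j\<close>, is an associated contact form with Reeb field \<open>f \<partial>\<^sub>1 + g \<partial>\<^sub>2\<close>; its Webster
  curvature is \<open>(2 + kk\<^sup>2 s (1 - s)) / kk\<close> and the sublaplacian of a function \<open>\<phi>\<close> of \<open>s\<close> is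
  \<open>2 / kk * (s (1 - s) \<phi>')'\<close> (\<open>Webster_curvature_H0\<close>, \<open>sublaplacian_H0\<close>). That these values may be
  read off from one generator rests on the transformation law \<open>Tanaka_Webster_gauge\<close>.

  The equation is thereby reduced, for \<open>u = sqrt (\<beta> / kk) X(s)\<close> with \<open>X(0) = 1\<close>, to
  \<open>4 (s (1 - s) X')' = (1 + kk\<^sup>2 / 2 * s (1 - s)) X - \<beta> X\<^sup>3\<close> with singular points at both ends of
  \<open>[0, 1]\<close>. Solutions on \<open>[0, 1/2]\<close> that are regular at \<open>0\<close> are obtained by a fixed point argument,
  depending continuously on \<open>\<beta>\<close> (\<open>ex_radial_family\<close>). If \<open>X(1/2) = 0\<close>, the solution is regular at
  \<open>1\<close> too, for the equation is invariant under \<open>s \<mapsto> 1 - s\<close> and \<open>X \<mapsto> - X\<close>, so that \<open>X\<close> continues as an odd function about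
  \<open>1/2\<close> (\<open>odd_reflection\<close>). Arbitrarily large \<open>\<beta>\<close> with \<open>X(1/2) = 0\<close> exist (\<open>ex_zero_at_half\<close>): an
  energy identity of Pohozaev type keeps \<open>(X, 4 s (1 - s) X')\<close> away from the origin, and the angle
  that this vector sweeps out on \<open>[0, 1/2]\<close> grows without bound with \<open>\<beta>\<close>. The solutions \<open>u\<close> so obtained
  change sign, and on the circle \<open>w\<^sub>1 = 0\<close> they take the value \<open>sqrt (\<beta> / kk)\<close>.

  Finally, \<open>H0\<close> is not equivalent to the standard structure (\<open>H0_not_standard\<close>). An equivalence \<open>\<phi>\<close>
  would make the conjugates of the two complex coordinates of \<open>\<phi>\<close> functions annihilated by \<open>H0\<close>. The
  Fourier coefficient \<open>c\<close> of index \<open>(m, n)\<close> of such a function on the tori obeys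
  \<open>c' = (n f - m g) / (2 s (1 - s)) * c\<close>. Because the curve \<open>(f, g)\<close> winds, the integrals of
  \<open>f / (2 s (1 - s))\<close> and \<open>g / (2 s (1 - s))\<close> over some interval \<open>[1/2 - \<tau>, 1/2 + \<tau>]\<close> both vanish
  (\<open>ex_loop\<close>). The function then takes equal values at points with equal angles on the two tori at the
  ends of this interval (\<open>annihilated_agree\<close>), so \<open>\<phi>\<close> is not injective.
\<close>

section \<open>Calculus of smooth maps\<close>

lemma Ck_on_cong:
  assumes "open V" "\<And>x. x \<in> V \<Longrightarrow> f x = g x" "Ck_on n f V"
  shows "Ck_on n g V"
  using assms(2,3)
proof (induction n arbitrary: f g)
  case 0
  then show ?case by (auto cong: continuous_on_cong)
next
  case (Suc n)
  have d: "(g has_derivative frechet_derivative f (at x)) (at x)" if "x \<in> V" for x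
  proof -
    have "(f has_derivative frechet_derivative f (at x)) (at x)"
      using Suc.prems that frechet_derivative_works by auto
    then show ?thesis
      using has_derivative_transform_within_open[OF _ assms(1) that] Suc.prems(1) by blast
  qed
  have e: "frechet_derivative g (at x) = frechet_derivative f (at x)" if "x \<in> V" for x
    using frechet_derivative_at[OF d[OF that]] by simp
  have "Ck_on n (\<lambda>x. frechet_derivative g (at x) v) V" for v
    by (rule Suc.IH[of "\<lambda>x. frechet_derivative f (at x) v"]) (use Suc.prems e in auto)
  then show ?case using d by (auto simp: differentiable_def)
qed

lemma Ck_on_SucI:
  assumes "open V" "\<And>x. x \<in> V \<Longrightarrow> (f has_derivative f' x) (at x)"
    "\<And>v. Ck_on n (\<lambda>x. f' x v) V"
  shows "Ck_on (Suc n) f V"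
proof -
  have e: "frechet_derivative f (at x) = f' x" if "x \<in> V" for x
    using frechet_derivative_at[OF assms(2)[OF that]] by simp
  have "Ck_on n (\<lambda>x. frechet_derivative f (at x) v) V" for v
    by (rule Ck_on_cong[OF assms(1) _ assms(3)[of v]]) (simp add: e)
  then show ?thesis using assms(2) by (auto simp: differentiable_def)
qed

lemma Ck_on_Suc_has_derivative:
  "Ck_on (Suc n) f V \<Longrightarrow> x \<in> V \<Longrightarrow> (f has_derivative frechet_derivative f (at x)) (at x)"
  using frechet_derivative_works by auto

lemma Ck_on_SucD: "Ck_on (Suc n) f V \<Longrightarrow> Ck_on n f V"
proof (induction n arbitrary: f)
  case 0
  then show ?case
    by (auto intro!: continuous_at_imp_continuous_on differentiable_imp_continuous_within)
qed simp

lemma Ck_on_continuous: "Ck_on n f V \<Longrightarrow> continuous_on V f"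
  by (induction n) (simp, blast dest: Ck_on_SucD)

lemma Ck_on_const: "Ck_on n (\<lambda>x. c) V"
  by (induction n arbitrary: c) (auto simp: frechet_derivative_const)

lemma Ck_on_add:
  assumes "open V" shows "Ck_on n f V \<Longrightarrow> Ck_on n g V \<Longrightarrow> Ck_on n (\<lambda>x. f x + g x) V"
proof (induction n arbitrary: f g)
  case 0 then show ?case by (auto intro: continuous_intros)
next
  case (Suc n)
  show ?case
    by (rule Ck_on_SucI[OF assms has_derivative_add])
       (use Suc in \<open>auto simp: frechet_derivative_works\<close>)
qed

lemma Ck_on_bounded_linear:
  assumes "open V" "bounded_linear T" shows "Ck_on n f V \<Longrightarrow> Ck_on n (\<lambda>x. T (f x)) V"
proof (induction n arbitrary: f)
  case 0 then show ?case
    using continuous_on_compose2[OF linear_continuous_on[OF assms(2)]] by auto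
next
  case (Suc n)
  show ?case
    by (rule Ck_on_SucI[OF assms(1) bounded_linear.has_derivative[OF assms(2)]])
       (use Suc in \<open>auto simp: frechet_derivative_works\<close>)
qed

lemma Ck_on_ident: assumes "open V" shows "Ck_on n (\<lambda>x. x) V"
proof (cases n)
  case (Suc m)
  show ?thesis unfolding Suc by (rule Ck_on_SucI[OF assms has_derivative_ident]) (rule Ck_on_const)
qed auto

lemma Ck_on_bilinear:
  assumes "open V" "bounded_bilinear b"
  shows "Ck_on n f V \<Longrightarrow> Ck_on n g V \<Longrightarrow> Ck_on n (\<lambda>x. b (f x) (g x)) V"
proof (induction n arbitrary: f g)
  case 0 then show ?case using bounded_bilinear.continuous_on[OF assms(2)] by auto
next
  case (Suc n)
  have f: "(f has_derivative frechet_derivative f (at x)) (at x)"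
    and g: "(g has_derivative frechet_derivative g (at x)) (at x)" if "x \<in> V" for x
    by (rule Ck_on_Suc_has_derivative[OF Suc.prems(1) that], rule Ck_on_Suc_has_derivative[OF Suc.prems(2) that])
  show ?case
  proof (rule Ck_on_SucI[OF assms(1) bounded_bilinear.FDERIV[OF assms(2) f g]])
    fix v
    have 1: "Ck_on n (\<lambda>x. frechet_derivative f (at x) v) V" "Ck_on n (\<lambda>x. frechet_derivative g (at x) v) V"
      using Suc.prems by simp_all
    show "Ck_on n (\<lambda>x. b (f x) (frechet_derivative g (at x) v) + b (frechet_derivative f (at x) v) (g x)) V"
      by (rule Ck_on_add[OF assms(1) Suc.IH[OF Ck_on_SucD[OF Suc.prems(1)] 1(2)]
            Suc.IH[OF 1(1) Ck_on_SucD[OF Suc.prems(2)]]])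
  qed
qed

lemma Ck_on_compose_real:
  fixes f :: "'a::real_normed_vector \<Rightarrow> real" and g :: "real \<Rightarrow> 'c::real_normed_vector"
  assumes "open V" "f ` V \<subseteq> I"
  shows "Ck_on n f V \<Longrightarrow> Ck_on n g I \<Longrightarrow> Ck_on n (\<lambda>x. g (f x)) V"
proof (induction n arbitrary: g)
  case 0 then show ?case using continuous_on_compose2[of I g V f] assms(2) by simp
next
  case (Suc n)
  have d: "((\<lambda>x. g (f x)) has_derivative
     (\<lambda>v. frechet_derivative f (at x) v *\<^sub>R frechet_derivative g (at (f x)) 1)) (at x)" if "x \<in> V" for x
  proof -
    have 1: "(f has_derivative frechet_derivative f (at x)) (at x)"
      using Ck_on_Suc_has_derivative[OF Suc.prems(1) that] .
    have 2: "(g has_derivative frechet_derivative g (at (f x))) (at (f x))"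
      using Ck_on_Suc_has_derivative[OF Suc.prems(2)] assms that by blast
    have 3: "frechet_derivative g (at (f x)) r = r *\<^sub>R frechet_derivative g (at (f x)) 1" for r
      using linear_scale[OF bounded_linear.linear[OF has_derivative_bounded_linear[OF 2]], of r 1] by simp
    show ?thesis using has_derivative_compose[OF 1 2] by (subst (asm) 3) simp
  qed
  show ?case
  proof (rule Ck_on_SucI[OF assms(1) d])
    fix v
    have "Ck_on n (\<lambda>x. frechet_derivative f (at x) v) V" using Suc.prems(1) by simp
    moreover have "Ck_on n (\<lambda>x. frechet_derivative g (at (f x)) 1) V"
      by (rule Suc.IH) (use Suc.prems(2) Ck_on_SucD[OF Suc.prems(1)] in auto)
    ultimately show "Ck_on n (\<lambda>x. frechet_derivative f (at x) v *\<^sub>R frechet_derivative g (at (f x)) 1) V"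
      by (rule Ck_on_bilinear[OF assms(1) bounded_bilinear_scaleR])
  qed
qed

lemma Ck_on_union:
  assumes "open V" "open W" shows "Ck_on n f V \<Longrightarrow> Ck_on n f W \<Longrightarrow> Ck_on n f (V \<union> W)"
  by (induction n arbitrary: f) (auto intro: continuous_on_open_Un assms)

lemma Ck_on_subset: "Ck_on n f V \<Longrightarrow> W \<subseteq> V \<Longrightarrow> Ck_on n f W"
  by (induction n arbitrary: f) (auto intro: continuous_on_subset)

lemma Ck_on_powr: "Ck_on n (\<lambda>r::real. r powr \<alpha>) {0<..}"
proof (induction n arbitrary: \<alpha>)
  case 0
  have "isCont (\<lambda>r::real. r powr \<alpha>) x" if "x > 0" for x :: real
    using DERIV_isCont[OF has_real_derivative_powr[OF that]] .
  then show ?case by (auto intro!: continuous_at_imp_continuous_on)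
next
  case (Suc n)
  have "((\<lambda>r. r powr \<alpha>) has_derivative (\<lambda>v. v *\<^sub>R (\<alpha> * x powr (\<alpha> - 1)))) (at x)" if "x \<in> {0<..}" for x :: real
    using has_real_derivative_powr[of x \<alpha>] that
    by (simp add: has_field_derivative_def mult_commute_abs)
  then show ?case
    by (rule Ck_on_SucI[rotated])
       (auto intro!: Ck_on_bounded_linear[OF _ bounded_linear_scaleR_right]
          Ck_on_bounded_linear[OF _ bounded_linear_mult_right] Suc)
qed

lemma smooth_on_cong:
  "open V \<Longrightarrow> (\<And>x. x \<in> V \<Longrightarrow> f x = g x) \<Longrightarrow> smooth_on f V \<Longrightarrow> smooth_on g V"
  unfolding smooth_on_def using Ck_on_cong by blast

lemma smooth_on_const: "smooth_on (\<lambda>x. c) V"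
  by (simp add: smooth_on_def Ck_on_const)

lemma smooth_on_ident: "open V \<Longrightarrow> smooth_on (\<lambda>x. x) V"
  by (simp add: smooth_on_def Ck_on_ident)

lemma smooth_on_add: "open V \<Longrightarrow> smooth_on f V \<Longrightarrow> smooth_on g V \<Longrightarrow> smooth_on (\<lambda>x. f x + g x) V"
  by (simp add: smooth_on_def Ck_on_add)

lemma smooth_on_bounded_linear:
  "open V \<Longrightarrow> bounded_linear T \<Longrightarrow> smooth_on f V \<Longrightarrow> smooth_on (\<lambda>x. T (f x)) V"
  by (simp add: smooth_on_def Ck_on_bounded_linear)

lemma smooth_on_bilinear:
  "open V \<Longrightarrow> bounded_bilinear b \<Longrightarrow> smooth_on f V \<Longrightarrow> smooth_on g V \<Longrightarrow> smooth_on (\<lambda>x. b (f x) (g x)) V"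
  by (simp add: smooth_on_def Ck_on_bilinear)

lemma smooth_on_mult:
  fixes f g :: "'a::real_normed_vector \<Rightarrow> 'b::real_normed_algebra"
  shows "open V \<Longrightarrow> smooth_on f V \<Longrightarrow> smooth_on g V \<Longrightarrow> smooth_on (\<lambda>x. f x * g x) V"
  by (rule smooth_on_bilinear[OF _ bounded_bilinear_mult])

lemma smooth_on_diff: "open V \<Longrightarrow> smooth_on f V \<Longrightarrow> smooth_on g V \<Longrightarrow> smooth_on (\<lambda>x. f x - g x) V"
  using smooth_on_add[of V f "\<lambda>x. - g x"] smooth_on_bounded_linear[of V uminus g]
  by (simp add: bounded_linear_minus[OF bounded_linear_ident])

lemma smooth_on_compose_real:
  fixes f :: "'a::real_normed_vector \<Rightarrow> real"
  shows "open V \<Longrightarrow> f ` V \<subseteq> I \<Longrightarrow> smooth_on f V \<Longrightarrow> smooth_on g I \<Longrightarrow> smooth_on (\<lambda>x. g (f x)) V"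
  unfolding smooth_on_def using Ck_on_compose_real by blast

lemma smooth_on_subset: "smooth_on f V \<Longrightarrow> W \<subseteq> V \<Longrightarrow> smooth_on f W"
  unfolding smooth_on_def using Ck_on_subset by blast

lemma smooth_on_union: "open V \<Longrightarrow> open W \<Longrightarrow> smooth_on f V \<Longrightarrow> smooth_on f W \<Longrightarrow> smooth_on f (V \<union> W)"
  unfolding smooth_on_def using Ck_on_union by blast

lemma smooth_on_has_derivative:
  "smooth_on f V \<Longrightarrow> x \<in> V \<Longrightarrow> (f has_derivative frechet_derivative f (at x)) (at x)"
  unfolding smooth_on_def using Ck_on_Suc_has_derivative by blast

lemma smooth_on_frechet: "smooth_on f V \<Longrightarrow> smooth_on (\<lambda>x. frechet_derivative f (at x) v) V"
  unfolding smooth_on_def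
proof
  fix n assume "\<forall>n. Ck_on n f V"
  then have "Ck_on (Suc n) f V" by blast
  then show "Ck_on n (\<lambda>x. frechet_derivative f (at x) v) V" by simp
qed

lemma smooth_on_continuous: "smooth_on f V \<Longrightarrow> continuous_on V f"
  unfolding smooth_on_def using Ck_on_continuous by blast

lemma smooth_on_sgn: "smooth_on (sgn :: 'a::real_inner \<Rightarrow> 'a) (- {0})"
proof -
  have o: "open (- {0::'a})" by auto
  have 1: "smooth_on (\<lambda>x::'a. x \<bullet> x) (- {0})"
    by (intro smooth_on_bilinear[OF o bounded_bilinear_inner] smooth_on_ident o)
  have 2: "smooth_on (\<lambda>x::'a. (x \<bullet> x) powr (-1/2)) (- {0})"
    by (rule smooth_on_compose_real[OF o _ 1, of "{0<..}"]) (auto simp: smooth_on_def Ck_on_powr)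
  have 3: "smooth_on (\<lambda>x::'a. (x \<bullet> x) powr (-1/2) *\<^sub>R x) (- {0})"
    by (intro smooth_on_bilinear[OF o bounded_bilinear_scaleR] 2 smooth_on_ident o)
  show ?thesis
  proof (rule smooth_on_cong[OF o _ 3])
    fix x :: 'a assume "x \<in> - {0}"
    then have "(x \<bullet> x) powr (-1/2) = inverse (norm x)"
      by (simp add: powr_minus norm_eq_sqrt_inner powr_half_sqrt)
    then show "(x \<bullet> x) powr (-1/2) *\<^sub>R x = sgn x" by (simp add: sgn_div_norm)
  qed
qed

section \<open>Smooth functions on the sphere\<close>

abbreviation ray_cone :: "(real^4) set \<Rightarrow> (real^4) set" where
  "ray_cone U \<equiv> {x. x \<noteq> 0 \<and> sgn x \<in> U}"

lemma continuous_on_sgn': "continuous_on (- {0::real^4}) sgn"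
  using smooth_on_continuous[OF smooth_on_sgn] .

lemma open_cone: assumes "open_S3 U" shows "open (ray_cone U)"
proof -
  obtain T where T: "open T" "U = S3 \<inter> T" using assms by (auto simp: open_S3_def openin_open)
  have "ray_cone U = (- {0}) \<inter> sgn -` T" using T by (auto simp: norm_sgn)
  moreover have "open ((- {0::real^4}) \<inter> sgn -` T)"
    using continuous_on_open_vimage[of "- {0::real^4}" sgn] continuous_on_sgn' T by (auto simp: Int_commute)
  ultimately show ?thesis by simp
qed

lemma open_S3_UNIV [simp, intro]: "open_S3 S3" by (simp add: open_S3_def)
lemma open_S3_subset: "open_S3 U \<Longrightarrow> U \<subseteq> S3" by (auto simp: open_S3_def openin_subset dest: openin_imp_subset)
lemma open_S3_Int: "open_S3 U \<Longrightarrow> open_S3 V \<Longrightarrow> open_S3 (U \<inter> V)" by (simp add: open_S3_def openin_Int)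

lemma smooth_S3_const: "smooth_S3 (\<lambda>x. c) U"
  by (simp add: smooth_S3_def smooth_on_const)

lemma smooth_S3_add: "open_S3 U \<Longrightarrow> smooth_S3 f U \<Longrightarrow> smooth_S3 g U \<Longrightarrow> smooth_S3 (\<lambda>x. f x + g x) U"
  unfolding smooth_S3_def by (rule smooth_on_add[OF open_cone])

lemma smooth_S3_diff: "open_S3 U \<Longrightarrow> smooth_S3 f U \<Longrightarrow> smooth_S3 g U \<Longrightarrow> smooth_S3 (\<lambda>x. f x - g x) U"
  unfolding smooth_S3_def by (rule smooth_on_diff[OF open_cone])

lemma smooth_S3_bounded_linear:
  "open_S3 U \<Longrightarrow> bounded_linear T \<Longrightarrow> smooth_S3 f U \<Longrightarrow> smooth_S3 (\<lambda>x. T (f x)) U"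
  unfolding smooth_S3_def by (rule smooth_on_bounded_linear[OF open_cone])

lemma smooth_S3_bilinear:
  "open_S3 U \<Longrightarrow> bounded_bilinear b \<Longrightarrow> smooth_S3 f U \<Longrightarrow> smooth_S3 g U \<Longrightarrow> smooth_S3 (\<lambda>x. b (f x) (g x)) U"
  unfolding smooth_S3_def by (rule smooth_on_bilinear[OF open_cone])

lemma smooth_S3_mult:
  fixes f g :: "real^4 \<Rightarrow> 'b::real_normed_algebra"
  shows "open_S3 U \<Longrightarrow> smooth_S3 f U \<Longrightarrow> smooth_S3 g U \<Longrightarrow> smooth_S3 (\<lambda>x. f x * g x) U"
  by (rule smooth_S3_bilinear[OF _ bounded_bilinear_mult])

lemma smooth_S3_subset: "smooth_S3 f U \<Longrightarrow> V \<subseteq> U \<Longrightarrow> smooth_S3 f V"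
  unfolding smooth_S3_def by (erule smooth_on_subset) auto

lemma smooth_S3_linear: "bounded_linear T \<Longrightarrow> open_S3 U \<Longrightarrow> smooth_S3 T U"
  unfolding smooth_S3_def
  by (rule smooth_on_bounded_linear[OF open_cone _ smooth_on_subset[OF smooth_on_sgn]]) auto

lemma smooth_S3_compose_real:
  fixes f :: "real^4 \<Rightarrow> real"
  assumes "open_S3 U" "\<And>x. x \<in> U \<Longrightarrow> f x \<in> I" "smooth_S3 f U" "smooth_on g I"
  shows "smooth_S3 (\<lambda>x. g (f x)) U"
  using smooth_on_compose_real[OF open_cone[OF assms(1)] _ assms(3)[unfolded smooth_S3_def] assms(4)] assms(2)
  by (auto simp: smooth_S3_def)

lemma in_S3 [simp]: "p \<in> S3 \<Longrightarrow> sgn p = p" "p \<in> S3 \<Longrightarrow> p \<noteq> 0"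
  by (auto simp: sgn_div_norm)

text \<open>
  Differentiability of the very extension that \<open>dirD\<close> differentiates; under it, \<open>dirD\<close> obeys the
  product and chain rules.
\<close>

definition diffS :: "(real^4 \<Rightarrow> 'b::real_normed_vector) \<Rightarrow> real^4 \<Rightarrow> bool" where
  "diffS f p \<longleftrightarrow> (\<lambda>x. f (sgn x)) differentiable (at p)"

lemma smooth_S3_diffS: "smooth_S3 f U \<Longrightarrow> p \<in> U \<Longrightarrow> p \<in> S3 \<Longrightarrow> diffS f p"
  unfolding diffS_def smooth_S3_def
  by (rule differentiableI, rule smooth_on_has_derivative[where V="ray_cone U"]) auto

lemma dirD_eq:
  assumes "((\<lambda>x. f (sgn x)) has_derivative D) (at p)"
  shows "dirD f p v = (\<Sum>j\<in>UNIV. v $ j * D (axis j 1))"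
  by (simp add: dirD_def frechet_derivative_at[OF assms, symmetric])

lemma diffS_const: "diffS (\<lambda>x. c) p" by (simp add: diffS_def)

lemma diffS_add: "diffS f p \<Longrightarrow> diffS g p \<Longrightarrow> diffS (\<lambda>x. f x + g x) p"
  by (simp add: diffS_def)

lemma diffS_diff: "diffS f p \<Longrightarrow> diffS g p \<Longrightarrow> diffS (\<lambda>x. f x - g x) p"
  by (simp add: diffS_def)

lemma diffS_mult: "diffS f p \<Longrightarrow> diffS g p \<Longrightarrow> diffS (\<lambda>x. f x * g x :: 'b::real_normed_field) p"
  by (simp add: diffS_def)

lemma diffS_bounded_linear: "bounded_linear T \<Longrightarrow> diffS f p \<Longrightarrow> diffS (\<lambda>x. T (f x)) p"
  unfolding diffS_def differentiable_def using bounded_linear.has_derivative by blast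

lemma diffS_E:
  assumes "diffS f p" obtains D where "((\<lambda>x. f (sgn x)) has_derivative D) (at p)"
  using assms by (auto simp: diffS_def differentiable_def)

lemma dirD_const [simp]: "dirD (\<lambda>x. c) p v = 0"
  by (subst dirD_eq[where D="\<lambda>_. 0"]) auto

lemma dirD_add: assumes "diffS f p" "diffS g p"
  shows "dirD (\<lambda>x. f x + g x) p v = dirD f p v + dirD g p v"
proof -
  obtain D E where D: "((\<lambda>x. f (sgn x)) has_derivative D) (at p)"
    and E: "((\<lambda>x. g (sgn x)) has_derivative E) (at p)" using assms diffS_E by metis
  show ?thesis unfolding dirD_eq[OF D] dirD_eq[OF E] dirD_eq[OF has_derivative_add[OF D E]]
    by (simp add: sum.distrib algebra_simps)
qed

lemma dirD_diff: assumes "diffS f p" "diffS g p"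
  shows "dirD (\<lambda>x. f x - g x) p v = dirD f p v - dirD g p v"
proof -
  obtain D E where D: "((\<lambda>x. f (sgn x)) has_derivative D) (at p)"
    and E: "((\<lambda>x. g (sgn x)) has_derivative E) (at p)" using assms diffS_E by metis
  show ?thesis unfolding dirD_eq[OF D] dirD_eq[OF E] dirD_eq[OF has_derivative_diff[OF D E]]
    by (simp add: sum_subtractf algebra_simps)
qed

lemma dirD_mult: assumes "diffS f p" "diffS g p" "p \<in> S3"
  shows "dirD (\<lambda>x. f x * g x) p v = f p * dirD g p v + dirD f p v * g p"
proof -
  obtain D E where D: "((\<lambda>x. f (sgn x)) has_derivative D) (at p)"
    and E: "((\<lambda>x. g (sgn x)) has_derivative E) (at p)" using assms diffS_E by metis
  show ?thesis unfolding dirD_eq[OF D] dirD_eq[OF E] dirD_eq[OF has_derivative_mult[OF D E]]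
    using assms(3) by (simp add: sum.distrib sum_distrib_left sum_distrib_right algebra_simps)
qed

lemma dirD_cmult: assumes "diffS f p" shows "dirD (\<lambda>x. c * f x) p v = c * dirD f p v"
proof -
  obtain D where D: "((\<lambda>x. f (sgn x)) has_derivative D) (at p)" using assms diffS_E by metis
  show ?thesis unfolding dirD_eq[OF D] dirD_eq[OF has_derivative_mult_right[OF D]]
    by (simp add: sum_distrib_left algebra_simps)
qed

lemma dirD_cnj: assumes "diffS f p" shows "dirD (\<lambda>x. cnj (f x)) p v = cnj (dirD f p (cnjv v))"
proof -
  obtain D where D: "((\<lambda>x. f (sgn x)) has_derivative D) (at p)" using assms diffS_E by metis
  show ?thesis unfolding dirD_eq[OF D] dirD_eq[OF bounded_linear.has_derivative[OF bounded_linear_cnj D]]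
    by (simp add: cnjv_def)
qed

lemma dirD_lin: "dirD f p (c *s v) = c * dirD f p v" "dirD f p (v + w) = dirD f p v + dirD f p w"
  by (auto simp: dirD_def sum_distrib_left sum.distrib algebra_simps)

lemma dirD_compose_real:
  fixes f :: "real^4 \<Rightarrow> real"
  assumes "diffS f p" "(\<phi> has_real_derivative \<phi>') (at (f p))" "p \<in> S3"
  shows "dirD (\<lambda>x. complex_of_real (\<phi> (f x))) p v = of_real \<phi>' * dirD (\<lambda>x. of_real (f x)) p v"
    and "diffS (\<lambda>x. \<phi> (f x)) p"
proof -
  obtain D where D: "((\<lambda>x. f (sgn x)) has_derivative D) (at p)" using assms diffS_E by metis
  have 1: "((\<lambda>x. \<phi> (f (sgn x))) has_derivative (\<lambda>v. \<phi>' * D v)) (at p)"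
    using has_derivative_compose[OF D, of \<phi> "(*) \<phi>'"] assms by (simp add: has_field_derivative_def)
  then show "diffS (\<lambda>x. \<phi> (f x)) p" by (auto simp: diffS_def differentiable_def)
  show "dirD (\<lambda>x. complex_of_real (\<phi> (f x))) p v = of_real \<phi>' * dirD (\<lambda>x. of_real (f x)) p v"
    unfolding dirD_eq[OF bounded_linear.has_derivative[OF bounded_linear_of_real D]]
      dirD_eq[OF bounded_linear.has_derivative[OF bounded_linear_of_real 1]]
    by (simp add: sum_distrib_left algebra_simps)
qed

lemma dirD_cong:
  assumes "open_S3 U" "p \<in> U" "\<And>x. x \<in> U \<Longrightarrow> f x = g x"
  shows "dirD f p v = dirD g p v" "diffS f p \<longleftrightarrow> diffS g p"
proof -
  have p: "p \<in> ray_cone U" using assms open_S3_subset by fastforce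
  have *: "((\<lambda>x. f (sgn x)) has_derivative D) (at p) \<longleftrightarrow> ((\<lambda>x. g (sgn x)) has_derivative D) (at p)" for D
    by (rule iffI; erule has_derivative_transform_within_open[OF _ open_cone[OF assms(1)] p]) (use assms(3) in auto)
  show "dirD f p v = dirD g p v" by (simp add: dirD_def frechet_derivative_def *)
  show "diffS f p \<longleftrightarrow> diffS g p" by (simp add: diffS_def differentiable_def *)
qed

lemma has_derivative_sgn_S3:
  assumes "p \<in> S3" shows "(sgn has_derivative (\<lambda>v. v - (p \<bullet> v) *\<^sub>R p)) (at (p::real^4))"
proof -
  have n: "norm p = 1" using assms by simp
  have "((\<lambda>x. inverse (norm x) *\<^sub>R x) has_derivative
    (\<lambda>h. inverse (norm p) *\<^sub>R h + (- (inverse (norm p) * (p \<bullet> h / norm p) * inverse (norm p))) *\<^sub>R p)) (at p)"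
    using n has_derivative_norm[of p] in_S3(2)[OF assms]
    by (auto intro!: derivative_eq_intros simp: sgn_div_norm inner_commute)
  then show ?thesis using n by (simp add: sgn_div_norm[abs_def] algebra_simps)
qed

text \<open>
  The derivative of \<open>sgn\<close> at \<open>p\<close> is the projection along \<open>p\<close>, which fixes tangent vectors. Hence every
  extension of a function to a neighbourhood of \<open>p\<close> may be differentiated in place of the one that is
  constant along rays.
\<close>

lemma dirD_ambient:
  assumes "p \<in> S3" "v \<in> CT p" "(f has_derivative f') (at p)"
  shows "dirD f p v = (\<Sum>j\<in>UNIV. v $ j * f' (axis j 1))"
proof -
  have d: "((\<lambda>x. f (sgn x)) has_derivative (\<lambda>v. f' (v - (p \<bullet> v) *\<^sub>R p))) (at p)"
    using has_derivative_compose[OF has_derivative_sgn_S3[OF assms(1)], of f f'] assms(1,3) by simp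
  have l: "linear f'" using assms(3) has_derivative_bounded_linear bounded_linear.linear by blast
  have e: "f' (axis j 1 - (p \<bullet> axis j 1) *\<^sub>R p) = f' (axis j 1) - of_real (p $ j) * f' p" for j
    by (simp add: linear_diff[OF l] linear_scale[OF l] inner_axis) (simp add: scaleR_conv_of_real)
  then have "dirD f p v = (\<Sum>j\<in>UNIV. v $ j * f' (axis j 1)) - (\<Sum>j\<in>UNIV. of_real (p $ j) * v $ j) * f' p"
    unfolding dirD_eq[OF d] e by (simp add: sum_subtractf sum_distrib_left algebra_simps)
  then show ?thesis using assms(2) by (simp add: CT_def pairing_def cvec_def)
qed

lemma diffS_ambient: "p \<in> S3 \<Longrightarrow> f differentiable (at p) \<Longrightarrow> diffS f p"
  unfolding diffS_def differentiable_def
  using has_derivative_compose[OF has_derivative_sgn_S3, of p f] by fastforce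

section \<open>Tangent vectors and the exterior derivative\<close>

lemma pairing_simps:
  "pairing (\<alpha> + \<beta>) v = pairing \<alpha> v + pairing \<beta> v"
  "pairing (\<alpha> - \<beta>) v = pairing \<alpha> v - pairing \<beta> v"
  "pairing (c *s \<alpha>) v = c * pairing \<alpha> v"
  "pairing \<alpha> (v + w) = pairing \<alpha> v + pairing \<alpha> w"
  "pairing \<alpha> (v - w) = pairing \<alpha> v - pairing \<alpha> w"
  "pairing \<alpha> (c *s v) = c * pairing \<alpha> v"
  "pairing \<alpha> 0 = 0" "pairing 0 v = 0"
  by (auto simp: pairing_def sum.distrib sum_subtractf sum_distrib_left algebra_simps)

lemma pairing_axis [simp]: "pairing \<alpha> (axis i 1) = \<alpha> $ i"
  by (simp add: pairing_def axis_def if_distrib cong: if_cong)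

lemma pairing_commute: "pairing \<alpha> v = pairing v \<alpha>"
  by (simp add: pairing_def mult.commute)

lemma cnjv_simps [simp]: "cnjv (cnjv v) = v" "cnjv (cvec x) = cvec x" "cnjv v $ i = cnj (v $ i)"
  "cnjv (v + w) = cnjv v + cnjv w" "cnjv (v - w) = cnjv v - cnjv w" "cnjv (c *s v) = cnj c *s cnjv v"
  "cvec x $ i = of_real (x $ i)" "cnjv 0 = 0"
  by (auto simp: cnjv_def cvec_def vec_eq_iff)

lemma pairing_cnjv: "pairing (cnjv \<alpha>) v = cnj (pairing \<alpha> (cnjv v))"
  by (simp add: pairing_def)

lemma pairing_cvec_cvec: "pairing (cvec x) (cvec y) = of_real (x \<bullet> y)"
  by (simp add: pairing_def inner_vec_def)

lemma pairing_cvec_cnjv: "pairing (cvec x) (cnjv v) = cnj (pairing (cvec x) v)"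
  by (simp add: pairing_def)

lemma CT_simps: "v \<in> CT p \<Longrightarrow> w \<in> CT p \<Longrightarrow> v + w \<in> CT p" "v \<in> CT p \<Longrightarrow> c *s v \<in> CT p"
  "v \<in> CT p \<Longrightarrow> cnjv v \<in> CT p"
  by (auto simp: CT_def pairing_simps pairing_cvec_cnjv)

text \<open>
  After subtraction of its value on the position vector, each covector of the coframe kills that
  vector. Position vector and frame, position covector and coframe then form mutually inverse matrices
  of size four, and a left inverse of a square matrix is a right inverse.
\<close>

lemma dual_frame:
  assumes p: "p \<in> S3" and e: "e1 \<in> CT p" "e2 \<in> CT p" "e3 \<in> CT p"
    and d: "pairing \<alpha>1 e1 = 1" "pairing \<alpha>1 e2 = 0" "pairing \<alpha>1 e3 = 0"
      "pairing \<alpha>2 e1 = 0" "pairing \<alpha>2 e2 = 1" "pairing \<alpha>2 e3 = 0"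
      "pairing \<alpha>3 e1 = 0" "pairing \<alpha>3 e2 = 0" "pairing \<alpha>3 e3 = 1"
    and v: "v \<in> CT p"
  shows "v = pairing \<alpha>1 v *s e1 + pairing \<alpha>2 v *s e2 + pairing \<alpha>3 v *s e3"
proof -
  define n where "n = cvec p"
  define b where "b \<alpha> = \<alpha> - pairing \<alpha> n *s n" for \<alpha>
  define A :: "complex^4^4" where
    "A = (\<chi> i. if i = 1 then b \<alpha>1 else if i = 2 then b \<alpha>2 else if i = 3 then b \<alpha>3 else n)"
  define B :: "complex^4^4" where
    "B = transpose (\<chi> i. if i = 1 then e1 else if i = 2 then e2 else if i = 3 then e3 else n)"
  have nn: "pairing n n = 1" using p by (simp add: n_def pairing_cvec_cvec dot_square_norm)
  have ne: "pairing n e1 = 0" "pairing n e2 = 0" "pairing n e3 = 0" "pairing n v = 0"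
    using e v by (auto simp: CT_def n_def)
  have be: "pairing (b \<alpha>) w = pairing \<alpha> w" if "pairing n w = 0" for \<alpha> w
    using that by (simp add: b_def pairing_simps)
  have bn: "pairing (b \<alpha>) n = 0" for \<alpha> using nn by (simp add: b_def pairing_simps)
  have pr: "(A ** B) $ i $ j = pairing (A $ i) (transpose B $ j)" for i j
    by (simp add: matrix_matrix_mult_def pairing_def transpose_def)
  have "A ** B = mat 1"
    by (simp add: vec_eq_iff forall_4 pr) (simp add: A_def B_def mat_def be bn nn ne d)
  then have BA: "B ** A = mat 1" using matrix_left_right_inverse by blast
  have "v = B *v (A *v v)" by (simp add: matrix_vector_mul_assoc BA)
  also have "\<dots> = (\<Sum>i\<in>UNIV. pairing (A $ i) v *s (transpose B $ i))"
    by (simp add: vec_eq_iff matrix_vector_mult_def pairing_def transpose_def mult.commute)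
  also have "\<dots> = pairing \<alpha>1 v *s e1 + pairing \<alpha>2 v *s e2 + pairing \<alpha>3 v *s e3"
    by (simp add: sum_4) (simp add: A_def B_def be ne)
  finally show ?thesis .
qed

lemma diffS_vec_nth: "diffS F p \<Longrightarrow> diffS (\<lambda>x. F x $ i) p"
  by (rule diffS_bounded_linear[OF bounded_linear_vec_nth])

lemma ext_d_add: assumes "diffS \<alpha> p" "diffS \<beta> p"
  shows "ext_d (\<lambda>x. \<alpha> x + \<beta> x) p v w = ext_d \<alpha> p v w + ext_d \<beta> p v w"
  by (simp add: ext_d_def pairing_def dirD_vec_def dirD_add[OF diffS_vec_nth[OF assms(1)] diffS_vec_nth[OF assms(2)]]
      sum.distrib algebra_simps)

lemma ext_d_diff: assumes "diffS \<alpha> p" "diffS \<beta> p"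
  shows "ext_d (\<lambda>x. \<alpha> x - \<beta> x) p v w = ext_d \<alpha> p v w - ext_d \<beta> p v w"
  by (simp add: ext_d_def pairing_def dirD_vec_def dirD_diff[OF diffS_vec_nth[OF assms(1)] diffS_vec_nth[OF assms(2)]]
      sum_subtractf algebra_simps)

lemma ext_d_scale: assumes "diffS c p" "diffS \<alpha> p" "p \<in> S3"
  shows "ext_d (\<lambda>x. c x *s \<alpha> x) p v w =
    dirD c p v * pairing (\<alpha> p) w - dirD c p w * pairing (\<alpha> p) v + c p * ext_d \<alpha> p v w"
  by (simp add: ext_d_def pairing_def dirD_vec_def dirD_mult[OF assms(1) diffS_vec_nth[OF assms(2)] assms(3)]
      sum.distrib sum_distrib_left sum_subtractf algebra_simps)

lemma ext_d_const [simp]: "ext_d (\<lambda>x. \<zeta>) p v w = 0"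
  by (simp add: ext_d_def pairing_def dirD_vec_def)

lemma ext_d_lin:
  "ext_d \<alpha> p (c *s v) w = c * ext_d \<alpha> p v w" "ext_d \<alpha> p v (c *s w) = c * ext_d \<alpha> p v w"
  "ext_d \<alpha> p (v + v') w = ext_d \<alpha> p v w + ext_d \<alpha> p v' w"
  "ext_d \<alpha> p v (w + w') = ext_d \<alpha> p v w + ext_d \<alpha> p v w'"
  "ext_d \<alpha> p v v = 0"
  by (auto simp: ext_d_def pairing_def dirD_vec_def dirD_lin sum.distrib sum_distrib_left sum_subtractf algebra_simps)

lemma ext_d_swap: "ext_d \<alpha> p w v = - ext_d \<alpha> p v w"
  by (simp add: ext_d_def)

lemma ext_d_cong: assumes "open_S3 U" "p \<in> U" "\<And>x. x \<in> U \<Longrightarrow> \<alpha> x = \<beta> x"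
  shows "ext_d \<alpha> p v w = ext_d \<beta> p v w"
proof -
  have "dirD (\<lambda>x. \<alpha> x $ i) p u = dirD (\<lambda>x. \<beta> x $ i) p u" for i u
    using dirD_cong(1)[OF assms(1,2), of "\<lambda>x. \<alpha> x $ i" "\<lambda>x. \<beta> x $ i"] assms(3) by simp
  then show ?thesis by (simp add: ext_d_def dirD_vec_def)
qed

lemma bounded_linear_coord: "bounded_linear (\<lambda>x::real^4. complex_of_real (x $ i))"
  using bounded_linear_compose[OF bounded_linear_of_real bounded_linear_vec_nth] .

lemma dirD_linear: assumes "p \<in> S3" "v \<in> CT p" "bounded_linear L"
  shows "dirD L p v = (\<Sum>j\<in>UNIV. v $ j * L (axis j 1))"
  by (rule dirD_ambient[OF assms(1,2) bounded_linear_imp_has_derivative[OF assms(3)]])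

lemma diffS_linear: "p \<in> S3 \<Longrightarrow> bounded_linear L \<Longrightarrow> diffS L p"
  by (rule diffS_ambient) (auto simp: differentiable_def intro: bounded_linear_imp_has_derivative)

lemma dirD_coord: assumes "p \<in> S3" "v \<in> CT p"
  shows "dirD (\<lambda>x. of_real (x $ i)) p v = v $ i"
  by (simp add: dirD_linear[OF assms bounded_linear_coord] axis_def if_distrib cong: if_cong)

lemma bounded_linear_cvec: "bounded_linear (cvec :: real^4 \<Rightarrow> complex^4)"
  by (rule linear_conv_bounded_linear[THEN iffD1])
     (auto intro!: linearI simp: vec_eq_iff scaleR_conv_of_real[where 'a=complex])

text \<open>
  A form that vanishes on all tangent vectors is \<open>a \<nu>\<close> with \<open>\<nu> = \<Sum> x\<^sub>i dx\<^sub>i\<close>, and its derivative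
  \<open>da \<and> \<nu> + a d\<nu>\<close> vanishes on tangent vectors since \<open>\<nu>\<close> does and \<open>\<nu>\<close> is closed.
\<close>

lemma ext_d_cong_CT:
  assumes U: "open_S3 U" "p \<in> U" and d: "diffS \<alpha> p" "diffS \<beta> p"
    and eq: "\<And>x u. x \<in> U \<Longrightarrow> u \<in> CT x \<Longrightarrow> pairing (\<alpha> x) u = pairing (\<beta> x) u"
    and vw: "v \<in> CT p" "w \<in> CT p"
  shows "ext_d \<alpha> p v w = ext_d \<beta> p v w"
proof -
  have p: "p \<in> S3" using U open_S3_subset by blast
  define \<gamma> where "\<gamma> x = \<alpha> x - \<beta> x" for x
  define a where "a x = (\<Sum>i\<in>UNIV. \<gamma> x $ i * of_real (x $ i))" for x
  have dg: "diffS \<gamma> p" unfolding \<gamma>_def using d by (rule diffS_diff)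
  have "diffS (\<lambda>x. \<gamma> x $ i * of_real (x $ i)) p" for i
    by (intro diffS_mult diffS_vec_nth dg diffS_linear[OF p] bounded_linear_coord)
  then have da: "diffS a p" unfolding a_def by (simp add: sum_4 diffS_add)
  have rad: "\<gamma> x = a x *s cvec x" if x: "x \<in> U" for x
  proof -
    have xS: "x \<in> S3" using U x open_S3_subset by blast
    have g0: "pairing (\<gamma> x) u = 0" if "u \<in> CT x" for u
      using eq[OF x that] by (simp add: \<gamma>_def pairing_simps)
    have a: "a x = pairing (\<gamma> x) (cvec x)" by (simp add: a_def pairing_def)
    have nn: "pairing (cvec x) (cvec x) = 1" using xS by (simp add: pairing_cvec_cvec dot_square_norm)
    have "\<gamma> x $ i = a x * cvec x $ i" for i
    proof -
      have "axis i 1 - pairing (cvec x) (axis i 1) *s cvec x \<in> CT x"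
        by (simp only: CT_def mem_Collect_eq pairing_simps nn) simp
      from g0[OF this] show ?thesis
        unfolding a by (simp only: pairing_simps pairing_axis) simp
    qed
    then show ?thesis by (simp add: vec_eq_iff)
  qed
  have "ext_d \<alpha> p v w - ext_d \<beta> p v w = ext_d \<gamma> p v w"
    unfolding \<gamma>_def by (rule ext_d_diff[OF d, symmetric])
  also have "\<dots> = ext_d (\<lambda>x. a x *s cvec x) p v w"
    by (rule ext_d_cong[OF U rad])
  also have "\<dots> = a p * ext_d cvec p v w"
    using vw by (subst ext_d_scale[OF da diffS_linear[OF p bounded_linear_cvec] p]) (simp add: CT_def)
  also have "ext_d cvec p v w = 0"
    using vw by (simp add: ext_d_def dirD_vec_def dirD_coord[OF p] pairing_commute[of v w])
  finally show ?thesis by simp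
qed

text \<open>
  \<open>Ck_on\<close> speaks of the derivatives in one direction at a time, so the two mixed derivatives are
  compared in the plane \<open>p + s u + t v\<close>. There \<open>f (p + s u + t v) - f (p + s u)\<close> is the integral of the
  derivative along \<open>v\<close> over \<open>[0, t]\<close>; differentiating it in \<open>s\<close> under the integral sign, and then in
  \<open>t\<close>, gives one mixed derivative, and differentiating it directly gives the other.
\<close>

lemma mixed_derivative_symmetric:
  fixes f :: "'a::real_normed_vector \<Rightarrow> 'b::euclidean_space"
  assumes V: "open V" "p \<in> V" and C2: "Ck_on (Suc (Suc 0)) f V"
  shows "frechet_derivative (\<lambda>x. frechet_derivative f (at x) u) (at p) v =
         frechet_derivative (\<lambda>x. frechet_derivative f (at x) v) (at p) u"
proof -
  define D where "D u x = frechet_derivative f (at x) u" for u x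
  define DD where "DD u v x = frechet_derivative (D u) (at x) v" for u v x
  have C1: "Ck_on (Suc 0) (D u) V" for u using C2 by (simp add: D_def[abs_def])
  have cDD: "continuous_on V (DD u v)" for u v using C1[of u] by (simp add: DD_def)
  have cD: "continuous_on V (D u)" for u using Ck_on_continuous[OF C1] .
  have hf: "(f has_derivative (\<lambda>u. D u x)) (at x)" if "x \<in> V" for x
    using Ck_on_Suc_has_derivative[OF C2 that] by (simp add: D_def)
  have hD: "(D u has_derivative (\<lambda>v. DD u v x)) (at x)" if "x \<in> V" for x u
    using Ck_on_Suc_has_derivative[OF C1 that] by (simp add: DD_def)
  have line: "((\<lambda>s. F (q + s *\<^sub>R u)) has_vector_derivative F' u) (at s within S)"
    if "(F has_derivative F') (at (q + s *\<^sub>R u))" for F :: "'a \<Rightarrow> 'b" and F' q u s S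
  proof -
    have 1: "((\<lambda>s. q + s *\<^sub>R u) has_derivative (\<lambda>r. r *\<^sub>R u)) (at s within S)"
      by (auto intro!: derivative_eq_intros)
    have "F' (r *\<^sub>R u) = r *\<^sub>R F' u" for r
      using linear_scale[OF bounded_linear.linear[OF has_derivative_bounded_linear[OF that]]] .
    then show ?thesis
      using has_derivative_compose[OF 1 that] by (simp add: has_vector_derivative_def)
  qed
  obtain r where r: "r > 0" "ball p r \<subseteq> V" using V openE by blast
  \<comment> \<open>The size of a parallelogram spanned by \<open>u\<close> and \<open>v\<close> at \<open>p\<close> that stays inside \<open>V\<close>.\<close>
  define \<epsilon> where "\<epsilon> = r / (2 * (norm u + norm v + 1))"
  have pos: "norm u + norm v + 1 > 0" by (simp add: add_nonneg_pos)
  have \<epsilon>: "\<epsilon> > 0" using r pos by (simp add: \<epsilon>_def)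
  have inV: "p + s *\<^sub>R u + t *\<^sub>R v \<in> V" if "\<bar>s\<bar> \<le> \<epsilon>" "\<bar>t\<bar> \<le> \<epsilon>" for s t
  proof -
    have "norm (s *\<^sub>R u + t *\<^sub>R v) \<le> \<bar>s\<bar> * norm u + \<bar>t\<bar> * norm v"
      by (rule norm_triangle_le) simp
    also have "\<dots> \<le> \<epsilon> * norm u + \<epsilon> * norm v"
      using that by (intro add_mono mult_right_mono) auto
    also have "\<dots> = \<epsilon> * (norm u + norm v)" by (simp add: distrib_left)
    also have "\<dots> < \<epsilon> * (2 * (norm u + norm v + 1))"
      by (rule mult_strict_left_mono[OF _ \<epsilon>]) (smt (verit) norm_ge_zero)
    also have "\<dots> = r" using pos by (simp add: \<epsilon>_def)
    finally have "dist p (p + s *\<^sub>R u + t *\<^sub>R v) < r"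
      unfolding dist_norm by (metis add.assoc add_diff_cancel_left' norm_minus_commute)
    then show ?thesis using r by auto
  qed
  have int: "((\<lambda>\<tau>. D v (p + s *\<^sub>R u + \<tau> *\<^sub>R v)) has_integral
      (f (p + s *\<^sub>R u + t *\<^sub>R v) - f (p + s *\<^sub>R u))) (cbox 0 t)"
    if "\<bar>s\<bar> \<le> \<epsilon>" "0 \<le> t" "t \<le> \<epsilon>" for s t
    using fundamental_theorem_of_calculus[of 0 t "\<lambda>\<tau>. f (p + s *\<^sub>R u + \<tau> *\<^sub>R v)" "\<lambda>\<tau>. D v (p + s *\<^sub>R u + \<tau> *\<^sub>R v)"]
      that line[OF hf[OF inV], of s _ ] by simp
  have key: "D u (p + t *\<^sub>R v) - D u p = integral {0..t} (\<lambda>\<tau>. DD v u (p + \<tau> *\<^sub>R v))"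
    if t: "0 \<le> t" "t \<le> \<epsilon>" for t
  proof -
    let ?U = "{-\<epsilon>..\<epsilon>}"
    have A: "((\<lambda>s. integral (cbox 0 t) (\<lambda>\<tau>. D v (p + s *\<^sub>R u + \<tau> *\<^sub>R v))) has_vector_derivative
        integral (cbox 0 t) (\<lambda>\<tau>. DD v u (p + 0 *\<^sub>R u + \<tau> *\<^sub>R v))) (at 0 within ?U)"
    proof (rule leibniz_rule_vector_derivative)
      fix s \<tau> :: real assume "s \<in> ?U" "\<tau> \<in> cbox 0 t"
      then have "p + \<tau> *\<^sub>R v + s *\<^sub>R u \<in> V" using t inV[of s \<tau>] by (auto simp: add_ac abs_le_iff)
      from line[OF hD[OF this]]
      show "((\<lambda>s. D v (p + s *\<^sub>R u + \<tau> *\<^sub>R v)) has_vector_derivative DD v u (p + s *\<^sub>R u + \<tau> *\<^sub>R v)) (at s within ?U)"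
        by (simp add: add_ac)
    next
      fix s assume "s \<in> ?U"
      then show "(\<lambda>\<tau>. D v (p + s *\<^sub>R u + \<tau> *\<^sub>R v)) integrable_on cbox 0 t"
        using int[of s t] t by (auto simp: abs_le_iff)
    next
      show "continuous_on (?U \<times> cbox 0 t) (\<lambda>(s, \<tau>). DD v u (p + s *\<^sub>R u + \<tau> *\<^sub>R v))"
        unfolding case_prod_beta
        by (rule continuous_on_compose2[OF cDD]) (use t inV in \<open>auto intro!: continuous_intros\<close>)
    qed (use \<epsilon> in auto)
    have B: "((\<lambda>s. f (p + s *\<^sub>R u + t *\<^sub>R v) - f (p + s *\<^sub>R u)) has_vector_derivative
        D u (p + 0 *\<^sub>R u + t *\<^sub>R v) - D u (p + 0 *\<^sub>R u)) (at 0 within ?U)"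
    proof (rule has_vector_derivative_diff)
      show "((\<lambda>s. f (p + s *\<^sub>R u + t *\<^sub>R v)) has_vector_derivative D u (p + 0 *\<^sub>R u + t *\<^sub>R v)) (at 0 within ?U)"
        using line[OF hf, of "p + t *\<^sub>R v" 0 u ?U] inV[of 0 t] t \<epsilon> by (simp add: add_ac)
      show "((\<lambda>s. f (p + s *\<^sub>R u)) has_vector_derivative D u (p + 0 *\<^sub>R u)) (at 0 within ?U)"
        using line[OF hf, of p 0 u ?U] inV[of 0 0] \<epsilon> by simp
    qed
    have "((\<lambda>s. integral (cbox 0 t) (\<lambda>\<tau>. D v (p + s *\<^sub>R u + \<tau> *\<^sub>R v))) has_vector_derivative
        D u (p + 0 *\<^sub>R u + t *\<^sub>R v) - D u (p + 0 *\<^sub>R u)) (at 0 within ?U)"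
      by (rule has_vector_derivative_transform[OF _ _ B])
         (use \<epsilon> int t in \<open>auto intro!: integral_unique simp flip: box_real\<close>)
    then have "D u (p + 0 *\<^sub>R u + t *\<^sub>R v) - D u (p + 0 *\<^sub>R u) =
       integral (cbox 0 t) (\<lambda>\<tau>. DD v u (p + 0 *\<^sub>R u + \<tau> *\<^sub>R v))"
      using vector_derivative_unique_within[OF _ _ A] \<epsilon> by (simp add: trivial_limit_within islimpt_Icc)
    then show ?thesis by simp
  qed
  have c: "continuous_on {0..\<epsilon>} (\<lambda>\<tau>. DD v u (p + \<tau> *\<^sub>R v))"
    by (rule continuous_on_compose2[OF cDD]) (use inV[of 0] \<epsilon> in \<open>auto intro!: continuous_intros\<close>)
  have "((\<lambda>t. integral {0..t} (\<lambda>\<tau>. DD v u (p + \<tau> *\<^sub>R v))) has_vector_derivative DD v u (p + 0 *\<^sub>R v)) (at 0 within {0..\<epsilon>})"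
    by (rule integral_has_vector_derivative[OF c]) (use \<epsilon> in auto)
  moreover have "((\<lambda>t. integral {0..t} (\<lambda>\<tau>. DD v u (p + \<tau> *\<^sub>R v))) has_vector_derivative DD u v (p + 0 *\<^sub>R v)) (at 0 within {0..\<epsilon>})"
    by (rule has_vector_derivative_transform[where f="\<lambda>t. D u (p + t *\<^sub>R v) - D u p"])
       (use \<epsilon> key line[OF hD, of p 0 v] V in \<open>auto intro!: derivative_eq_intros\<close>)
  ultimately have "DD v u p = DD u v p"
    using vector_derivative_unique_within[of 0 "{0..\<epsilon>}"] \<epsilon> by (fastforce simp: trivial_limit_within islimpt_Icc)
  then show ?thesis by (simp add: DD_def D_def[abs_def])
qed

lemma bounded_linear_axis: "bounded_linear (axis i :: complex \<Rightarrow> complex^'n)"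
  by (rule linear_conv_bounded_linear[THEN iffD1]) (auto intro!: linearI simp: vec_eq_iff axis_def)

text \<open>
  The coefficients of \<open>dc\<close>, with values off the sphere as well, so that \<open>ext_d\<close> applies to them.
\<close>

definition grad :: "(real^4 \<Rightarrow> complex) \<Rightarrow> real^4 \<Rightarrow> complex^4" where
  "grad c x = (\<chi> j. frechet_derivative (\<lambda>x. c (sgn x)) (at x) (axis j 1))"

lemma dirD_grad: "dirD c p v = pairing (grad c p) v"
  by (simp add: dirD_def pairing_def grad_def mult.commute)

lemma grad_ambient:
  assumes "open_S3 U" "smooth_S3 c U" "p \<in> U"
  shows "(\<lambda>x. grad c x $ j) differentiable (at p)" "diffS (\<lambda>x. grad c x $ j) p" "diffS (grad c) p"
proof -
  have p: "p \<in> S3" using assms open_S3_subset by blast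
  have "p \<in> ray_cone U" using assms in_S3 p by auto
  then have "grad c differentiable (at p) \<and> (\<forall>j. (\<lambda>x. grad c x $ j) differentiable (at p))"
  proof -
    have d: "(\<lambda>x. frechet_derivative (\<lambda>x. c (sgn x)) (at x) w) differentiable (at p)" for w
      using smooth_on_has_derivative[OF smooth_on_frechet[OF assms(2)[unfolded smooth_S3_def]] \<open>p \<in> ray_cone U\<close>]
      by (rule differentiableI)
    then have 1: "(\<lambda>x. grad c x $ j) differentiable (at p)" for j by (simp add: grad_def)
    have "grad c = (\<lambda>x. \<Sum>j\<in>UNIV. axis j (grad c x $ j))"
      by (auto simp: fun_eq_iff vec_eq_iff axis_def if_distrib cong: if_cong)
    moreover have "(\<lambda>x. axis j (grad c x $ j) :: complex^4) differentiable (at p)" for j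
      using 1[of j] bounded_linear.has_derivative[OF bounded_linear_axis]
      unfolding differentiable_def by blast
    then have "(\<lambda>x. \<Sum>j\<in>UNIV. axis j (grad c x $ j) :: complex^4) differentiable (at p)"
      by (simp add: sum_4)
    ultimately show ?thesis using 1 by simp
  qed
  then show "(\<lambda>x. grad c x $ j) differentiable (at p)" "diffS (\<lambda>x. grad c x $ j) p" "diffS (grad c) p"
    using diffS_ambient[OF p] by blast+
qed

text \<open>
  \<open>d (dc) = 0\<close>, by the symmetry of second derivatives of the extension along rays.
\<close>

lemma ext_d_grad:
  assumes U: "open_S3 U" "smooth_S3 c U" "p \<in> U" and vw: "v \<in> CT p" "w \<in> CT p"
  shows "ext_d (grad c) p v w = 0"
proof -
  have p: "p \<in> S3" using assms open_S3_subset by blast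
  define H where "H i j = frechet_derivative (\<lambda>x. grad c x $ j) (at p) (axis i 1)" for i j
  have d: "dirD (\<lambda>x. grad c x $ j) p u = (\<Sum>i\<in>UNIV. u $ i * H i j)" if "u \<in> CT p" for u j
    unfolding H_def
    by (rule dirD_ambient[OF p that]) (use grad_ambient(1)[OF U] frechet_derivative_works in blast)
  have pc: "p \<in> ray_cone U" using U p in_S3 by auto
  have sym: "H i j = H j i" for i j
    unfolding H_def grad_def
    using mixed_derivative_symmetric[OF open_cone[OF U(1)] pc, of "\<lambda>x. c (sgn x)"] U(2)
    by (simp add: smooth_S3_def smooth_on_def del: Ck_on.simps)
  have "pairing (dirD_vec (grad c) p v) w = (\<Sum>i\<in>UNIV. \<Sum>j\<in>UNIV. v $ i * H i j * w $ j)"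
    unfolding pairing_def dirD_vec_def
    by (simp add: d[OF vw(1)] sum_distrib_right) (rule sum.swap)
  also have "\<dots> = pairing (dirD_vec (grad c) p w) v"
    unfolding pairing_def dirD_vec_def
    by (simp add: d[OF vw(2)] sum_distrib_right) (simp add: sym mult_ac)
  finally show ?thesis by (simp add: ext_d_def)
qed

lemma diffS_inverse: "diffS f p \<Longrightarrow> p \<in> S3 \<Longrightarrow> f p \<noteq> 0 \<Longrightarrow> diffS (\<lambda>x. inverse (f x) :: complex) p"
  unfolding diffS_def by (rule differentiable_inverse) auto

lemma dirD_inverse:
  assumes "diffS c p" "p \<in> S3" "c p \<noteq> 0"
  shows "dirD (\<lambda>x. inverse (c x)) p v = - dirD c p v / (c p)\<^sup>2"
proof -
  obtain D where D: "((\<lambda>x. c (sgn x)) has_derivative D) (at p)" using assms diffS_E by metis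
  have "((\<lambda>x. inverse (c (sgn x))) has_derivative (\<lambda>h. - (inverse (c (sgn p)) * D h * inverse (c (sgn p))))) (at p)"
    by (rule Deriv.has_derivative_inverse[OF _ D]) (use assms in simp)
  from dirD_eq[OF this] show ?thesis unfolding dirD_eq[OF D] using assms
    by (simp add: sum_negf sum_distrib_left divide_inverse power2_eq_square mult_ac sum_divide_distrib)
qed

lemma diffS_vf_apply:
  assumes "open_S3 U" "smooth_S3 c U" "smooth_S3 Z U" "p \<in> U"
  shows "diffS (vf_apply Z c) p"
proof -
  have p: "p \<in> S3" using assms open_S3_subset by blast
  have "vf_apply Z c = (\<lambda>x. \<Sum>j\<in>UNIV. grad c x $ j * Z x $ j)"
    by (simp add: vf_apply_def dirD_grad pairing_def)
  moreover have "diffS (\<lambda>x. grad c x $ j * Z x $ j) p" for j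
    using grad_ambient(2)[OF assms(1,2,4)] diffS_vec_nth[OF smooth_S3_diffS[OF assms(3,4) p]]
    by (rule diffS_mult)
  ultimately show ?thesis by (simp add: sum_4 diffS_add)
qed

section \<open>Independence of the Tanaka-Webster scalars from the generator\<close>

text \<open>
  The vanishing of \<open>\<theta>\<close> on the Levi distribution in complex form: as \<open>\<theta>\<close> is real, it kills \<open>cnjv Z\<close> with
  \<open>Z\<close>.
\<close>

definition annihilates :: "(real^4 \<Rightarrow> real^4) \<Rightarrow> (real^4 \<Rightarrow> (complex^4) set) \<Rightarrow> bool" where
  "annihilates \<theta> H \<longleftrightarrow> (\<forall>p\<in>S3. \<forall>Z\<in>H p. pairing (cvec (\<theta> p)) Z = 0)"

lemma bounded_linear_cnjv: "bounded_linear (cnjv :: complex^4 \<Rightarrow> complex^4)"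
  by (rule linear_conv_bounded_linear[THEN iffD1]) (auto intro!: linearI simp: vec_eq_iff)

lemma smooth_S3_cnjv: "open_S3 U \<Longrightarrow> smooth_S3 Z U \<Longrightarrow> smooth_S3 (\<lambda>x. cnjv (Z x) :: complex^4) U"
  by (rule smooth_S3_bounded_linear[OF _ bounded_linear_cnjv])

lemma smooth_S3_vec_nth: "open_S3 U \<Longrightarrow> smooth_S3 Z U \<Longrightarrow> smooth_S3 (\<lambda>x. Z x $ i) U"
  by (rule smooth_S3_bounded_linear[OF _ bounded_linear_vec_nth])

lemma smooth_S3_pairing:
  "open_S3 U \<Longrightarrow> smooth_S3 \<alpha> U \<Longrightarrow> smooth_S3 Z U \<Longrightarrow> smooth_S3 (\<lambda>x. pairing (\<alpha> x :: complex^4) (Z x)) U"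
  unfolding pairing_def by (auto simp: sum_4 intro!: smooth_S3_add smooth_S3_mult smooth_S3_vec_nth)

lemma smooth_S3_scale:
  "open_S3 U \<Longrightarrow> smooth_S3 c U \<Longrightarrow> smooth_S3 \<alpha> U \<Longrightarrow> smooth_S3 (\<lambda>x. c x *s (\<alpha> x :: complex^4)) U"
proof -
  assume a: "open_S3 U" "smooth_S3 c U" "smooth_S3 \<alpha> U"
  have "smooth_S3 (\<lambda>x. \<Sum>i\<in>UNIV. axis i (c x * \<alpha> x $ i)) U"
    by (auto simp: sum_4 intro!: a smooth_S3_add smooth_S3_bounded_linear[OF _ bounded_linear_axis]
        smooth_S3_mult smooth_S3_vec_nth)
  moreover have "(\<lambda>x. \<Sum>i\<in>UNIV. axis i (c x * \<alpha> x $ i)) = (\<lambda>x. c x *s \<alpha> x)"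
    by (auto simp: fun_eq_iff vec_eq_iff axis_def if_distrib cong: if_cong)
  ultimately show ?thesis by simp
qed

lemma diffS_scale:
  assumes "diffS c p" "diffS \<alpha> p" shows "diffS (\<lambda>x. c x *s (\<alpha> x :: complex^4)) p"
proof -
  have "diffS (\<lambda>x. \<Sum>i\<in>UNIV. axis i (c x * \<alpha> x $ i)) p"
    by (auto simp: sum_4 intro!: assms diffS_add diffS_bounded_linear[OF bounded_linear_axis]
        diffS_mult diffS_vec_nth)
  moreover have "(\<lambda>x. \<Sum>i\<in>UNIV. axis i (c x * \<alpha> x $ i)) = (\<lambda>x. c x *s \<alpha> x)"
    by (auto simp: fun_eq_iff vec_eq_iff axis_def if_distrib cong: if_cong)
  ultimately show ?thesis by simp
qed

abbreviation adapted_frame ::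
  "(real^4 \<Rightarrow> real^4) \<Rightarrow> (real^4 \<Rightarrow> complex^4) \<Rightarrow> (real^4 \<Rightarrow> complex^4) \<Rightarrow> (real^4 \<Rightarrow> real^4) \<Rightarrow> real^4 \<Rightarrow> bool" where
  "adapted_frame \<theta> \<theta>1 Z T x \<equiv>
       cvec (T x) \<in> CT x \<and>
       (\<forall>v\<in>CT x. ext_d (\<lambda>x. cvec (\<theta> x)) x (cvec (T x)) v = 0) \<and>
       pairing (\<theta>1 x) (Z x) = 1 \<and> pairing (\<theta>1 x) (cnjv (Z x)) = 0 \<and> pairing (\<theta>1 x) (cvec (T x)) = 0 \<and>
       pairing (cnjv (\<theta>1 x)) (Z x) = 0 \<and> pairing (cnjv (\<theta>1 x)) (cnjv (Z x)) = 1 \<and>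
       pairing (cnjv (\<theta>1 x)) (cvec (T x)) = 0 \<and>
       pairing (cvec (\<theta> x)) (Z x) = 0 \<and> pairing (cvec (\<theta> x)) (cnjv (Z x)) = 0 \<and>
       pairing (cvec (\<theta> x)) (cvec (T x)) = 1"

lemma Tanaka_Webster_frame:
  assumes TW: "Tanaka_Webster H \<theta> U Z \<theta>1 h \<omega>" and ann: "annihilates \<theta> H"
  shows "open_S3 U" "smooth_S3 Z U" "smooth_S3 \<theta>1 U" "smooth_S3 h U" "smooth_S3 \<omega> U"
    and "\<And>x. x \<in> U \<Longrightarrow> Z x \<in> CT x \<and> Z x \<noteq> 0 \<and> H x = vec.span {Z x} \<and> h x > 0"
    and "\<exists>T. \<forall>x\<in>U. adapted_frame \<theta> \<theta>1 Z T x"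
proof -
  note tw = TW[unfolded Tanaka_Webster_def local_generator_def]
  show "open_S3 U" "smooth_S3 Z U" "smooth_S3 \<theta>1 U" "smooth_S3 h U" "smooth_S3 \<omega> U" using tw by blast+
  show l: "Z x \<in> CT x \<and> Z x \<noteq> 0 \<and> H x = vec.span {Z x} \<and> h x > 0" if "x \<in> U" for x using tw that by blast
  obtain T where T: "Reeb_field \<theta> U T" "\<forall>p\<in>U. pairing (\<theta>1 p) (Z p) = 1 \<and> pairing (\<theta>1 p) (cnjv (Z p)) = 0 \<and>
               pairing (\<theta>1 p) (cvec (T p)) = 0" using tw by blast
  show "\<exists>T. \<forall>x\<in>U. adapted_frame \<theta> \<theta>1 Z T x"
  proof (intro exI[of _ T] ballI)
    fix x assume x: "x \<in> U"
    have xS: "x \<in> S3" using tw x open_S3_subset by blast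
    have "Z x \<in> H x" using l[OF x] by (simp add: vec.span_base)
    then have "pairing (cvec (\<theta> x)) (Z x) = 0" using ann xS by (auto simp: annihilates_def)
    then show "adapted_frame \<theta> \<theta>1 Z T x"
      using T x by (simp add: Reeb_field_def pairing_cnjv pairing_cvec_cnjv pairing_cvec_cvec)
  qed
qed

text \<open>
  Two generators differ by a nowhere zero factor \<open>c\<close>, so that \<open>\<theta>1 = c \<theta>1'\<close> on tangent vectors, and the
  two Reeb fields agree because \<open>d\<theta>\<close> is nondegenerate on \<open>H + cnj H\<close>. Let
  \<open>\<delta> = \<omega>' - \<omega> - dc / c\<close> be the defect in the transformation law of the connection form. Comparing the
  structure equations for \<open>\<theta>1\<close> and \<open>c \<theta>1'\<close> shows that \<open>c \<theta>1' \<and> \<delta>\<close> is a multiple of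
  \<open>\<theta> \<and> cnj \<theta>1'\<close>; evaluation on the frame makes both sides vanish, so \<open>\<delta>\<close> is a multiple of \<open>\<theta>1'\<close>. The
  equations for \<open>dh\<close> and \<open>dh'\<close> force \<open>\<delta> + cnj \<delta> = 0\<close>, and hence \<open>\<delta> = 0\<close>.
\<close>

lemma Tanaka_Webster_gauge:
  assumes TW: "Tanaka_Webster H \<theta> U Z \<theta>1 h \<omega>" and TW': "Tanaka_Webster H \<theta> U' Z' \<theta>1' h' \<omega>'"
    and ann: "annihilates \<theta> H"
  defines "c \<equiv> \<lambda>x. pairing (\<theta>1 x) (Z' x)"
  shows "open_S3 (U \<inter> U')" "smooth_S3 c (U \<inter> U')"
    and "\<And>x. x \<in> U \<inter> U' \<Longrightarrow> c x \<noteq> 0 \<and> Z' x = c x *s Z x \<and> of_real (h' x) = c x * cnj (c x) * of_real (h x)"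
    and "\<And>x v. x \<in> U \<inter> U' \<Longrightarrow> v \<in> CT x \<Longrightarrow> pairing (\<omega>' x) v = pairing (\<omega> x) v + dirD c x v / c x"
proof -
  note F = Tanaka_Webster_frame[OF TW ann] and F' = Tanaka_Webster_frame[OF TW' ann]
  note tw = TW[unfolded Tanaka_Webster_def] and tw' = TW'[unfolded Tanaka_Webster_def]
  let ?V = "U \<inter> U'"
  let ?th = "\<lambda>x. cvec (\<theta> x)"
  show V: "open_S3 ?V" using F(1) F'(1) by (rule open_S3_Int)
  show sc: "smooth_S3 c ?V" unfolding c_def
    by (rule smooth_S3_pairing[OF V]) (auto intro: smooth_S3_subset F F')
  obtain T where T: "\<forall>x\<in>U. adapted_frame \<theta> \<theta>1 Z T x" using F(7) by blast
  obtain T' where T': "\<forall>x\<in>U'. adapted_frame \<theta> \<theta>1' Z' T' x" using F'(7) by blast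
  have dth: "ext_d ?th x v w = \<i> * of_real (h x) * wedge (\<theta>1 x) (cnjv (\<theta>1 x)) v w"
    if "x \<in> U" "v \<in> CT x" "w \<in> CT x" for x v w using tw that by blast
  have dth': "ext_d ?th x v w = \<i> * of_real (h' x) * wedge (\<theta>1' x) (cnjv (\<theta>1' x)) v w"
    if "x \<in> U'" "v \<in> CT x" "w \<in> CT x" for x v w using tw' that by blast
  have Z': "c x \<noteq> 0 \<and> Z' x = c x *s Z x" if x: "x \<in> ?V" for x
  proof -
    have "Z' x \<in> vec.span {Z x}" using F(6)[of x] F'(6)[of x] x vec.span_base[of "Z' x" "{Z' x}"] by auto
    then obtain k where k: "Z' x = k *s Z x" by (auto simp: vec.span_singleton)
    then have "c x = k" using T x by (simp add: c_def pairing_simps)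
    then show ?thesis using k F'(6)[of x] x by auto
  qed
  have hc: "of_real (h' x) = c x * cnj (c x) * of_real (h x)" if x: "x \<in> ?V" for x
  proof -
    have m: "Z x \<in> CT x" "cnjv (Z x) \<in> CT x" "Z' x \<in> CT x" "cnjv (Z' x) \<in> CT x"
      using F(6)[of x] F'(6)[of x] x CT_simps(3) by auto
    have "ext_d ?th x (Z' x) (cnjv (Z' x)) = \<i> * of_real (h' x)"
      using dth'[of x "Z' x" "cnjv (Z' x)"] m x T' by (simp add: wedge_def)
    moreover have "ext_d ?th x (Z x) (cnjv (Z x)) = \<i> * of_real (h x)"
      using dth[of x "Z x" "cnjv (Z x)"] m x T by (simp add: wedge_def)
    ultimately show ?thesis using Z'[OF x] by (simp add: ext_d_lin mult_ac)
  qed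
  show "c x \<noteq> 0 \<and> Z' x = c x *s Z x \<and> of_real (h' x) = c x * cnj (c x) * of_real (h x)"
    if "x \<in> U \<inter> U'" for x using Z'[OF that] hc[OF that] by simp
  have TT: "cvec (T' x) = cvec (T x)" if x: "x \<in> ?V" for x
  proof -
    have xS: "x \<in> S3" using V x open_S3_subset by blast
    have m: "Z x \<in> CT x" "cnjv (Z x) \<in> CT x" "cvec (T x) \<in> CT x" "cvec (T' x) \<in> CT x"
      using F(6)[of x] x CT_simps(3) T T' by auto
    have h: "h x \<noteq> 0" using F(6)[of x] x by auto
    have 1: "cvec (T' x) = pairing (\<theta>1 x) (cvec (T' x)) *s Z x + pairing (cnjv (\<theta>1 x)) (cvec (T' x)) *s cnjv (Z x)
      + pairing (?th x) (cvec (T' x)) *s cvec (T x)"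
      by (rule dual_frame[OF xS m(1-3)]) (use T x m in auto)
    have "0 = ext_d ?th x (cvec (T' x)) (cnjv (Z x))" using T' x m by auto
    then have a: "pairing (\<theta>1 x) (cvec (T' x)) = 0"
      using dth[of x "cvec (T' x)" "cnjv (Z x)"] m x T h by (simp add: wedge_def)
    then have b: "pairing (cnjv (\<theta>1 x)) (cvec (T' x)) = 0" by (simp add: pairing_cnjv)
    have "pairing (?th x) (cvec (T' x)) = 1" using T' x by auto
    then show ?thesis using 1 unfolding a b by simp
  qed
  have th1: "pairing (\<theta>1 x) v = c x * pairing (\<theta>1' x) v" if x: "x \<in> ?V" and v: "v \<in> CT x" for x v
  proof -
    have xS: "x \<in> S3" using V x open_S3_subset by blast
    have m: "Z x \<in> CT x" "cnjv (Z x) \<in> CT x" "cvec (T x) \<in> CT x"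
      using F(6)[of x] x CT_simps(3) T T' by auto
    have 1: "v = pairing (\<theta>1 x) v *s Z x + pairing (cnjv (\<theta>1 x)) v *s cnjv (Z x) + pairing (?th x) v *s cvec (T x)"
      by (rule dual_frame[OF xS m(1-3)]) (use T x m v in auto)
    have "c x * pairing (\<theta>1' x) (Z x) = 1" "pairing (\<theta>1' x) (cnjv (Z x)) = 0" "pairing (\<theta>1' x) (cvec (T x)) = 0"
    proof -
      have "pairing (\<theta>1' x) (Z' x) = 1" "pairing (\<theta>1' x) (cnjv (Z' x)) = 0" using T' x by auto
      then show "c x * pairing (\<theta>1' x) (Z x) = 1" "pairing (\<theta>1' x) (cnjv (Z x)) = 0"
        using Z'[OF x] by (auto simp: pairing_simps)
      show "pairing (\<theta>1' x) (cvec (T x)) = 0" using T' x TT[OF x] by auto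
    qed
    then show ?thesis by (subst (2) 1) (simp add: pairing_simps)
  qed
  obtain A where A: "\<forall>p\<in>U. \<forall>v\<in>CT p. \<forall>w\<in>CT p.
        ext_d \<theta>1 p v w = wedge (\<theta>1 p) (\<omega> p) v w
            + A p * wedge (cvec (\<theta> p)) (cnjv (\<theta>1 p)) v w" using tw by blast
  obtain A' where A': "\<forall>p\<in>U'. \<forall>v\<in>CT p. \<forall>w\<in>CT p.
        ext_d \<theta>1' p v w = wedge (\<theta>1' p) (\<omega>' p) v w
            + A' p * wedge (cvec (\<theta> p)) (cnjv (\<theta>1' p)) v w" using tw' by blast
  show "pairing (\<omega>' x) v = pairing (\<omega> x) v + dirD c x v / c x" if x: "x \<in> ?V" and v: "v \<in> CT x" for x v
  proof -
    have xS: "x \<in> S3" using V x open_S3_subset by blast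
    have c0: "c x \<noteq> 0" using Z'[OF x] by simp
    define \<delta> where "\<delta> v = pairing (\<omega>' x) v - pairing (\<omega> x) v - dirD c x v / c x" for v
    define B where "B = A x * cnj (c x) - c x * A' x"
    have dc: "diffS c x" using sc x xS by (rule smooth_S3_diffS)
    have d1: "diffS \<theta>1 x" "diffS \<theta>1' x" using smooth_S3_diffS F(3) F'(3) x xS by auto
    have eq: "c x * (pairing (\<theta>1' x) v * \<delta> w - pairing (\<theta>1' x) w * \<delta> v) =
        B * wedge (?th x) (cnjv (\<theta>1' x)) v w" if vw: "v \<in> CT x" "w \<in> CT x" for v w
    proof -
      have "ext_d \<theta>1 x v w = ext_d (\<lambda>x. c x *s \<theta>1' x) x v w"
        by (rule ext_d_cong_CT[OF V x d1(1) diffS_scale[OF dc d1(2)] _ vw]) (simp add: th1 pairing_simps)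
      also have "\<dots> = dirD c x v * pairing (\<theta>1' x) w - dirD c x w * pairing (\<theta>1' x) v + c x * ext_d \<theta>1' x v w"
        by (rule ext_d_scale[OF dc d1(2) xS])
      finally have E: "wedge (\<theta>1 x) (\<omega> x) v w + A x * wedge (?th x) (cnjv (\<theta>1 x)) v w =
        dirD c x v * pairing (\<theta>1' x) w - dirD c x w * pairing (\<theta>1' x) v
        + c x * (wedge (\<theta>1' x) (\<omega>' x) v w + A' x * wedge (?th x) (cnjv (\<theta>1' x)) v w)"
        using A A' x vw by simp
      have t: "pairing (cnjv (\<theta>1 x)) u = cnj (c x) * pairing (cnjv (\<theta>1' x)) u" if "u \<in> CT x" for u
        using th1[OF x CT_simps(3)[OF that]] by (simp add: pairing_cnjv)
      have cd: "c x * \<delta> u = c x * pairing (\<omega>' x) u - c x * pairing (\<omega> x) u - dirD c x u" for u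
        using c0 by (simp add: \<delta>_def right_diff_distrib)
      have "c x * (pairing (\<theta>1' x) v * \<delta> w - pairing (\<theta>1' x) w * \<delta> v) =
         pairing (\<theta>1' x) v * (c x * \<delta> w) - pairing (\<theta>1' x) w * (c x * \<delta> v)" by (simp add: algebra_simps)
      also have "\<dots> = B * wedge (?th x) (cnjv (\<theta>1' x)) v w"
        using E unfolding cd by (simp add: wedge_def th1[OF x vw(1)] th1[OF x vw(2)] t[OF vw(1)] t[OF vw(2)] B_def algebra_simps)
      finally show ?thesis .
    qed
    have m: "Z' x \<in> CT x" "cnjv (Z' x) \<in> CT x" "cvec (T' x) \<in> CT x"
      using F'(6)[of x] x CT_simps(3) T' by auto
    have dzb: "\<delta> (cnjv (Z' x)) = 0" using eq[OF m(1,2)] T' x c0 by (simp add: wedge_def)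
    have beta0: "B = 0" using eq[OF m(2,3)] T' x c0 by (simp add: wedge_def)
    have dT: "\<delta> (cvec (T' x)) = 0" using eq[OF m(1,3)] T' x c0 beta0 by (simp add: wedge_def)
    have dz: "\<delta> (Z' x) = 0"
    proof -
      have dh: "dirD (\<lambda>x. of_real (h' x)) x u = dirD (\<lambda>x. c x * cnj (c x) * of_real (h x)) x u" for u
        by (rule dirD_cong(1)[OF V x hc])
      have dd: "diffS (\<lambda>x. cnj (c x)) x" "diffS (\<lambda>x. complex_of_real (h x)) x" "diffS (\<lambda>x. c x * cnj (c x)) x"
        using diffS_bounded_linear[OF bounded_linear_cnj dc]
          diffS_bounded_linear[OF bounded_linear_of_real smooth_S3_diffS[OF F(4)]] x xS diffS_mult[OF dc] by auto
      have dh': "dirD (\<lambda>x. complex_of_real (h x)) x u = of_real (h x) * (pairing (\<omega> x) u + pairing (cnjv (\<omega> x)) u)"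
        if "u \<in> CT x" for u using tw x that by blast
      have dh'': "dirD (\<lambda>x. complex_of_real (h' x)) x u = of_real (h' x) * (pairing (\<omega>' x) u + pairing (cnjv (\<omega>' x)) u)"
        if "u \<in> CT x" for u using tw' x that by blast
      have h0: "h x \<noteq> 0" using F(6)[of x] x by auto
      let ?u = "Z' x"
      have "c x * cnj (c x) * of_real (h x) * (pairing (\<omega>' x) ?u + pairing (cnjv (\<omega>' x)) ?u) =
         (c x * cnj (dirD c x (cnjv ?u)) + dirD c x ?u * cnj (c x)) * of_real (h x) +
         c x * cnj (c x) * of_real (h x) * (pairing (\<omega> x) ?u + pairing (cnjv (\<omega> x)) ?u)"
        using dh[of ?u] unfolding dh''[OF m(1)] hc[OF x] dirD_mult[OF dd(3,2) xS] dirD_mult[OF dc dd(1) xS]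
          dirD_cnj[OF dc] dh'[OF m(1)] by (simp add: algebra_simps)
      then have "complex_of_real (h x) * (c x * cnj (c x) * (pairing (\<omega>' x) ?u + pairing (cnjv (\<omega>' x)) ?u)) =
         of_real (h x) * ((c x * cnj (dirD c x (cnjv ?u)) + dirD c x ?u * cnj (c x)) +
         c x * cnj (c x) * (pairing (\<omega> x) ?u + pairing (cnjv (\<omega> x)) ?u))"
        by (simp add: algebra_simps)
      then have "c x * cnj (c x) * (pairing (\<omega>' x) ?u + pairing (cnjv (\<omega>' x)) ?u) =
         (c x * cnj (dirD c x (cnjv ?u)) + dirD c x ?u * cnj (c x)) +
         c x * cnj (c x) * (pairing (\<omega> x) ?u + pairing (cnjv (\<omega> x)) ?u)"
        using h0 by (simp only: mult_left_cancel of_real_eq_0_iff not_False_eq_True)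
      then have "\<delta> ?u + cnj (\<delta> (cnjv ?u)) = 0"
        using c0 by (simp add: \<delta>_def pairing_cnjv divide_simps) (simp add: algebra_simps)
      then show ?thesis using dzb by simp
    qed
    have lin: "\<delta> (a *s u) = a * \<delta> u" "\<delta> (u + w) = \<delta> u + \<delta> w" for a u w
      by (simp_all add: \<delta>_def pairing_simps dirD_lin algebra_simps add_divide_distrib)
    have "v = pairing (\<theta>1' x) v *s Z' x + pairing (cnjv (\<theta>1' x)) v *s cnjv (Z' x) + pairing (?th x) v *s cvec (T' x)"
      by (rule dual_frame[OF xS m(1-3)]) (use T' x m v in auto)
    then have "\<delta> v = pairing (\<theta>1' x) v * \<delta> (Z' x) + pairing (cnjv (\<theta>1' x)) v * \<delta> (cnjv (Z' x)) + pairing (?th x) v * \<delta> (cvec (T' x))"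
      by (metis lin)
    then have "\<delta> v = 0" using dz dzb dT by simp
    then show ?thesis by (simp add: \<delta>_def algebra_simps)
  qed
qed

text \<open>
  The connection forms differ by \<open>dc / c\<close>, which is closed.
\<close>

lemma ext_d_connection_gauge:
  assumes TW: "Tanaka_Webster H \<theta> U Z \<theta>1 h \<omega>" and TW': "Tanaka_Webster H \<theta> U' Z' \<theta>1' h' \<omega>'"
    and ann: "annihilates \<theta> H" and p: "p \<in> U \<inter> U'" and vw: "v \<in> CT p" "w \<in> CT p"
  shows "ext_d \<omega>' p v w = ext_d \<omega> p v w"
proof -
  note F = Tanaka_Webster_frame[OF TW ann] and F' = Tanaka_Webster_frame[OF TW' ann]
  define c where "c x = pairing (\<theta>1 x) (Z' x)" for x
  note G = Tanaka_Webster_gauge[OF TW TW' ann, folded c_def]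
  have pS: "p \<in> S3" using p G(1) open_S3_subset by blast
  have c0: "c p \<noteq> 0" using G(3)[OF p] by simp
  have dc: "diffS c p" using G(2) p pS by (rule smooth_S3_diffS)
  have dg: "diffS (grad c) p" using grad_ambient(3)[OF G(1,2) p] .
  have di: "diffS (\<lambda>x. inverse (c x)) p" using dc pS c0 by (rule diffS_inverse)
  have d\<omega>: "diffS \<omega> p" "diffS \<omega>' p" using F(5) F'(5) p pS by (auto intro: smooth_S3_diffS)
  have ds: "diffS (\<lambda>x. inverse (c x) *s grad c x) p" using di dg by (rule diffS_scale)
  have "ext_d \<omega>' p v w = ext_d (\<lambda>x. \<omega> x + inverse (c x) *s grad c x) p v w"
    by (rule ext_d_cong_CT[OF G(1) p d\<omega>(2) diffS_add[OF d\<omega>(1) ds] _ vw])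
       (simp add: G(4) pairing_simps dirD_grad divide_inverse mult.commute)
  also have "\<dots> = ext_d \<omega> p v w + ext_d (\<lambda>x. inverse (c x) *s grad c x) p v w"
    by (rule ext_d_add[OF d\<omega>(1) ds])
  also have "ext_d (\<lambda>x. inverse (c x) *s grad c x) p v w = 0"
    by (simp add: ext_d_scale[OF di dg pS] ext_d_grad[OF G(1,2) p vw] dirD_inverse[OF dc pS c0] flip: dirD_grad)
  finally show ?thesis by simp
qed

text \<open>
  Replacing \<open>Z\<close> by \<open>c Z\<close> multiplies both \<open>d\<omega>(Z, cnj Z)\<close> and \<open>h\<close> by \<open>\<bar>c\<bar>\<^sup>2\<close>, so every generator yields the
  same quotient.
\<close>

lemma Webster_curvature_eqI:
  assumes TW: "Tanaka_Webster H \<theta> U Z \<theta>1 h \<omega>" and ann: "annihilates \<theta> H" and p: "p \<in> U"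
    and R: "ext_d \<omega> p (Z p) (cnjv (Z p)) = of_real R * of_real (h p)"
  shows "Webster_curvature H \<theta> p = R"
  unfolding Webster_curvature_def
proof (rule the_equality)
  note F = Tanaka_Webster_frame[OF TW ann]
  let ?th = "cvec (\<theta> p)"
  have pS: "p \<in> S3" using p F(1) open_S3_subset by blast
  obtain T where T: "\<forall>x\<in>U. adapted_frame \<theta> \<theta>1 Z T x" using F(7) by blast
  have m: "Z p \<in> CT p" "cnjv (Z p) \<in> CT p" "cvec (T p) \<in> CT p"
    using F(6)[OF p] CT_simps(3) T p by auto
  define \<beta> where "\<beta> = ext_d \<omega> p (Z p) (cvec (T p)) *s \<theta>1 p + ext_d \<omega> p (cnjv (Z p)) (cvec (T p)) *s cnjv (\<theta>1 p)"
  have "ext_d \<omega> p v w = complex_of_real R * complex_of_real (h p) * wedge (\<theta>1 p) (cnjv (\<theta>1 p)) v w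
        + wedge \<beta> ?th v w" if vw: "v \<in> CT p" "w \<in> CT p" for v w
  proof -
    have fr: "u = pairing (\<theta>1 p) u *s Z p + pairing (cnjv (\<theta>1 p)) u *s cnjv (Z p) + pairing ?th u *s cvec (T p)"
      if "u \<in> CT p" for u
      by (rule dual_frame[OF pS m]) (use T p that in auto)
    define v1 v2 v3 w1 w2 w3 where "v1 = pairing (\<theta>1 p) v" "v2 = pairing (cnjv (\<theta>1 p)) v" "v3 = pairing ?th v"
      "w1 = pairing (\<theta>1 p) w" "w2 = pairing (cnjv (\<theta>1 p)) w" "w3 = pairing ?th w"
    note v1_def = this
    have e: "ext_d \<omega> p v w = ext_d \<omega> p (v1 *s Z p + v2 *s cnjv (Z p) + v3 *s cvec (T p))
      (w1 *s Z p + w2 *s cnjv (Z p) + w3 *s cvec (T p))"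
      using fr[OF vw(1)] fr[OF vw(2)] v1_def by metis
    have b: "pairing \<beta> v = ext_d \<omega> p (Z p) (cvec (T p)) * v1 + ext_d \<omega> p (cnjv (Z p)) (cvec (T p)) * v2"
      "pairing \<beta> w = ext_d \<omega> p (Z p) (cvec (T p)) * w1 + ext_d \<omega> p (cnjv (Z p)) (cvec (T p)) * w2"
      by (simp_all add: \<beta>_def pairing_simps v1_def)
    show ?thesis
      unfolding e wedge_def b v1_def(3,6)[symmetric] v1_def(1,2,4,5)[symmetric]
      by (simp add: ext_d_lin ext_d_swap[of \<omega> p "cvec (T p)"] ext_d_swap[of \<omega> p "cnjv (Z p)" "Z p"] R algebra_simps)
  qed
  then show "\<exists>U Z \<theta>1 h \<omega> \<beta>. p \<in> U \<and> Tanaka_Webster H \<theta> U Z \<theta>1 h \<omega> \<and>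
     (\<forall>v\<in>CT p. \<forall>w\<in>CT p. ext_d \<omega> p v w
        = complex_of_real R * complex_of_real (h p) * wedge (\<theta>1 p) (cnjv (\<theta>1 p)) v w
        + wedge \<beta> (cvec (\<theta> p)) v w)"
    using p TW by blast
  fix R'
  assume "\<exists>U Z \<theta>1 h \<omega> \<beta>. p \<in> U \<and> Tanaka_Webster H \<theta> U Z \<theta>1 h \<omega> \<and>
     (\<forall>v\<in>CT p. \<forall>w\<in>CT p. ext_d \<omega> p v w
        = complex_of_real R' * complex_of_real (h p) * wedge (\<theta>1 p) (cnjv (\<theta>1 p)) v w
        + wedge \<beta> (cvec (\<theta> p)) v w)"
  then obtain U' Z' \<theta>1' h' \<omega>' \<beta>' where p': "p \<in> U'" and TW': "Tanaka_Webster H \<theta> U' Z' \<theta>1' h' \<omega>'"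
    and E: "\<And>v w. v \<in> CT p \<Longrightarrow> w \<in> CT p \<Longrightarrow> ext_d \<omega>' p v w
        = complex_of_real R' * complex_of_real (h' p) * wedge (\<theta>1' p) (cnjv (\<theta>1' p)) v w
        + wedge \<beta>' (cvec (\<theta> p)) v w" by blast
  note F' = Tanaka_Webster_frame[OF TW' ann]
  have pp: "p \<in> U \<inter> U'" using p p' by simp
  define c where "c x = pairing (\<theta>1 x) (Z' x)" for x
  note G = Tanaka_Webster_gauge(3)[OF TW TW' ann pp, folded c_def]
  have m': "Z' p \<in> CT p" "cnjv (Z' p) \<in> CT p" using F'(6)[OF p'] CT_simps(3) by auto
  have "ext_d \<omega>' p (Z' p) (cnjv (Z' p)) = of_real R' * of_real (h' p)"
    unfolding E[OF m'] using F'(7) p' by (auto simp: wedge_def)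
  moreover have "ext_d \<omega>' p (Z' p) (cnjv (Z' p)) = c p * cnj (c p) * (of_real R * of_real (h p))"
    unfolding ext_d_connection_gauge[OF TW TW' ann pp m'] using G R by (simp add: ext_d_lin)
  ultimately have "complex_of_real (h' p) * of_real R' = of_real (h' p) * of_real R" using G by (simp add: mult_ac)
  then show "R' = R" using F'(6)[OF p'] by simp
qed

text \<open>
  Passing from \<open>Z\<close> to \<open>c Z\<close> multiplies the second-order terms by \<open>\<bar>c\<bar>\<^sup>2\<close> and adds first-order terms with
  derivatives of \<open>c\<close>; the latter are cancelled by the summand \<open>dc / c\<close> in the new connection form.
\<close>

lemma sublaplacian_eqI:
  assumes TW: "Tanaka_Webster H \<theta> U Z \<theta>1 h \<omega>" and ann: "annihilates \<theta> H" and p: "p \<in> U"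
    and u: "smooth_S3 u S3"
    and r: "complex_of_real r = 1 / complex_of_real (h p) *
        (vf_apply Z (vf_apply (\<lambda>x. cnjv (Z x)) (\<lambda>x. complex_of_real (u x))) p
         + vf_apply (\<lambda>x. cnjv (Z x)) (vf_apply Z (\<lambda>x. complex_of_real (u x))) p
         - pairing (\<omega> p) (cnjv (Z p)) * vf_apply Z (\<lambda>x. complex_of_real (u x)) p
         - pairing (cnjv (\<omega> p)) (Z p) * vf_apply (\<lambda>x. cnjv (Z x)) (\<lambda>x. complex_of_real (u x)) p)"
  shows "sublaplacian H \<theta> u p = r"
  unfolding sublaplacian_def Let_def
proof (rule the_equality)
  show "\<exists>U Z \<theta>1 h \<omega>. p \<in> U \<and> Tanaka_Webster H \<theta> U Z \<theta>1 h \<omega> \<and> complex_of_real r = 1 / complex_of_real (h p) *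
        (vf_apply Z (vf_apply (\<lambda>x. cnjv (Z x)) (\<lambda>x. complex_of_real (u x))) p
         + vf_apply (\<lambda>x. cnjv (Z x)) (vf_apply Z (\<lambda>x. complex_of_real (u x))) p
         - pairing (\<omega> p) (cnjv (Z p)) * vf_apply Z (\<lambda>x. complex_of_real (u x)) p
         - pairing (cnjv (\<omega> p)) (Z p) * vf_apply (\<lambda>x. cnjv (Z x)) (\<lambda>x. complex_of_real (u x)) p)"
    using TW p r by blast
  fix r'
  assume "\<exists>U Z \<theta>1 h \<omega>. p \<in> U \<and> Tanaka_Webster H \<theta> U Z \<theta>1 h \<omega> \<and> complex_of_real r' = 1 / complex_of_real (h p) *
        (vf_apply Z (vf_apply (\<lambda>x. cnjv (Z x)) (\<lambda>x. complex_of_real (u x))) p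
         + vf_apply (\<lambda>x. cnjv (Z x)) (vf_apply Z (\<lambda>x. complex_of_real (u x))) p
         - pairing (\<omega> p) (cnjv (Z p)) * vf_apply Z (\<lambda>x. complex_of_real (u x)) p
         - pairing (cnjv (\<omega> p)) (Z p) * vf_apply (\<lambda>x. cnjv (Z x)) (\<lambda>x. complex_of_real (u x)) p)"
  then obtain U' Z' \<theta>1' h' \<omega>' where p': "p \<in> U'" and TW': "Tanaka_Webster H \<theta> U' Z' \<theta>1' h' \<omega>'"
    and r': "complex_of_real r' = 1 / complex_of_real (h' p) *
        (vf_apply Z' (vf_apply (\<lambda>x. cnjv (Z' x)) (\<lambda>x. complex_of_real (u x))) p
         + vf_apply (\<lambda>x. cnjv (Z' x)) (vf_apply Z' (\<lambda>x. complex_of_real (u x))) p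
         - pairing (\<omega>' p) (cnjv (Z' p)) * vf_apply Z' (\<lambda>x. complex_of_real (u x)) p
         - pairing (cnjv (\<omega>' p)) (Z' p) * vf_apply (\<lambda>x. cnjv (Z' x)) (\<lambda>x. complex_of_real (u x)) p)" by blast
  note F = Tanaka_Webster_frame[OF TW ann] and F' = Tanaka_Webster_frame[OF TW' ann]
  have pp: "p \<in> U \<inter> U'" using p p' by simp
  define c where "c x = pairing (\<theta>1 x) (Z' x)" for x
  note G = Tanaka_Webster_gauge[OF TW TW' ann, folded c_def]
  let ?uc = "\<lambda>x. complex_of_real (u x)"
  let ?Zb = "\<lambda>x. cnjv (Z x)"
  have pS: "p \<in> S3" using p F(1) open_S3_subset by blast
  have c0: "c p \<noteq> 0" using G(3)[OF pp] by simp
  have dc: "diffS c p" using G(2) pp pS by (rule smooth_S3_diffS)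
  have dcc: "diffS (\<lambda>x. cnj (c x)) p" using diffS_bounded_linear[OF bounded_linear_cnj dc] .
  have uc: "smooth_S3 ?uc U"
    using smooth_S3_subset[OF smooth_S3_bounded_linear[OF open_S3_UNIV bounded_linear_of_real u]] open_S3_subset[OF F(1)] by blast
  have dg: "diffS (vf_apply Z ?uc) p" "diffS (vf_apply ?Zb ?uc) p"
    using diffS_vf_apply[OF F(1) uc F(2) p] diffS_vf_apply[OF F(1) uc smooth_S3_cnjv[OF F(1,2)] p] by auto
  have Zx: "Z' x = c x *s Z x" if "x \<in> U \<inter> U'" for x using G(3)[OF that] by simp
  have 1: "vf_apply Z' ?uc x = c x * vf_apply Z ?uc x" "vf_apply (\<lambda>x. cnjv (Z' x)) ?uc x = cnj (c x) * vf_apply ?Zb ?uc x"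
    if "x \<in> U \<inter> U'" for x using Zx[OF that] by (auto simp: vf_apply_def dirD_lin)
  have 2: "vf_apply Z' (vf_apply (\<lambda>x. cnjv (Z' x)) ?uc) p =
     c p * (cnj (c p) * vf_apply Z (vf_apply ?Zb ?uc) p + cnj (dirD c p (cnjv (Z p))) * vf_apply ?Zb ?uc p)"
  proof -
    have "vf_apply Z' (vf_apply (\<lambda>x. cnjv (Z' x)) ?uc) p = c p * dirD (vf_apply (\<lambda>x. cnjv (Z' x)) ?uc) p (Z p)"
      by (simp add: vf_apply_def Zx[OF pp] dirD_lin)
    also have "dirD (vf_apply (\<lambda>x. cnjv (Z' x)) ?uc) p (Z p) = dirD (\<lambda>x. cnj (c x) * vf_apply ?Zb ?uc x) p (Z p)"
      by (rule dirD_cong(1)[OF G(1) pp 1(2)])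
    also have "\<dots> = cnj (c p) * dirD (vf_apply ?Zb ?uc) p (Z p) + dirD (\<lambda>x. cnj (c x)) p (Z p) * vf_apply ?Zb ?uc p"
      by (rule dirD_mult[OF dcc dg(2) pS])
    finally show ?thesis by (simp add: dirD_cnj[OF dc]) (simp add: vf_apply_def)
  qed
  have 3: "vf_apply (\<lambda>x. cnjv (Z' x)) (vf_apply Z' ?uc) p =
     cnj (c p) * (c p * vf_apply ?Zb (vf_apply Z ?uc) p + dirD c p (cnjv (Z p)) * vf_apply Z ?uc p)"
  proof -
    have "vf_apply (\<lambda>x. cnjv (Z' x)) (vf_apply Z' ?uc) p = cnj (c p) * dirD (vf_apply Z' ?uc) p (cnjv (Z p))"
      by (simp add: vf_apply_def Zx[OF pp] dirD_lin)
    also have "dirD (vf_apply Z' ?uc) p (cnjv (Z p)) = dirD (\<lambda>x. c x * vf_apply Z ?uc x) p (cnjv (Z p))"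
      by (rule dirD_cong(1)[OF G(1) pp 1(1)])
    also have "\<dots> = c p * dirD (vf_apply Z ?uc) p (cnjv (Z p)) + dirD c p (cnjv (Z p)) * vf_apply Z ?uc p"
      by (rule dirD_mult[OF dc dg(1) pS])
    finally show ?thesis by (simp add: vf_apply_def)
  qed
  have mz: "cnjv (Z p) \<in> CT p" using F(6)[OF p] CT_simps(3) by auto
  have 4: "pairing (\<omega>' p) (cnjv (Z' p)) = cnj (c p) * (pairing (\<omega> p) (cnjv (Z p)) + dirD c p (cnjv (Z p)) / c p)"
    using G(4)[OF pp mz] Zx[OF pp] by (simp add: pairing_simps)
  have 5: "pairing (cnjv (\<omega>' p)) (Z' p) = cnj (pairing (\<omega>' p) (cnjv (Z' p)))" by (rule pairing_cnjv)
  have 6: "pairing (cnjv (\<omega> p)) (Z p) = cnj (pairing (\<omega> p) (cnjv (Z p)))" by (rule pairing_cnjv)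
  have h0: "complex_of_real (h p) \<noteq> 0" using F(6)[OF p] by auto
  have h': "complex_of_real (h' p) = c p * cnj (c p) * of_real (h p)" using G(3)[OF pp] by simp
  have "complex_of_real r' = complex_of_real r"
    unfolding r r' 2 3 4 5 6 h' 1[OF pp] using c0 h0 by (simp add: divide_simps) (simp add: algebra_simps)
  then show "r' = r" by simp
qed

section \<open>Division of smooth functions by a coordinate\<close>

lemma has_derivative_imp_real_derivative:
  fixes \<phi> :: "real \<Rightarrow> real"
  assumes "(\<phi> has_derivative L) F" shows "(\<phi> has_real_derivative L 1) F"
proof -
  have "L x = L 1 * x" for x
    using linear_scale[OF bounded_linear.linear[OF has_derivative_bounded_linear[OF assms]], of x 1]
    by (simp only: real_scaleR_def mult_1_right mult.commute[of _ x])
  then have "L = (*) (L 1)" by (rule ext)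
  then show ?thesis unfolding has_field_derivative_def using assms by simp
qed

lemma smooth_on_has_real_derivative:
  assumes "smooth_on \<phi> I" "s \<in> I" shows "(\<phi> has_real_derivative frechet_derivative \<phi> (at s) 1) (at s)"
  by (rule has_derivative_imp_real_derivative[OF smooth_on_has_derivative[OF assms]])

text \<open>
  Differentiation under the integral sign replaces \<open>\<phi>\<close> by its derivative and raises the power of \<open>x\<close> by
  one; the weight \<open>x ^ j\<close> lets the induction absorb this.
\<close>

lemma Ck_on_average:
  fixes \<phi> :: "real \<Rightarrow> real"
  assumes I: "open I" "convex I" "0 \<in> I"
  shows "Ck_on n \<phi> I \<Longrightarrow> Ck_on n (\<lambda>s. integral {0..1} (\<lambda>x. x ^ j * \<phi> (x * s))) I"
proof (induction n arbitrary: \<phi> j)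
  have star: "x * s \<in> I" if "s \<in> I" "x \<in> {0..1}" for x s
    using convexD_alt[OF I(2,3) that(1), of x] that(2) by simp
  have cc: "continuous_on (I \<times> cbox 0 1) (\<lambda>(s, x). x ^ j * \<psi> (x * s))" if "continuous_on I \<psi>"
    for \<psi> :: "real \<Rightarrow> real" and j
  proof -
    have "continuous_on (I \<times> cbox 0 1) (\<lambda>p. \<psi> (snd p * fst p))"
      by (rule continuous_on_compose2[OF that]) (use star in \<open>auto intro!: continuous_intros\<close>)
    then show ?thesis unfolding case_prod_beta by (intro continuous_intros)
  qed
  {
    case 0
    have "continuous_on I (\<lambda>s. integral (cbox 0 1) (\<lambda>x. x ^ j * \<phi> (x * s)))"
      by (rule integral_continuous_on_param[OF cc]) (use 0 in simp)
    then show ?case by simp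
  next
    case (Suc n)
    define \<phi>' where "\<phi>' s = frechet_derivative \<phi> (at s) 1" for s
    have d: "(\<phi> has_real_derivative \<phi>' s) (at s)" if "s \<in> I" for s
      unfolding \<phi>'_def
      by (rule has_derivative_imp_real_derivative[OF Ck_on_Suc_has_derivative[OF Suc.prems that]])
    have C': "Ck_on n \<phi>' I" using Suc.prems by (simp add: \<phi>'_def[abs_def])
    have c': "continuous_on I \<phi>'" using Ck_on_continuous[OF C'] .
    have c: "continuous_on I \<phi>" using Ck_on_continuous[OF Suc.prems] .
    have D: "((\<lambda>s. integral (cbox 0 1) (\<lambda>x. x ^ j * \<phi> (x * s))) has_field_derivative
        integral (cbox 0 1) (\<lambda>x. x ^ Suc j * \<phi>' (x * s))) (at s within I)" if "s \<in> I" for s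
    proof (rule leibniz_rule_field_derivative[OF _ _ _ that I(2)])
      fix r x :: real assume r: "r \<in> I" "x \<in> cbox 0 1"
      then have "x * r \<in> I" using star by auto
      then show "((\<lambda>r. x ^ j * \<phi> (x * r)) has_field_derivative x ^ Suc j * \<phi>' (x * r)) (at r within I)"
        by (auto intro!: derivative_eq_intros DERIV_chain2[OF d])
    next
      fix r assume r: "r \<in> I"
      show "(\<lambda>x. x ^ j * \<phi> (x * r)) integrable_on cbox 0 1"
      proof (rule integrable_continuous)
        have "continuous_on (cbox 0 1) (\<lambda>x. \<phi> (x * r))"
          by (rule continuous_on_compose2[OF c]) (use r star in \<open>auto intro!: continuous_intros\<close>)
        then show "continuous_on (cbox 0 1) (\<lambda>x. x ^ j * \<phi> (x * r))" by (intro continuous_intros)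
      qed
    next
      show "continuous_on (I \<times> cbox 0 1) (\<lambda>(s, x). x ^ Suc j * \<phi>' (x * s))"
        by (rule cc[OF c'])
    qed
    have D': "((\<lambda>s. integral {0..1} (\<lambda>x. x ^ j * \<phi> (x * s))) has_derivative
        (\<lambda>v. v * integral {0..1} (\<lambda>x. x ^ Suc j * \<phi>' (x * s)))) (at s)" if "s \<in> I" for s
      using D[OF that] at_within_open[OF that I(1)]
      by (simp add: has_field_derivative_def mult_commute_abs)
    show ?case
      by (rule Ck_on_SucI[OF I(1) D'])
         (auto intro!: Ck_on_bounded_linear[OF I(1) bounded_linear_mult_right] Suc.IH[OF C', of "Suc j", simplified])
  }
qed

text \<open>
  \<open>\<psi> s\<close> is the mean of the derivative of \<open>\<phi>\<close> over the segment from \<open>0\<close> to \<open>s\<close>.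
\<close>

lemma Hadamard_quotient:
  fixes \<phi> :: "real \<Rightarrow> real"
  assumes "smooth_on \<phi> UNIV" "\<phi> 0 = 0"
  obtains \<psi> where "smooth_on \<psi> UNIV" "\<And>s. \<phi> s = s * \<psi> s"
proof
  define \<phi>' where "\<phi>' s = frechet_derivative \<phi> (at s) 1" for s
  have s': "smooth_on \<phi>' UNIV" unfolding \<phi>'_def[abs_def] by (rule smooth_on_frechet[OF assms(1)])
  have d: "(\<phi> has_real_derivative \<phi>' s) (at s)" for s
    unfolding \<phi>'_def by (rule smooth_on_has_real_derivative[OF assms(1)]) simp
  let ?\<psi> = "\<lambda>s. integral {0..1} (\<lambda>x. x ^ 0 * \<phi>' (x * s))"
  show "smooth_on ?\<psi> UNIV"
    using s' unfolding smooth_on_def by (auto intro!: Ck_on_average simp del: power_0)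
  fix s
  have "((\<lambda>x. s * \<phi>' (x * s)) has_integral (\<phi> (1 * s) - \<phi> (0 * s))) {0..1}"
  proof (rule fundamental_theorem_of_calculus)
    fix x :: real
    have "((\<lambda>x. \<phi> (x * s)) has_real_derivative \<phi>' (x * s) * s) (at x within {0..1})"
      by (rule DERIV_chain2[OF d]) (auto intro!: derivative_eq_intros)
    then show "((\<lambda>x. \<phi> (x * s)) has_vector_derivative s * \<phi>' (x * s)) (at x within {0..1})"
      by (simp add: has_real_derivative_iff_has_vector_derivative mult.commute)
  qed simp
  from integral_unique[OF this] show "\<phi> s = s * ?\<psi> s" using assms(2) by simp
qed

text \<open>
  Differentiation shifts the phase \<open>d\<close> by \<open>\<pi> / 2\<close>.
\<close>

lemma smooth_on_sin: "smooth_on (\<lambda>r::real. sin (c * r + d)) UNIV"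
  unfolding smooth_on_def
proof
  show "Ck_on n (\<lambda>r::real. sin (c * r + d)) UNIV" for n
  proof (induction n arbitrary: d)
    case 0 show ?case by (auto intro!: continuous_intros)
  next
    case (Suc n)
    have "((\<lambda>r. sin (c * r + d)) has_derivative (\<lambda>v. v * (c * sin (c * x + (d + pi / 2))))) (at x)" for x
    proof -
      have "sin (c * x + (d + pi / 2)) = cos (c * x + d)"
        using sin_add[of "c * x + d" "pi / 2"] by (simp add: add.assoc)
      then show ?thesis by (auto intro!: derivative_eq_intros)
    qed
    then show ?case
      by (rule Ck_on_SucI[OF open_UNIV])
         (auto intro!: Ck_on_bounded_linear[OF open_UNIV bounded_linear_mult_right] Suc.IH)
  qed
qed

section \<open>Coefficient functions of the structure\<close>

text \<open>
  The arc \<open>(ff, gg)\<close> runs from \<open>(0, 1)\<close> to \<open>(1, 0)\<close>, the end points of the segment \<open>(s, 1 - s)\<close> of the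
  standard structure; this makes the structure extend smoothly across the circles \<open>w\<^sub>1 = 0\<close> and
  \<open>w\<^sub>2 = 0\<close>. The quarter turn would do for that and for the symmetry \<open>ff (1 - s) = gg s\<close>. The two
  further turns produce the loop in \<open>ex_loop\<close>.
\<close>

definition kk :: real where "kk = 9 * pi / 2"

abbreviation ff :: "real \<Rightarrow> real" where "ff s \<equiv> sin (kk * s)"
abbreviation gg :: "real \<Rightarrow> real" where "gg s \<equiv> cos (kk * s)"

lemma kk_pos: "kk > 0" by (simp add: kk_def)

lemma ff_gg_reflect: "ff (1 - s) = gg s" "gg (1 - s) = ff s"
proof -
  have 1: "kk * (1 - s) = (pi / 2 - kk * s) + 2 * (2 * pi)" by (simp add: kk_def field_simps)
  have p: "sin (x + 2 * (2 * pi)) = sin x" "cos (x + 2 * (2 * pi)) = cos x" for x :: real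
    using sin_periodic[of "x + 2 * pi"] sin_periodic[of x] cos_periodic[of "x + 2 * pi"] cos_periodic[of x]
    by (simp_all add: algebra_simps)
  then show "ff (1 - s) = gg s" "gg (1 - s) = ff s"
    unfolding 1 p by (simp_all add: sin_diff cos_diff)
qed

lemma smooth_ff_gg: "smooth_on ff UNIV" "smooth_on gg UNIV"
  using smooth_on_sin[of kk 0] smooth_on_sin[of kk "pi/2"] by (simp_all add: sin_add)

text \<open>
  \<open>gg s\<close> and \<open>1 - s\<close> agree at \<open>0\<close> and at \<open>1\<close>, so their difference is smoothly divisible by \<open>s (1 - s)\<close>;
  Hadamard's lemma is applied at each of the two points.
\<close>

lemma ex_fM: "\<exists>M. smooth_on M UNIV \<and> (\<forall>s. gg s = (1 - s) * (1 - s * M s))"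
proof -
  have i: "smooth_on (\<lambda>s::real. s) UNIV" by (rule smooth_on_ident) simp
  have r: "smooth_on (\<lambda>s::real. 1 - s) UNIV" by (intro smooth_on_diff smooth_on_const i) simp
  have "smooth_on (\<lambda>s. gg s - (1 - s)) UNIV" by (intro smooth_on_diff smooth_ff_gg r) simp
  then obtain X where X: "smooth_on X UNIV" "\<And>s. gg s - (1 - s) = s * X s"
    by (rule Hadamard_quotient) auto
  have "smooth_on (\<lambda>s. X (1 - s)) UNIV" by (rule smooth_on_compose_real[OF _ _ r X(1)]) auto
  moreover have "X (1 - 0) = 0" using X(2)[of 1] ff_gg_reflect(2)[of 0] by simp
  ultimately obtain Y where Y: "smooth_on Y UNIV" "\<And>s. X (1 - s) = s * Y s" by (rule Hadamard_quotient) auto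
  have "smooth_on (\<lambda>s. 0 - Y (1 - s)) UNIV"
    by (rule smooth_on_diff[OF _ smooth_on_const smooth_on_compose_real[OF _ _ r Y(1)]]) auto
  moreover have "gg s = (1 - s) * (1 - s * (0 - Y (1 - s)))" for s
  proof -
    have "gg s - (1 - s) = s * X s" "X s = (1 - s) * Y (1 - s)" using X(2)[of s] Y(2)[of "1 - s"] by auto
    then show ?thesis by algebra
  qed
  ultimately show ?thesis by blast
qed

text \<open>
  These functions are smooth on the whole line, where \<open>fF = ff / s\<close>, \<open>fG = gg / (1 - s)\<close>,
  \<open>fC = (1 - gg) / s\<close> and \<open>fK = (1 - ff) / (1 - s)\<close> off the zeros of the denominators. In \<open>fM\<close> and
  \<open>fN\<close> one has the deviation of the arc from the segment \<open>(s, 1 - s)\<close>, and \<open>fP\<close>, \<open>fQ\<close> are the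
  coefficients of the connection form \<open>omega0\<close>.
\<close>

definition fM :: "real \<Rightarrow> real" where
  "fM = (SOME M. smooth_on M UNIV \<and> (\<forall>s. gg s = (1 - s) * (1 - s * M s)))"

definition fN where "fN s = fM (1 - s)"
definition fF where "fF s = 1 - (1 - s) * fN s"
definition fG where "fG s = 1 - s * fM s"
definition fC where "fC s = 1 + (1 - s) * fM s"
definition fK where "fK s = 1 + s * fN s"
definition fP where "fP s = - fC s - 2 * gg s - kk * (1 - s) * ff s"
definition fQ where "fQ s = - fK s - 2 * ff s - kk * s * gg s"

lemma fM: "smooth_on fM UNIV" "gg s = (1 - s) * (1 - s * fM s)"
  using someI_ex[OF ex_fM, folded fM_def] by blast+

lemma smooth_fs: "smooth_on fM UNIV" "smooth_on fN UNIV" "smooth_on fF UNIV" "smooth_on fG UNIV"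
  "smooth_on fC UNIV" "smooth_on fK UNIV" "smooth_on fP UNIV" "smooth_on fQ UNIV"
proof -
  have i: "smooth_on (\<lambda>s::real. s) UNIV" by (rule smooth_on_ident) simp
  have r: "smooth_on (\<lambda>s::real. 1 - s) UNIV" by (intro smooth_on_diff smooth_on_const i) simp
  show N: "smooth_on fN UNIV" unfolding fN_def[abs_def]
    by (rule smooth_on_compose_real[OF _ _ r fM(1)]) auto
  show M: "smooth_on fM UNIV" by (rule fM(1))
  show "smooth_on fF UNIV" "smooth_on fG UNIV" and C: "smooth_on fC UNIV" and K: "smooth_on fK UNIV"
    unfolding fF_def[abs_def] fG_def[abs_def] fC_def[abs_def] fK_def[abs_def]
    by (intro smooth_on_diff smooth_on_add smooth_on_mult smooth_on_const i r M N open_UNIV)+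
  have m: "- x = 0 - x" for x :: real by simp
  show "smooth_on fP UNIV" "smooth_on fQ UNIV"
    unfolding fP_def[abs_def] fQ_def[abs_def] m[of "fC _"] m[of "fK _"]
    by (intro smooth_on_diff smooth_on_add smooth_on_mult smooth_on_const i r smooth_ff_gg C K open_UNIV)+
qed

lemma f_relations: "ff s = s * fF s" "gg s = (1 - s) * fG s"
  "1 - gg s = s * fC s" "1 - ff s = (1 - s) * fK s"
  "s * fP s = (1 - 2 * s) * gg s - kk * s * (1 - s) * ff s - 1"
  "(1 - s) * fQ s = - (1 - 2 * s) * ff s - kk * s * (1 - s) * gg s - 1"
proof -
  show g: "gg s = (1 - s) * fG s" using fM(2) by (simp add: fG_def)
  show f: "ff s = s * fF s" using fM(2)[of "1 - s"] ff_gg_reflect(2)[of s] by (simp add: fF_def fN_def)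
  show C: "1 - gg s = s * fC s" unfolding g by (simp add: fG_def fC_def algebra_simps)
  show K: "1 - ff s = (1 - s) * fK s" unfolding f by (simp add: fF_def fK_def algebra_simps)
  show "s * fP s = (1 - 2 * s) * gg s - kk * s * (1 - s) * ff s - 1"
    using C by (simp add: fP_def algebra_simps)
  show "(1 - s) * fQ s = - (1 - 2 * s) * ff s - kk * s * (1 - s) * gg s - 1"
    using K by (simp add: fQ_def algebra_simps)
qed

text \<open>
  This is \<open>ff\<^sup>2 + gg\<^sup>2 = 1\<close> divided by \<open>s (1 - s)\<close>, and extended to \<open>s = 0\<close> and \<open>s = 1\<close> by continuity.
\<close>

lemma fM_fN_relation: "s * (1 - s) * ((fM s)\<^sup>2 + (fN s)\<^sup>2) = 2 * (1 + s * fN s + (1 - s) * fM s)"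
proof -
  let ?E = "\<lambda>s. s * (1 - s) * ((fM s)\<^sup>2 + (fN s)\<^sup>2) - 2 * (1 + s * fN s + (1 - s) * fM s)"
  have e: "?E s = 0" if "s \<in> - {0, 1}" for s
  proof -
    have "(s * (1 - (1 - s) * fN s))\<^sup>2 + ((1 - s) * (1 - s * fM s))\<^sup>2 = 1"
      using sin_cos_squared_add[of "kk * s"] f_relations(1,2)[of s] by (simp add: fF_def fG_def)
    then have "s * (1 - s) * ?E s = 0" by algebra
    then show ?thesis using that by simp
  qed
  have "continuous_on UNIV ?E"
    using smooth_on_continuous[OF smooth_fs(1)] smooth_on_continuous[OF smooth_fs(2)]
    by (auto intro!: continuous_intros)
  moreover have "closure (- {0, 1::real}) = UNIV"
    by (simp add: closure_complement empty_interior_finite)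
  ultimately have "?E s = 0"
    using continuous_constant_on_closure[of "- {0, 1}" ?E 0 s] e by simp
  then show ?thesis by simp
qed

text \<open>
  Exterior derivatives of invariant forms involve the derivatives of \<open>s * fF s\<close>, \<open>(1 - s) * fG s\<close> and so on,
  and these products are elementary functions.
\<close>

lemma f_derivatives:
  obtains F' G' C' K' P' Q' where
    "(fF has_real_derivative F') (at s)" "(fG has_real_derivative G') (at s)"
    "(fC has_real_derivative C') (at s)" "(fK has_real_derivative K') (at s)"
    "(fP has_real_derivative P') (at s)" "(fQ has_real_derivative Q') (at s)"
    "fF s + s * F' = kk * gg s" "(1 - s) * G' - fG s = - kk * ff s"
    "fC s + s * C' = kk * ff s" "(1 - s) * K' - fK s = - kk * gg s"
    "fP s + s * P' = - 2 * gg s - 2 * kk * (1 - 2 * s) * ff s - kk\<^sup>2 * s * (1 - s) * gg s"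
    "(1 - s) * Q' - fQ s = 2 * ff s - 2 * kk * (1 - 2 * s) * gg s + kk\<^sup>2 * s * (1 - s) * ff s"
proof -
  note D = smooth_on_has_real_derivative[OF smooth_fs(3), OF UNIV_I, of s]
    smooth_on_has_real_derivative[OF smooth_fs(4), OF UNIV_I, of s]
    smooth_on_has_real_derivative[OF smooth_fs(5), OF UNIV_I, of s]
    smooth_on_has_real_derivative[OF smooth_fs(6), OF UNIV_I, of s]
    smooth_on_has_real_derivative[OF smooth_fs(7), OF UNIV_I, of s]
    smooth_on_has_real_derivative[OF smooth_fs(8), OF UNIV_I, of s]
  note df = derivative_eq_intros DERIV_mult DERIV_diff
  have u: "d = e" if "(\<phi> has_real_derivative d) (at s)" "(\<psi> has_real_derivative e) (at s)" "\<And>s. \<phi> s = \<psi> s"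
    for \<phi> \<psi> :: "real \<Rightarrow> real" and d e
  proof -
    have "\<phi> = \<psi>" using that(3) by (rule ext)
    then show ?thesis using DERIV_unique[OF that(1)] that(2) by simp
  qed
  have "((\<lambda>s. s * \<phi> s) has_real_derivative \<phi> s + s * d) (at s)"
    if "(\<phi> has_real_derivative d) (at s)" for \<phi> d
    using that by (auto intro!: derivative_eq_intros)
  note m1 = this
  have m2: "((\<lambda>s. (1 - s) * \<phi> s) has_real_derivative (1 - s) * d - \<phi> s) (at s)"
    if "(\<phi> has_real_derivative d) (at s)" for \<phi> d
    using that by (auto intro!: derivative_eq_intros)
  show ?thesis
  proof (rule that[OF D])
    show "fF s + s * frechet_derivative fF (at s) 1 = kk * gg s"
      by (rule u[OF m1[OF D(1)] _ f_relations(1)[symmetric]]) (auto intro!: derivative_eq_intros)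
    show "(1 - s) * frechet_derivative fG (at s) 1 - fG s = - kk * ff s"
      by (rule u[OF m2[OF D(2)] _ f_relations(2)[symmetric]]) (auto intro!: derivative_eq_intros)
    show "fC s + s * frechet_derivative fC (at s) 1 = kk * ff s"
      by (rule u[OF m1[OF D(3)] _ f_relations(3)[symmetric]]) (auto intro!: derivative_eq_intros)
    show "(1 - s) * frechet_derivative fK (at s) 1 - fK s = - kk * gg s"
      by (rule u[OF m2[OF D(4)] _ f_relations(4)[symmetric]]) (auto intro!: derivative_eq_intros)
    show "fP s + s * frechet_derivative fP (at s) 1 = - 2 * gg s - 2 * kk * (1 - 2 * s) * ff s - kk\<^sup>2 * s * (1 - s) * gg s"
      by (rule u[OF m1[OF D(5)] _ f_relations(5)])
         (auto intro!: derivative_eq_intros simp: algebra_simps power2_eq_square)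
    show "(1 - s) * frechet_derivative fQ (at s) 1 - fQ s = 2 * ff s - 2 * kk * (1 - 2 * s) * gg s + kk\<^sup>2 * s * (1 - s) * ff s"
      by (rule u[OF m2[OF D(6)] _ f_relations(6)])
         (auto intro!: derivative_eq_intros simp: algebra_simps power2_eq_square)
  qed
qed

section \<open>A torus-invariant CR structure\<close>

lemma pairing_minus: "pairing (- \<alpha>) v = - pairing \<alpha> v" "pairing \<alpha> (- v) = - pairing \<alpha> v"
  by (simp_all add: pairing_def sum_negf)

lemma quarter_eqI: "2 * x - y * z = 4 * r \<Longrightarrow> (1/2) * x - y / 4 * z = r" for x y z r :: complex
  by (simp add: field_simps)

definition dw1 :: "complex^4" where "dw1 = axis 1 1 + axis 2 \<i>"
definition dw2 :: "complex^4" where "dw2 = axis 3 1 + axis 4 \<i>"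

text \<open>
  The coordinate \<open>\<bar>w\<^sub>1\<bar>\<^sup>2\<close>, whose level sets are the orbits of the rotations of \<open>w\<^sub>1\<close> and \<open>w\<^sub>2\<close>.
\<close>

definition ss :: "real^4 \<Rightarrow> real" where "ss p = (p $ 1)\<^sup>2 + (p $ 2)\<^sup>2"

definition rot1 :: "real^4 \<Rightarrow> real^4" where "rot1 p = axis 1 (- p $ 2) + axis 2 (p $ 1)"
definition rot2 :: "real^4 \<Rightarrow> real^4" where "rot2 p = axis 3 (- p $ 4) + axis 4 (p $ 3)"

text \<open>
  \<open>eta1 = 2 i \<bar>w\<^sub>1\<bar>\<^sup>2 d\<phi>\<^sub>1\<close> and \<open>eta2 = 2 i \<bar>w\<^sub>2\<bar>\<^sup>2 d\<phi>\<^sub>2\<close>, with the angle \<open>\<phi>\<^sub>j\<close> of \<open>w\<^sub>j\<close>.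
\<close>

definition eta1 :: "real^4 \<Rightarrow> complex^4" where "eta1 p = cnj (w1 p) *s dw1 - w1 p *s cnjv dw1"
definition eta2 :: "real^4 \<Rightarrow> complex^4" where "eta2 p = cnj (w2 p) *s dw2 - w2 p *s cnjv dw2"

text \<open>
  Where \<open>w\<^sub>1 w\<^sub>2\<close> is not zero, this is \<open>2 s (1 - s) \<partial>\<^sub>s - i (gg \<partial>\<^sub>1 - ff \<partial>\<^sub>2)\<close> divided by \<open>w\<^sub>1 w\<^sub>2\<close> (see
  \<open>W0_on_torus\<close>), written with smooth coefficients. With \<open>fM = fN = 0\<close> and \<open>fF = fG = 1\<close> it would be
  twice the generator of the standard structure.
\<close>

definition W0 :: "real^4 \<Rightarrow> complex^4" where
  "W0 p = (cnj (w2 p) * (1 + of_real (fG (ss p)))) *s del_w1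
        + (cnj (w2 p) * (cnj (w1 p) * cnj (w1 p) * of_real (fM (ss p)))) *s cnjv del_w1
        - (cnj (w1 p) * (1 + of_real (fF (ss p)))) *s del_w2
        - (cnj (w1 p) * (cnj (w2 p) * cnj (w2 p) * of_real (fN (ss p)))) *s cnjv del_w2"

text \<open>
  In angles, \<open>T0 = ff \<partial>\<^sub>1 + gg \<partial>\<^sub>2\<close> and \<open>theta0 = ff d\<phi>\<^sub>1 + gg d\<phi>\<^sub>2\<close>; the latter kills \<open>W0\<close>, and takes the
  value \<open>ff\<^sup>2 + gg\<^sup>2 = 1\<close> on \<open>T0\<close>.
\<close>

definition T0 :: "real^4 \<Rightarrow> real^4" where "T0 p = ff (ss p) *\<^sub>R rot1 p + gg (ss p) *\<^sub>R rot2 p"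
definition theta0 :: "real^4 \<Rightarrow> real^4" where "theta0 p = fF (ss p) *\<^sub>R rot1 p + fG (ss p) *\<^sub>R rot2 p"

text \<open>
  The solution of the duality relations \<open>dual_theta1\<close>, and the connection form \<open>omega0\<close> that the
  structure equation \<open>ext_d_theta1\<close> then dictates.
\<close>

definition theta1 :: "real^4 \<Rightarrow> complex^4" where
  "theta1 p = (1/2) *s (w2 p *s dw1 - w1 p *s dw2)
     - (w1 p * w2 p / 4) *s (of_real (fC (ss p)) *s eta1 p - of_real (fK (ss p)) *s eta2 p)"

definition omega0 :: "real^4 \<Rightarrow> complex^4" where
  "omega0 p = (1/2) *s (of_real (fP (ss p)) *s eta1 p + of_real (fQ (ss p)) *s eta2 p)"

definition H0 :: "real^4 \<Rightarrow> (complex^4) set" where "H0 p = vec.span {W0 p}"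

lemma pairing_dual [simp]:
  "pairing dw1 del_w1 = 1" "pairing dw1 (cnjv del_w1) = 0" "pairing dw1 del_w2 = 0" "pairing dw1 (cnjv del_w2) = 0"
  "pairing dw2 del_w1 = 0" "pairing dw2 (cnjv del_w1) = 0" "pairing dw2 del_w2 = 1" "pairing dw2 (cnjv del_w2) = 0"
  by (auto simp: pairing_def sum_4 dw1_def dw2_def del_w1_def del_w2_def axis_def)

lemma pairing_dual' [simp]:
  "pairing (cnjv dw1) del_w1 = 0" "pairing (cnjv dw1) (cnjv del_w1) = 1" "pairing (cnjv dw1) del_w2 = 0" "pairing (cnjv dw1) (cnjv del_w2) = 0"
  "pairing (cnjv dw2) del_w1 = 0" "pairing (cnjv dw2) (cnjv del_w1) = 0" "pairing (cnjv dw2) del_w2 = 0" "pairing (cnjv dw2) (cnjv del_w2) = 1"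
  by (simp_all add: pairing_cnjv)

lemma w_eq: "w1 p = of_real (p $ 1) + \<i> * of_real (p $ 2)" "w2 p = of_real (p $ 3) + \<i> * of_real (p $ 4)"
  by (simp_all add: w1_def w2_def complex_eq_iff)

lemma w_norm: assumes "p \<in> S3"
  shows "w1 p * cnj (w1 p) = of_real (ss p)" "w2 p * cnj (w2 p) = of_real (1 - ss p)"
proof -
  show 1: "w1 p * cnj (w1 p) = of_real (ss p)"
    by (simp add: w1_def ss_def complex_eq_iff power2_eq_square)
  have "(p $ 1)\<^sup>2 + (p $ 2)\<^sup>2 + (p $ 3)\<^sup>2 + (p $ 4)\<^sup>2 = 1"
    using assms by (simp add: norm_eq_sqrt_inner inner_vec_def sum_4 power2_eq_square)
  then show "w2 p * cnj (w2 p) = of_real (1 - ss p)"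
    by (simp add: w2_def ss_def complex_eq_iff power2_eq_square algebra_simps)
qed

lemma cvec_position: "cvec p = (1/2) *s (cnj (w1 p) *s dw1 + w1 p *s cnjv dw1 + cnj (w2 p) *s dw2 + w2 p *s cnjv dw2)"
  by (simp add: vec_eq_iff forall_4 dw1_def dw2_def axis_def w_eq algebra_simps)

lemma CT_iff: "v \<in> CT p \<longleftrightarrow> cnj (w1 p) * pairing dw1 v + w1 p * pairing (cnjv dw1) v
     + cnj (w2 p) * pairing dw2 v + w2 p * pairing (cnjv dw2) v = 0"
  by (simp only: CT_def mem_Collect_eq cvec_position pairing_simps) simp

lemma cvec_rot: "cvec (rot1 p) = (\<i> * w1 p) *s del_w1 - (\<i> * cnj (w1 p)) *s cnjv del_w1"
  "cvec (rot2 p) = (\<i> * w2 p) *s del_w2 - (\<i> * cnj (w2 p)) *s cnjv del_w2"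
  by (simp_all add: vec_eq_iff forall_4 del_w1_def del_w2_def axis_def w_eq rot1_def rot2_def) (simp_all add: field_simps)

lemma cvec_rot_eta: "cvec (rot1 p) = (- \<i> / 2) *s eta1 p" "cvec (rot2 p) = (- \<i> / 2) *s eta2 p"
  by (simp_all add: vec_eq_iff forall_4 eta1_def eta2_def dw1_def dw2_def axis_def w_eq rot1_def rot2_def)

lemma cvec_lin: "cvec (x + y) = cvec x + cvec y" "cvec (r *\<^sub>R x) = of_real r *s cvec x"
  by (simp_all add: vec_eq_iff)

lemma components_W0 [simp]:
  "pairing dw1 (W0 p) = cnj (w2 p) * (1 + of_real (fG (ss p)))"
  "pairing (cnjv dw1) (W0 p) = cnj (w2 p) * (cnj (w1 p) * cnj (w1 p) * of_real (fM (ss p)))"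
  "pairing dw2 (W0 p) = - cnj (w1 p) * (1 + of_real (fF (ss p)))"
  "pairing (cnjv dw2) (W0 p) = - cnj (w1 p) * (cnj (w2 p) * cnj (w2 p) * of_real (fN (ss p)))"
  by (simp_all add: W0_def pairing_simps)

lemma components_T0 [simp]:
  "pairing dw1 (cvec (T0 p)) = \<i> * of_real (ff (ss p)) * w1 p"
  "pairing (cnjv dw1) (cvec (T0 p)) = - \<i> * of_real (ff (ss p)) * cnj (w1 p)"
  "pairing dw2 (cvec (T0 p)) = \<i> * of_real (gg (ss p)) * w2 p"
  "pairing (cnjv dw2) (cvec (T0 p)) = - \<i> * of_real (gg (ss p)) * cnj (w2 p)"
  by (simp_all add: T0_def pairing_simps cvec_lin cvec_rot)

lemma components_cnjv [simp]:
  "pairing dw1 (cnjv v) = cnj (pairing (cnjv dw1) v)" "pairing (cnjv dw1) (cnjv v) = cnj (pairing dw1 v)"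
  "pairing dw2 (cnjv v) = cnj (pairing (cnjv dw2) v)" "pairing (cnjv dw2) (cnjv v) = cnj (pairing dw2 v)"
  by (simp_all add: pairing_cnjv)

lemma pairing_eta: "pairing (eta1 p) v = cnj (w1 p) * pairing dw1 v - w1 p * pairing (cnjv dw1) v"
  "pairing (eta2 p) v = cnj (w2 p) * pairing dw2 v - w2 p * pairing (cnjv dw2) v"
  by (simp_all add: eta1_def eta2_def pairing_simps)

text \<open>
  The identities needed at a point of the sphere are polynomial consequences of these relations, in
  which \<open>w\<^sub>j\<close> and its conjugate count as independent unknowns. Naming all values turns each of them into
  an identity between complex variables.
\<close>

lemma point_relations:
  assumes "p \<in> S3"
  obtains a a' b b' s t f g F G C K M N P Q :: complex where
    "w1 p = a" "cnj a = a'" "w2 p = b" "cnj b = b'" "cnj a' = a" "cnj b' = b"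
    "of_real (ss p) = s" "of_real (ff (ss p)) = f" "of_real (gg (ss p)) = g"
    "of_real (fF (ss p)) = F" "of_real (fG (ss p)) = G" "of_real (fC (ss p)) = C" "of_real (fK (ss p)) = K"
    "of_real (fM (ss p)) = M" "of_real (fN (ss p)) = N" "of_real (fP (ss p)) = P" "of_real (fQ (ss p)) = Q"
    "cnj M = M" "cnj N = N" "cnj F = F" "cnj G = G"
    "s = a * a'" "t = b * b'" "s + t = 1"
    "F = 1 - t * N" "G = 1 - s * M" "C = 1 + t * M" "K = 1 + s * N" "f = s * F" "g = t * G"
    "s * t * (M\<^sup>2 + N\<^sup>2) = 2 * (1 + s * N + t * M)" "f\<^sup>2 + g\<^sup>2 = 1"
    "P = - C - 2 * g - of_real kk * t * f" "Q = - K - 2 * f - of_real kk * s * g"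
proof -
  let ?s = "ss p"
  have e1: "of_real ?s = w1 p * cnj (w1 p)" "of_real (1 - ?s) = w2 p * cnj (w2 p)"
    by (rule w_norm[OF assms, symmetric])+
  have e2: "complex_of_real ?s + of_real (1 - ?s) = 1" by simp
  have e3: "complex_of_real (fF ?s) = 1 - of_real (1 - ?s) * of_real (fN ?s)"
    "complex_of_real (fG ?s) = 1 - of_real ?s * of_real (fM ?s)"
    "complex_of_real (fC ?s) = 1 + of_real (1 - ?s) * of_real (fM ?s)"
    "complex_of_real (fK ?s) = 1 + of_real ?s * of_real (fN ?s)"
    "complex_of_real (fP ?s) = - of_real (fC ?s) - 2 * of_real (gg ?s) - of_real kk * of_real (1 - ?s) * of_real (ff ?s)"
    "complex_of_real (fQ ?s) = - of_real (fK ?s) - 2 * of_real (ff ?s) - of_real kk * of_real ?s * of_real (gg ?s)"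
    by (simp_all only: fF_def fG_def fC_def fK_def fP_def fQ_def of_real_diff of_real_add of_real_mult of_real_minus of_real_1 of_real_numeral)
  have e4: "complex_of_real (ff ?s) = of_real ?s * of_real (fF ?s)"
    "complex_of_real (gg ?s) = of_real (1 - ?s) * of_real (fG ?s)"
    by (simp_all only: f_relations(1,2)[of ?s] of_real_mult)
  have e5: "complex_of_real ?s * of_real (1 - ?s) * ((of_real (fM ?s))\<^sup>2 + (of_real (fN ?s))\<^sup>2)
      = 2 * (1 + of_real ?s * of_real (fN ?s) + of_real (1 - ?s) * of_real (fM ?s))"
    using arg_cong[OF fM_fN_relation[of ?s], of complex_of_real]
    by (simp only: of_real_mult of_real_add of_real_power of_real_1 of_real_numeral)
  have e6: "(complex_of_real (ff ?s))\<^sup>2 + (of_real (gg ?s))\<^sup>2 = 1"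
    using arg_cong[OF sin_cos_squared_add[of "kk * ?s"], of complex_of_real]
    by (simp only: of_real_power of_real_add of_real_1)
  show thesis
    by (rule that[of "w1 p" "cnj (w1 p)" "w2 p" "cnj (w2 p)" "of_real (ss p)" "of_real (ff (ss p))" "of_real (gg (ss p))"
    "of_real (fF (ss p))" "of_real (fG (ss p))" "of_real (fC (ss p))" "of_real (fK (ss p))" "of_real (fM (ss p))"
    "of_real (fN (ss p))" "of_real (fP (ss p))" "of_real (fQ (ss p))" "of_real (1 - ss p)"]) (fact e1 e2 e3 e4 e5 e6 | simp)+
qed

lemma CT_frame: assumes "p \<in> S3"
  shows "W0 p \<in> CT p" "cnjv (W0 p) \<in> CT p" "cvec (T0 p) \<in> CT p"
proof -
  show "W0 p \<in> CT p" using assms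
  proof (rule point_relations)
    fix a a' b b' s t f g F G C K M N P Q :: complex
    assume r: "w1 p = a" "cnj a = a'" "w2 p = b" "cnj b = b'" "cnj a' = a" "cnj b' = b"
      "of_real (fF (ss p)) = F" "of_real (fG (ss p)) = G" "of_real (fM (ss p)) = M" "of_real (fN (ss p)) = N"
      and q: "s = a * a'" "t = b * b'" "F = 1 - t * N" "G = 1 - s * M"
    show ?thesis unfolding CT_iff components_W0 r using q by algebra
  qed
  then show "cnjv (W0 p) \<in> CT p" by (rule CT_simps)
  show "cvec (T0 p) \<in> CT p" by (simp add: CT_iff)
qed

lemma eta_frame: assumes "p \<in> S3"
  shows "pairing (eta1 p) (W0 p) = 2 * of_real (fG (ss p)) * (cnj (w1 p) * cnj (w2 p))"
    "pairing (eta2 p) (W0 p) = - 2 * of_real (fF (ss p)) * (cnj (w1 p) * cnj (w2 p))"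
    "pairing (eta1 p) (cnjv (W0 p)) = - 2 * of_real (fG (ss p)) * (w1 p * w2 p)"
    "pairing (eta2 p) (cnjv (W0 p)) = 2 * of_real (fF (ss p)) * (w1 p * w2 p)"
    "pairing (eta1 p) (cvec (T0 p)) = 2 * \<i> * of_real (ff (ss p)) * of_real (ss p)"
    "pairing (eta2 p) (cvec (T0 p)) = 2 * \<i> * of_real (gg (ss p)) * of_real (1 - ss p)"
proof -
  show 1: "pairing (eta1 p) (W0 p) = 2 * of_real (fG (ss p)) * (cnj (w1 p) * cnj (w2 p))"
    and 2: "pairing (eta2 p) (W0 p) = - 2 * of_real (fF (ss p)) * (cnj (w1 p) * cnj (w2 p))"
  proof (atomize (full), rule point_relations[OF assms])
    fix a a' b b' s t f g F G C K M N P Q :: complex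
    assume r: "w1 p = a" "cnj a = a'" "w2 p = b" "cnj b = b'" "cnj a' = a" "cnj b' = b"
      "of_real (fF (ss p)) = F" "of_real (fG (ss p)) = G" "of_real (fM (ss p)) = M" "of_real (fN (ss p)) = N"
      and q: "s = a * a'" "t = b * b'" "F = 1 - t * N" "G = 1 - s * M"
    have "a' * (b' * (1 + G)) - a * (b' * (a' * a' * M)) = 2 * G * (a' * b')" using q by algebra
    moreover have "b' * (- a' * (1 + F)) - b * (- a' * (b' * b' * N)) = - 2 * F * (a' * b')" using q by algebra
    ultimately show "pairing (eta1 p) (W0 p) = 2 * of_real (fG (ss p)) * (cnj (w1 p) * cnj (w2 p)) \<and>
       pairing (eta2 p) (W0 p) = - 2 * of_real (fF (ss p)) * (cnj (w1 p) * cnj (w2 p))"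
      unfolding pairing_eta components_W0 r by simp
  qed
  have c: "cnjv (eta1 p) = (-1) *s eta1 p" "cnjv (eta2 p) = (-1) *s eta2 p"
    by (simp_all add: eta1_def eta2_def vec_eq_iff)
  have "pairing (eta p) (cnjv v) = - cnj (pairing (eta p) v)" if "cnjv (eta p) = (-1) *s eta p" for eta :: "real^4 \<Rightarrow> complex^4" and v
    using arg_cong[OF pairing_cnjv[of "eta p" v], of cnj] unfolding that by (simp add: pairing_simps pairing_minus)
  note cc = this[of eta1, OF c(1)] this[of eta2, OF c(2)]
  show "pairing (eta1 p) (cnjv (W0 p)) = - 2 * of_real (fG (ss p)) * (w1 p * w2 p)"
    "pairing (eta2 p) (cnjv (W0 p)) = 2 * of_real (fF (ss p)) * (w1 p * w2 p)"
    unfolding cc 1 2 by simp_all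
  show "pairing (eta1 p) (cvec (T0 p)) = 2 * \<i> * of_real (ff (ss p)) * of_real (ss p)"
    "pairing (eta2 p) (cvec (T0 p)) = 2 * \<i> * of_real (gg (ss p)) * of_real (1 - ss p)"
    unfolding pairing_eta components_T0 w_norm[OF assms, symmetric] by (simp_all add: algebra_simps)
qed

lemma dual_theta: assumes "p \<in> S3"
  shows "pairing (cvec (theta0 p)) (W0 p) = 0" "pairing (cvec (theta0 p)) (cnjv (W0 p)) = 0"
    "pairing (cvec (theta0 p)) (cvec (T0 p)) = 1"
proof -
  show 1: "pairing (cvec (theta0 p)) (W0 p) = 0"
    by (simp add: theta0_def cvec_lin cvec_rot_eta pairing_simps pairing_minus eta_frame[OF assms])
  show "pairing (cvec (theta0 p)) (cnjv (W0 p)) = 0" unfolding pairing_cvec_cnjv 1 by simp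
  show "pairing (cvec (theta0 p)) (cvec (T0 p)) = 1" using assms
  proof (rule point_relations)
    fix a a' b b' s t f g F G C K M N P Q :: complex
    assume r: "of_real (fF (ss p)) = F" "of_real (fG (ss p)) = G" "of_real (ff (ss p)) = f" "of_real (gg (ss p)) = g" "of_real (ss p) = s"
      and q: "s + t = 1" "f = s * F" "g = t * G" "f\<^sup>2 + g\<^sup>2 = 1"
    have t: "of_real (1 - ss p) = t" using q(1) r by (simp add: algebra_simps)
    have i: "\<i> * \<i> = -1" by simp
    have "F * (- \<i> / 2 * (2 * \<i> * f * s)) + G * (- \<i> / 2 * (2 * \<i> * g * t)) = F * f * s + G * g * t"
      using i by (simp add: field_simps)
    also have "\<dots> = 1" using q by algebra
    finally show ?thesis
      unfolding theta0_def cvec_lin cvec_rot_eta pairing_simps eta_frame[OF assms] r t .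
  qed
qed

lemma dual_theta1: assumes "p \<in> S3"
  shows "pairing (theta1 p) (W0 p) = 1" "pairing (theta1 p) (cnjv (W0 p)) = 0"
    "pairing (theta1 p) (cvec (T0 p)) = 0"
proof (atomize (full), rule point_relations[OF assms])
  fix a a' b b' s t f g F G C K M N P Q :: complex
  assume r: "w1 p = a" "cnj a = a'" "w2 p = b" "cnj b = b'" "cnj a' = a" "cnj b' = b"
      "of_real (fF (ss p)) = F" "of_real (fG (ss p)) = G" "of_real (fM (ss p)) = M" "of_real (fN (ss p)) = N"
      "of_real (fC (ss p)) = C" "of_real (fK (ss p)) = K" "of_real (ff (ss p)) = f" "of_real (gg (ss p)) = g" "of_real (ss p) = s"
      "cnj M = M" "cnj N = N"
    and q: "s = a * a'" "t = b * b'" "s + t = 1" "F = 1 - t * N" "G = 1 - s * M" "C = 1 + t * M" "K = 1 + s * N" "f = s * F" "g = t * G"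
      "s * t * (M\<^sup>2 + N\<^sup>2) = 2 * (1 + s * N + t * M)" "f\<^sup>2 + g\<^sup>2 = 1"
  have t: "of_real (1 - ss p) = t" using q(3) r by (simp add: algebra_simps)
  \<comment> \<open>This combination is where \<open>f\<^sup>2 + g\<^sup>2 = 1\<close>, divided by \<open>s t\<close>, enters.\<close>
  have CK: "C * G + K * F = - (M + N)" using q(3-7,10) by algebra
  have 1: "(1/2) * (b * (b' * (1 + G)) - a * (- a' * (1 + F)))
     - a * b / 4 * (C * (2 * G * (a' * b')) - K * (- 2 * F * (a' * b'))) = 1"
  proof -
    have "2 * (b * (b' * (1 + G)) - a * (- a' * (1 + F)))
     - a * b * (C * (2 * G * (a' * b')) - K * (- 2 * F * (a' * b'))) = 
      2 * (t * (1 + G) + s * (1 + F)) - 2 * s * t * (C * G + K * F)" using q(1,2) by algebra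
    also have "\<dots> = 4 * 1" unfolding CK using q(3-5) by algebra
    finally show ?thesis by (rule quarter_eqI)
  qed
  have 2: "(1/2) * (b * (b * (a * a * M)) - a * (- a * (b * b * N)))
     - a * b / 4 * (C * (- 2 * G * (a * b)) - K * (2 * F * (a * b))) = 0"
  proof -
    have "2 * (b * (b * (a * a * M)) - a * (- a * (b * b * N)))
     - a * b * (C * (- 2 * G * (a * b)) - K * (2 * F * (a * b))) = 2 * (a * b)\<^sup>2 * (M + N + (C * G + K * F))" by algebra
    also have "\<dots> = 4 * 0" unfolding CK by simp
    finally show ?thesis by (rule quarter_eqI)
  qed
  have 3: "(1/2) * (b * (\<i> * f * a) - a * (\<i> * g * b)) - a * b / 4 * (C * (2 * \<i> * f * s) - K * (2 * \<i> * g * t)) = 0"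
  proof -
    have "2 * (b * (\<i> * f * a) - a * (\<i> * g * b)) - a * b * (C * (2 * \<i> * f * s) - K * (2 * \<i> * g * t)) =
       2 * \<i> * a * b * (f - g - (f * (s * C) - g * (t * K)))" by algebra
    also have "s * C = 1 - g" using q(3,5,6,9) by algebra
    also have "t * K = 1 - f" using q(3,4,7,8) by algebra
    also have "2 * \<i> * a * b * (f - g - (f * (1 - g) - g * (1 - f))) = 4 * 0" by algebra
    finally show ?thesis by (rule quarter_eqI)
  qed
  show "pairing (theta1 p) (W0 p) = 1 \<and> pairing (theta1 p) (cnjv (W0 p)) = 0 \<and> pairing (theta1 p) (cvec (T0 p)) = 0"
    unfolding theta1_def pairing_simps eta_frame[OF assms] components_cnjv components_W0 components_T0 r t
    using 1 2 3 by (simp add: r)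
qed

section \<open>Structure equations\<close>

lemma bounded_linear_w: "bounded_linear w1" "bounded_linear w2"
proof -
  have "bounded_linear (\<lambda>p::real^4. of_real (p $ i) + \<i> * of_real (p $ j))" for i j
    by (intro bounded_linear_add bounded_linear_coord bounded_linear_const_mult)
  then show "bounded_linear w1" "bounded_linear w2" by (simp_all add: w_eq[abs_def])
qed

lemma bounded_linear_cnj_w: "bounded_linear (\<lambda>x. cnj (w1 x))" "bounded_linear (\<lambda>x. cnj (w2 x))"
  using bounded_linear_compose[OF bounded_linear_cnj] bounded_linear_w by blast+

lemma dirD_w: assumes "p \<in> S3" "v \<in> CT p"
  shows "dirD w1 p v = pairing dw1 v" "dirD w2 p v = pairing dw2 v"
    "dirD (\<lambda>x. cnj (w1 x)) p v = pairing (cnjv dw1) v" "dirD (\<lambda>x. cnj (w2 x)) p v = pairing (cnjv dw2) v"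
  unfolding dirD_linear[OF assms bounded_linear_w(1)] dirD_linear[OF assms bounded_linear_w(2)]
    dirD_linear[OF assms bounded_linear_cnj_w(1)] dirD_linear[OF assms bounded_linear_cnj_w(2)]
  by (simp_all add: sum_4 w_eq axis_def dw1_def dw2_def pairing_def)

lemma diffS_w: assumes "p \<in> S3"
  shows "diffS w1 p" "diffS w2 p" "diffS (\<lambda>x. cnj (w1 x)) p" "diffS (\<lambda>x. cnj (w2 x)) p"
  using diffS_linear[OF assms] bounded_linear_w bounded_linear_cnj_w by blast+

lemma ss_eq: "complex_of_real (ss x) = w1 x * cnj (w1 x)"
  by (simp add: w1_def ss_def complex_eq_iff power2_eq_square)

text \<open>
  The differential of \<open>ss\<close>.
\<close>

definition ds :: "real^4 \<Rightarrow> complex^4 \<Rightarrow> complex" where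
  "ds p v = cnj (w1 p) * pairing dw1 v + w1 p * pairing (cnjv dw1) v"

lemma dirD_ss: assumes "p \<in> S3" "v \<in> CT p" shows "dirD (\<lambda>x. of_real (ss x)) p v = ds p v"
  unfolding ss_eq[abs_def] dirD_mult[OF diffS_w(1,3)[OF assms(1)] assms(1)] dirD_w[OF assms]
  by (simp add: ds_def)

lemma smooth_S3_ss: "open_S3 U \<Longrightarrow> smooth_S3 ss U"
  unfolding ss_def[abs_def] power2_eq_square
  by (intro smooth_S3_add smooth_S3_mult smooth_S3_linear bounded_linear_vec_nth)

lemma diffS_ss: "p \<in> S3 \<Longrightarrow> diffS ss p"
  using smooth_S3_diffS[OF smooth_S3_ss[OF open_S3_UNIV]] by blast

lemma dirD_fun_ss:
  assumes "p \<in> S3" "v \<in> CT p" "(\<phi> has_real_derivative d) (at (ss p))"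
  shows "dirD (\<lambda>x. of_real (\<phi> (ss x))) p v = of_real d * ds p v"
  using dirD_compose_real(1)[OF diffS_ss[OF assms(1)] assms(3,1)] dirD_ss[OF assms(1,2)] by simp

lemma diffS_fun_ss:
  assumes "p \<in> S3" "(\<phi> has_real_derivative d) (at (ss p))"
  shows "diffS (\<lambda>x. complex_of_real (\<phi> (ss x))) p"
  by (rule diffS_bounded_linear[OF bounded_linear_of_real dirD_compose_real(2)[OF diffS_ss[OF assms(1)] assms(2,1)]])

lemma ss_range: assumes "p \<in> S3" shows "0 \<le> ss p" "ss p \<le> 1"
proof -
  show "0 \<le> ss p" by (simp add: ss_def)
  have "Re (w2 p * cnj (w2 p)) = 1 - ss p" using w_norm(2)[OF assms] by simp
  moreover have "Re (w2 p * cnj (w2 p)) \<ge> 0" by (simp add: w2_def)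
  ultimately show "ss p \<le> 1" by simp
qed

lemma eta_as: "eta1 = (\<lambda>x. cnj (w1 x) *s dw1 - w1 x *s cnjv dw1)"
  "eta2 = (\<lambda>x. cnj (w2 x) *s dw2 - w2 x *s cnjv dw2)"
  by (auto simp: eta1_def eta2_def)

lemma diffS_eta: assumes "p \<in> S3" shows "diffS eta1 p" "diffS eta2 p"
  unfolding eta_as by (intro diffS_diff diffS_scale diffS_const diffS_w[OF assms])+

lemma ext_d_eta: assumes "p \<in> S3" "v \<in> CT p" "w \<in> CT p"
  shows "ext_d eta1 p v w = 2 * (pairing (cnjv dw1) v * pairing dw1 w - pairing (cnjv dw1) w * pairing dw1 v)"
    "ext_d eta2 p v w = 2 * (pairing (cnjv dw2) v * pairing dw2 w - pairing (cnjv dw2) w * pairing dw2 v)"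
proof -
  note d = diffS_w[OF assms(1)]
  note s = ext_d_scale[OF _ diffS_const assms(1)]
  show "ext_d eta1 p v w = 2 * (pairing (cnjv dw1) v * pairing dw1 w - pairing (cnjv dw1) w * pairing dw1 v)"
    unfolding eta_as ext_d_diff[OF diffS_scale[OF d(3) diffS_const] diffS_scale[OF d(1) diffS_const]] s[OF d(1)] s[OF d(3)]
      dirD_w[OF assms(1,2)] dirD_w[OF assms(1,3)] by simp
  show "ext_d eta2 p v w = 2 * (pairing (cnjv dw2) v * pairing dw2 w - pairing (cnjv dw2) w * pairing dw2 v)"
    unfolding eta_as ext_d_diff[OF diffS_scale[OF d(4) diffS_const] diffS_scale[OF d(2) diffS_const]] s[OF d(2)] s[OF d(4)]
      dirD_w[OF assms(1,2)] dirD_w[OF assms(1,3)] by simp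
qed

text \<open>
  The general torus-invariant form without \<open>ds\<close>-part. The forms \<open>theta0\<close>, \<open>omega0\<close> and the correction
  term of \<open>theta1\<close> are built from it, so one computation of its derivative serves for all three.
\<close>

definition torus_form :: "(real \<Rightarrow> real) \<Rightarrow> (real \<Rightarrow> real) \<Rightarrow> real^4 \<Rightarrow> complex^4" where
  "torus_form A B x = of_real (A (ss x)) *s eta1 x + of_real (B (ss x)) *s eta2 x"

lemma diffS_torus_form:
  assumes "p \<in> S3" "(A has_real_derivative A') (at (ss p))" "(B has_real_derivative B') (at (ss p))"
  shows "diffS (torus_form A B) p"
  unfolding torus_form_def[abs_def]
  by (intro diffS_add diffS_scale diffS_eta[OF assms(1)] diffS_fun_ss[OF assms(1,2)] diffS_fun_ss[OF assms(1,3)])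

lemma ds_frame: assumes "p \<in> S3"
  shows "ds p (W0 p) = 2 * (cnj (w1 p) * cnj (w2 p))" "ds p (cnjv (W0 p)) = 2 * (w1 p * w2 p)"
    "ds p (cvec (T0 p)) = 0"
proof -
  show "ds p (W0 p) = 2 * (cnj (w1 p) * cnj (w2 p))"
  proof (rule point_relations[OF assms])
    fix a a' b b' s t f g F G C K M N P Q :: complex
    assume r: "w1 p = a" "cnj a = a'" "w2 p = b" "cnj b = b'" "of_real (fG (ss p)) = G" "of_real (fM (ss p)) = M"
      and q: "s = a * a'" "G = 1 - s * M"
    show ?thesis unfolding ds_def components_W0 r using q by algebra
  qed
  from arg_cong[OF this, of cnj] show "ds p (cnjv (W0 p)) = 2 * (w1 p * w2 p)" by (simp add: ds_def algebra_simps)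
  show "ds p (cvec (T0 p)) = 0" by (simp add: ds_def)
qed

lemma ext_d_torus_form:
  assumes p: "p \<in> S3" and A: "(A has_real_derivative A') (at (ss p))" and B: "(B has_real_derivative B') (at (ss p))"
    and v: "v \<in> CT p" and w: "w \<in> CT p"
  shows "ext_d (torus_form A B) p v w =
      of_real A' * (ds p v * pairing (eta1 p) w - ds p w * pairing (eta1 p) v)
    + of_real (A (ss p)) * (2 * (pairing (cnjv dw1) v * pairing dw1 w - pairing (cnjv dw1) w * pairing dw1 v))
    + of_real B' * (ds p v * pairing (eta2 p) w - ds p w * pairing (eta2 p) v)
    + of_real (B (ss p)) * (2 * (pairing (cnjv dw2) v * pairing dw2 w - pairing (cnjv dw2) w * pairing dw2 v))"
  unfolding torus_form_def[abs_def]
    ext_d_add[OF diffS_scale[OF diffS_fun_ss[OF p A] diffS_eta(1)[OF p]] diffS_scale[OF diffS_fun_ss[OF p B] diffS_eta(2)[OF p]]]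
    ext_d_scale[OF diffS_fun_ss[OF p A] diffS_eta(1)[OF p] p] ext_d_scale[OF diffS_fun_ss[OF p B] diffS_eta(2)[OF p] p]
    dirD_fun_ss[OF p v A] dirD_fun_ss[OF p w A] dirD_fun_ss[OF p v B] dirD_fun_ss[OF p w B] ext_d_eta[OF p v w]
  by (simp add: algebra_simps)

text \<open>
  As \<open>eta1 = 2 i s d\<phi>\<^sub>1\<close> and \<open>eta2 = 2 i (1 - s) d\<phi>\<^sub>2\<close>, only the derivatives of \<open>s A(s)\<close> and of
  \<open>(1 - s) B(s)\<close> appear.
\<close>

lemma torus_form_frame:
  assumes p: "p \<in> S3" and A: "(A has_real_derivative A') (at (ss p))" and B: "(B has_real_derivative B') (at (ss p))"
  defines "X \<equiv> complex_of_real (A (ss p) + ss p * A')" and "Y \<equiv> complex_of_real ((1 - ss p) * B' - B (ss p))"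
  shows "ext_d (torus_form A B) p (W0 p) (cnjv (W0 p)) = - 8 * (of_real (gg (ss p)) * X - of_real (ff (ss p)) * Y)"
    and "ext_d (torus_form A B) p (W0 p) (cvec (T0 p)) =
      4 * \<i> * (cnj (w1 p) * cnj (w2 p)) * (of_real (ff (ss p)) * X + of_real (gg (ss p)) * Y)"
    and "ext_d (torus_form A B) p (cnjv (W0 p)) (cvec (T0 p)) =
      4 * \<i> * (w1 p * w2 p) * (of_real (ff (ss p)) * X + of_real (gg (ss p)) * Y)"
proof (atomize (full), rule point_relations[OF p])
  fix a a' b b' s t f g F G C K M N P Q :: complex
  assume r: "w1 p = a" "cnj a = a'" "w2 p = b" "cnj b = b'" "cnj a' = a" "cnj b' = b"
      "of_real (fF (ss p)) = F" "of_real (fG (ss p)) = G" "of_real (fM (ss p)) = M" "of_real (fN (ss p)) = N"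
      "of_real (ff (ss p)) = f" "of_real (gg (ss p)) = g" "of_real (ss p) = s" "cnj M = M" "cnj N = N" "cnj F = F" "cnj G = G"
    and q: "s = a * a'" "t = b * b'" "s + t = 1" "F = 1 - t * N" "G = 1 - s * M" "f = s * F" "g = t * G"
  have t: "of_real (1 - ss p) = t" using q(3) r by (simp add: algebra_simps)
  define A0 A1 beta0 B1 where "A0 = complex_of_real (A (ss p))" "A1 = complex_of_real A'"
    "beta0 = complex_of_real (B (ss p))" "B1 = complex_of_real B'"
  note d = this
  have X: "X = A0 + s * A1" unfolding X_def d r(13)[symmetric] by simp
  have Y: "Y = t * B1 - beta0" unfolding Y_def d t[symmetric] by simp
  note m = CT_frame[OF p]
  have 1: "A1 * (2 * (a' * b') * (- 2 * G * (a * b)) - 2 * (a * b) * (2 * G * (a' * b')))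
    + A0 * (2 * (b' * (a' * a' * M) * (b * (a * a * M)) - b * (1 + G) * (b' * (1 + G))))
    + B1 * (2 * (a' * b') * (2 * F * (a * b)) - 2 * (a * b) * (- 2 * F * (a' * b')))
    + beta0 * (2 * (- a' * (b' * b' * N) * (- a * (b * b * N)) - - a * (1 + F) * (- a' * (1 + F))))
    = - 8 * (g * X - f * Y)"
    unfolding X Y using q(1,2,4-7) by algebra
  have 2: "A1 * (2 * (a' * b') * (2 * \<i> * f * s))
    + A0 * (2 * (b' * (a' * a' * M) * (\<i> * f * a) - - \<i> * f * a' * (b' * (1 + G))))
    + B1 * (2 * (a' * b') * (2 * \<i> * g * t))
    + beta0 * (2 * (- a' * (b' * b' * N) * (\<i> * g * b) - - \<i> * g * b' * (- a' * (1 + F))))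
    = 4 * \<i> * (a' * b') * (f * X + g * Y)"
    unfolding X Y using q(1,2,4,5) by algebra
  have 3: "A1 * (2 * (a * b) * (2 * \<i> * f * s))
    + A0 * (2 * (b * (1 + G) * (\<i> * f * a) - - \<i> * f * a' * (b * (a * a * M))))
    + B1 * (2 * (a * b) * (2 * \<i> * g * t))
    + beta0 * (2 * (- a * (1 + F) * (\<i> * g * b) - - \<i> * g * b' * (- a * (b * b * N))))
    = 4 * \<i> * (a * b) * (f * X + g * Y)"
    unfolding X Y using q(1,2,4,5) by algebra
  show "ext_d (torus_form A B) p (W0 p) (cnjv (W0 p)) = - 8 * (of_real (gg (ss p)) * X - of_real (ff (ss p)) * Y) \<and>
    ext_d (torus_form A B) p (W0 p) (cvec (T0 p)) =
      4 * \<i> * (cnj (w1 p) * cnj (w2 p)) * (of_real (ff (ss p)) * X + of_real (gg (ss p)) * Y) \<and>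
    ext_d (torus_form A B) p (cnjv (W0 p)) (cvec (T0 p)) =
      4 * \<i> * (w1 p * w2 p) * (of_real (ff (ss p)) * X + of_real (gg (ss p)) * Y)"
    unfolding ext_d_torus_form[OF p A B m(1,2)] ext_d_torus_form[OF p A B m(1,3)] ext_d_torus_form[OF p A B m(2,3)]
      ds_frame[OF p] eta_frame[OF p] d[symmetric] components_cnjv components_W0 components_T0 r t
    using 1 2 3 by (simp add: r)
qed

definition alt2 :: "(complex^4 \<Rightarrow> complex^4 \<Rightarrow> complex) \<Rightarrow> bool" where
  "alt2 \<Omega> \<longleftrightarrow> (\<forall>u v w. \<Omega> (u + v) w = \<Omega> u w + \<Omega> v w) \<and> (\<forall>c v w. \<Omega> (c *s v) w = c * \<Omega> v w) \<and>
     (\<forall>v w. \<Omega> v w = - \<Omega> w v)"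

lemma alt2D: assumes "alt2 \<Omega>"
  shows "\<Omega> (u + v) w = \<Omega> u w + \<Omega> v w" "\<Omega> (c *s v) w = c * \<Omega> v w" "\<Omega> v w = - \<Omega> w v"
  using assms unfolding alt2_def by blast+

lemma alt2I:
  assumes "\<And>u v w. \<Omega> (u + v) w = \<Omega> u w + \<Omega> v w" "\<And>c v w. \<Omega> (c *s v) w = c * \<Omega> v w" "\<And>v w. \<Omega> v w = - \<Omega> w v"
  shows "alt2 \<Omega>"
  using assms unfolding alt2_def by blast

lemma alt2_ext_d: "alt2 (ext_d \<alpha> p)"
  by (rule alt2I[OF ext_d_lin(3) ext_d_lin(1) ext_d_swap])

lemma alt2_wedge: "alt2 (wedge \<alpha> \<beta>)"
  by (rule alt2I) (simp_all add: wedge_def pairing_simps algebra_simps)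

lemma alt2_add: assumes "alt2 \<Omega>" "alt2 \<Omega>'" shows "alt2 (\<lambda>v w. \<Omega> v w + \<Omega>' v w)"
proof (rule alt2I)
  show "\<Omega> v w + \<Omega>' v w = - (\<Omega> w v + \<Omega>' w v)" for v w
    by (subst alt2D(3)[OF assms(1)], subst alt2D(3)[OF assms(2)]) simp
qed (simp_all add: alt2D(1,2)[OF assms(1)] alt2D(1,2)[OF assms(2)] algebra_simps)

lemma alt2_scale: assumes "alt2 \<Omega>" shows "alt2 (\<lambda>v w. c * \<Omega> v w)"
proof (rule alt2I)
  show "c * \<Omega> v w = - (c * \<Omega> w v)" for v w
    by (subst alt2D(3)[OF assms(1)]) simp
qed (simp_all add: alt2D(1,2)[OF assms(1)] algebra_simps)

text \<open>
  Three pairs of frame vectors determine an alternating form on the tangent space.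
\<close>

lemma form2_eqI:
  assumes p: "p \<in> S3" and alt: "alt2 \<Omega>" "alt2 \<Omega>'"
    and eq: "\<Omega> (W0 p) (cnjv (W0 p)) = \<Omega>' (W0 p) (cnjv (W0 p))"
      "\<Omega> (W0 p) (cvec (T0 p)) = \<Omega>' (W0 p) (cvec (T0 p))"
      "\<Omega> (cnjv (W0 p)) (cvec (T0 p)) = \<Omega>' (cnjv (W0 p)) (cvec (T0 p))"
    and vw: "v \<in> CT p" "w \<in> CT p"
  shows "\<Omega> v w = \<Omega>' v w"
proof -
  have fr: "\<exists>c1 c2 c3. u = c1 *s W0 p + c2 *s cnjv (W0 p) + c3 *s cvec (T0 p)" if "u \<in> CT p" for u
    using dual_frame[OF p CT_frame[OF p], of "theta1 p" "cnjv (theta1 p)" "cvec (theta0 p)" u]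
      dual_theta[OF p] dual_theta1[OF p] that by (auto simp: pairing_cnjv)
  have ex: "B (a1 *s x + a2 *s y + a3 *s z) (b1 *s x + b2 *s y + b3 *s z) =
     (a1 * b2 - a2 * b1) * B x y + (a1 * b3 - a3 * b1) * B x z + (a2 * b3 - a3 * b2) * B y z"
    if "alt2 B" for B :: "complex^4 \<Rightarrow> complex^4 \<Rightarrow> complex" and a1 a2 a3 b1 b2 b3 x y z
  proof -
    note l = alt2D(1,2)[OF that] and sw = alt2D(3)[OF that]
    have l2: "B w (u + v) = B w u + B w v" "B w (c *s v) = c * B w v" for u v w c
      by (metis sw l(1) minus_add_distrib, metis sw l(2) mult_minus_right)
    have z: "B v v = 0" for v using sw[of v v] by simp
    show ?thesis by (simp add: l l2 z sw[of y x] sw[of z x] sw[of z y] algebra_simps)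
  qed
  obtain a1 a2 a3 b1 b2 b3 where v: "v = a1 *s W0 p + a2 *s cnjv (W0 p) + a3 *s cvec (T0 p)"
    and w: "w = b1 *s W0 p + b2 *s cnjv (W0 p) + b3 *s cvec (T0 p)" using fr vw by meson
  show ?thesis unfolding v w ex[OF alt(1)] ex[OF alt(2)] eq ..
qed

lemma smooth_S3_w: "open_S3 U \<Longrightarrow> smooth_S3 w1 U" "open_S3 U \<Longrightarrow> smooth_S3 w2 U"
  "open_S3 U \<Longrightarrow> smooth_S3 (\<lambda>x. cnj (w1 x)) U" "open_S3 U \<Longrightarrow> smooth_S3 (\<lambda>x. cnj (w2 x)) U"
  by (intro smooth_S3_linear bounded_linear_w bounded_linear_cnj_w; assumption)+

lemma smooth_S3_fun_ss_real: "open_S3 U \<Longrightarrow> smooth_on \<phi> UNIV \<Longrightarrow> smooth_S3 (\<lambda>x. \<phi> (ss x)) U"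
  by (rule smooth_S3_compose_real[of _ _ UNIV]) (auto intro: smooth_S3_ss)

lemma smooth_S3_fun_ss: "open_S3 U \<Longrightarrow> smooth_on \<phi> UNIV \<Longrightarrow> smooth_S3 (\<lambda>x. complex_of_real (\<phi> (ss x))) U"
  by (rule smooth_S3_bounded_linear[OF _ bounded_linear_of_real smooth_S3_fun_ss_real])

lemma smooth_S3_eta: "open_S3 U \<Longrightarrow> smooth_S3 eta1 U" "open_S3 U \<Longrightarrow> smooth_S3 eta2 U"
  unfolding eta_as by (intro smooth_S3_diff smooth_S3_scale smooth_S3_w smooth_S3_const; assumption)+

lemma smooth_frame:
  "smooth_S3 W0 S3" "smooth_S3 theta1 S3" "smooth_S3 omega0 S3" "smooth_S3 theta0 S3" "smooth_S3 T0 S3"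
proof -
  note i = smooth_S3_diff smooth_S3_add smooth_S3_scale smooth_S3_mult smooth_S3_w smooth_S3_eta smooth_S3_const
    smooth_S3_fun_ss smooth_fs open_S3_UNIV
  show "smooth_S3 W0 S3" unfolding W0_def[abs_def] by (intro i)
  have q: "w1 p * w2 p / 4 = (1/4) * (w1 p * w2 p)" for p by simp
  show "smooth_S3 theta1 S3" unfolding theta1_def[abs_def] q by (intro i)
  show "smooth_S3 omega0 S3" unfolding omega0_def[abs_def] by (intro i)
  have c: "bounded_linear (\<lambda>p::real^4. axis i (p $ j) :: real^4)" "bounded_linear (\<lambda>p::real^4. axis i (- p $ j) :: real^4)" for i j
    by (rule linear_conv_bounded_linear[THEN iffD1], auto intro!: linearI simp: vec_eq_iff axis_def)+
  have r: "bounded_linear rot1" "bounded_linear rot2"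
    unfolding rot1_def[abs_def] rot2_def[abs_def] by (intro bounded_linear_add c)+
  note j = smooth_S3_add smooth_S3_bilinear[OF _ bounded_bilinear_scaleR] smooth_S3_fun_ss_real smooth_S3_linear[OF r(1)]
    smooth_S3_linear[OF r(2)] smooth_fs smooth_ff_gg open_S3_UNIV
  show "smooth_S3 theta0 S3" unfolding theta0_def[abs_def] by (intro j)
  show "smooth_S3 T0 S3" unfolding T0_def[abs_def] by (intro j)
qed

lemma cvec_theta0: "(\<lambda>x. cvec (theta0 x)) = (\<lambda>x. (- \<i> / 2) *s torus_form fF fG x)"
  by (rule ext) (simp add: theta0_def torus_form_def cvec_lin cvec_rot_eta vec_eq_iff algebra_simps)

lemma omega0_eq: "omega0 = (\<lambda>x. (1/2) *s torus_form fP fQ x)"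
  by (rule ext) (simp add: omega0_def torus_form_def)

lemma theta1_eq: "theta1 = (\<lambda>x. (1/2) *s (w2 x *s dw1 - w1 x *s dw2) - (w1 x * w2 x / 4) *s torus_form fC (\<lambda>s. - fK s) x)"
  by (rule ext) (simp add: theta1_def torus_form_def vec_eq_iff)

text \<open>
  The arc \<open>(ff, gg)\<close> has constant speed \<open>kk\<close> and is orthogonal to its velocity. The first fact makes
  \<open>h = 4 kk\<close> constant, the second makes \<open>T0\<close> the Reeb field.
\<close>

lemma ext_d_theta0: assumes p: "p \<in> S3" "v \<in> CT p" "w \<in> CT p"
  shows "ext_d (\<lambda>x. cvec (theta0 x)) p v w = \<i> * of_real (4 * kk) * wedge (theta1 p) (cnjv (theta1 p)) v w"
proof (rule form2_eqI[OF p(1) alt2_ext_d alt2_scale[OF alt2_wedge] _ _ _ p(2,3)])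
  obtain F' G' C' K' P' Q' where D: "(fF has_real_derivative F') (at (ss p))" "(fG has_real_derivative G') (at (ss p))"
    and E: "fF (ss p) + ss p * F' = kk * gg (ss p)" "(1 - ss p) * G' - fG (ss p) = - kk * ff (ss p)"
    by (rule f_derivatives)
  have e: "ext_d (\<lambda>x. cvec (theta0 x)) p v w = (- \<i> / 2) * ext_d (torus_form fF fG) p v w" for v w
    unfolding cvec_theta0 ext_d_scale[OF diffS_const diffS_torus_form[OF p(1) D] p(1)] by simp
  note T = torus_form_frame[OF p(1) D, unfolded E]
  have w: "wedge (theta1 p) (cnjv (theta1 p)) (W0 p) (cnjv (W0 p)) = 1"
    "wedge (theta1 p) (cnjv (theta1 p)) (W0 p) (cvec (T0 p)) = 0"
    "wedge (theta1 p) (cnjv (theta1 p)) (cnjv (W0 p)) (cvec (T0 p)) = 0"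
    by (simp_all add: wedge_def pairing_cnjv dual_theta1[OF p(1)])
  have sc: "(complex_of_real (gg (ss p)))\<^sup>2 + (of_real (ff (ss p)))\<^sup>2 = 1"
    using arg_cong[OF sin_cos_squared_add[of "kk * ss p"], of complex_of_real]
    by (simp only: of_real_power of_real_add of_real_1 add.commute)
  show "ext_d (\<lambda>x. cvec (theta0 x)) p (W0 p) (cnjv (W0 p)) = \<i> * of_real (4 * kk) * wedge (theta1 p) (cnjv (theta1 p)) (W0 p) (cnjv (W0 p))"
    unfolding e T w
  proof -
    have "- \<i> / 2 * (- 8 * (of_real (gg (ss p)) * complex_of_real (kk * gg (ss p)) - of_real (ff (ss p)) * complex_of_real (- kk * ff (ss p))))
      = 4 * \<i> * of_real kk * ((complex_of_real (gg (ss p)))\<^sup>2 + (of_real (ff (ss p)))\<^sup>2)"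
      by (simp add: algebra_simps power2_eq_square)
    then show "- \<i> / 2 * (- 8 * (of_real (gg (ss p)) * complex_of_real (kk * gg (ss p)) - of_real (ff (ss p)) * complex_of_real (- kk * ff (ss p))))
      = \<i> * of_real (4 * kk) * 1" unfolding sc by simp
  qed
  show "ext_d (\<lambda>x. cvec (theta0 x)) p (W0 p) (cvec (T0 p)) = \<i> * of_real (4 * kk) * wedge (theta1 p) (cnjv (theta1 p)) (W0 p) (cvec (T0 p))"
    "ext_d (\<lambda>x. cvec (theta0 x)) p (cnjv (W0 p)) (cvec (T0 p)) = \<i> * of_real (4 * kk) * wedge (theta1 p) (cnjv (theta1 p)) (cnjv (W0 p)) (cvec (T0 p))"
    unfolding e T w by simp_all
qed

lemma omega0_frame: assumes "p \<in> S3"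
  shows "pairing (omega0 p) (cnjv (W0 p)) = w1 p * w2 p * of_real (fN (ss p) - fM (ss p))"
    "pairing (omega0 p) (cvec (T0 p)) = - \<i> * of_real (ff (ss p) + gg (ss p) + kk * ss p * (1 - ss p))"
proof (atomize (full), rule point_relations[OF assms])
  fix a a' b b' s t f g F G C K M N P Q :: complex
  assume r: "w1 p = a" "w2 p = b"
      "of_real (fF (ss p)) = F" "of_real (fG (ss p)) = G" "of_real (fM (ss p)) = M" "of_real (fN (ss p)) = N"
      "of_real (ff (ss p)) = f" "of_real (gg (ss p)) = g" "of_real (ss p) = s"
      "of_real (fP (ss p)) = P" "of_real (fQ (ss p)) = Q"
    and q: "s + t = 1" "F = 1 - t * N" "G = 1 - s * M" "C = 1 + t * M" "K = 1 + s * N" "f = s * F" "g = t * G"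
      "s * t * (M\<^sup>2 + N\<^sup>2) = 2 * (1 + s * N + t * M)" "f\<^sup>2 + g\<^sup>2 = 1"
      "P = - C - 2 * g - of_real kk * t * f" "Q = - K - 2 * f - of_real kk * s * g"
  have ts: "t = 1 - s" using q(1) by (simp add: algebra_simps)
  have t: "of_real (1 - ss p) = t" using q(1) r by (simp add: algebra_simps)
  define k where "k = complex_of_real kk"
  have 1: "F * Q - G * P = N - M"
  proof -
    have "F * Q - G * P = (t - s) * (M + N + 2) - (t - s) * (s * t * (M\<^sup>2 + N\<^sup>2)) + 4 * s * t * (N - M)"
      unfolding q(2-7) q(10,11)[folded k_def] ts by algebra
    also have "\<dots> = (t - s) * (M + N + 2) - (t - s) * (2 * (1 + s * N + t * M)) + 4 * s * t * (N - M)"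
      by (simp only: q(8))
    also have "\<dots> = N - M" unfolding ts by algebra
    finally show ?thesis .
  qed
  have "s * P = - (1 - g) - 2 * s * g - k * s * t * f" "t * Q = - (1 - f) - 2 * t * f - k * s * t * g"
    unfolding q(2-7) q(10,11)[folded k_def] ts by algebra+
  then have "f * (s * P) + g * (t * Q) = f * (- (1 - g) - 2 * s * g - k * s * t * f) + g * (- (1 - f) - 2 * t * f - k * s * t * g)"
    by simp
  also have "\<dots> = - (f + g + k * s * t * (f\<^sup>2 + g\<^sup>2))" unfolding ts by algebra
  finally have "f * (s * P) + g * (t * Q) = - (f + g + k * s * t * (f\<^sup>2 + g\<^sup>2))" .
  then have 2: "f * (s * P) + g * (t * Q) = - (f + g + k * s * t)" using q(9) by simp
  have o1: "pairing (omega0 p) (cnjv (W0 p)) = a * b * (F * Q - G * P)"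
    unfolding omega0_def pairing_simps eta_frame[OF assms] r by (simp add: algebra_simps)
  have o2: "pairing (omega0 p) (cvec (T0 p)) = \<i> * (f * (s * P) + g * (t * Q))"
    unfolding omega0_def pairing_simps eta_frame[OF assms] r t by (simp add: algebra_simps)
  have o3: "complex_of_real (ff (ss p) + gg (ss p) + kk * ss p * (1 - ss p)) = f + g + k * s * t"
    unfolding of_real_add of_real_mult r t k_def ..
  have o4: "complex_of_real (fN (ss p) - fM (ss p)) = N - M" by (simp add: r)
  show "pairing (omega0 p) (cnjv (W0 p)) = w1 p * w2 p * of_real (fN (ss p) - fM (ss p)) \<and>
    pairing (omega0 p) (cvec (T0 p)) = - \<i> * of_real (ff (ss p) + gg (ss p) + kk * ss p * (1 - ss p))"
    unfolding o1 o2 o3 o4 1 2 r(1,2) by (simp add: algebra_simps)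
qed

text \<open>
  Both sides are compared on the frame. The pair \<open>(cnj W0, T0)\<close> determines the torsion coefficient
  \<open>i kk (w\<^sub>1 w\<^sub>2)\<^sup>2\<close>; the other two pairs give the values of \<open>omega0\<close> on \<open>cnj W0\<close> and \<open>T0\<close>.
\<close>

lemma ext_d_theta1: assumes p: "p \<in> S3" "v \<in> CT p" "w \<in> CT p"
  shows "ext_d theta1 p v w = wedge (theta1 p) (omega0 p) v w
     + \<i> * of_real kk * (w1 p * w2 p)\<^sup>2 * wedge (cvec (theta0 p)) (cnjv (theta1 p)) v w"
proof (rule form2_eqI[OF p(1) alt2_ext_d alt2_add[OF alt2_wedge alt2_scale[OF alt2_wedge]] _ _ _ p(2,3)])
  obtain C' K' where D: "(fC has_real_derivative C') (at (ss p))" and DK: "(fK has_real_derivative K') (at (ss p))"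
    and E: "fC (ss p) + ss p * C' = kk * ff (ss p)" "(1 - ss p) * K' - fK (ss p) = - kk * gg (ss p)"
    by (rule f_derivatives)
  have DK': "((\<lambda>s. - fK s) has_real_derivative - K') (at (ss p))" using DK by (rule DERIV_minus)
  have E': "(1 - ss p) * (- K') - - fK (ss p) = kk * gg (ss p)" using E(2) by simp
  define \<alpha> where "\<alpha> = torus_form fC (\<lambda>s. - fK s)"
  note T = torus_form_frame[OF p(1) D DK', unfolded E(1) E', folded \<alpha>_def]
  note d = diffS_w[OF p(1)]
  have da: "diffS \<alpha> p" unfolding \<alpha>_def using p(1) D DK' by (rule diffS_torus_form)
  have dab: "diffS (\<lambda>x. w1 x * w2 x / 4) p"
    using diffS_mult[OF diffS_mult[OF d(1,2)] diffS_const[of "1/4"]] by simp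
  have Dab: "dirD (\<lambda>x. w1 x * w2 x / 4) p u = (w1 p * pairing dw2 u + w2 p * pairing dw1 u) / 4" if "u \<in> CT p" for u
  proof -
    have "dirD (\<lambda>x. w1 x * w2 x / 4) p u = dirD (\<lambda>x. (1/4) * (w1 x * w2 x)) p u" by simp
    also have "\<dots> = (1/4) * dirD (\<lambda>x. w1 x * w2 x) p u"
      by (rule dirD_cmult) (rule diffS_mult[OF d(1,2)])
    also have "dirD (\<lambda>x. w1 x * w2 x) p u = w1 p * dirD w2 p u + dirD w1 p u * w2 p"
      by (rule dirD_mult[OF d(1,2) p(1)])
    finally show ?thesis using that by (simp add: dirD_w[OF p(1)] algebra_simps)
  qed
  have db: "diffS (\<lambda>x. w2 x *s dw1 - w1 x *s dw2) p" by (intro diffS_diff diffS_scale d diffS_const)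
  have Db: "ext_d (\<lambda>x. w2 x *s dw1 - w1 x *s dw2) p u v = 2 * (pairing dw2 u * pairing dw1 v - pairing dw2 v * pairing dw1 u)"
    if "u \<in> CT p" "v \<in> CT p" for u v
    by (subst ext_d_diff[OF diffS_scale[OF d(2) diffS_const] diffS_scale[OF d(1) diffS_const]])
       (simp add: ext_d_scale[OF d(2) diffS_const p(1)] ext_d_scale[OF d(1) diffS_const p(1)] dirD_w[OF p(1)] that algebra_simps)
  have e: "ext_d theta1 p u v = (pairing dw2 u * pairing dw1 v - pairing dw2 v * pairing dw1 u)
     - (1/4) * ((w1 p * pairing dw2 u + w2 p * pairing dw1 u) * pairing (\<alpha> p) v
       - (w1 p * pairing dw2 v + w2 p * pairing dw1 v) * pairing (\<alpha> p) u + w1 p * w2 p * ext_d \<alpha> p u v)"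
    if "u \<in> CT p" "v \<in> CT p" for u v
  proof -
    have "ext_d theta1 p u v = ext_d (\<lambda>x. (1/2) *s (w2 x *s dw1 - w1 x *s dw2)) p u v - ext_d (\<lambda>x. (w1 x * w2 x / 4) *s \<alpha> x) p u v"
      unfolding theta1_eq \<alpha>_def[symmetric] by (rule ext_d_diff[OF diffS_scale[OF diffS_const db] diffS_scale[OF dab da]])
    then show ?thesis
      unfolding ext_d_scale[OF diffS_const db p(1)] ext_d_scale[OF dab da p(1)] Db[OF that] Dab[OF that(1)] Dab[OF that(2)]
      by (simp add: algebra_simps add_divide_distrib)
  qed
  note m = CT_frame[OF p(1)]
  have pa: "pairing (\<alpha> p) u = of_real (fC (ss p)) * pairing (eta1 p) u - of_real (fK (ss p)) * pairing (eta2 p) u" for u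
    by (simp add: \<alpha>_def torus_form_def pairing_simps pairing_minus)
  note fin = e[OF m(1,2)] e[OF m(1,3)] e[OF m(2,3)]
  have wd: "wedge (theta1 p) (omega0 p) (W0 p) u = pairing (omega0 p) u" if "u = cnjv (W0 p) \<or> u = cvec (T0 p)" for u
    using that by (auto simp: wedge_def dual_theta1[OF p(1)])
  have wd': "wedge (theta1 p) (omega0 p) (cnjv (W0 p)) (cvec (T0 p)) = 0"
    by (simp add: wedge_def dual_theta1[OF p(1)])
  have wt: "wedge (cvec (theta0 p)) (cnjv (theta1 p)) (W0 p) (cnjv (W0 p)) = 0"
    "wedge (cvec (theta0 p)) (cnjv (theta1 p)) (W0 p) (cvec (T0 p)) = 0"
    "wedge (cvec (theta0 p)) (cnjv (theta1 p)) (cnjv (W0 p)) (cvec (T0 p)) = - 1"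
    by (simp_all add: wedge_def pairing_cnjv dual_theta1[OF p(1)] dual_theta[OF p(1)])
  have "ext_d theta1 p (W0 p) (cnjv (W0 p)) = pairing (omega0 p) (cnjv (W0 p)) \<and>
     ext_d theta1 p (W0 p) (cvec (T0 p)) = pairing (omega0 p) (cvec (T0 p)) \<and>
     ext_d theta1 p (cnjv (W0 p)) (cvec (T0 p)) = - (\<i> * of_real kk * (w1 p * w2 p)\<^sup>2)"
  proof (rule point_relations[OF p(1)])
    fix a a' b b' s t f g F G C K M N P Q :: complex
    assume r: "w1 p = a" "cnj a = a'" "w2 p = b" "cnj b = b'" "cnj a' = a" "cnj b' = b"
      "of_real (fF (ss p)) = F" "of_real (fG (ss p)) = G" "of_real (fM (ss p)) = M" "of_real (fN (ss p)) = N"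
      "of_real (fC (ss p)) = C" "of_real (fK (ss p)) = K" "of_real (ff (ss p)) = f" "of_real (gg (ss p)) = g" "of_real (ss p) = s"
      "cnj M = M" "cnj N = N" "cnj F = F" "cnj G = G"
    and q: "s = a * a'" "t = b * b'" "s + t = 1" "F = 1 - t * N" "G = 1 - s * M" "C = 1 + t * M" "K = 1 + s * N" "f = s * F" "g = t * G"
      "s * t * (M\<^sup>2 + N\<^sup>2) = 2 * (1 + s * N + t * M)" "f\<^sup>2 + g\<^sup>2 = 1"
    have ts: "t = 1 - s" using q(3) by (simp add: algebra_simps)
    have t: "of_real (1 - ss p) = t" using q(3) r by (simp add: algebra_simps)
    define k where "k = complex_of_real kk"
    have rk: "complex_of_real (kk * ff (ss p)) = k * f" "complex_of_real (kk * gg (ss p)) = k * g"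
      unfolding of_real_mult r k_def by simp_all
    have CK: "C * G + K * F = - (M + N)" unfolding q(4-7) using q(10) ts by algebra
    have a1: "pairing (\<alpha> p) (W0 p) = - 2 * (a' * b') * (M + N)"
      unfolding pa eta_frame[OF p(1)] r using CK by algebra
    have a2: "pairing (\<alpha> p) (cnjv (W0 p)) = 2 * (a * b) * (M + N)"
      unfolding pa eta_frame[OF p(1)] r using CK by algebra
    have sC: "s * C = 1 - g" "t * K = 1 - f" unfolding q(4-9) ts by algebra+
    have a3: "pairing (\<alpha> p) (cvec (T0 p)) = 2 * \<i> * (f - g)"
    proof -
      have "pairing (\<alpha> p) (cvec (T0 p)) = 2 * \<i> * (f * (s * C) - g * (t * K))"
        unfolding pa eta_frame[OF p(1)] r t by (simp add: algebra_simps)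
      then show ?thesis unfolding sC by (simp add: algebra_simps)
    qed
    have x1: "ext_d \<alpha> p (W0 p) (cnjv (W0 p)) = 0" unfolding T rk r by simp
    have x2: "ext_d \<alpha> p (W0 p) (cvec (T0 p)) = 4 * \<i> * k * (a' * b')"
    proof -
      have "ext_d \<alpha> p (W0 p) (cvec (T0 p)) = 4 * \<i> * k * (a' * b') * (f\<^sup>2 + g\<^sup>2)"
        unfolding T rk r by (simp add: algebra_simps power2_eq_square)
      then show ?thesis unfolding q(11) by simp
    qed
    have x3: "ext_d \<alpha> p (cnjv (W0 p)) (cvec (T0 p)) = 4 * \<i> * k * (a * b)"
    proof -
      have "ext_d \<alpha> p (cnjv (W0 p)) (cvec (T0 p)) = 4 * \<i> * k * (a * b) * (f\<^sup>2 + g\<^sup>2)"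
        unfolding T rk r by (simp add: algebra_simps power2_eq_square)
      then show ?thesis unfolding q(11) by simp
    qed
    have o1: "pairing (omega0 p) (cnjv (W0 p)) = a * b * (N - M)"
      unfolding omega0_frame(1)[OF p(1)] r by (simp add: r)
    have o2: "pairing (omega0 p) (cvec (T0 p)) = - \<i> * (f + g + k * s * t)"
      unfolding omega0_frame(2)[OF p(1)] of_real_add of_real_mult r t k_def ..
    have L1: "(- a' * (1 + F)) * (b * (a * a * M)) - (- a * (b * b * N)) * (b' * (1 + G))
      = a * b * (t * (1 + G) * N - s * (1 + F) * M)" using q(1,2) by algebra
    have L2: "a * (- a' * (1 + F)) + b * (b' * (1 + G)) = t * (1 + G) - s * (1 + F)" using q(1,2) by algebra
    have L3: "a * (- a * (b * b * N)) + b * (b * (a * a * M)) = (a * b)\<^sup>2 * (M - N)" by algebra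
    have c1: "ext_d theta1 p (W0 p) (cnjv (W0 p)) = a * b * (N - M)"
    proof -
      have "ext_d theta1 p (W0 p) (cnjv (W0 p)) = ((- a' * (1 + F)) * (b * (a * a * M)) - (- a * (b * b * N)) * (b' * (1 + G)))
        - (1/4) * ((a * (- a' * (1 + F)) + b * (b' * (1 + G))) * (2 * (a * b) * (M + N))
           - (a * (- a * (b * b * N)) + b * (b * (a * a * M))) * (- 2 * (a' * b') * (M + N)))"
        unfolding fin x1 a1 a2 components_cnjv components_W0 r by (simp add: r)
      also have "\<dots> = a * b * (t * (1 + G) * N - s * (1 + F) * M)
        - (1/4) * ((t * (1 + G) - s * (1 + F)) * (2 * (a * b) * (M + N)) - ((a * b)\<^sup>2 * (M - N)) * (- 2 * (a' * b') * (M + N)))"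
        unfolding L1 L2 L3 ..
      also have "((a * b)\<^sup>2 * (M - N)) * (- 2 * (a' * b') * (M + N)) = - 2 * (a * b) * (s * t * (M - N) * (M + N))"
        using q(1,2) by algebra
      also have "a * b * (t * (1 + G) * N - s * (1 + F) * M)
        - (1/4) * ((t * (1 + G) - s * (1 + F)) * (2 * (a * b) * (M + N)) - (- 2 * (a * b) * (s * t * (M - N) * (M + N))))
        = a * b * (1/2) * (2 * (t * (1 + G) * N - s * (1 + F) * M) - (t * (1 + G) - s * (1 + F)) * (M + N) - s * t * (M - N) * (M + N))"
        by (simp add: field_simps)
      also have "2 * (t * (1 + G) * N - s * (1 + F) * M) - (t * (1 + G) - s * (1 + F)) * (M + N) - s * t * (M - N) * (M + N) = 2 * (N - M)"
        unfolding q(4,5) ts by algebra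
      finally have E: "ext_d theta1 p (W0 p) (cnjv (W0 p)) = a * b * (1 / 2) * (2 * (N - M))" .
      show ?thesis unfolding E by (simp add: algebra_simps)
    qed
    have st: "s * (1 + F) = s + f" "t * (1 + G) = t + g" using q(8,9) by (simp_all add: algebra_simps)
    have stMN: "s * t * (M + N) = 1 - f - g" unfolding q(8,9) unfolding q(4,5) ts by algebra
    have c2: "ext_d theta1 p (W0 p) (cvec (T0 p)) = - \<i> * (f + g + k * s * t)"
    proof -
      have "ext_d theta1 p (W0 p) (cvec (T0 p)) = ((- a' * (1 + F)) * (\<i> * f * a) - (\<i> * g * b) * (b' * (1 + G)))
        - (1/4) * ((a * (- a' * (1 + F)) + b * (b' * (1 + G))) * (2 * \<i> * (f - g))
           - (a * (\<i> * g * b) + b * (\<i> * f * a)) * (- 2 * (a' * b') * (M + N)) + a * b * (4 * \<i> * k * (a' * b')))"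
        unfolding fin x2 a1 a3 components_T0 components_W0 r by (simp add: r)
      also have "(- a' * (1 + F)) * (\<i> * f * a) - (\<i> * g * b) * (b' * (1 + G)) = - \<i> * (f * (s * (1 + F)) + g * (t * (1 + G)))"
        using q(1,2) by algebra
      also have "(a * (\<i> * g * b) + b * (\<i> * f * a)) * (- 2 * (a' * b') * (M + N)) = - 2 * \<i> * (f + g) * (s * t * (M + N))"
        using q(1,2) by algebra
      also have "a * b * (4 * \<i> * k * (a' * b')) = 4 * \<i> * k * s * t" using q(1,2) by algebra
      finally have "ext_d theta1 p (W0 p) (cvec (T0 p)) = - \<i> * (f * (s + f) + g * (t + g))
        - (1/4) * ((t + g - (s + f)) * (2 * \<i> * (f - g)) - - 2 * \<i> * (f + g) * (1 - f - g) + 4 * \<i> * k * s * t)"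
        unfolding L2 st stMN .
      also have "\<dots> = - \<i> * (1/2) * (2 * (f * (s + f) + g * (t + g)) + (t + g - (s + f)) * (f - g) + (f + g) * (1 - f - g) + 2 * k * s * t)"
        by (simp add: field_simps)
      also have "2 * (f * (s + f) + g * (t + g)) + (t + g - (s + f)) * (f - g) + (f + g) * (1 - f - g) + 2 * k * s * t
         = 2 * (f + g + k * s * t)"
        unfolding ts by algebra
      finally show ?thesis by simp
    qed
    have c3: "ext_d theta1 p (cnjv (W0 p)) (cvec (T0 p)) = - (\<i> * k * (a * b)\<^sup>2)"
    proof -
      have "ext_d theta1 p (cnjv (W0 p)) (cvec (T0 p)) = ((- a * (b * b * N)) * (\<i> * f * a) - (\<i> * g * b) * (b * (a * a * M)))
        - (1/4) * ((a * (- a * (b * b * N)) + b * (b * (a * a * M))) * (2 * \<i> * (f - g))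
           - (a * (\<i> * g * b) + b * (\<i> * f * a)) * (2 * (a * b) * (M + N)) + a * b * (4 * \<i> * k * (a * b)))"
        unfolding fin x3 a2 a3 components_T0 components_cnjv components_W0 r by (simp add: r)
      also have "\<dots> = - (\<i> * k * (a * b)\<^sup>2)" by (simp add: field_simps power2_eq_square)
      finally show ?thesis .
    qed
    show ?thesis unfolding c1 c2 c3 o1 o2 r k_def by simp
  qed
  then show "ext_d theta1 p (W0 p) (cnjv (W0 p)) = wedge (theta1 p) (omega0 p) (W0 p) (cnjv (W0 p))
     + \<i> * of_real kk * (w1 p * w2 p)\<^sup>2 * wedge (cvec (theta0 p)) (cnjv (theta1 p)) (W0 p) (cnjv (W0 p))"
    "ext_d theta1 p (W0 p) (cvec (T0 p)) = wedge (theta1 p) (omega0 p) (W0 p) (cvec (T0 p))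
     + \<i> * of_real kk * (w1 p * w2 p)\<^sup>2 * wedge (cvec (theta0 p)) (cnjv (theta1 p)) (W0 p) (cvec (T0 p))"
    "ext_d theta1 p (cnjv (W0 p)) (cvec (T0 p)) = wedge (theta1 p) (omega0 p) (cnjv (W0 p)) (cvec (T0 p))
     + \<i> * of_real kk * (w1 p * w2 p)\<^sup>2 * wedge (cvec (theta0 p)) (cnjv (theta1 p)) (cnjv (W0 p)) (cvec (T0 p))"
    by (simp_all add: wd wd' wt)
qed

section \<open>Webster curvature and sublaplacian of the structure\<close>

lemma W0_nonzero: "p \<in> S3 \<Longrightarrow> W0 p \<noteq> 0"
  using dual_theta1(1)[of p] by (auto simp: pairing_simps)

lemma local_generator_W0: "local_generator H0 S3 W0"
  by (simp add: local_generator_def open_S3_UNIV smooth_frame CT_frame W0_nonzero H0_def)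

lemma CR_structure_H0: "CR_structure H0"
  unfolding CR_structure_def
proof (intro conjI ballI)
  fix p :: "real^4" assume p: "p \<in> S3"
  show "\<exists>U Z. p \<in> U \<and> local_generator H0 U Z" using p local_generator_W0 by blast
  show "H0 p \<inter> cnjv ` H0 p = {0}"
  proof
    show "H0 p \<inter> cnjv ` H0 p \<subseteq> {0}"
    proof
      fix v assume "v \<in> H0 p \<inter> cnjv ` H0 p"
      then obtain u where "v \<in> H0 p" "u \<in> H0 p" "v = cnjv u" by blast
      then obtain c d where v: "v = c *s W0 p" "v = cnjv (d *s W0 p)" unfolding H0_def vec.span_singleton by blast
      have "c = pairing (theta1 p) v" unfolding v(1) using dual_theta1[OF p] by (simp add: pairing_simps)
      also have "\<dots> = 0" unfolding v(2) using dual_theta1[OF p] by (simp add: pairing_simps)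
      finally show "v \<in> {0}" using v by simp
    qed
    have "0 \<in> H0 p" by (simp add: H0_def vec.span_zero)
    then show "{0} \<subseteq> H0 p \<inter> cnjv ` H0 p" by (auto intro!: image_eqI[of 0 cnjv 0])
  qed
qed

lemma annihilates_theta0: "annihilates theta0 H0"
  by (auto simp: annihilates_def H0_def vec.span_singleton pairing_simps dual_theta)

lemma ext_d_theta0_W0: assumes "p \<in> S3"
  shows "ext_d (\<lambda>x. cvec (theta0 x)) p (W0 p) (cnjv (W0 p)) = \<i> * of_real (4 * kk)"
  using ext_d_theta0[OF assms CT_frame(1,2)[OF assms]]
  by (simp add: wedge_def pairing_cnjv dual_theta1[OF assms])

lemma associated_theta0: "associated_contact_form H0 theta0"
  unfolding associated_contact_form_def contact_form_def
proof (intro conjI ballI)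
  show "smooth_S3 theta0 S3" by (rule smooth_frame)
  fix p :: "real^4" assume p: "p \<in> S3"
  let ?th = "\<lambda>x. cvec (theta0 x)"
  have "pairing (cvec (theta0 p)) (W0 p) * ext_d ?th p (cnjv (W0 p)) (cvec (T0 p))
      + pairing (cvec (theta0 p)) (cnjv (W0 p)) * ext_d ?th p (cvec (T0 p)) (W0 p)
      + pairing (cvec (theta0 p)) (cvec (T0 p)) * ext_d ?th p (W0 p) (cnjv (W0 p)) \<noteq> 0"
    using kk_pos by (simp add: dual_theta[OF p] ext_d_theta0_W0[OF p])
  then show "\<exists>u\<in>CT p. \<exists>v\<in>CT p. \<exists>w\<in>CT p.
        pairing (cvec (theta0 p)) u * ext_d ?th p v w
      + pairing (cvec (theta0 p)) v * ext_d ?th p w u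
      + pairing (cvec (theta0 p)) w * ext_d ?th p u v \<noteq> 0" using CT_frame[OF p] by blast
  fix v assume "v \<in> Levi_distribution H0 p"
  then obtain Z W where ZW: "Z \<in> H0 p" "W \<in> H0 p" "cvec v = Z + cnjv W" by (auto simp: Levi_distribution_def)
  have "complex_of_real (theta0 p \<bullet> v) = pairing (cvec (theta0 p)) (cvec v)" by (simp add: pairing_cvec_cvec)
  also have "\<dots> = 0" unfolding ZW(3) pairing_simps pairing_cvec_cnjv
    using annihilates_theta0 p ZW by (simp add: annihilates_def)
  finally show "theta0 p \<bullet> v = 0" by simp
qed

lemma Levi_positive_theta0: "Levi_positive H0 theta0"
  unfolding Levi_positive_def
proof (intro ballI impI)
  fix p :: "real^4" and Z assume p: "p \<in> S3" and Z: "Z \<in> H0 p" "Z \<noteq> 0"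
  then obtain c where c: "Z = c *s W0 p" by (auto simp: H0_def vec.span_singleton)
  then have c0: "c \<noteq> 0" using Z by auto
  have "ext_d (\<lambda>x. cvec (theta0 x)) p Z (cnjv Z) = c * cnj c * (\<i> * of_real (4 * kk))"
    unfolding c by (simp add: ext_d_lin ext_d_theta0_W0[OF p])
  also have "\<dots> = \<i> * complex_of_real ((cmod c)\<^sup>2 * (4 * kk))"
    unfolding complex_norm_square[symmetric] of_real_mult of_real_power[symmetric] by (simp add: mult_ac)
  finally show "\<exists>h>0. ext_d (\<lambda>x. cvec (theta0 x)) p Z (cnjv Z) = \<i> * complex_of_real h"
    using c0 kk_pos by (intro exI[of _ "(cmod c)\<^sup>2 * (4 * kk)"]) simp
qed

lemma Tanaka_Webster_H0: "Tanaka_Webster H0 theta0 S3 W0 theta1 (\<lambda>_. 4 * kk) omega0"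
  unfolding Tanaka_Webster_def
proof (intro conjI)
  show "local_generator H0 S3 W0" "smooth_S3 theta1 S3" "smooth_S3 omega0 S3" "smooth_S3 (\<lambda>_. 4 * kk) S3"
    by (rule local_generator_W0 smooth_frame smooth_S3_const)+
  have "ext_d (\<lambda>x. cvec (theta0 x)) p (cvec (T0 p)) v = 0" if "p \<in> S3" "v \<in> CT p" for p v
    unfolding ext_d_theta0[OF that(1) CT_frame(3)[OF that(1)] that(2)]
    by (simp add: wedge_def pairing_cnjv dual_theta1[OF that(1)])
  then have R: "Reeb_field theta0 S3 T0"
    using dual_theta(3) by (auto simp: Reeb_field_def smooth_frame CT_frame pairing_cvec_cvec)
  show "\<exists>T. Reeb_field theta0 S3 T \<and>
        (\<forall>p\<in>S3. pairing (theta1 p) (W0 p) = 1 \<and> pairing (theta1 p) (cnjv (W0 p)) = 0 \<and>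
               pairing (theta1 p) (cvec (T p)) = 0)"
    using R dual_theta1 by blast
  show "\<forall>p\<in>S3. 4 * kk > 0 \<and> (\<forall>v\<in>CT p. \<forall>w\<in>CT p. ext_d (\<lambda>x. cvec (theta0 x)) p v w
            = \<i> * complex_of_real (4 * kk) * wedge (theta1 p) (cnjv (theta1 p)) v w)"
    by (intro ballI conjI) (use kk_pos in simp, rule ext_d_theta0)
  have q: "\<i> * of_real kk * (w1 x * w2 x)\<^sup>2 = (\<i> * of_real kk) * ((w1 x * w2 x) * (w1 x * w2 x))" for x
    by (simp add: power2_eq_square)
  have "smooth_S3 (\<lambda>p. \<i> * of_real kk * (w1 p * w2 p)\<^sup>2) S3"
    unfolding q by (intro smooth_S3_mult smooth_S3_const smooth_S3_w open_S3_UNIV)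
  then show "\<exists>A. smooth_S3 A S3 \<and> (\<forall>p\<in>S3. \<forall>v\<in>CT p. \<forall>w\<in>CT p.
        ext_d theta1 p v w = wedge (theta1 p) (omega0 p) v w
            + A p * wedge (cvec (theta0 p)) (cnjv (theta1 p)) v w)"
    using ext_d_theta1 by (intro exI[of _ "\<lambda>p. \<i> * of_real kk * (w1 p * w2 p)\<^sup>2"]) simp
  \<comment> \<open>With \<open>h\<close> constant, compatibility with the metric means that the connection form is imaginary.\<close>
  have c: "cnjv (omega0 p) = (-1) *s omega0 p" for p
    by (simp add: omega0_def eta1_def eta2_def vec_eq_iff algebra_simps)
  show "\<forall>p\<in>S3. \<forall>v\<in>CT p. dirD (\<lambda>x. complex_of_real (4 * kk)) p v
        = complex_of_real (4 * kk) * (pairing (omega0 p) v + pairing (cnjv (omega0 p)) v)"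
    unfolding c by (simp add: pairing_simps pairing_minus)
qed

lemma Webster_curvature_H0: assumes p: "p \<in> S3"
  shows "Webster_curvature H0 theta0 p = (2 + kk\<^sup>2 * (ss p * (1 - ss p))) / kk"
proof (rule Webster_curvature_eqI[OF Tanaka_Webster_H0 annihilates_theta0 p])
  let ?s = "ss p"
  obtain P' Q' where D: "(fP has_real_derivative P') (at ?s)" "(fQ has_real_derivative Q') (at ?s)"
    and E: "fP ?s + ?s * P' = - 2 * gg ?s - 2 * kk * (1 - 2 * ?s) * ff ?s - kk\<^sup>2 * ?s * (1 - ?s) * gg ?s"
      "(1 - ?s) * Q' - fQ ?s = 2 * ff ?s - 2 * kk * (1 - 2 * ?s) * gg ?s + kk\<^sup>2 * ?s * (1 - ?s) * ff ?s"
    by (rule f_derivatives)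
  have "ext_d omega0 p (W0 p) (cnjv (W0 p)) = (1/2) * ext_d (torus_form fP fQ) p (W0 p) (cnjv (W0 p))"
    unfolding omega0_eq ext_d_scale[OF diffS_const diffS_torus_form[OF p D] p] by simp
  also have "\<dots> = complex_of_real (- 4 * (gg ?s * (fP ?s + ?s * P') - ff ?s * ((1 - ?s) * Q' - fQ ?s)))"
    unfolding torus_form_frame[OF p D] by simp
  also have "- 4 * (gg ?s * (fP ?s + ?s * P') - ff ?s * ((1 - ?s) * Q' - fQ ?s)) =
      4 * (2 + kk\<^sup>2 * (?s * (1 - ?s))) * ((ff ?s)\<^sup>2 + (gg ?s)\<^sup>2)"
    unfolding E by algebra
  also have "\<dots> = (2 + kk\<^sup>2 * (?s * (1 - ?s))) / kk * (4 * kk)" using kk_pos by simp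
  finally show "ext_d omega0 p (W0 p) (cnjv (W0 p)) =
      complex_of_real ((2 + kk\<^sup>2 * (?s * (1 - ?s))) / kk) * complex_of_real (4 * kk)"
    by (simp only: of_real_mult)
qed

text \<open>
  On a function of \<open>ss\<close>, the field \<open>W0\<close> acts as \<open>2 cnj (w\<^sub>1 w\<^sub>2)\<close> times the derivative in \<open>s\<close>. The terms
  with \<open>fM - fN\<close> cancel against those of the connection, and the Legendre operator \<open>(s (1 - s) \<phi>')'\<close>
  remains.
\<close>

lemma sublaplacian_H0:
  assumes p: "p \<in> S3" and I: "{0..1} \<subseteq> I" and sm: "smooth_on \<phi> I"
    and d1: "\<And>s. s \<in> I \<Longrightarrow> (\<phi> has_real_derivative \<phi>1 s) (at s)"
    and d2: "(\<phi>1 has_real_derivative \<phi>2) (at (ss p))"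
  shows "smooth_S3 (\<lambda>x. \<phi> (ss x)) S3"
    and "sublaplacian H0 theta0 (\<lambda>x. \<phi> (ss x)) p =
      2 / kk * (ss p * (1 - ss p) * \<phi>2 + (1 - 2 * ss p) * \<phi>1 (ss p))"
proof -
  have inI: "ss x \<in> I" if "x \<in> S3" for x using ss_range[OF that] I by auto
  show sS: "smooth_S3 (\<lambda>x. \<phi> (ss x)) S3"
    by (rule smooth_S3_compose_real[OF open_S3_UNIV inI smooth_S3_ss[OF open_S3_UNIV] sm])
  let ?uc = "\<lambda>x. complex_of_real (\<phi> (ss x))"
  have W: "vf_apply W0 ?uc x = of_real (\<phi>1 (ss x)) * (2 * (cnj (w1 x) * cnj (w2 x)))"
    "vf_apply (\<lambda>x. cnjv (W0 x)) ?uc x = of_real (\<phi>1 (ss x)) * (2 * (w1 x * w2 x))" if "x \<in> S3" for x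
    unfolding vf_apply_def using dirD_fun_ss[OF that CT_frame(1)[OF that] d1[OF inI[OF that]]]
      dirD_fun_ss[OF that CT_frame(2)[OF that] d1[OF inI[OF that]]] ds_frame[OF that] by simp_all
  note d = diffS_w[OF p] and m = CT_frame[OF p]
  have df: "diffS (\<lambda>x. complex_of_real (\<phi>1 (ss x))) p" by (rule diffS_fun_ss[OF p d2])
  have dab: "diffS (\<lambda>x. 2 * (w1 x * w2 x)) p" "diffS (\<lambda>x. 2 * (cnj (w1 x) * cnj (w2 x))) p"
    by (intro diffS_mult diffS_const d)+
  have Dab: "dirD (\<lambda>x. 2 * (w1 x * w2 x)) p v = 2 * (w1 p * pairing dw2 v + pairing dw1 v * w2 p)"
    "dirD (\<lambda>x. 2 * (cnj (w1 x) * cnj (w2 x))) p v = 2 * (cnj (w1 p) * pairing (cnjv dw2) v + pairing (cnjv dw1) v * cnj (w2 p))"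
    if "v \<in> CT p" for v
    by (simp_all add: dirD_cmult[OF diffS_mult[OF d(1,2)]] dirD_cmult[OF diffS_mult[OF d(3,4)]]
        dirD_mult[OF d(1,2) p] dirD_mult[OF d(3,4) p] dirD_w[OF p that])
  have WW1: "vf_apply W0 (vf_apply (\<lambda>x. cnjv (W0 x)) ?uc) p =
     of_real (\<phi>1 (ss p)) * (2 * (w1 p * pairing dw2 (W0 p) + pairing dw1 (W0 p) * w2 p))
     + of_real \<phi>2 * ds p (W0 p) * (2 * (w1 p * w2 p))"
  proof -
    have "vf_apply W0 (vf_apply (\<lambda>x. cnjv (W0 x)) ?uc) p = dirD (vf_apply (\<lambda>x. cnjv (W0 x)) ?uc) p (W0 p)"
      by (rule fun_cong[OF vf_apply_def])
    also have "\<dots> = dirD (\<lambda>x. of_real (\<phi>1 (ss x)) * (2 * (w1 x * w2 x))) p (W0 p)"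
      by (rule dirD_cong(1)[OF open_S3_UNIV p W(2)])
    finally show ?thesis
      unfolding dirD_mult[OF df dab(1) p] Dab(1)[OF m(1)] dirD_fun_ss[OF p m(1) d2] .
  qed
  have WW2: "vf_apply (\<lambda>x. cnjv (W0 x)) (vf_apply W0 ?uc) p =
     of_real (\<phi>1 (ss p)) * (2 * (cnj (w1 p) * pairing (cnjv dw2) (cnjv (W0 p)) + pairing (cnjv dw1) (cnjv (W0 p)) * cnj (w2 p)))
     + of_real \<phi>2 * ds p (cnjv (W0 p)) * (2 * (cnj (w1 p) * cnj (w2 p)))"
  proof -
    have "vf_apply (\<lambda>x. cnjv (W0 x)) (vf_apply W0 ?uc) p = dirD (vf_apply W0 ?uc) p (cnjv (W0 p))"
      by (rule fun_cong[OF vf_apply_def])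
    also have "\<dots> = dirD (\<lambda>x. of_real (\<phi>1 (ss x)) * (2 * (cnj (w1 x) * cnj (w2 x)))) p (cnjv (W0 p))"
      by (rule dirD_cong(1)[OF open_S3_UNIV p W(1)])
    finally show ?thesis
      unfolding dirD_mult[OF df dab(2) p] Dab(2)[OF m(2)] dirD_fun_ss[OF p m(2) d2] .
  qed
  have om: "pairing (cnjv (omega0 p)) (W0 p) = cnj (w1 p) * cnj (w2 p) * of_real (fN (ss p) - fM (ss p))"
    by (simp add: pairing_cnjv omega0_frame(1)[OF p])
  have "vf_apply W0 (vf_apply (\<lambda>x. cnjv (W0 x)) ?uc) p + vf_apply (\<lambda>x. cnjv (W0 x)) (vf_apply W0 ?uc) p
       - pairing (omega0 p) (cnjv (W0 p)) * vf_apply W0 ?uc p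
       - pairing (cnjv (omega0 p)) (W0 p) * vf_apply (\<lambda>x. cnjv (W0 x)) ?uc p
    = 8 * (of_real (ss p) * of_real (1 - ss p) * of_real \<phi>2 + (1 - 2 * of_real (ss p)) * of_real (\<phi>1 (ss p)))"
  proof (rule point_relations[OF p])
    fix a a' b b' s t f g F G C K M N P Q :: complex
    assume r: "w1 p = a" "cnj a = a'" "w2 p = b" "cnj b = b'" "cnj a' = a" "cnj b' = b"
      "of_real (fF (ss p)) = F" "of_real (fG (ss p)) = G" "of_real (fM (ss p)) = M" "of_real (fN (ss p)) = N"
      "of_real (ss p) = s" "cnj M = M" "cnj N = N" "cnj F = F" "cnj G = G"
    and q: "s = a * a'" "t = b * b'" "s + t = 1" "F = 1 - t * N" "G = 1 - s * M"
    have ts: "t = 1 - s" using q(3) by (simp add: algebra_simps)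
    have t: "of_real (1 - ss p) = t" using q(3) r by (simp add: algebra_simps)
    define u1 u2 where "u1 = complex_of_real (\<phi>1 (ss p))" "u2 = complex_of_real \<phi>2"
    note u = this
    have L: "u1 * (2 * (a * (- a' * (1 + F)) + b' * (1 + G) * b)) + u2 * (2 * (a' * b')) * (2 * (a * b)) +
       (u1 * (2 * (a' * (- a * (1 + F)) + b * (1 + G) * b')) + u2 * (2 * (a * b)) * (2 * (a' * b')))
       - a * b * (N - M) * (u1 * (2 * (a' * b'))) - a' * b' * (N - M) * (u1 * (2 * (a * b)))
       = 8 * s * t * u2 + 4 * u1 * (t * (1 + G) - s * (1 + F) - s * t * (N - M))" using q(1,2) by algebra
    have "t * (1 + G) - s * (1 + F) - s * t * (N - M) = 2 * (1 - 2 * s)" unfolding q(4,5) ts by algebra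
    note L = L[unfolded this]
    show ?thesis
      unfolding WW1 WW2 om omega0_frame(1)[OF p] W[OF p] ds_frame[OF p] components_cnjv components_W0 u[symmetric] r t
      using L by (simp add: r algebra_simps)
  qed
  note tot = this
  show "sublaplacian H0 theta0 (\<lambda>x. \<phi> (ss x)) p =
      2 / kk * (ss p * (1 - ss p) * \<phi>2 + (1 - 2 * ss p) * \<phi>1 (ss p))"
    by (rule sublaplacian_eqI[OF Tanaka_Webster_H0 annihilates_theta0 p sS])
       (unfold tot, use kk_pos in \<open>simp add: field_simps\<close>)
qed

section \<open>The radial equation\<close>

text \<open>
  For \<open>u = sqrt (\<beta> / kk) X(s)\<close> the Yamabe equation reads \<open>4 (s (1 - s) X')' = cc s * X - \<beta> X\<^sup>3\<close>.
\<close>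

definition cc :: "real \<Rightarrow> real" where "cc s = 1 + kk\<^sup>2 / 2 * (s * (1 - s))"

text \<open>
  With the flux \<open>w = 4 s (1 - s) x'\<close> and \<open>J = w / s\<close>, the radial equation is the system
  \<open>x' = J / (4 (1 - s))\<close>, \<open>(s J)' = cc s * x - \<beta> x\<^sup>3\<close>, with a singular point at \<open>0\<close> that integration
  from \<open>0\<close> resolves. The truncations keep away from the singular point \<open>1\<close> and make the right-hand side
  globally Lipschitz; they change nothing for \<open>s\<close> in \<open>[-1/4, 3/4]\<close> and \<open>\<bar>x\<bar> \<le> 2\<close>, and for
  large \<open>\<beta>\<close> the solutions obey the latter bound on \<open>[0, 1/2]\<close> (\<open>x_bound\<close>).
\<close>

definition clamp :: "real \<Rightarrow> real" where "clamp s = max (-1/4) (min (3/4) s)"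
definition inv_coeff :: "real \<Rightarrow> real" where "inv_coeff s = 1 / (4 * (1 - clamp s))"
definition cube4 :: "real \<Rightarrow> real" where "cube4 x = x * min (x\<^sup>2) 4"
definition rhs :: "real \<Rightarrow> real \<Rightarrow> real \<Rightarrow> real" where
  "rhs s \<beta> x = cc (clamp s) * x - \<beta> * cube4 x"

lemma clamp_bounds: "- 1/4 \<le> clamp s" "clamp s \<le> 3/4" by (auto simp: clamp_def)
lemma clamp_eq: "- 1/4 \<le> s \<Longrightarrow> s \<le> 3/4 \<Longrightarrow> clamp s = s" by (auto simp: clamp_def)

lemma inv_coeff_bounds: "0 \<le> inv_coeff s" "inv_coeff s \<le> 1"
  using clamp_bounds[of s] by (auto simp: inv_coeff_def field_simps)

lemma continuous_inv_coeff: "continuous_on UNIV inv_coeff"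
  unfolding inv_coeff_def[abs_def] clamp_def[abs_def]
proof (intro continuous_intros ballI)
  fix s :: real
  show "4 * (1 - max (- 1 / 4) (min (3 / 4) s)) \<noteq> 0" using clamp_bounds[of s] by (auto simp: clamp_def)
qed

lemma cube4_Lipschitz: "\<bar>cube4 x - cube4 y\<bar> \<le> 16 * \<bar>x - y\<bar>"
proof -
  define c where "c x = max (-2) (min 2 x)" for x :: real
  \<comment> \<open>\<open>cube4\<close> is the cube of the truncation at \<open>2\<close>, continued with slope \<open>4\<close>.\<close>
  have e: "cube4 x = (c x)^3 + 4 * (x - c x)" for x
  proof -
    consider "x < -2" | "-2 \<le> x" "x \<le> 2" | "x > 2" by linarith
    then show ?thesis
    proof cases
      case 1
      then have "x\<^sup>2 \<ge> 4" using power_mono[of 2 "-x" 2] by simp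
      with 1 show ?thesis by (simp add: cube4_def c_def power3_eq_cube)
    next
      case 2
      then have "x\<^sup>2 \<le> 4" using abs_le_square_iff[of x 2] by (simp add: abs_le_iff)
      with 2 show ?thesis by (simp add: cube4_def c_def power3_eq_cube power2_eq_square)
    next
      case 3
      then have "x\<^sup>2 \<ge> 4" using power_mono[of 2 x 2] by simp
      with 3 show ?thesis by (simp add: cube4_def c_def power3_eq_cube)
    qed
  qed
  have cb: "\<bar>c x\<bar> \<le> 2" for x by (auto simp: c_def)
  have cl: "\<bar>c x - c y\<bar> \<le> \<bar>x - y\<bar>" "\<bar>(x - c x) - (y - c y)\<bar> \<le> \<bar>x - y\<bar>" by (auto simp: c_def)
  have "(c x)^3 - (c y)^3 = ((c x)\<^sup>2 + c x * c y + (c y)\<^sup>2) * (c x - c y)"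
    by (simp add: power3_eq_cube power2_eq_square algebra_simps)
  then have "\<bar>(c x)^3 - (c y)^3\<bar> = \<bar>(c x)\<^sup>2 + c x * c y + (c y)\<^sup>2\<bar> * \<bar>c x - c y\<bar>" by (simp add: abs_mult)
  also have "\<dots> \<le> 12 * \<bar>x - y\<bar>"
  proof (rule mult_mono)
    have "(c x)\<^sup>2 \<le> 4" "(c y)\<^sup>2 \<le> 4" using abs_le_square_iff[of _ 2] cb by auto
    moreover have "\<bar>c x * c y\<bar> \<le> 2 * 2" unfolding abs_mult by (intro mult_mono cb) auto
    ultimately show "\<bar>(c x)\<^sup>2 + c x * c y + (c y)\<^sup>2\<bar> \<le> 12" using zero_le_power2[of "c x"] zero_le_power2[of "c y"] by linarith
  qed (use cl in auto)
  finally have 1: "\<bar>(c x)^3 - (c y)^3\<bar> \<le> 12 * \<bar>x - y\<bar>" .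
  have "cube4 x - cube4 y = ((c x)^3 - (c y)^3) + 4 * ((x - c x) - (y - c y))" unfolding e by simp
  moreover have "\<bar>P + 4 * Q\<bar> \<le> 16 * d" if "\<bar>P\<bar> \<le> 12 * d" "\<bar>Q\<bar> \<le> d" for P Q d :: real using that by linarith
  ultimately show ?thesis using 1 cl(2) by presburger
qed

text \<open>
  In the norm with weight \<open>exp (weight \<beta> * \<bar>s\<bar>)\<close> the Picard map halves distances, since integration over
  \<open>[0, s]\<close> gains the factor \<open>1 / weight \<beta>\<close>.
\<close>

definition lip_bound :: "real \<Rightarrow> real" where "lip_bound \<beta> = 1 + kk\<^sup>2 + 16 * \<bar>\<beta>\<bar>"
definition weight :: "real \<Rightarrow> real" where "weight \<beta> = 2 * lip_bound \<beta>"

lemma lip_bound_pos: "lip_bound \<beta> > 0" by (simp add: lip_bound_def add_pos_nonneg)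
lemma weight_pos: "weight \<beta> > 0" using lip_bound_pos by (simp add: weight_def)

lemma cc_clamp: "\<bar>cc (clamp s)\<bar> \<le> 1 + kk\<^sup>2"
proof -
  let ?t = "clamp s"
  have "\<bar>?t * (1 - ?t)\<bar> \<le> 1 * 2"
    unfolding abs_mult by (rule mult_mono) (use clamp_bounds[of s] in \<open>auto simp: abs_le_iff\<close>)
  then have "\<bar>kk\<^sup>2 / 2 * (?t * (1 - ?t))\<bar> \<le> kk\<^sup>2 / 2 * 2"
    unfolding abs_mult[of "kk\<^sup>2 / 2"] by (intro mult_mono) auto
  then show ?thesis unfolding cc_def by linarith
qed

lemma rhs_Lipschitz: "\<bar>rhs s \<beta> x - rhs s \<beta> y\<bar> \<le> lip_bound \<beta> * \<bar>x - y\<bar>"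
proof -
  have "rhs s \<beta> x - rhs s \<beta> y = cc (clamp s) * (x - y) - \<beta> * (cube4 x - cube4 y)"
    by (simp add: rhs_def algebra_simps)
  then have "\<bar>rhs s \<beta> x - rhs s \<beta> y\<bar> \<le> \<bar>cc (clamp s) * (x - y)\<bar> + \<bar>\<beta> * (cube4 x - cube4 y)\<bar>" by linarith
  also have "\<dots> \<le> (1 + kk\<^sup>2) * \<bar>x - y\<bar> + \<bar>\<beta>\<bar> * (16 * \<bar>x - y\<bar>)"
    unfolding abs_mult using cc_clamp cube4_Lipschitz by (intro add_mono mult_mono) auto
  finally show ?thesis by (simp add: lip_bound_def algebra_simps)
qed

lemma continuous_rhs:
  assumes "continuous_on A f" "continuous_on A g" "continuous_on A h"
  shows "continuous_on A (\<lambda>z. rhs (f z) (g z) (h z))"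
  unfolding rhs_def cc_def clamp_def cube4_def by (intro continuous_intros assms)

text \<open>
  Both integrations of the system are written over \<open>[0, 1]\<close>, after scaling by \<open>s\<close>. In this form \<open>J\<close> is
  the mean of the right-hand side over the segment from \<open>0\<close> to \<open>s\<close>, which is regular at \<open>0\<close>.
\<close>

definition avg_rhs :: "(real \<times> real \<Rightarrow> real) \<Rightarrow> real \<times> real \<Rightarrow> real" where
  "avg_rhs v p = integral {0..1} (\<lambda>t. rhs (t * fst p) (snd p) (v (t * fst p, snd p)))"

definition Picard :: "(real \<times> real \<Rightarrow> real) \<Rightarrow> real \<times> real \<Rightarrow> real" where
  "Picard v p = 1 + fst p * integral {0..1} (\<lambda>r. inv_coeff (r * fst p) * avg_rhs v (r * fst p, snd p))"

lemma continuous_scaled: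
  assumes "continuous_on UNIV v"
  shows "continuous_on A (\<lambda>(p::real \<times> real, t::real). v (t * fst p, snd p) :: real)"
  unfolding case_prod_beta
  by (rule continuous_on_compose2[OF assms]) (auto intro!: continuous_intros)

lemma continuous_avg_rhs: assumes "continuous_on UNIV v" shows "continuous_on UNIV (avg_rhs v)"
proof -
  have "continuous_on (UNIV \<times> cbox 0 1) (\<lambda>(p, t). rhs (t * fst p) (snd p) (v (t * fst p, snd p)))"
    using continuous_scaled[OF assms] unfolding case_prod_beta
    by (intro continuous_rhs) (auto intro!: continuous_intros)
  from integral_continuous_on_param[OF this] show ?thesis by (simp add: avg_rhs_def[abs_def])
qed

lemma continuous_Picard: assumes "continuous_on UNIV v" shows "continuous_on UNIV (Picard v)"
proof -
  have "continuous_on (UNIV \<times> cbox 0 1) (\<lambda>(p::real \<times> real, r). inv_coeff (r * fst p) * avg_rhs v (r * fst p, snd p))"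
    using continuous_scaled[OF continuous_avg_rhs[OF assms]] unfolding case_prod_beta
    by (intro continuous_on_mult continuous_on_compose2[OF continuous_inv_coeff]) (auto intro!: continuous_intros)
  from integral_continuous_on_param[OF this] show ?thesis
    unfolding Picard_def[abs_def] by (auto intro!: continuous_intros)
qed

lemma continuous_line: assumes "continuous_on UNIV (v :: real \<times> real \<Rightarrow> real)"
  shows "continuous_on A (\<lambda>t. v (t * s, \<beta>))"
  by (rule continuous_on_compose2[OF assms]) (auto intro!: continuous_intros)

text \<open>
  Averaging over the segment from \<open>0\<close> to \<open>s\<close> does not increase the weight, so \<open>J\<close> inherits the
  Lipschitz bound; the integral of the weight over this segment is at most the weight at its end
  divided by \<open>weight \<beta> = 2 lip_bound \<beta>\<close>.
\<close>

lemma Picard_contraction: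
  assumes c: "continuous_on UNIV v" "continuous_on UNIV v'"
    and D: "\<And>s. \<bar>v (s, \<beta>) - v' (s, \<beta>)\<bar> \<le> D * exp (weight \<beta> * \<bar>s\<bar>)" and D0: "D \<ge> 0"
  shows "\<bar>Picard v (s, \<beta>) - Picard v' (s, \<beta>)\<bar> \<le> D / 2 * exp (weight \<beta> * \<bar>s\<bar>)"
proof -
  let ?k = "weight \<beta>"
  have iJ: "(\<lambda>t. rhs (t * s) \<beta> (w (t * s, \<beta>))) integrable_on {0..1}" if "continuous_on UNIV w" for w s
    by (rule integrable_continuous_real) (intro continuous_rhs continuous_line[OF that] continuous_intros)
  have J: "\<bar>avg_rhs v (s, \<beta>) - avg_rhs v' (s, \<beta>)\<bar> \<le> lip_bound \<beta> * D * exp (?k * \<bar>s\<bar>)" for s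
  proof -
    have "avg_rhs v (s, \<beta>) - avg_rhs v' (s, \<beta>) = integral {0..1} (\<lambda>t. rhs (t * s) \<beta> (v (t * s, \<beta>)) - rhs (t * s) \<beta> (v' (t * s, \<beta>)))"
      unfolding avg_rhs_def using integral_diff[OF iJ[OF c(1)] iJ[OF c(2)]] by simp
    also have "norm \<dots> \<le> lip_bound \<beta> * D * exp (?k * \<bar>s\<bar>) * (1 - 0)"
    proof (rule integral_bound)
      show "continuous_on {0..1} (\<lambda>t. rhs (t * s) \<beta> (v (t * s, \<beta>)) - rhs (t * s) \<beta> (v' (t * s, \<beta>)))"
        by (intro continuous_rhs continuous_line c continuous_intros)
      fix t :: real assume t: "t \<in> {0..1}"
      have "\<bar>rhs (t * s) \<beta> (v (t * s, \<beta>)) - rhs (t * s) \<beta> (v' (t * s, \<beta>))\<bar> \<le> lip_bound \<beta> * \<bar>v (t * s, \<beta>) - v' (t * s, \<beta>)\<bar>"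
        by (rule rhs_Lipschitz)
      also have "\<dots> \<le> lip_bound \<beta> * (D * exp (?k * \<bar>t * s\<bar>))" by (rule mult_left_mono[OF D]) (use lip_bound_pos[of \<beta>] in simp)
      also have "\<dots> \<le> lip_bound \<beta> * (D * exp (?k * \<bar>s\<bar>))"
      proof -
        have "\<bar>t * s\<bar> \<le> \<bar>s\<bar>" using t by (simp add: abs_mult mult_left_le_one_le)
        then show ?thesis using lip_bound_pos[of \<beta>] weight_pos[of \<beta>] D0 by (intro mult_left_mono) auto
      qed
      finally show "norm (rhs (t * s) \<beta> (v (t * s, \<beta>)) - rhs (t * s) \<beta> (v' (t * s, \<beta>))) \<le> lip_bound \<beta> * D * exp (?k * \<bar>s\<bar>)" by simp
    qed simp
    finally show ?thesis by simp
  qed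
  have ci: "continuous_on {0..1} (\<lambda>r. inv_coeff (r * s) * avg_rhs w (r * s, \<beta>))" if "continuous_on UNIV w" for w
    by (intro continuous_on_mult continuous_line[OF continuous_avg_rhs[OF that]] continuous_on_compose2[OF continuous_inv_coeff])
       (auto intro!: continuous_intros)
  have iP: "(\<lambda>r. inv_coeff (r * s) * avg_rhs w (r * s, \<beta>)) integrable_on {0..1}" if "continuous_on UNIV w" for w
    by (rule integrable_continuous_real[OF ci[OF that]])
  have fi: "((\<lambda>r. ?k * \<bar>s\<bar> * exp (?k * \<bar>s\<bar> * r)) has_integral (exp (?k * \<bar>s\<bar> * 1) - exp (?k * \<bar>s\<bar> * 0))) {0..1}"
    by (rule fundamental_theorem_of_calculus)
       (auto intro!: derivative_eq_intros simp flip: has_real_derivative_iff_has_vector_derivative)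
  have ie: "(\<lambda>r. \<bar>s\<bar> * (lip_bound \<beta> * D * exp (?k * \<bar>r * s\<bar>))) integrable_on {0..1}"
    by (rule integrable_continuous_real) (intro continuous_intros)
  have "Picard v (s, \<beta>) - Picard v' (s, \<beta>) =
      s * (integral {0..1} (\<lambda>r. inv_coeff (r * s) * avg_rhs v (r * s, \<beta>)) - integral {0..1} (\<lambda>r. inv_coeff (r * s) * avg_rhs v' (r * s, \<beta>)))"
    by (simp add: Picard_def algebra_simps)
  also have "\<dots> = integral {0..1} (\<lambda>r. s * (inv_coeff (r * s) * avg_rhs v (r * s, \<beta>) - inv_coeff (r * s) * avg_rhs v' (r * s, \<beta>)))"
    using integral_diff[OF iP[OF c(1)] iP[OF c(2)]] by simp
  finally have E: "Picard v (s, \<beta>) - Picard v' (s, \<beta>) =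
      integral {0..1} (\<lambda>r. s * (inv_coeff (r * s) * avg_rhs v (r * s, \<beta>) - inv_coeff (r * s) * avg_rhs v' (r * s, \<beta>)))" .
  have X: "norm (Picard v (s, \<beta>) - Picard v' (s, \<beta>)) \<le> integral {0..1} (\<lambda>r. \<bar>s\<bar> * (lip_bound \<beta> * D * exp (?k * \<bar>r * s\<bar>)))"
    unfolding E
  proof (rule integral_norm_bound_integral[OF _ ie])
    show "(\<lambda>r. s * (inv_coeff (r * s) * avg_rhs v (r * s, \<beta>) - inv_coeff (r * s) * avg_rhs v' (r * s, \<beta>))) integrable_on {0..1}"
      by (rule integrable_continuous_real) (intro continuous_on_mult continuous_on_diff ci c continuous_on_const)
    fix r :: real
    have "\<bar>s * (inv_coeff (r * s) * avg_rhs v (r * s, \<beta>) - inv_coeff (r * s) * avg_rhs v' (r * s, \<beta>))\<bar> =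
       \<bar>s\<bar> * (\<bar>inv_coeff (r * s)\<bar> * \<bar>avg_rhs v (r * s, \<beta>) - avg_rhs v' (r * s, \<beta>)\<bar>)"
      by (simp add: abs_mult[symmetric] right_diff_distrib)
    also have "\<dots> \<le> \<bar>s\<bar> * (1 * (lip_bound \<beta> * D * exp (?k * \<bar>r * s\<bar>)))"
      using inv_coeff_bounds[of "r * s"] J[of "r * s"] by (intro mult_left_mono mult_mono) auto
    finally show "norm (s * (inv_coeff (r * s) * avg_rhs v (r * s, \<beta>) - inv_coeff (r * s) * avg_rhs v' (r * s, \<beta>))) \<le> \<bar>s\<bar> * (lip_bound \<beta> * D * exp (?k * \<bar>r * s\<bar>))"
      by simp
  qed
  have "integral {0..1} (\<lambda>r. \<bar>s\<bar> * (lip_bound \<beta> * D * exp (?k * \<bar>r * s\<bar>))) =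
      integral {0..1} (\<lambda>r. D / 2 * (?k * \<bar>s\<bar> * exp (?k * \<bar>s\<bar> * r)))"
    by (rule integral_cong) (simp add: weight_def abs_mult mult_ac)
  also have "\<dots> = D / 2 * (exp (?k * \<bar>s\<bar> * 1) - exp (?k * \<bar>s\<bar> * 0))"
    using integral_unique[OF fi] by simp
  also have "\<dots> \<le> D / 2 * exp (?k * \<bar>s\<bar>)" using D0 by (intro mult_left_mono) auto
  finally show ?thesis using X by simp
qed

lemma Picard_zero: "Picard (\<lambda>_. 0) p = 1"
  by (simp add: Picard_def avg_rhs_def rhs_def cube4_def)

text \<open>
  Banach's theorem is applied to \<open>v\<close> divided by the weight, in the space of bounded continuous functions
  of \<open>s\<close> and \<open>\<beta>\<close> together; in this way the solution comes out jointly continuous.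
\<close>

lemma ex_Picard_fixed_point:
  "\<exists>v. continuous_on UNIV v \<and> (\<forall>p. Picard v p = v p)"
proof -
  let ?e = "\<lambda>p::real \<times> real. exp (weight (snd p) * \<bar>fst p\<bar>)"
  have ce: "continuous_on UNIV ?e" unfolding weight_def lip_bound_def by (intro continuous_intros)
  define V where "V b p = ?e p * apply_bcontfun b p" for b :: "(real \<times> real) \<Rightarrow>\<^sub>C real" and p
  have cV: "continuous_on UNIV (V b)" for b unfolding V_def[abs_def]
    by (intro continuous_on_mult ce) simp
  have key: "\<bar>Picard (V b) p - Picard (V b') p\<bar> \<le> dist b b' / 2 * ?e p" for b b' p
  proof (cases p)
    case (Pair s \<beta>)
    have "\<bar>V b (s, \<beta>) - V b' (s, \<beta>)\<bar> \<le> dist b b' * exp (weight \<beta> * \<bar>s\<bar>)" for s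
    proof -
      have "\<bar>V b (s, \<beta>) - V b' (s, \<beta>)\<bar> = exp (weight \<beta> * \<bar>s\<bar>) * dist (apply_bcontfun b (s, \<beta>)) (apply_bcontfun b' (s, \<beta>))"
        by (simp add: V_def dist_real_def right_diff_distrib[symmetric] abs_mult)
      also have "\<dots> \<le> exp (weight \<beta> * \<bar>s\<bar>) * dist b b'" by (intro mult_left_mono dist_bounded) simp
      finally show ?thesis by (simp add: mult.commute)
    qed
    from Picard_contraction[OF cV cV this zero_le_dist] show ?thesis using Pair by simp
  qed
  define T where "T b = Bcontfun (\<lambda>p. exp (- (weight (snd p) * \<bar>fst p\<bar>)) * Picard (V b) p)" for b
  have einv: "exp (- (weight (snd p) * \<bar>fst p\<bar>)) * ?e p = 1" for p by (simp flip: exp_add)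
  have bc: "(\<lambda>p. exp (- (weight (snd p) * \<bar>fst p\<bar>)) * Picard (V b) p) \<in> bcontfun" for b
  proof (rule bcontfun_normI)
    show "continuous_on UNIV (\<lambda>p. exp (- (weight (snd p) * \<bar>fst p\<bar>)) * Picard (V b) p)"
      unfolding weight_def lip_bound_def by (intro continuous_intros continuous_Picard[OF cV])
    fix p
    have z: "V 0 = (\<lambda>_. 0)" by (auto simp: V_def)
    have "\<bar>Picard (V b) p\<bar> \<le> 1 + dist b 0 / 2 * ?e p"
      using key[of b p 0] unfolding z Picard_zero by linarith
    also have "\<dots> \<le> ?e p * 1 + ?e p * (dist b 0 / 2)" using weight_pos[of "snd p"] by (simp add: mult.commute)
    finally have 1: "\<bar>Picard (V b) p\<bar> \<le> ?e p * (1 + dist b 0 / 2)" by (simp add: distrib_left)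
    have "norm (exp (- (weight (snd p) * \<bar>fst p\<bar>)) * Picard (V b) p) = exp (- (weight (snd p) * \<bar>fst p\<bar>)) * \<bar>Picard (V b) p\<bar>"
      by (simp add: abs_mult)
    also have "\<dots> \<le> exp (- (weight (snd p) * \<bar>fst p\<bar>)) * (?e p * (1 + dist b 0 / 2))"
      by (rule mult_left_mono[OF 1]) simp
    also have "\<dots> = 1 + dist b 0 / 2" using einv[of p] by (metis mult.assoc mult_1)
    finally show "norm (exp (- (weight (snd p) * \<bar>fst p\<bar>)) * Picard (V b) p) \<le> 1 + dist b 0 / 2" .
  qed
  have Tb: "apply_bcontfun (T b) p = exp (- (weight (snd p) * \<bar>fst p\<bar>)) * Picard (V b) p" for b p
    unfolding T_def by (simp add: Bcontfun_inverse[OF bc])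
  have "dist (T b) (T b') \<le> 1/2 * dist b b'" for b b'
  proof (rule dist_bound)
    fix p
    have "dist (apply_bcontfun (T b) p) (apply_bcontfun (T b') p) =
       exp (- (weight (snd p) * \<bar>fst p\<bar>)) * \<bar>Picard (V b) p - Picard (V b') p\<bar>"
      by (simp add: Tb dist_real_def right_diff_distrib[symmetric] abs_mult)
    also have "\<dots> \<le> exp (- (weight (snd p) * \<bar>fst p\<bar>)) * (dist b b' / 2 * ?e p)"
      by (intro mult_left_mono key) simp
    also have "\<dots> = 1/2 * dist b b' * (exp (- (weight (snd p) * \<bar>fst p\<bar>)) * ?e p)" by simp
    finally show "dist (apply_bcontfun (T b) p) (apply_bcontfun (T b') p) \<le> 1/2 * dist b b'"
      unfolding einv by simp
  qed
  then obtain b where b: "T b = b" using banach_fix_type[of "1/2" T] by auto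
  have "Picard (V b) p = V b p" for p
  proof -
    have "apply_bcontfun b p = exp (- (weight (snd p) * \<bar>fst p\<bar>)) * Picard (V b) p" using Tb[of b p] b by simp
    then have "V b p = (exp (- (weight (snd p) * \<bar>fst p\<bar>)) * ?e p) * Picard (V b) p" by (simp add: V_def)
    then show ?thesis unfolding einv by simp
  qed
  then show ?thesis using cV by blast
qed

text \<open>
  The scaled integral is the integral of \<open>G\<close> from \<open>0\<close> to \<open>s\<close>, for either sign of \<open>s\<close>.
\<close>

lemma antiderivative_scaled:
  fixes G :: "real \<Rightarrow> real"
  assumes "continuous_on UNIV G"
  shows "((\<lambda>s. s * integral {0..1} (\<lambda>r. G (r * s))) has_real_derivative G s) (at s)"
proof -
  define R where "R = \<bar>s\<bar> + 1"
  have R: "R > 0" by (simp add: R_def)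
  obtain A where A: "\<And>x. x \<in> {-R..R} \<Longrightarrow> (A has_vector_derivative G x) (at x within {-R..R})"
    using antiderivative_continuous[OF continuous_on_subset[OF assms], of "-R" R] by auto
  have e: "s' * integral {0..1} (\<lambda>r. G (r * s')) = A s' - A 0" if s': "s' \<in> {-R<..<R}" for s'
  proof -
    have "((\<lambda>r. s' * G (r * s')) has_integral (A (1 * s') - A (0 * s'))) {0..1}"
    proof (rule fundamental_theorem_of_calculus)
      fix r :: real assume r: "r \<in> {0..1}"
      have rs: "r * s' \<in> {-R<..<R}"
      proof -
        have "\<bar>r * s'\<bar> \<le> \<bar>s'\<bar>" using r by (simp add: abs_mult mult_left_le_one_le)
        then show ?thesis using s' by auto
      qed
      have "(A has_real_derivative G (r * s')) (at (r * s') within {-R..R})"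
        using A[of "r * s'"] rs by (simp add: has_real_derivative_iff_has_vector_derivative)
      then have "(A has_real_derivative G (r * s')) (at (r * s'))"
        using rs by (subst (asm) at_within_interior) (auto simp: interior_atLeastAtMost_real)
      then have "((\<lambda>r. A (r * s')) has_real_derivative G (r * s') * s') (at r within {0..1})"
        by (rule DERIV_chain2) (auto intro!: derivative_eq_intros)
      then show "((\<lambda>r. A (r * s')) has_vector_derivative s' * G (r * s')) (at r within {0..1})"
        by (simp add: has_real_derivative_iff_has_vector_derivative mult.commute)
    qed simp
    from integral_unique[OF this] show ?thesis by simp
  qed
  have sR: "s \<in> {-R<..<R}" by (auto simp: R_def)
  have "(A has_real_derivative G s) (at s)"
  proof -
    have "(A has_real_derivative G s) (at s within {-R..R})"
      using A[of s] sR by (simp add: has_real_derivative_iff_has_vector_derivative)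
    then show ?thesis using sR by (subst (asm) at_within_interior) (auto simp: interior_atLeastAtMost_real)
  qed
  then have "((\<lambda>s. A s - A 0) has_real_derivative G s) (at s)" by (auto intro!: derivative_eq_intros)
  then show ?thesis
    by (rule DERIV_cong_ev[THEN iffD1, rotated -1]) 
       (use sR e in \<open>auto intro!: eventually_nhds_in_open[THEN eventually_mono, of "{-R<..<R}"]\<close>)
qed

text \<open>
  One solution for each \<open>\<beta>\<close>, on the whole line by virtue of the truncations; \<open>s J\<close> is the
  flux \<open>4 s (1 - s) x'\<close> where the truncation is inactive.
\<close>

locale radial_family =
  fixes x J :: "real \<Rightarrow> real \<Rightarrow> real"
  assumes cont_x: "continuous_on UNIV (\<lambda>(s, \<beta>). x s \<beta>)"
    and cont_J: "continuous_on UNIV (\<lambda>(s, \<beta>). J s \<beta>)"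
    and x0: "x 0 \<beta> = 1"
    and dx: "((\<lambda>s. x s \<beta>) has_real_derivative inv_coeff s * J s \<beta>) (at s)"
    and dJ: "((\<lambda>s. s * J s \<beta>) has_real_derivative rhs s \<beta> (x s \<beta>)) (at s)"
    and J_def: "J s \<beta> = integral {0..1} (\<lambda>t. rhs (t * s) \<beta> (x (t * s) \<beta>))"

lemma ex_radial_family: "\<exists>x J. radial_family x J"
proof -
  obtain v where v: "continuous_on UNIV v" "\<And>p. Picard v p = v p" using ex_Picard_fixed_point by blast
  define x where "x s \<beta> = v (s, \<beta>)" for s \<beta>
  define J where "J s \<beta> = avg_rhs v (s, \<beta>)" for s \<beta>
  have line: "continuous_on UNIV (\<lambda>s. w (s, \<beta>))" if "continuous_on UNIV w" for w :: "real \<times> real \<Rightarrow> real" and \<beta>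
    by (rule continuous_on_compose2[OF that]) (auto intro!: continuous_intros)
  have "radial_family x J"
  proof
    show "continuous_on UNIV (\<lambda>(s, \<beta>). x s \<beta>)" using v(1) by (simp add: x_def case_prod_beta)
    show "continuous_on UNIV (\<lambda>(s, \<beta>). J s \<beta>)" using continuous_avg_rhs[OF v(1)] by (simp add: J_def case_prod_beta)
    show "x 0 \<beta> = 1" for \<beta> using v(2)[of "(0, \<beta>)"] by (simp add: Picard_def x_def)
    show "J s \<beta> = integral {0..1} (\<lambda>t. rhs (t * s) \<beta> (x (t * s) \<beta>))" for s \<beta> by (simp add: J_def avg_rhs_def x_def)
    fix s \<beta>
    have "((\<lambda>s. s * integral {0..1} (\<lambda>r. inv_coeff (r * s) * J (r * s) \<beta>)) has_real_derivative inv_coeff s * J s \<beta>) (at s)"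
      unfolding J_def
      by (rule antiderivative_scaled) (intro continuous_on_mult continuous_inv_coeff line continuous_avg_rhs v)
    from DERIV_add[OF DERIV_const[of 1] this]
    have "((\<lambda>s. 1 + s * integral {0..1} (\<lambda>r. inv_coeff (r * s) * J (r * s) \<beta>)) has_real_derivative inv_coeff s * J s \<beta>) (at s)"
      by simp
    moreover have "x s \<beta> = 1 + s * integral {0..1} (\<lambda>r. inv_coeff (r * s) * J (r * s) \<beta>)" for s
      using v(2)[of "(s, \<beta>)"] by (simp add: Picard_def x_def J_def)
    ultimately show "((\<lambda>s. x s \<beta>) has_real_derivative inv_coeff s * J s \<beta>) (at s)" by simp
    have "((\<lambda>s. s * integral {0..1} (\<lambda>t. rhs (t * s) \<beta> (x (t * s) \<beta>))) has_real_derivative rhs s \<beta> (x s \<beta>)) (at s)"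
      unfolding x_def
      by (rule antiderivative_scaled) (intro continuous_rhs line v continuous_intros)
    then show "((\<lambda>s. s * J s \<beta>) has_real_derivative rhs s \<beta> (x s \<beta>)) (at s)"
      by (simp add: J_def avg_rhs_def x_def)
  qed
  then show ?thesis by blast
qed

section \<open>Energy estimates\<close>

text \<open>
  The maximum of \<open>cc\<close> on \<open>[0, 1]\<close>, taken at \<open>1/2\<close>.
\<close>

definition cc_max :: real where "cc_max = 1 + kk\<^sup>2 / 8"

lemma cc_max_ge: "cc_max \<ge> 1" by (simp add: cc_max_def)

lemma quarter_bound: "s * (1 - s) \<le> 1/4" for s :: real
  using zero_le_power2[of "s - 1/2"] by (simp add: power2_eq_square algebra_simps)

lemma cc_bounds: assumes "0 \<le> s" "s \<le> 1" shows "1 \<le> cc s" "cc s \<le> cc_max"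
    "cc s / 2 + kk\<^sup>2 * (s * (1 - s)) / 4 \<le> cc_max" "0 \<le> cc s / 2 + kk\<^sup>2 * (s * (1 - s)) / 4"
proof -
  have a: "0 \<le> s * (1 - s)" using assms by simp
  have b: "kk\<^sup>2 * (s * (1 - s)) \<le> kk\<^sup>2 * (1/4)" by (intro mult_left_mono quarter_bound) simp
  have c: "0 \<le> kk\<^sup>2 * (s * (1 - s))" using a by simp
  define Z where "Z = kk\<^sup>2 * (s * (1 - s))"
  have e: "cc s = 1 + Z / 2" by (simp add: cc_def Z_def)
  show "1 \<le> cc s" "cc s \<le> cc_max" "cc s / 2 + kk\<^sup>2 * (s * (1 - s)) / 4 \<le> cc_max" "0 \<le> cc s / 2 + kk\<^sup>2 * (s * (1 - s)) / 4"
    unfolding e cc_max_def using b c unfolding Z_def[symmetric] by (simp_all add: field_simps)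
qed

lemma rhs_eq: assumes "- 1/4 \<le> s" "s \<le> 3/4" "\<bar>x\<bar> \<le> 2"
  shows "rhs s \<beta> x = cc s * x - \<beta> * x ^ 3"
proof -
  have "x\<^sup>2 \<le> 4" using abs_le_square_iff[of x 2] assms(3) by simp
  then show ?thesis using clamp_eq[OF assms(1,2)]
    by (simp add: rhs_def cube4_def power3_eq_cube power2_eq_square)
qed

lemma inv_coeff_eq: "- 1/4 \<le> s \<Longrightarrow> s \<le> 3/4 \<Longrightarrow> inv_coeff s = 1 / (4 * (1 - s))"
  by (simp add: inv_coeff_def clamp_eq)

context radial_family
begin

abbreviation w :: "real \<Rightarrow> real \<Rightarrow> real" where "w s \<beta> \<equiv> s * J s \<beta>"

lemma cont_x1: "continuous_on A (\<lambda>s. x s \<beta>)"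
  using continuous_on_compose2[OF cont_x continuous_on_Pair[OF continuous_on_id continuous_on_const]] by simp
lemma cont_J1: "continuous_on A (\<lambda>s. J s \<beta>)"
  using continuous_on_compose2[OF cont_J continuous_on_Pair[OF continuous_on_id continuous_on_const]] by simp

text \<open>
  The first summand is \<open>2 s (1 - s) x'\<^sup>2\<close>. On \<open>[0, 1/2]\<close> the energy decreases, as \<open>s (1 - s)\<close> and \<open>cc\<close>
  increase there.
\<close>

definition energy :: "real \<Rightarrow> real \<Rightarrow> real" where
  "energy \<beta> s = (w s \<beta>)\<^sup>2 / (8 * (s * (1 - s))) + (\<beta> * (x s \<beta>) ^ 4 / 4 - cc s * (x s \<beta>)\<^sup>2 / 2)"

text \<open>
  The energy times \<open>s (1 - s)\<close>. The flux drops out of its derivative (\<open>Pohozaev_deriv\<close>), whose sign is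
  governed by \<open>x\<close> alone.
\<close>

definition Pohozaev :: "real \<Rightarrow> real \<Rightarrow> real" where
  "Pohozaev \<beta> s = (w s \<beta>)\<^sup>2 / 8 + s * (1 - s) * (\<beta> * (x s \<beta>) ^ 4 / 4 - cc s * (x s \<beta>)\<^sup>2 / 2)"

lemma energy_derivs:
  assumes "0 \<le> t" "t \<le> 1/2" "\<bar>x t \<beta>\<bar> \<le> 2"
  defines "n \<equiv> cc t * x t \<beta> - \<beta> * (x t \<beta>) ^ 3"
  shows "((\<lambda>s. (w s \<beta>)\<^sup>2) has_real_derivative 2 * w t \<beta> * n) (at t)"
    and "((\<lambda>s. \<beta> * (x s \<beta>) ^ 4 / 4 - cc s * (x s \<beta>)\<^sup>2 / 2) has_real_derivative
      - n * (inv_coeff t * J t \<beta>) - kk\<^sup>2 / 4 * (1 - 2 * t) * (x t \<beta>)\<^sup>2) (at t)"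
    and "((\<lambda>s. s * (1 - s)) has_real_derivative 1 - 2 * t) (at t)"
proof -
  have dw: "((\<lambda>s. w s \<beta>) has_real_derivative n) (at t)"
    using dJ[of \<beta> t] rhs_eq[of t "x t \<beta>" \<beta>] assms by simp
  show "((\<lambda>s. (w s \<beta>)\<^sup>2) has_real_derivative 2 * w t \<beta> * n) (at t)"
    using DERIV_power[OF dw, of 2] by (simp add: mult_ac)
  show y: "((\<lambda>s. s * (1 - s)) has_real_derivative 1 - 2 * t) (at t)"
    by (auto intro!: derivative_eq_intros)
  have dcc: "(cc has_real_derivative kk\<^sup>2 / 2 * (1 - 2 * t)) (at t)"
    unfolding cc_def[abs_def] using DERIV_add[OF DERIV_const[of 1] DERIV_cmult[OF y, of "kk\<^sup>2 / 2"]] by simp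
  note x4 = DERIV_cmult[OF DERIV_power[OF dx[of \<beta> t], of 4], of "\<beta> / 4"]
  note x2 = DERIV_cmult[OF DERIV_mult[OF dcc DERIV_power[OF dx[of \<beta> t], of 2]], of "1/2"]
  show "((\<lambda>s. \<beta> * (x s \<beta>) ^ 4 / 4 - cc s * (x s \<beta>)\<^sup>2 / 2) has_real_derivative
      - n * (inv_coeff t * J t \<beta>) - kk\<^sup>2 / 4 * (1 - 2 * t) * (x t \<beta>)\<^sup>2) (at t)"
  proof (rule DERIV_cong)
    show "((\<lambda>s. \<beta> * (x s \<beta>) ^ 4 / 4 - cc s * (x s \<beta>)\<^sup>2 / 2) has_real_derivative
       \<beta> / 4 * (of_nat 4 * (inv_coeff t * J t \<beta> * x t \<beta> ^ (4 - Suc 0))) - 1 / 2 *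
       (kk\<^sup>2 / 2 * (1 - 2 * t) * (x t \<beta>)\<^sup>2 + of_nat 2 * (inv_coeff t * J t \<beta> * x t \<beta> ^ (2 - Suc 0)) * cc t)) (at t)"
      using DERIV_diff[OF x4 x2] by simp
  qed (simp add: n_def field_simps)
qed

lemma Pohozaev_deriv:
  assumes t: "0 \<le> t" "t \<le> 1/2" and b: "\<bar>x t \<beta>\<bar> \<le> 2"
  shows "(Pohozaev \<beta> has_real_derivative
    (1 - 2 * t) * (\<beta> * (x t \<beta>) ^ 4 / 4 - (cc t / 2 + kk\<^sup>2 * (t * (1 - t)) / 4) * (x t \<beta>)\<^sup>2)) (at t)"
proof -
  define n where "n = cc t * x t \<beta> - \<beta> * (x t \<beta>) ^ 3"
  define V where "V = \<beta> * (x t \<beta>) ^ 4 / 4 - cc t * (x t \<beta>)\<^sup>2 / 2"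
  note d = energy_derivs[OF t b, folded n_def]
  have q: "t * (1 - t) * (inv_coeff t * J t \<beta>) = w t \<beta> / 4"
  proof -
    have "t * c * (1 / (4 * c) * J t \<beta>) = t * J t \<beta> / 4" if "c \<noteq> 0" for c using that by simp
    from this[of "1 - t"] show ?thesis using t inv_coeff_eq[of t] by simp
  qed
  have "(Pohozaev \<beta> has_real_derivative 2 * w t \<beta> * n / 8 +
     ((1 - 2 * t) * V + (- n * (inv_coeff t * J t \<beta>) - kk\<^sup>2 / 4 * (1 - 2 * t) * (x t \<beta>)\<^sup>2) * (t * (1 - t)))) (at t)"
    unfolding Pohozaev_def[abs_def] V_def by (rule DERIV_add[OF DERIV_cdivide[OF d(1)] DERIV_mult[OF d(3,2)]])
  also have "2 * w t \<beta> * n / 8 +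
     ((1 - 2 * t) * V + (- n * (inv_coeff t * J t \<beta>) - kk\<^sup>2 / 4 * (1 - 2 * t) * (x t \<beta>)\<^sup>2) * (t * (1 - t))) =
     w t \<beta> * n / 4 + (1 - 2 * t) * V - n * (t * (1 - t) * (inv_coeff t * J t \<beta>)) - kk\<^sup>2 / 4 * (1 - 2 * t) * (x t \<beta>)\<^sup>2 * (t * (1 - t))"
    by (simp add: algebra_simps)
  also have "\<dots> = (1 - 2 * t) * (V - kk\<^sup>2 * (t * (1 - t)) / 4 * (x t \<beta>)\<^sup>2)"
    unfolding q by (simp add: algebra_simps)
  also have "V - kk\<^sup>2 * (t * (1 - t)) / 4 * (x t \<beta>)\<^sup>2 =
     \<beta> * (x t \<beta>) ^ 4 / 4 - (cc t / 2 + kk\<^sup>2 * (t * (1 - t)) / 4) * (x t \<beta>)\<^sup>2"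
    by (simp add: V_def algebra_simps)
  finally show ?thesis .
qed

lemma energy_deriv:
  assumes t: "0 < t" "t \<le> 1/2" and b: "\<bar>x t \<beta>\<bar> \<le> 2"
  shows "\<exists>D\<le>0. (energy \<beta> has_real_derivative D) (at t)"
proof -
  define n where "n = cc t * x t \<beta> - \<beta> * (x t \<beta>) ^ 3"
  define y where "y = t * (1 - t)"
  have y: "y > 0" using t by (simp add: y_def)
  have t0: "0 \<le> t" using t by simp
  note d = energy_derivs[OF t0 t(2) b, folded n_def]
  have q: "inv_coeff t * J t \<beta> = w t \<beta> / (4 * y)" using t by (simp add: inv_coeff_eq y_def)
  let ?D = "(2 * w t \<beta> * n * (8 * y) - (w t \<beta>)\<^sup>2 * (8 * (1 - 2 * t))) / ((8 * y) * (8 * y)) +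
     (- n * (inv_coeff t * J t \<beta>) - kk\<^sup>2 / 4 * (1 - 2 * t) * (x t \<beta>)\<^sup>2)"
  have D: "(energy \<beta> has_real_derivative ?D) (at t)"
    unfolding energy_def[abs_def] y_def
    by (rule DERIV_add[OF DERIV_divide[OF d(1) DERIV_cmult[OF d(3)]] d(2)]) (use t in simp)
  have "?D = - (1 - 2 * t) * ((w t \<beta>)\<^sup>2 / (8 * y\<^sup>2) + kk\<^sup>2 / 4 * (x t \<beta>)\<^sup>2)"
    unfolding q using y by (simp add: field_simps power2_eq_square)
  also have "\<dots> \<le> 0" using t by (intro mult_nonpos_nonneg) auto
  finally show ?thesis using D by blast
qed

text \<open>
  At the first point where \<open>\<bar>x\<bar> = 2\<close> the potential part of the energy is \<open>4 \<beta> - 2 cc\<close>, more than the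
  initial energy \<open>\<beta> / 4 - 1/2\<close>.
\<close>

lemma x_bound: assumes \<beta>: "\<beta> \<ge> cc_max" and s: "0 \<le> s" "s \<le> 1/2" shows "\<bar>x s \<beta>\<bar> < 2"
proof (rule ccontr)
  assume "\<not> \<bar>x s \<beta>\<bar> < 2"
  then have s2: "\<bar>x s \<beta>\<bar> \<ge> 2" by simp
  have cabs: "continuous_on A (\<lambda>s. \<bar>x s \<beta>\<bar>)" for A by (intro continuous_intros cont_x1)
  have hit: "\<exists>r. 0 \<le> r \<and> r \<le> t \<and> \<bar>x r \<beta>\<bar> = 2" if "0 \<le> t" "\<bar>x t \<beta>\<bar> \<ge> 2" for t
    using IVT'[of "\<lambda>s. \<bar>x s \<beta>\<bar>" 0 2 t] that cabs x0 by auto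
  define S where "S = {r \<in> {0..1/2}. \<bar>x r \<beta>\<bar> = 2}"
  have "closed S" unfolding S_def
    by (rule continuous_closed_preimage_constant[OF cabs closed_real_atLeastAtMost])
  moreover have "bounded S" by (rule bounded_subset[of "{0..1/2}"]) (auto simp: S_def)
  ultimately have "compact S" by (simp add: compact_eq_bounded_closed)
  moreover have "S \<noteq> {}"
  proof -
    obtain r' where "0 \<le> r'" "r' \<le> s" "\<bar>x r' \<beta>\<bar> = 2" using hit[OF s(1) s2] by blast
    then have "r' \<in> S" using s by (simp add: S_def)
    then show ?thesis by blast
  qed
  ultimately have "\<exists>r\<in>S. \<forall>t\<in>S. r \<le> t" by (rule compact_attains_inf)
  then obtain r where r: "r \<in> S" "\<And>t. t \<in> S \<Longrightarrow> r \<le> t" by blast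
  have r0: "0 \<le> r" "r \<le> 1/2" "\<bar>x r \<beta>\<bar> = 2" using r by (auto simp: S_def)
  have small: "\<bar>x t \<beta>\<bar> \<le> 2" if t: "0 \<le> t" "t \<le> r" for t
  proof (rule ccontr)
    assume "\<not> \<bar>x t \<beta>\<bar> \<le> 2"
    then obtain r' where "0 \<le> r'" "r' \<le> t" "\<bar>x r' \<beta>\<bar> = 2" using hit[of t] t by auto
    then have "r \<le> r'" using r(2)[of r'] t r0 by (auto simp: S_def)
    then have "r = t" using \<open>r' \<le> t\<close> t by simp
    then show False using r0 \<open>\<not> \<bar>x t \<beta>\<bar> \<le> 2\<close> by simp
  qed
  have r_pos: "0 < r" using r0 x0[of \<beta>] by (cases "r = 0") auto
  have "energy \<beta> r \<le> energy \<beta> 0"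
  proof (rule DERIV_nonpos_imp_decreasing_open[where f = "energy \<beta>" and a = 0 and b = r])
    show "0 \<le> r" by (rule r0)
    show "\<exists>y. (energy \<beta> has_real_derivative y) (at t) \<and> y \<le> 0" if "0 < t" "t < r" for t
      using energy_deriv[of t \<beta>] small[of t] that r0 by auto
    have e: "energy \<beta> t = t * (J t \<beta>)\<^sup>2 / (8 * (1 - t)) + (\<beta> * (x t \<beta>) ^ 4 / 4 - cc t * (x t \<beta>)\<^sup>2 / 2)" if "t \<in> {0..r}" for t
    proof -
      have "t \<noteq> 1" using that r0 by auto
      then show ?thesis by (cases "t = 0") (simp_all add: energy_def power2_eq_square)
    qed
    have "continuous_on {0..r} (\<lambda>t. t * (J t \<beta>)\<^sup>2 / (8 * (1 - t)) + (\<beta> * (x t \<beta>) ^ 4 / 4 - cc t * (x t \<beta>)\<^sup>2 / 2))"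
      unfolding cc_def using r0 by (intro continuous_intros cont_x1 cont_J1 ballI) auto
    then show "continuous_on {0..r} (energy \<beta>)"
      by (rule continuous_on_eq) (rule e[symmetric])
  qed
  also have "energy \<beta> 0 = \<beta> / 4 - 1/2" by (simp add: energy_def x0 cc_def)
  finally have up: "energy \<beta> r \<le> \<beta> / 4 - 1/2" .
  have "(x r \<beta>)\<^sup>2 = 4" using arg_cong[OF r0(3), of "\<lambda>z. z\<^sup>2"] by simp
  then have "energy \<beta> r = (w r \<beta>)\<^sup>2 / (8 * (r * (1 - r))) + (4 * \<beta> - 2 * cc r)"
    unfolding energy_def by (simp add: power4_eq_xxxx power2_eq_square)
  moreover have "(w r \<beta>)\<^sup>2 / (8 * (r * (1 - r))) \<ge> 0" using r0 by simp
  moreover have "cc r \<le> cc_max" using cc_bounds r0 by simp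
  ultimately show False using up \<beta> cc_max_ge by linarith
qed

lemma rhs_on: assumes "\<beta> \<ge> cc_max" "0 \<le> s" "s \<le> 1/2"
  shows "rhs s \<beta> (x s \<beta>) = cc s * x s \<beta> - \<beta> * (x s \<beta>) ^ 3"
  using rhs_eq[of s "x s \<beta>" \<beta>] x_bound[OF assms] assms by simp

text \<open>
  Chosen such that the loss \<open>cc_max\<^sup>2 / \<beta>\<close> of the Pohozaev quantity over \<open>[0, 1/2]\<close> is at most \<open>1/5120\<close>,
  half of its initial gain \<open>1/2560\<close> (see \<open>Pohozaev_lower\<close>).
\<close>

definition beta0 :: real where "beta0 = 5120 * cc_max\<^sup>2"

lemma beta0_ge: "beta0 \<ge> 32 * cc_max" "beta0 \<ge> cc_max" "beta0 > 0"
proof -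
  have "cc_max * 1 \<le> cc_max * cc_max" by (rule mult_left_mono) (use cc_max_ge in auto)
  then show "beta0 \<ge> 32 * cc_max" "beta0 \<ge> cc_max" "beta0 > 0" using cc_max_ge unfolding beta0_def power2_eq_square by linarith+
qed

text \<open>
  The right-hand side is bounded by \<open>10 \<beta>\<close>, hence so is its mean \<open>J\<close>, and \<open>\<bar>x'\<bar> \<le> 5 \<beta>\<close>.
\<close>

lemma x_near_0:
  assumes \<beta>: "\<beta> \<ge> beta0" and s: "0 \<le> s" "s \<le> 1 / (10 * \<beta>)" shows "x s \<beta> \<ge> 1/2"
proof -
  have bp: "\<beta> > 0" "\<beta> \<ge> cc_max" "\<beta> \<ge> 1" using \<beta> beta0_ge cc_max_ge by auto
  have sm: "s \<le> 1/10"
  proof -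
    have "1 / (10 * \<beta>) \<le> 1 / 10" using bp by (simp add: field_simps)
    then show ?thesis using s by linarith
  qed
  have Nb: "\<bar>rhs t \<beta> (x t \<beta>)\<bar> \<le> 10 * \<beta>" if t: "0 \<le> t" "t \<le> 1/2" for t
  proof -
    have b: "\<bar>x t \<beta>\<bar> \<le> 2" using x_bound[OF bp(2) t] by simp
    have c: "\<bar>cc t\<bar> \<le> cc_max" using cc_bounds[of t] t by simp
    have 1: "\<bar>cc t * x t \<beta>\<bar> \<le> cc_max * 2" unfolding abs_mult using b c cc_max_ge by (intro mult_mono) auto
    have "\<bar>x t \<beta>\<bar> ^ 3 \<le> 2 ^ 3" using b by (intro power_mono) auto
    then have 2: "\<bar>\<beta> * (x t \<beta>) ^ 3\<bar> \<le> \<beta> * 8" unfolding abs_mult power_abs[symmetric] using bp by (intro mult_mono) (auto simp: power_abs)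
    show ?thesis unfolding rhs_on[OF bp(2) t] using 1 2 bp by linarith
  qed
  have Jb: "\<bar>J t \<beta>\<bar> \<le> 10 * \<beta>" if t: "0 \<le> t" "t \<le> 1/2" for t
  proof -
    have "norm (integral {0..1} (\<lambda>r. rhs (r * t) \<beta> (x (r * t) \<beta>))) \<le> 10 * \<beta> * (1 - 0)"
    proof (rule integral_bound)
      show "continuous_on {0..1} (\<lambda>r. rhs (r * t) \<beta> (x (r * t) \<beta>))"
        by (intro continuous_rhs continuous_intros continuous_on_compose2[OF cont_x1[of UNIV]]) auto
      fix r :: real assume r: "r \<in> {0..1}"
      have "r * t \<le> 1 * t" using r t by (intro mult_right_mono) auto
      then show "norm (rhs (r * t) \<beta> (x (r * t) \<beta>)) \<le> 10 * \<beta>" using Nb[of "r * t"] r t by auto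
    qed simp
    then show ?thesis by (simp add: J_def)
  qed
  have "x 0 \<beta> - 5 * \<beta> * (s - 0) \<le> x s \<beta>"
  proof (cases "s = 0")
    case False
    then have s0: "0 < s" using s by simp
    obtain z where z: "0 < z" "z < s" "x s \<beta> - x 0 \<beta> = (s - 0) * (inv_coeff z * J z \<beta>)"
      using MVT2[OF s0, of "\<lambda>s. x s \<beta>" "\<lambda>s. inv_coeff s * J s \<beta>"] dx by auto
    have "\<bar>inv_coeff z * J z \<beta>\<bar> \<le> 1/2 * (10 * \<beta>)"
      unfolding abs_mult
    proof (rule mult_mono)
      show "\<bar>inv_coeff z\<bar> \<le> 1/2" using z sm by (simp add: inv_coeff_eq field_simps)
    qed (use Jb[of z] z sm bp in auto)
    then have "s * (- (5 * \<beta>)) \<le> s * (inv_coeff z * J z \<beta>)" using s0 by (intro mult_left_mono) auto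
    then show ?thesis using z by (simp add: algebra_simps)
  qed simp
  moreover have "5 * \<beta> * s \<le> 1/2" using s bp by (simp add: field_simps)
  ultimately show ?thesis using x0[of \<beta>] by simp
qed

text \<open>
  Up to \<open>s = 1 / (10 \<beta>)\<close>, where \<open>x \<ge> 1/2\<close>, the quartic term dominates and the derivative is at least
  \<open>\<beta> / 256\<close>, a gain of \<open>1/2560\<close> in all. Afterwards, completing the square in \<open>x\<^sup>2\<close> bounds the derivative
  below by \<open>- cc_max\<^sup>2 / \<beta>\<close>.
\<close>

lemma Pohozaev_lower:
  assumes \<beta>: "\<beta> \<ge> beta0" and s: "1 / (10 * \<beta>) \<le> s" "s \<le> 1/2" shows "Pohozaev \<beta> s \<ge> 1/5120"
proof -
  have bp: "\<beta> > 0" "\<beta> \<ge> cc_max" "\<beta> \<ge> 1" "\<beta> \<ge> 32 * cc_max" using \<beta> beta0_ge cc_max_ge by auto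
  define s0 where "s0 = 1 / (10 * \<beta>)"
  have s0: "0 < s0" "s0 \<le> 1/10" using bp by (auto simp: s0_def field_simps)
  define D where "D t = (1 - 2 * t) * (\<beta> * (x t \<beta>) ^ 4 / 4 - (cc t / 2 + kk\<^sup>2 * (t * (1 - t)) / 4) * (x t \<beta>)\<^sup>2)" for t
  have YD: "(Pohozaev \<beta> has_real_derivative D t) (at t)" if "0 \<le> t" "t \<le> 1/2" for t
    unfolding D_def by (rule Pohozaev_deriv) (use that x_bound[OF bp(2)] in \<open>auto intro: less_imp_le\<close>)
  have k: "\<beta> * (x t \<beta>) ^ 4 / 4 - cc_max * (x t \<beta>)\<^sup>2 \<le> \<beta> * (x t \<beta>) ^ 4 / 4 - (cc t / 2 + kk\<^sup>2 * (t * (1 - t)) / 4) * (x t \<beta>)\<^sup>2"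
    if "0 \<le> t" "t \<le> 1/2" for t
    using mult_right_mono[OF cc_bounds(3)[of t], of "(x t \<beta>)\<^sup>2"] that by simp
  have x4: "(x t \<beta>) ^ 4 = ((x t \<beta>)\<^sup>2)\<^sup>2" for t by simp
  have D1: "D t \<ge> \<beta> / 256" if t: "0 \<le> t" "t \<le> s0" for t
  proof -
    define X where "X = (x t \<beta>)\<^sup>2"
    have "x t \<beta> \<ge> 1/2" using x_near_0[OF \<beta>, of t] t by (simp add: s0_def)
    then have X: "X \<ge> 1/4" using power_mono[of "1/2" "x t \<beta>" 2] by (simp add: X_def power_divide)
    have "\<beta> / 128 \<le> 1/4 * (\<beta> * (1/4) / 4 - cc_max)" using bp by simp
    also have "\<dots> \<le> X * (\<beta> * X / 4 - cc_max)"
    proof (rule mult_mono)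
      show "\<beta> * (1/4) / 4 - cc_max \<le> \<beta> * X / 4 - cc_max" using X bp by (simp add: field_simps)
      show "0 \<le> \<beta> * (1/4) / 4 - cc_max" using bp by simp
    qed (use X in auto)
    also have "\<dots> = \<beta> * (x t \<beta>) ^ 4 / 4 - cc_max * (x t \<beta>)\<^sup>2" unfolding x4 X_def[symmetric] by (simp add: power2_eq_square algebra_simps)
    finally have "\<beta> / 128 \<le> \<beta> * (x t \<beta>) ^ 4 / 4 - (cc t / 2 + kk\<^sup>2 * (t * (1 - t)) / 4) * (x t \<beta>)\<^sup>2"
      using k[of t] t s0 by linarith
    then have "1/2 * (\<beta> / 128) \<le> D t" unfolding D_def using t s0 bp by (intro mult_mono) auto
    then show ?thesis by simp
  qed
  have D2: "D t \<ge> - (cc_max\<^sup>2 / \<beta>)" if t: "0 \<le> t" "t \<le> 1/2" for t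
  proof -
    define X where "X = (x t \<beta>)\<^sup>2"
    have "0 \<le> (\<beta> * X / 2 - cc_max)\<^sup>2 / \<beta>" using bp by simp
    also have "\<dots> = \<beta> * X\<^sup>2 / 4 - cc_max * X + cc_max\<^sup>2 / \<beta>" using bp by (simp add: power2_eq_square field_simps)
    finally have "- (cc_max\<^sup>2 / \<beta>) \<le> \<beta> * (x t \<beta>) ^ 4 / 4 - cc_max * (x t \<beta>)\<^sup>2" unfolding x4 X_def[symmetric] by simp
    then have 1: "- (cc_max\<^sup>2 / \<beta>) \<le> \<beta> * (x t \<beta>) ^ 4 / 4 - (cc t / 2 + kk\<^sup>2 * (t * (1 - t)) / 4) * (x t \<beta>)\<^sup>2"
      using k[OF t] by linarith
    have "- (cc_max\<^sup>2 / \<beta>) \<le> (1 - 2 * t) * (- (cc_max\<^sup>2 / \<beta>))"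
      using mult_right_mono[of "1 - 2 * t" 1 "cc_max\<^sup>2 / \<beta>"] t bp by simp
    also have "\<dots> \<le> D t" unfolding D_def using 1 t by (intro mult_left_mono) auto
    finally show ?thesis .
  qed
  have Y0: "Pohozaev \<beta> 0 = 0" by (simp add: Pohozaev_def)
  obtain z where z: "0 < z" "z < s0" "Pohozaev \<beta> s0 - Pohozaev \<beta> 0 = (s0 - 0) * D z"
    using MVT2[OF s0(1), of "Pohozaev \<beta>" D] YD s0 by auto
  have "s0 * (\<beta> / 256) \<le> s0 * D z" using D1[of z] z s0 by (intro mult_left_mono) auto
  then have Y1: "Pohozaev \<beta> s0 \<ge> 1/2560" using z Y0 bp by (simp add: s0_def)
  have Y2: "Pohozaev \<beta> s \<ge> Pohozaev \<beta> s0 - cc_max\<^sup>2 / \<beta> * (s - s0)"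
  proof (cases "s = s0")
    case False
    then have "s0 < s" using s by (simp add: s0_def)
    then obtain z where z: "s0 < z" "z < s" "Pohozaev \<beta> s - Pohozaev \<beta> s0 = (s - s0) * D z"
      using MVT2[of s0 s "Pohozaev \<beta>" D] YD s0 s by auto
    have "(s - s0) * (- (cc_max\<^sup>2 / \<beta>)) \<le> (s - s0) * D z" using D2[of z] z s s0 \<open>s0 < s\<close> by (intro mult_left_mono) auto
    then show ?thesis using z by (simp add: algebra_simps)
  qed simp
  have "cc_max\<^sup>2 / \<beta> * (s - s0) \<le> 1 / 5120 * 1"
  proof (rule mult_mono)
    show "cc_max\<^sup>2 / \<beta> \<le> 1 / 5120" using \<beta> bp by (simp add: beta0_def field_simps)
    show "s - s0 \<le> 1" using s s0 by linarith
  qed (use s s0 in \<open>auto simp: s0_def\<close>)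
  then show ?thesis using Y1 Y2 by linarith
qed

lemma nonvanishing:
  assumes \<beta>: "\<beta> \<ge> beta0" and s: "0 \<le> s" "s \<le> 1/2" and K: "K \<ge> 1"
  shows "K\<^sup>2 * (x s \<beta>)\<^sup>2 + (w s \<beta>)\<^sup>2 > 0"
proof (cases "s \<le> 1 / (10 * \<beta>)")
  case True
  then have "x s \<beta> \<noteq> 0" using x_near_0[OF \<beta> s(1)] by auto
  then show ?thesis using K by (intro add_pos_nonneg) auto
next
  case False
  then have "Pohozaev \<beta> s > 0" using Pohozaev_lower[OF \<beta> _ s(2)] by simp
  then have "x s \<beta> \<noteq> 0 \<or> w s \<beta> \<noteq> 0" unfolding Pohozaev_def by auto
  then show ?thesis using K by (auto intro: add_pos_nonneg add_nonneg_pos)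
qed

section \<open>Solutions that vanish on the middle torus\<close>

text \<open>
  The rate at which the vector \<open>(K x, w)\<close> turns clockwise. Stretching by \<open>K\<close> does not affect the zeros of
  \<open>x\<close>, and a large \<open>K\<close>, with a still larger \<open>\<beta>\<close>, makes the vector turn fast
  (\<open>swept_angle_lower\<close>).
\<close>

definition turning_rate :: "real \<Rightarrow> real \<Rightarrow> real \<Rightarrow> real" where
  "turning_rate K \<beta> s = K * (w s \<beta> * (inv_coeff s * J s \<beta>) - x s \<beta> * rhs s \<beta> (x s \<beta>)) / (K\<^sup>2 * (x s \<beta>)\<^sup>2 + (w s \<beta>)\<^sup>2)"

definition swept_angle :: "real \<Rightarrow> real \<Rightarrow> real" where
  "swept_angle K \<beta> = integral {0..1/2} (turning_rate K \<beta>)"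

lemma continuous_turning_rate:
  assumes "A \<subseteq> {1..} \<times> {beta0..}"
  shows "continuous_on (A \<times> {0..1/2}) (\<lambda>(p, s). turning_rate (fst p) (snd p) s)"
proof -
  let ?A = "A \<times> {0..1/2::real}"
  have m: "continuous_on ?A (\<lambda>z. (snd z, snd (fst z)))" by (intro continuous_intros)
  have cx: "continuous_on ?A (\<lambda>z. x (snd z) (snd (fst z)))"
    using continuous_on_compose2[OF cont_x m] by simp
  have cJ: "continuous_on ?A (\<lambda>z. J (snd z) (snd (fst z)))"
    using continuous_on_compose2[OF cont_J m] by simp
  have cq: "continuous_on ?A (\<lambda>z. inv_coeff (snd z))"
    by (rule continuous_on_compose2[OF continuous_inv_coeff]) (auto intro!: continuous_intros)
  show ?thesis unfolding case_prod_beta turning_rate_def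
  proof (intro continuous_on_divide continuous_on_mult continuous_on_add continuous_on_diff continuous_on_power
      continuous_on_fst continuous_on_snd continuous_on_id cx cJ cq continuous_rhs ballI)
    fix z assume "z \<in> ?A"
    then obtain K \<beta> s where z: "z = ((K, \<beta>), s)" "(K, \<beta>) \<in> A" "0 \<le> s" "s \<le> 1/2" by (cases z) auto
    then have "1 \<le> K" "beta0 \<le> \<beta>" using assms by auto
    then show "(fst (fst z))\<^sup>2 * (x (snd z) (snd (fst z)))\<^sup>2 + (snd z * J (snd z) (snd (fst z)))\<^sup>2 \<noteq> 0"
      using nonvanishing[of \<beta> s K] z by simp
  qed
qed

lemma continuous_rho1: assumes "K \<ge> 1" "\<beta> \<ge> beta0" shows "continuous_on {0..1/2} (turning_rate K \<beta>)"
proof -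
  have "continuous_on ({(K, \<beta>)} \<times> {0..1/2}) (\<lambda>(p, s). turning_rate (fst p) (snd p) s)"
    by (rule continuous_turning_rate) (use assms in auto)
  then have "continuous_on {0..1/2} (\<lambda>s. (\<lambda>(p, s). turning_rate (fst p) (snd p) s) ((K, \<beta>), s))"
    by (rule continuous_on_compose2) (auto intro!: continuous_intros)
  then show ?thesis by simp
qed

lemma continuous_swept_angle: "continuous_on ({1..} \<times> {beta0..}) (\<lambda>p. swept_angle (fst p) (snd p))"
proof -
  have "continuous_on (({1..} \<times> {beta0..}) \<times> cbox 0 (1/2)) (\<lambda>(p, s). turning_rate (fst p) (snd p) s)"
    using continuous_turning_rate[of "{1..} \<times> {beta0..}"] by simp
  from integral_continuous_on_param[OF this] show ?thesis by (simp add: swept_angle_def)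
qed

text \<open>
  The vector \<open>(K x, w)\<close> starts in the direction of angle \<open>0\<close>, so at \<open>1/2\<close> its angle is minus the swept
  angle; if that is an odd multiple of \<open>\<pi> / 2\<close>, the first component is zero. The proof rotates the
  vector back by the angle swept so far, divides by the growth of its modulus, and finds that the second
  component remains zero.
\<close>

lemma cos_swept_angle:
  assumes K: "K \<ge> 1" and \<beta>: "\<beta> \<ge> beta0" and c: "cos (swept_angle K \<beta>) = 0"
  shows "x (1/2) \<beta> = 0"
proof -
  let ?I = "{0..1/2::real}"
  define X where "X s = K * x s \<beta>" for s
  define W where "W s = w s \<beta>" for s
  define X' where "X' s = K * (inv_coeff s * J s \<beta>)" for s
  define n where "n s = rhs s \<beta> (x s \<beta>)" for s
  define m where "m s = K\<^sup>2 * (x s \<beta>)\<^sup>2 + (w s \<beta>)\<^sup>2" for s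
  define lam where "lam s = (X s * X' s + W s * n s) / m s" for s
  have m: "m s > 0" "m s = (X s)\<^sup>2 + (W s)\<^sup>2" if "s \<in> ?I" for s
    using nonvanishing[OF \<beta> _ _ K, of s] that by (auto simp: m_def X_def W_def power_mult_distrib)
  have r: "turning_rate K \<beta> s = (W s * X' s - X s * n s) / m s" for s
    by (simp add: turning_rate_def W_def X'_def X_def n_def m_def algebra_simps)
  have dX: "(X has_real_derivative X' s) (at s within ?I)" for s
    unfolding X_def[abs_def] X'_def by (rule DERIV_cmult[OF has_field_derivative_at_within[OF dx]])
  have dW: "(W has_real_derivative n s) (at s within ?I)" for s
    unfolding W_def[abs_def] n_def by (rule has_field_derivative_at_within[OF dJ])
  have X'e: "X' s = lam s * X s + turning_rate K \<beta> s * W s" and ne: "n s = lam s * W s - turning_rate K \<beta> s * X s" if s: "s \<in> ?I" for s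
  proof -
    have "lam s * X s + turning_rate K \<beta> s * W s = X' s * ((X s)\<^sup>2 + (W s)\<^sup>2) / m s"
      unfolding lam_def r by (simp add: add_divide_distrib[symmetric] algebra_simps power2_eq_square)
    then show "X' s = lam s * X s + turning_rate K \<beta> s * W s" using m[OF s] by auto
    have "lam s * W s - turning_rate K \<beta> s * X s = n s * ((X s)\<^sup>2 + (W s)\<^sup>2) / m s"
      unfolding lam_def r by (simp add: diff_divide_distrib[symmetric] algebra_simps power2_eq_square)
    then show "n s = lam s * W s - turning_rate K \<beta> s * X s" using m[OF s] by auto
  qed
  have nz: "K\<^sup>2 * (x s \<beta>)\<^sup>2 + (w s \<beta>)\<^sup>2 \<noteq> 0" if "s \<in> ?I" for s
    using nonvanishing[OF \<beta> _ _ K, of s] that by auto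
  have clam: "continuous_on ?I lam"
    unfolding lam_def[abs_def] X_def X'_def W_def n_def m_def
    by (intro continuous_on_divide continuous_on_mult continuous_on_add continuous_on_const continuous_on_id continuous_on_power
        cont_x1 cont_J1 continuous_on_subset[OF continuous_inv_coeff] continuous_rhs ballI nz) auto
  define Th where "Th s = integral {0..s} (turning_rate K \<beta>)" for s
  define La where "La s = integral {0..s} lam" for s
  have dTh: "(Th has_real_derivative turning_rate K \<beta> s) (at s within ?I)" if "s \<in> ?I" for s
    using integral_has_vector_derivative[OF continuous_rho1[OF K \<beta>] that]
    by (simp add: Th_def[abs_def] has_real_derivative_iff_has_vector_derivative)
  have dLa: "(La has_real_derivative lam s) (at s within ?I)" if "s \<in> ?I" for s
    using integral_has_vector_derivative[OF clam that]
    by (simp add: La_def[abs_def] has_real_derivative_iff_has_vector_derivative)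
  define Q where "Q s = exp (- La s) * (X s * sin (Th s) + W s * cos (Th s))" for s
  have "(Q has_real_derivative 0) (at s within ?I)" if s: "s \<in> ?I" for s
  proof -
    have "(Q has_real_derivative (exp (- La s) * (- lam s)) * (X s * sin (Th s) + W s * cos (Th s))
       + exp (- La s) * (X' s * sin (Th s) + X s * (cos (Th s) * turning_rate K \<beta> s) + (n s * cos (Th s) + W s * (- sin (Th s) * turning_rate K \<beta> s))))
       (at s within ?I)"
      unfolding Q_def[abs_def]
      by (auto intro!: derivative_eq_intros dX dW dTh[OF s] dLa[OF s])
    also have "(exp (- La s) * (- lam s)) * (X s * sin (Th s) + W s * cos (Th s))
       + exp (- La s) * (X' s * sin (Th s) + X s * (cos (Th s) * turning_rate K \<beta> s) + (n s * cos (Th s) + W s * (- sin (Th s) * turning_rate K \<beta> s))) = 0"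
      unfolding X'e[OF s] ne[OF s] by (simp add: algebra_simps)
    finally show ?thesis .
  qed
  then obtain q where q: "\<And>s. s \<in> ?I \<Longrightarrow> Q s = q"
    using has_field_derivative_zero_constant[of ?I Q] by auto
  have "Q 0 = 0" by (simp add: Q_def Th_def W_def)
  then have "Q (1/2) = 0" using q[of 0] q[of "1/2"] by simp
  then have "X (1/2) * sin (swept_angle K \<beta>) = 0" using c by (simp add: Q_def Th_def swept_angle_def)
  moreover have "sin (swept_angle K \<beta>) \<noteq> 0" using c sin_cos_squared_add[of "swept_angle K \<beta>"] by auto
  ultimately show ?thesis using K by (simp add: X_def)
qed

text \<open>
  The rate never falls below \<open>- cc_max\<close>. On \<open>[1/4, 1/2]\<close> it is at least \<open>K / 2\<close>: there the lower bound for
  the Pohozaev quantity makes \<open>w\<^sup>2\<close> or \<open>\<beta> x\<^sup>4\<close> large, and once \<open>\<beta>\<close> exceeds a multiple of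
  \<open>K\<^sup>4\<close>, completing the square in \<open>x\<^sup>2\<close> absorbs the negative terms.
\<close>

lemma swept_angle_lower:
  assumes K: "K \<ge> 1" and \<beta>: "\<beta> \<ge> beta0" "\<beta> \<ge> 5120 / 12 * (cc_max + K\<^sup>2 / 2)\<^sup>2"
  shows "swept_angle K \<beta> \<ge> K / 8 - cc_max"
proof -
  have bp: "\<beta> > 0" "\<beta> \<ge> cc_max" using \<beta> beta0_ge by auto
  have ci: "turning_rate K \<beta> integrable_on {a..b}" if "0 \<le> a" "b \<le> 1/2" for a b
    by (rule integrable_continuous_real) (rule continuous_on_subset[OF continuous_rho1[OF K \<beta>(1)]], use that in auto)
  define P where "P s = w s \<beta> * (inv_coeff s * J s \<beta>)" for s
  have num: "w s \<beta> * (inv_coeff s * J s \<beta>) - x s \<beta> * rhs s \<beta> (x s \<beta>) = P s + \<beta> * (x s \<beta>) ^ 4 - cc s * (x s \<beta>)\<^sup>2"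
    if "0 \<le> s" "s \<le> 1/2" for s
    unfolding rhs_on[OF bp(2) that] P_def by (simp add: algebra_simps power2_eq_square power3_eq_cube power4_eq_xxxx)
  have low: "turning_rate K \<beta> s \<ge> - cc_max" if s: "0 \<le> s" "s \<le> 1/2" for s
  proof -
    let ?m = "K\<^sup>2 * (x s \<beta>)\<^sup>2 + (w s \<beta>)\<^sup>2"
    have m: "?m > 0" by (rule nonvanishing[OF \<beta>(1) s K])
    have "P s \<ge> 0" unfolding P_def using s inv_coeff_bounds(1)[of s] by (simp add: mult_ac zero_le_mult_iff)
    moreover have "cc s * (x s \<beta>)\<^sup>2 \<le> cc_max * (x s \<beta>)\<^sup>2" using cc_bounds(2)[of s] s by (intro mult_right_mono) auto
    moreover have "\<beta> * (x s \<beta>) ^ 4 \<ge> 0" using bp by simp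
    ultimately have "- (cc_max * (x s \<beta>)\<^sup>2) \<le> P s + \<beta> * (x s \<beta>) ^ 4 - cc s * (x s \<beta>)\<^sup>2" by linarith
    then have 1: "K * (- (cc_max * (x s \<beta>)\<^sup>2)) \<le> K * (P s + \<beta> * (x s \<beta>) ^ 4 - cc s * (x s \<beta>)\<^sup>2)" using K by (intro mult_left_mono) auto
    have "K * (cc_max * (x s \<beta>)\<^sup>2) \<le> K\<^sup>2 * (cc_max * (x s \<beta>)\<^sup>2)"
    proof (rule mult_right_mono)
      show "K \<le> K\<^sup>2" using K by (simp add: power2_eq_square)
    qed (use cc_max_ge in simp)
    also have "\<dots> \<le> cc_max * ?m" using cc_max_ge by (simp add: algebra_simps)
    finally have "- cc_max * ?m \<le> K * (P s + \<beta> * (x s \<beta>) ^ 4 - cc s * (x s \<beta>)\<^sup>2)" using 1 by simp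
    then show ?thesis unfolding turning_rate_def num[OF s] using m by (simp add: pos_le_divide_eq)
  qed
  have high: "turning_rate K \<beta> s \<ge> K / 2" if s: "1/4 \<le> s" "s \<le> 1/2" for s
  proof -
    have s': "0 \<le> s" "s \<le> 1/2" using s by auto
    let ?m = "K\<^sup>2 * (x s \<beta>)\<^sup>2 + (w s \<beta>)\<^sup>2"
    define X where "X = (x s \<beta>)\<^sup>2"
    define D where "D = cc_max + K\<^sup>2 / 2"
    define y where "y = s * (1 - s)"
    have y: "y > 0" "y \<le> 1/4" using s quarter_bound[of s] by (auto simp: y_def)
    have m: "?m > 0" by (rule nonvanishing[OF \<beta>(1) s' K])
    have x4: "(x s \<beta>) ^ 4 = X\<^sup>2" by (simp add: X_def)
    have s0: "1 / (10 * \<beta>) \<le> s"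
    proof -
      have "1 / (10 * \<beta>) \<le> 1/10" using bp cc_max_ge by (simp add: field_simps)
      then show ?thesis using s by linarith
    qed
    have Y: "(w s \<beta>)\<^sup>2 / 8 + y * (\<beta> * X\<^sup>2 / 4 - cc s * X / 2) \<ge> 1/5120"
      using Pohozaev_lower[OF \<beta>(1) s0 s(2)] unfolding Pohozaev_def x4 X_def[symmetric] y_def[symmetric] .
    have "y * (\<beta> * X\<^sup>2 / 4 - cc s * X / 2) \<le> y * (\<beta> * X\<^sup>2 / 4)"
      using y cc_bounds(1)[of s] s by (intro mult_left_mono) (auto simp: X_def)
    also have "\<dots> \<le> 1/4 * (\<beta> * X\<^sup>2 / 4)" using y bp by (intro mult_right_mono) auto
    finally have Y': "(w s \<beta>)\<^sup>2 / 8 + \<beta> * X\<^sup>2 / 16 \<ge> 1/5120" using Y by simp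
    have P: "P s \<ge> (w s \<beta>)\<^sup>2"
    proof -
      have "P s = (w s \<beta>)\<^sup>2 / (4 * y)"
        unfolding P_def y_def using s by (simp add: inv_coeff_eq power2_eq_square)
      moreover have "(w s \<beta>)\<^sup>2 \<le> (w s \<beta>)\<^sup>2 / (4 * y)"
        using y mult_left_mono[of "4 * y" 1 "(w s \<beta>)\<^sup>2"] by (simp add: pos_le_divide_eq)
      ultimately show ?thesis by simp
    qed
    have "(3/2 * \<beta> * X - D)\<^sup>2 \<ge> 0" by simp
    then have "D\<^sup>2 \<ge> 3 * \<beta> * X * D - 9/4 * \<beta>\<^sup>2 * X\<^sup>2" by (simp add: power2_eq_square algebra_simps)
    moreover have "12 / 5120 * \<beta> \<ge> D\<^sup>2" using \<beta>(2) by (simp add: D_def)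
    ultimately have "\<beta> * 0 \<le> \<beta> * (12/5120 + 9/4 * \<beta> * X\<^sup>2 - 3 * X * D)" by (simp add: power2_eq_square algebra_simps)
    then have quad: "0 \<le> 12/5120 + 9/4 * \<beta> * X\<^sup>2 - 3 * X * D" using bp(1) by (simp only: mult_le_cancel_left_pos)
    have ccX: "cc s * X \<le> cc_max * X" using cc_bounds(2)[of s] s by (intro mult_right_mono) (auto simp: X_def)
    have DX: "X * D = cc_max * X + K\<^sup>2 * X / 2" by (simp add: D_def algebra_simps)
    have quad': "0 \<le> 12/5120 + 9/4 * (\<beta> * X\<^sup>2) - 3 * (X * D)" using quad by (simp add: mult.assoc)
    have "?m / 2 \<le> P s + \<beta> * X\<^sup>2 - cc s * X"
      unfolding X_def[symmetric] using P Y' quad' ccX DX by (simp add: field_simps)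
    then have "K * (?m / 2) \<le> K * (P s + \<beta> * (x s \<beta>) ^ 4 - cc s * (x s \<beta>)\<^sup>2)"
      unfolding x4 X_def[symmetric] using K by (intro mult_left_mono) auto
    then have "K / 2 * ?m \<le> K * (P s + \<beta> * (x s \<beta>) ^ 4 - cc s * (x s \<beta>)\<^sup>2)" by simp
    then show ?thesis unfolding turning_rate_def num[OF s'] using m by (simp only: pos_le_divide_eq)
  qed
  have i1: "integral {0..1/4::real} (\<lambda>_. - cc_max) \<le> integral {0..1/4} (turning_rate K \<beta>)"
    by (rule integral_le) (use ci low in auto)
  have i2: "integral {1/4..1/2::real} (\<lambda>_. K / 2) \<le> integral {1/4..1/2} (turning_rate K \<beta>)"
    by (rule integral_le) (use ci high in auto)
  have "integral {0..1/4} (turning_rate K \<beta>) + integral {1/4..1/2} (turning_rate K \<beta>) = swept_angle K \<beta>"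
    unfolding swept_angle_def by (rule Henstock_Kurzweil_Integration.integral_combine) (use ci in auto)
  moreover have "integral {0..1/4::real} (\<lambda>_. - cc_max) = - cc_max / 4" "integral {1/4..1/2::real} (\<lambda>_. K / 2) = K / 8" by simp_all
  ultimately show ?thesis using i1 i2 cc_max_ge by linarith
qed

text \<open>
  The swept angle depends continuously on \<open>(K, \<beta>)\<close> in a connected set and is unbounded there, so it
  takes odd multiples of \<open>\<pi> / 2\<close> as values.
\<close>

lemma ex_zero_at_half: "\<exists>\<beta>\<ge>B. x (1/2) \<beta> = 0"
proof (rule ccontr)
  assume no: "\<not> (\<exists>\<beta>\<ge>B. x (1/2) \<beta> = 0)"
  define b where "b = max B beta0"
  let ?S = "{1..} \<times> {b..} :: (real \<times> real) set"
  let ?T = "\<lambda>p. swept_angle (fst p) (snd p)"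
  have "continuous_on ?S ?T"
    by (rule continuous_on_subset[OF continuous_swept_angle]) (auto simp: b_def)
  moreover have "connected ?S" by (intro convex_connected convex_Times convex_real_interval)
  ultimately have conn: "connected (?T ` ?S)" by (rule connected_continuous_image)
  define t0 where "t0 = swept_angle 1 b"
  define K where "K = max 1 (8 * (t0 + pi + cc_max))"
  define \<beta> where "\<beta> = max b (5120 / 12 * (cc_max + K\<^sup>2 / 2)\<^sup>2)"
  have "swept_angle K \<beta> \<ge> K / 8 - cc_max" by (rule swept_angle_lower) (auto simp: K_def \<beta>_def b_def)
  moreover have "K / 8 \<ge> t0 + pi + cc_max" by (simp add: K_def)
  ultimately have big: "swept_angle K \<beta> \<ge> t0 + pi" by linarith
  have in1: "t0 \<in> ?T ` ?S" unfolding t0_def by (rule image_eqI[of _ _ "(1, b)"]) auto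
  have in2: "swept_angle K \<beta> \<in> ?T ` ?S" by (rule image_eqI[of _ _ "(K, \<beta>)"]) (auto simp: K_def \<beta>_def)
  \<comment> \<open>\<open>z\<close> is the first odd multiple of \<open>\<pi> / 2\<close> from \<open>t0\<close> on.\<close>
  define N where "N = \<lceil>(t0 - pi / 2) / pi\<rceil>"
  define z where "z = of_int N * pi + pi / 2"
  have "(t0 - pi / 2) / pi \<le> of_int N" "of_int N < (t0 - pi / 2) / pi + 1" unfolding N_def by linarith+
  then have "t0 \<le> z" "z \<le> t0 + pi" unfolding z_def by (simp_all add: field_simps)
  then have "z \<in> ?T ` ?S" using connectedD_interval[OF conn in1 in2] big by auto
  then obtain K' \<beta>' where z: "K' \<ge> 1" "\<beta>' \<ge> b" "z = swept_angle K' \<beta>'" by auto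
  have "cos z = 0" unfolding cos_zero_iff_int2 z_def by blast
  then have "x (1/2) \<beta>' = 0" using cos_swept_angle[of K' \<beta>'] z by (auto simp: b_def)
  then show False using no z by (auto simp: b_def)
qed

end

section \<open>Smoothness and odd reflection\<close>

lemma Ck_on_mult_real:
  fixes f g :: "real \<Rightarrow> real"
  shows "open V \<Longrightarrow> Ck_on n f V \<Longrightarrow> Ck_on n g V \<Longrightarrow> Ck_on n (\<lambda>x. f x * g x) V"
  by (rule Ck_on_bilinear[OF _ bounded_bilinear_mult])

lemma Ck_on_cc: "open V \<Longrightarrow> Ck_on n cc V"
proof -
  assume V: "open V"
  have e: "cc = (\<lambda>s. 1 + kk\<^sup>2 / 2 * (s * (1 + (-1) * s)))" by (auto simp: cc_def)
  show ?thesis unfolding e by (intro Ck_on_add Ck_on_mult_real Ck_on_const Ck_on_ident V)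
qed

context radial_family
begin

text \<open>
  Bootstrapping: if \<open>x\<close> is of class \<open>C\<^sup>n\<close>, so is \<open>J\<close> as an average of \<open>cc x - \<beta> x\<^sup>3\<close>, and hence also
  \<open>x' = inv_coeff J\<close>.
\<close>

lemma smooth_x:
  assumes I: "open I" "convex I" "0 \<in> I" and sub: "I \<subseteq> {-1/4<..<3/4}" and b: "\<And>s. s \<in> I \<Longrightarrow> \<bar>x s \<beta>\<bar> \<le> 2"
  shows "smooth_on (\<lambda>s. x s \<beta>) I"
  unfolding smooth_on_def
proof
  have star: "t * s \<in> I" if "s \<in> I" "t \<in> {0..1}" for t s
    using convexD_alt[OF I(2,3) that(1), of t] that(2) by simp
  have Cq: "Ck_on n inv_coeff I" for n
  proof -
    have "Ck_on n (\<lambda>s::real. 1 + (-1) * s) I" by (intro Ck_on_add Ck_on_mult_real Ck_on_const Ck_on_ident I)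
    then have "Ck_on n (\<lambda>s. (1 + (-1) * s) powr (-1)) I"
      by (rule Ck_on_compose_real[OF I(1) _ _ Ck_on_powr, rotated]) (use sub in auto)
    then have "Ck_on n (\<lambda>s. 1/4 * (1 + (-1) * s) powr (-1)) I" by (intro Ck_on_mult_real Ck_on_const I)
    then show ?thesis
    proof (rule Ck_on_cong[OF I(1), rotated])
      fix s assume "s \<in> I"
      then have "- 1/4 < s" "s < 3/4" using sub by auto
      then show "1/4 * (1 + (-1) * s) powr (-1) = inv_coeff s" by (simp add: inv_coeff_eq powr_minus_divide)
    qed
  qed
  show "Ck_on n (\<lambda>s. x s \<beta>) I" for n
  proof (induction n)
    case 0 show ?case by (simp add: cont_x1)
  next
    case (Suc n)
    define \<phi> where "\<phi> s = cc s * x s \<beta> + (- \<beta>) * (x s \<beta> * (x s \<beta> * x s \<beta>))" for s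
    have "Ck_on n \<phi> I" unfolding \<phi>_def[abs_def]
      by (intro Ck_on_add Ck_on_mult_real Ck_on_const Ck_on_cc I Suc.IH)
    then have "Ck_on n (\<lambda>s. integral {0..1} (\<lambda>t. t ^ 0 * \<phi> (t * s))) I" by (rule Ck_on_average[OF I])
    then have CJ: "Ck_on n (\<lambda>s. J s \<beta>) I"
    proof (rule Ck_on_cong[OF I(1), rotated])
      fix s assume s: "s \<in> I"
      have "rhs (t * s) \<beta> (x (t * s) \<beta>) = t ^ 0 * \<phi> (t * s)" if "t \<in> {0..1}" for t
      proof -
        have ts: "t * s \<in> I" using star[OF s that] .
        then show ?thesis using rhs_eq[of "t * s" "x (t * s) \<beta>" \<beta>] sub b[OF ts]
          by (auto simp: \<phi>_def power3_eq_cube)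
      qed
      then show "integral {0..1} (\<lambda>t. t ^ 0 * \<phi> (t * s)) = J s \<beta>"
        unfolding J_def by (intro integral_cong) auto
    qed
    have d: "((\<lambda>s. x s \<beta>) has_derivative (\<lambda>v. v * (inv_coeff s * J s \<beta>))) (at s)" for s
      using dx[of \<beta> s] by (simp add: has_field_derivative_def mult_commute_abs)
    show ?case
      by (rule Ck_on_SucI[OF I(1) d])
         (intro Ck_on_mult_real[OF I(1)] Ck_on_const Cq CJ)
  qed
qed

end

lemma Gronwall_zero:
  fixes u u' :: "real \<Rightarrow> real"
  assumes d: "\<And>t. t \<in> {a<..<b} \<Longrightarrow> (u has_real_derivative u' t) (at t)"
    and b: "\<And>t. t \<in> {a<..<b} \<Longrightarrow> \<bar>u' t\<bar> \<le> M * u t"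
    and t0: "t0 \<in> {a<..<b}" "u t0 = 0" and t: "t \<in> {a<..<b}"
  shows "u t \<le> 0"
proof (cases "t0 \<le> t")
  case True
  have "u t * exp (- M * t) \<le> u t0 * exp (- M * t0)"
  proof (rule DERIV_nonpos_imp_nonincreasing[where f = "\<lambda>t. u t * exp (- M * t)", OF True])
    fix r assume "t0 \<le> r" "r \<le> t"
    then have r: "r \<in> {a<..<b}" using t t0 by auto
    have "((\<lambda>t. u t * exp (- M * t)) has_real_derivative (u' r - M * u r) * exp (- M * r)) (at r)"
      by (auto intro!: derivative_eq_intros d[OF r] simp: algebra_simps)
    moreover have "(u' r - M * u r) * exp (- M * r) \<le> 0" using b[OF r] by (intro mult_nonpos_nonneg) auto
    ultimately show "\<exists>y. ((\<lambda>t. u t * exp (- M * t)) has_real_derivative y) (at r) \<and> y \<le> 0" by blast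
  qed
  then show ?thesis using t0 by (simp add: mult_le_0_iff)
next
  case False
  then have le: "t \<le> t0" by simp
  have "u t * exp (M * t) \<le> u t0 * exp (M * t0)"
  proof (rule DERIV_nonneg_imp_nondecreasing[where f = "\<lambda>t. u t * exp (M * t)", OF le])
    fix r assume "t \<le> r" "r \<le> t0"
    then have r: "r \<in> {a<..<b}" using t t0 by auto
    have "((\<lambda>t. u t * exp (M * t)) has_real_derivative (u' r + M * u r) * exp (M * r)) (at r)"
      by (auto intro!: derivative_eq_intros d[OF r] simp: algebra_simps)
    moreover have "(u' r + M * u r) * exp (M * r) \<ge> 0" using b[OF r] by (intro mult_nonneg_nonneg) auto
    ultimately show "\<exists>y. ((\<lambda>t. u t * exp (M * t)) has_real_derivative y) (at r) \<and> y \<ge> 0" by blast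
  qed
  then show ?thesis using t0 by (simp add: mult_le_0_iff)
qed

definition radial_solution :: "real \<Rightarrow> real set \<Rightarrow> (real \<Rightarrow> real) \<Rightarrow> (real \<Rightarrow> real) \<Rightarrow> (real \<Rightarrow> real) \<Rightarrow> bool" where
  "radial_solution \<beta> I X X1 X2 \<longleftrightarrow> (\<forall>s\<in>I. (X has_real_derivative X1 s) (at s) \<and> (X1 has_real_derivative X2 s) (at s) \<and>
     4 * (s * (1 - s) * X2 s + (1 - 2 * s) * X1 s) = cc s * X s - \<beta> * X s ^ 3)"

lemma radial_solution_cong:
  assumes "radial_solution \<beta> I X X1 X2" "open I" "\<And>s. s \<in> I \<Longrightarrow> Y s = X s" "\<And>s. s \<in> I \<Longrightarrow> Y1 s = X1 s" "\<And>s. s \<in> I \<Longrightarrow> Y2 s = X2 s"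
  shows "radial_solution \<beta> I Y Y1 Y2"
  unfolding radial_solution_def
proof (intro ballI conjI)
  fix s assume s: "s \<in> I"
  note r = assms(1)[unfolded radial_solution_def, rule_format, OF s]
  show "(Y has_real_derivative Y1 s) (at s)" unfolding assms(4)[OF s]
    by (rule has_field_derivative_transform_within_open[OF _ assms(2) s]) (use r assms(3) in auto)
  show "(Y1 has_real_derivative Y2 s) (at s)" unfolding assms(5)[OF s]
    by (rule has_field_derivative_transform_within_open[OF _ assms(2) s]) (use r assms(4) in auto)
  show "4 * (s * (1 - s) * Y2 s + (1 - 2 * s) * Y1 s) = cc s * Y s - \<beta> * Y s ^ 3"
    using r assms(3-5)[OF s] by simp
qed

lemma cc_reflect: "cc (1 - s) = cc s" by (simp add: cc_def algebra_simps)

context radial_family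
begin

text \<open>
  Both \<open>x s\<close> and \<open>- x (1 - s)\<close> solve the equation near \<open>1/2\<close>, with the same value \<open>0\<close> and the same
  derivative at \<open>1/2\<close>; they agree there by uniqueness and can be glued. The singular point \<open>1\<close> lies in the
  domain of the reflected solution, which is smooth there because \<open>x\<close> is smooth around \<open>0\<close>.
\<close>

lemma odd_reflection:
  assumes \<beta>: "\<beta> \<ge> beta0" and z: "x (1/2) \<beta> = 0"
  shows "\<exists>I X X1 X2. open I \<and> {0..1} \<subseteq> I \<and> smooth_on X I \<and> X 0 = 1 \<and> radial_solution \<beta> I X X1 X2"
proof -
  have bp: "\<beta> > 0" "\<beta> \<ge> cc_max" using \<beta> beta0_ge by auto
  have xb: "\<bar>x s \<beta>\<bar> < 2" if "0 \<le> s" "s \<le> 1/2" for s using x_bound[OF bp(2) that] .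
  define O2 where "O2 = {s. \<bar>x s \<beta>\<bar> < 2}"
  have "open O2" unfolding O2_def by (intro open_Collect_less continuous_intros cont_x1)
  moreover have "0 \<in> O2" "1/2 \<in> O2" using xb[of 0] xb[of "1/2"] by (auto simp: O2_def)
  ultimately obtain e1 e2 where e: "e1 > 0" "ball 0 e1 \<subseteq> O2" "e2 > 0" "ball (1/2) e2 \<subseteq> O2"
    by (meson open_contains_ball_eq)
  define \<delta> where "\<delta> = min (1/8) (min e1 e2)"
  have \<delta>: "\<delta> > 0" "\<delta> \<le> 1/8" "\<delta> \<le> e1" "\<delta> \<le> e2" using e by (auto simp: \<delta>_def)
  define I where "I = {-\<delta><..<1/2+\<delta>}"
  have I: "open I" "convex I" "0 \<in> I" "I \<subseteq> {-1/4<..<3/4}" using \<delta> by (auto simp: I_def)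
  have bI: "\<bar>x s \<beta>\<bar> \<le> 2" if s: "s \<in> I" for s
  proof -
    consider "s < 0" | "0 \<le> s" "s \<le> 1/2" | "s > 1/2" by linarith
    then have "s \<in> O2"
    proof cases
      case 1 then show ?thesis using e(2) \<delta> s by (auto simp: I_def subset_iff dist_real_def)
    next
      case 2 then show ?thesis using xb by (simp add: O2_def)
    next
      case 3 then show ?thesis using e(4) \<delta> s by (auto simp: I_def subset_iff dist_real_def)
    qed
    then show ?thesis by (simp add: O2_def)
  qed
  have sx: "smooth_on (\<lambda>s. x s \<beta>) I" by (rule smooth_x[OF I bI])
  define Dx where "Dx s = frechet_derivative (\<lambda>s. x s \<beta>) (at s) 1" for s
  have sDx: "smooth_on Dx I" unfolding Dx_def[abs_def] by (rule smooth_on_frechet[OF sx])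
  define x2 where "x2 s = frechet_derivative Dx (at s) 1" for s
  have d1: "((\<lambda>s. x s \<beta>) has_real_derivative Dx s) (at s)" if "s \<in> I" for s
    unfolding Dx_def by (rule smooth_on_has_real_derivative[OF sx that])
  have d2: "(Dx has_real_derivative x2 s) (at s)" if "s \<in> I" for s
    unfolding x2_def by (rule smooth_on_has_real_derivative[OF sDx that])
  have wD: "4 * (s * (1 - s)) * Dx s = w s \<beta>" if s: "s \<in> I" for s
  proof -
    have e: "Dx s = inv_coeff s * J s \<beta>" using DERIV_unique[OF d1[OF s] dx] .
    have q: "inv_coeff s = 1 / (4 * (1 - s))" "1 - s \<noteq> 0" using I(4) s inv_coeff_eq[of s] by auto
    have "4 * (s * c) * (1 / (4 * c) * J s \<beta>) = w s \<beta>" if "c \<noteq> 0" for c using that by simp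
    from this[OF q(2)] show ?thesis unfolding e q(1) .
  qed
  have Neq: "rhs s \<beta> (x s \<beta>) = cc s * x s \<beta> - \<beta> * (x s \<beta>) ^ 3" if "s \<in> I" for s
    using rhs_eq[of s "x s \<beta>" \<beta>] I(4) that bI[OF that] by auto
  have dw: "((\<lambda>s. w s \<beta>) has_real_derivative cc s * x s \<beta> - \<beta> * (x s \<beta>) ^ 3) (at s)" if "s \<in> I" for s
    using dJ[of \<beta> s] Neq[OF that] by simp
  have eq: "4 * (s * (1 - s) * x2 s + (1 - 2 * s) * Dx s) = cc s * x s \<beta> - \<beta> * (x s \<beta>) ^ 3" if s: "s \<in> I" for s
  proof -
    have "((\<lambda>s. 4 * (s * (1 - s)) * Dx s) has_real_derivative 4 * (s * (1 - s) * x2 s + (1 - 2 * s) * Dx s)) (at s)"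
      by (auto intro!: derivative_eq_intros d2[OF s] simp: algebra_simps)
    then have "((\<lambda>s. w s \<beta>) has_real_derivative 4 * (s * (1 - s) * x2 s + (1 - 2 * s) * Dx s)) (at s)"
      by (rule has_field_derivative_transform_within_open[OF _ I(1) s]) (rule wD)
    from DERIV_unique[OF this dw[OF s]] show ?thesis .
  qed
  have sol: "radial_solution \<beta> I (\<lambda>s. x s \<beta>) Dx x2" using d1 d2 eq by (simp add: radial_solution_def)
  define I' where "I' = {1/2-\<delta><..<1+\<delta>}"
  have I': "open I'" "\<And>s. s \<in> I' \<longleftrightarrow> 1 - s \<in> I" by (auto simp: I'_def I_def)
  have sol': "radial_solution \<beta> I' (\<lambda>s. - x (1 - s) \<beta>) (\<lambda>s. Dx (1 - s)) (\<lambda>s. - x2 (1 - s))"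
    unfolding radial_solution_def
  proof (intro ballI conjI)
    fix s assume "s \<in> I'"
    then have r: "1 - s \<in> I" using I' by simp
    have l: "((\<lambda>s. 1 - s) has_real_derivative -1) (at s)" by (auto intro!: derivative_eq_intros)
    show "((\<lambda>s. - x (1 - s) \<beta>) has_real_derivative Dx (1 - s)) (at s)"
      using DERIV_minus[OF DERIV_chain2[OF d1[OF r] l]] by simp
    show "((\<lambda>s. Dx (1 - s)) has_real_derivative - x2 (1 - s)) (at s)"
      using DERIV_chain2[OF d2[OF r] l] by simp
    show "4 * (s * (1 - s) * - x2 (1 - s) + (1 - 2 * s) * Dx (1 - s)) = cc s * - x (1 - s) \<beta> - \<beta> * (- x (1 - s) \<beta>) ^ 3"
      using eq[OF r] unfolding cc_reflect by (simp add: algebra_simps)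
  qed
  define U where "U = {1/2-\<delta><..<1/2+\<delta>}"
  have U: "open U" "\<And>s. s \<in> U \<Longrightarrow> s \<in> I \<and> s \<in> I' \<and> 1 - s \<in> I \<and> 1 - s \<in> U" "1/2 \<in> U" using \<delta> by (auto simp: U_def I_def I'_def)
  have agree: "x s \<beta> = - x (1 - s) \<beta>" if s: "s \<in> U" for s
  proof -
    \<comment> \<open>The differences of the two solutions and of their fluxes satisfy a linear differential inequality.\<close>
    define d where "d s = x s \<beta> + x (1 - s) \<beta>" for s
    define e where "e s = w s \<beta> - w (1 - s) \<beta>" for s
    define d' where "d' s = Dx s - Dx (1 - s)" for s
    define e' where "e' s = (cc s * x s \<beta> - \<beta> * (x s \<beta>) ^ 3) + (cc s * x (1 - s) \<beta> - \<beta> * (x (1 - s) \<beta>) ^ 3)" for s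
    define M where "M = 2 + cc_max + 12 * \<beta>"
    have l: "((\<lambda>s. 1 - s) has_real_derivative -1) (at s)" for s :: real by (auto intro!: derivative_eq_intros)
    have dd: "(d has_real_derivative d' s) (at s)" if "s \<in> U" for s
      unfolding d_def[abs_def] d'_def
      using DERIV_add[OF d1 DERIV_chain2[OF d1 l], of s] U(2)[OF that] by simp
    have de: "(e has_real_derivative e' s) (at s)" if "s \<in> U" for s
      unfolding e_def[abs_def] e'_def
      using DERIV_diff[OF dw DERIV_chain2[OF dw l], of s] U(2)[OF that] by (simp add: cc_reflect algebra_simps)
    have bd: "\<bar>2 * d s * d' s + 2 * e s * e' s\<bar> \<le> M * ((d s)\<^sup>2 + (e s)\<^sup>2)" if s: "s \<in> U" for s
    proof -
      have s': "3/8 \<le> s" "s \<le> 5/8" using s \<delta> by (auto simp: U_def)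
      define y where "y = s * (1 - s)"
      have y: "y \<ge> 1/8"
      proof -
        have "3/8 * (3/8) \<le> s * (1 - s)" using s' by (intro mult_mono) auto
        then show ?thesis by (simp add: y_def)
      qed
      have "4 * y * d' s = e s"
        unfolding d'_def e_def y_def using wD[of s] wD[of "1 - s"] U(2)[OF s] by (simp add: algebra_simps)
      then have "\<bar>e s\<bar> = 4 * y * \<bar>d' s\<bar>" using y by (simp add: abs_mult flip: \<open>4 * y * d' s = e s\<close>)
      moreover have "1/2 * \<bar>d' s\<bar> \<le> 4 * y * \<bar>d' s\<bar>" using y by (intro mult_right_mono) auto
      ultimately have d'e: "\<bar>d' s\<bar> \<le> 2 * \<bar>e s\<bar>" by linarith
      define p q where "p = x s \<beta>" "q = x (1 - s) \<beta>"
      note pq = this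
      have pqb: "\<bar>p\<bar> \<le> 2" "\<bar>q\<bar> \<le> 2" using bI U(2)[OF s] by (auto simp: pq)
      have "e' s = (cc s - \<beta> * (p\<^sup>2 - p * q + q\<^sup>2)) * d s"
        by (simp add: e'_def d_def flip: pq) (simp add: algebra_simps power2_eq_square power3_eq_cube)
      moreover have "\<bar>cc s - \<beta> * (p\<^sup>2 - p * q + q\<^sup>2)\<bar> \<le> cc_max + \<beta> * 12"
      proof -
        have "p\<^sup>2 \<le> 4" "q\<^sup>2 \<le> 4" using abs_le_square_iff[of _ 2] pqb by auto
        moreover have "\<bar>p * q\<bar> \<le> 2 * 2" unfolding abs_mult by (intro mult_mono pqb) auto
        ultimately have "\<bar>p\<^sup>2 - p * q + q\<^sup>2\<bar> \<le> 12" using zero_le_power2[of p] zero_le_power2[of q] by linarith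
        then have "\<bar>\<beta> * (p\<^sup>2 - p * q + q\<^sup>2)\<bar> \<le> \<beta> * 12" unfolding abs_mult using bp by (intro mult_mono) auto
        moreover have "\<bar>cc s\<bar> \<le> cc_max" using cc_bounds[of s] s' by auto
        ultimately show ?thesis by linarith
      qed
      ultimately have e'd: "\<bar>e' s\<bar> \<le> (cc_max + \<beta> * 12) * \<bar>d s\<bar>"
        by (metis abs_ge_zero abs_mult mult_right_mono)
      have "\<bar>2 * d s * d' s + 2 * e s * e' s\<bar> \<le> 2 * \<bar>d s\<bar> * \<bar>d' s\<bar> + 2 * \<bar>e s\<bar> * \<bar>e' s\<bar>"
        by (rule order_trans[OF abs_triangle_ineq]) (simp add: abs_mult)
      also have "\<dots> \<le> 2 * \<bar>d s\<bar> * (2 * \<bar>e s\<bar>) + 2 * \<bar>e s\<bar> * ((cc_max + \<beta> * 12) * \<bar>d s\<bar>)"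
        using d'e e'd by (intro add_mono mult_left_mono) auto
      also have "\<dots> = M * (2 * \<bar>d s\<bar> * \<bar>e s\<bar>)" by (simp add: M_def algebra_simps)
      also have "\<dots> \<le> M * ((d s)\<^sup>2 + (e s)\<^sup>2)"
      proof (rule mult_left_mono)
        have "0 \<le> (\<bar>d s\<bar> - \<bar>e s\<bar>)\<^sup>2" by simp
        then show "2 * \<bar>d s\<bar> * \<bar>e s\<bar> \<le> (d s)\<^sup>2 + (e s)\<^sup>2" by (simp add: power2_diff)
      qed (use bp cc_max_ge in \<open>simp add: M_def\<close>)
      finally show ?thesis .
    qed
    have "(d s)\<^sup>2 + (e s)\<^sup>2 \<le> 0"
    proof (rule Gronwall_zero[of "1/2-\<delta>" "1/2+\<delta>" "\<lambda>s. (d s)\<^sup>2 + (e s)\<^sup>2" "\<lambda>s. 2 * d s * d' s + 2 * e s * e' s" M "1/2"])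
      show "((\<lambda>s. (d s)\<^sup>2 + (e s)\<^sup>2) has_real_derivative 2 * d t * d' t + 2 * e t * e' t) (at t)"
        if "t \<in> {1/2-\<delta><..<1/2+\<delta>}" for t
        by (auto intro!: derivative_eq_intros dd de simp: U_def that[simplified])
      show "\<bar>2 * d t * d' t + 2 * e t * e' t\<bar> \<le> M * ((d t)\<^sup>2 + (e t)\<^sup>2)" if "t \<in> {1/2-\<delta><..<1/2+\<delta>}" for t
        using bd[of t] that by (simp add: U_def)
      show "(d (1/2))\<^sup>2 + (e (1/2))\<^sup>2 = 0" using z by (simp add: d_def e_def)
    qed (use s \<delta> in \<open>auto simp: U_def\<close>)
    then have "d s = 0" by (simp add: sum_power2_le_zero_iff)
    then show ?thesis by (simp add: d_def)
  qed
  have agree1: "Dx s = Dx (1 - s)" if s: "s \<in> U" for s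
  proof -
    have "((\<lambda>s. - x (1 - s) \<beta>) has_real_derivative Dx s) (at s)"
      by (rule has_field_derivative_transform_within_open[OF d1 U(1) s]) (use U(2)[OF s] in simp, erule agree)
    moreover have "((\<lambda>s. - x (1 - s) \<beta>) has_real_derivative Dx (1 - s)) (at s)"
      using sol' U(2)[OF s] by (simp add: radial_solution_def)
    ultimately show ?thesis by (rule DERIV_unique)
  qed
  have agree2: "x2 s = - x2 (1 - s)" if s: "s \<in> U" for s
  proof -
    have "((\<lambda>s. Dx (1 - s)) has_real_derivative x2 s) (at s)"
      by (rule has_field_derivative_transform_within_open[OF d2 U(1) s]) (use U(2)[OF s] in simp, erule agree1)
    moreover have "((\<lambda>s. Dx (1 - s)) has_real_derivative - x2 (1 - s)) (at s)"
      using sol' U(2)[OF s] by (simp add: radial_solution_def)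
    ultimately show ?thesis by (rule DERIV_unique)
  qed
  define X where "X s = (if s \<le> 1/2 then x s \<beta> else - x (1 - s) \<beta>)" for s
  define X1 where "X1 s = (if s \<le> 1/2 then Dx s else Dx (1 - s))" for s
  define X2 where "X2 s = (if s \<le> 1/2 then x2 s else - x2 (1 - s))" for s
  have inU: "s \<in> U" if "s \<in> I" "\<not> s \<le> 1/2" for s using that \<delta> by (auto simp: I_def U_def)
  have inU': "s \<in> U" if "s \<in> I'" "s \<le> 1/2" for s using that \<delta> by (auto simp: I'_def U_def)
  have XI: "X s = x s \<beta>" "X1 s = Dx s" "X2 s = x2 s" if "s \<in> I" for s
    using agree[OF inU[OF that]] agree1[OF inU[OF that]] agree2[OF inU[OF that]] by (auto simp: X_def X1_def X2_def)
  have XI': "X s = - x (1 - s) \<beta>" "X1 s = Dx (1 - s)" "X2 s = - x2 (1 - s)" if "s \<in> I'" for s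
    using agree[OF inU'[OF that]] agree1[OF inU'[OF that]] agree2[OF inU'[OF that]] by (auto simp: X_def X1_def X2_def)
  have "radial_solution \<beta> (I \<union> I') X X1 X2"
    using radial_solution_cong[OF sol I(1) XI] radial_solution_cong[OF sol' I'(1) XI'] by (auto simp: radial_solution_def)
  moreover have "smooth_on X (I \<union> I')"
  proof (rule smooth_on_union[OF I(1) I'(1)])
    show "smooth_on X I" by (rule smooth_on_cong[OF I(1) _ sx]) (simp add: XI)
    have "smooth_on (\<lambda>s::real. 1 - s) I'" by (intro smooth_on_diff smooth_on_const smooth_on_ident I')
    then have "smooth_on (\<lambda>s. x (1 - s) \<beta>) I'"
      by (rule smooth_on_compose_real[OF I'(1) _ _ sx, rotated]) (use I' in auto)
    then have "smooth_on (\<lambda>s. 0 - x (1 - s) \<beta>) I'" by (intro smooth_on_diff smooth_on_const I')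
    then show "smooth_on X I'" by (rule smooth_on_cong[OF I'(1), rotated]) (simp add: XI')
  qed
  moreover have "{0..1} \<subseteq> I \<union> I'" using \<delta> by (auto simp: I_def I'_def)
  moreover have "X 0 = 1" by (simp add: X_def x0)
  ultimately show ?thesis using I(1) I'(1) by (metis open_Un)
qed

end

lemma ex_radial_solutions:
  "\<exists>\<beta>\<ge>B. \<beta> > 0 \<and> (\<exists>I X X1 X2. open I \<and> {0..1} \<subseteq> I \<and> smooth_on X I \<and> X 0 = 1 \<and> radial_solution \<beta> I X X1 X2)"
proof -
  obtain x J where "radial_family x J" using ex_radial_family by blast
  then interpret radial_family x J .
  obtain \<beta> where "\<beta> \<ge> max B beta0" "x (1/2) \<beta> = 0" using ex_zero_at_half by blast
  then show ?thesis using odd_reflection[of \<beta>] beta0_ge by (intro exI[of _ \<beta>]) auto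
qed

lemma CR_Yamabe_of_radial_solution:
  assumes \<beta>: "\<beta> > 0" and I: "{0..1} \<subseteq> I" "smooth_on X I" "open I" and sol: "radial_solution \<beta> I X X1 X2"
  shows "CR_Yamabe_solution H0 theta0 (\<lambda>p. sqrt (\<beta> / kk) * X (ss p))"
  unfolding CR_Yamabe_solution_def
proof (intro conjI ballI)
  define c where "c = sqrt (\<beta> / kk)"
  have c2: "c * c = \<beta> / kk" using \<beta> kk_pos by (simp add: c_def)
  have d1: "((\<lambda>s. c * X s) has_real_derivative c * X1 s) (at s)" if "s \<in> I" for s
    using sol that by (auto simp: radial_solution_def intro: DERIV_cmult)
  have d2: "((\<lambda>s. c * X1 s) has_real_derivative c * X2 s) (at s)" if "s \<in> I" for s
    using sol that by (auto simp: radial_solution_def intro: DERIV_cmult)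
  have "{0..1} \<subseteq> I" by (rule I)
  then have inI: "ss p \<in> I" if "p \<in> S3" for p using ss_range[OF that] by auto
  have Ck: "smooth_on (\<lambda>s. c * X s) I"
    by (rule smooth_on_bounded_linear[OF I(3) bounded_linear_mult_right I(2)])
  show "smooth_S3 (\<lambda>p. c * X (ss p)) S3"
    by (rule smooth_S3_compose_real[OF open_S3_UNIV _ smooth_S3_ss[OF open_S3_UNIV] Ck]) (rule inI)
  fix p :: "real^4" assume p: "p \<in> S3"
  let ?s = "ss p"
  have L: "sublaplacian H0 theta0 (\<lambda>p. c * X (ss p)) p = 2 / kk * (?s * (1 - ?s) * (c * X2 ?s) + (1 - 2 * ?s) * (c * X1 ?s))"
    by (rule sublaplacian_H0(2)[OF p I(1) Ck d1 d2[OF inI[OF p]]])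
  have eq: "4 * (?s * (1 - ?s) * X2 ?s + (1 - 2 * ?s) * X1 ?s) = cc ?s * X ?s - \<beta> * X ?s ^ 3"
    using sol inI[OF p] by (simp add: radial_solution_def)
  have L': "sublaplacian H0 theta0 (\<lambda>p. c * X (ss p)) p = c / (2 * kk) * (cc ?s * X ?s - \<beta> * X ?s ^ 3)"
  proof -
    have "2 / kk * (y * (c * a2) + z * (c * a1)) = c / (2 * kk) * (4 * (y * a2 + z * a1))" for y z a1 a2
      using kk_pos by (simp add: divide_simps) (simp add: algebra_simps)
    then show ?thesis unfolding L eq[symmetric] .
  qed
  have R: "Webster_curvature H0 theta0 p = 2 / kk * cc ?s"
  proof -
    have "(2 + kk\<^sup>2 * y) / kk = 2 / kk * (1 + kk\<^sup>2 / 2 * y)" for y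
      by (simp add: distrib_left add_divide_distrib)
    then show ?thesis unfolding Webster_curvature_H0[OF p] cc_def .
  qed
  have "conformal_sublaplacian H0 theta0 (\<lambda>p. c * X (ss p)) p = 2 * (\<beta> / kk) * c * X ?s ^ 3"
    unfolding conformal_sublaplacian_def L' R using kk_pos by (simp add: field_simps)
  also have "\<dots> = 2 * (c * X ?s) ^ 3" unfolding c2[symmetric] by (simp add: power3_eq_cube)
  finally show "conformal_sublaplacian H0 theta0 (\<lambda>p. c * X (ss p)) p = 2 * (c * X ?s) ^ 3" .
qed

section \<open>A loop between two tori\<close>

lemma ff_gg_half: "ff (1/2 + t) + gg (1/2 + t) = sqrt 2 * cos (kk * t)"
proof -
  have 1: "kk * (1/2 + t) = (pi / 4 + kk * t) + 2 * pi" by (simp add: kk_def field_simps)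
  show ?thesis unfolding 1 sin_periodic cos_periodic sin_add cos_add cos_45 sin_45 by (simp add: algebra_simps)
qed

lemma cos_signs: "0 < t \<Longrightarrow> t < 1/9 \<Longrightarrow> cos (kk * t) > 0" "1/9 \<le> t \<Longrightarrow> t \<le> 1/3 \<Longrightarrow> cos (kk * t) \<le> 0"
proof -
  show "cos (kk * t) > 0" if "0 < t" "t < 1/9"
  proof (rule cos_gt_zero)
    show "0 < kk * t" using that kk_pos by simp
    have "kk * t < kk * (1/9)" using that kk_pos by (intro mult_strict_left_mono) auto
    then show "kk * t < pi / 2" by (simp add: kk_def)
  qed
  show "cos (kk * t) \<le> 0" if "1/9 \<le> t" "t \<le> 1/3"
  proof -
    have "kk * (1/9) \<le> kk * t" "kk * t \<le> kk * (1/3)" using that kk_pos by (auto intro!: mult_left_mono)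
    moreover have "kk * (1/9) = pi / 2" "kk * (1/3) = pi + pi / 2" by (simp_all add: kk_def)
    ultimately have "0 \<le> cos (kk * t - pi)" by (intro cos_ge_zero) linarith+
    then show ?thesis by (simp add: cos_diff)
  qed
qed

text \<open>
  By the symmetry \<open>ff (1 - s) = gg s\<close>, both increments over \<open>[1/2 - t, 1/2 + t]\<close> equal the integral of
  \<open>sqrt 2 * cos (kk r) / lamh r\<close> over \<open>[0, t]\<close>, with \<open>lamh r = 2 (1/4 - r\<^sup>2)\<close>. The cosine is positive up to
  \<open>1/9\<close> and then negative up to \<open>1/3\<close>, over twice the length; as \<open>1 / lamh\<close> increases, the negative part
  prevails at \<open>t = 1/3\<close>, and the integral vanishes for some \<open>t\<close> between.
\<close>

lemma ex_loop:
  obtains \<tau> \<Gamma>1 \<Gamma>2 where "0 < \<tau>" "\<tau> < 1/3"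
    "\<And>s. s \<in> {1/6<..<5/6} \<Longrightarrow> (\<Gamma>1 has_real_derivative gg s / (2 * (s * (1 - s)))) (at s)"
    "\<And>s. s \<in> {1/6<..<5/6} \<Longrightarrow> (\<Gamma>2 has_real_derivative ff s / (2 * (s * (1 - s)))) (at s)"
    "\<Gamma>1 (1/2 - \<tau>) = \<Gamma>1 (1/2 + \<tau>)" "\<Gamma>2 (1/2 - \<tau>) = \<Gamma>2 (1/2 + \<tau>)"
proof -
  let ?I = "{1/6..5/6::real}"
  have ne: "2 * (s * (1 - s)) \<noteq> 0" if "s \<in> ?I" for s :: real using that by auto
  have c0: "continuous_on ?I (\<lambda>s. gg s / (2 * (s * (1 - s))))" "continuous_on ?I (\<lambda>s. ff s / (2 * (s * (1 - s))))"
    by (intro continuous_intros ballI ne; assumption)+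
  obtain \<Gamma>1 where G1: "\<And>s. s \<in> ?I \<Longrightarrow> (\<Gamma>1 has_vector_derivative gg s / (2 * (s * (1 - s)))) (at s within ?I)"
    using antiderivative_continuous[OF c0(1)] by blast
  obtain \<Gamma>2 where G2: "\<And>s. s \<in> ?I \<Longrightarrow> (\<Gamma>2 has_vector_derivative ff s / (2 * (s * (1 - s)))) (at s within ?I)"
    using antiderivative_continuous[OF c0(2)] by blast
  have at: "(\<Gamma> has_real_derivative d) (at s)" if "(\<Gamma> has_vector_derivative d) (at s within ?I)" "s \<in> {1/6<..<5/6}" for \<Gamma> d s
  proof -
    have "at s within ?I = at s" by (rule at_within_interior) (use that(2) in \<open>simp add: interior_atLeastAtMost_real\<close>)
    then show ?thesis using that(1) by (simp only: has_real_derivative_iff_has_vector_derivative)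
  qed
  have D1: "(\<Gamma>1 has_real_derivative gg s / (2 * (s * (1 - s)))) (at s)" if "s \<in> {1/6<..<5/6}" for s
    using at[OF G1 that] that by auto
  have D2: "(\<Gamma>2 has_real_derivative ff s / (2 * (s * (1 - s)))) (at s)" if "s \<in> {1/6<..<5/6}" for s
    using at[OF G2 that] that by auto
  have c1: "continuous_on ?I \<Gamma>1" "continuous_on ?I \<Gamma>2"
    using continuous_on_vector_derivative[OF G1] continuous_on_vector_derivative[OF G2] by auto
  have shift: "(\<lambda>t. 1/2 + t) ` {0..1/3} \<subseteq> ?I" "(\<lambda>t. 1/2 - t) ` {0..1/3::real} \<subseteq> ?I" by auto
  have cs: "continuous_on {0..1/3} (\<lambda>t. \<Gamma> (1/2 + t))" "continuous_on {0..1/3} (\<lambda>t. \<Gamma> (1/2 - t))"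
    if "continuous_on ?I \<Gamma>" for \<Gamma> :: "real \<Rightarrow> real"
    by (rule continuous_on_compose2[OF that _ shift(1)], intro continuous_intros)
       (rule continuous_on_compose2[OF that _ shift(2)], intro continuous_intros)
  define A where "A t = \<Gamma>1 (1/2 + t) - \<Gamma>1 (1/2 - t)" for t
  define B where "B t = \<Gamma>2 (1/2 + t) - \<Gamma>2 (1/2 - t)" for t
  have cAB: "continuous_on {0..1/3} A" "continuous_on {0..1/3} B" unfolding A_def[abs_def] B_def[abs_def]
    by (intro continuous_on_diff cs c1)+
  define lamh where "lamh t = 2 * (1/4 - t\<^sup>2)" for t :: real
  have lam: "2 * ((1/2 + t) * (1 - (1/2 + t))) = lamh t" "2 * ((1/2 - t) * (1 - (1/2 - t))) = lamh t" for t
    by (simp_all add: lamh_def power2_eq_square algebra_simps)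
  have refl: "ff (1/2 - t) = gg (1/2 + t)" "gg (1/2 - t) = ff (1/2 + t)" for t
    using ff_gg_reflect[of "1/2 + t"] by (simp_all add: algebra_simps)
  have dAB: "(A has_real_derivative sqrt 2 * cos (kk * t) / lamh t) (at t)" "(B has_real_derivative sqrt 2 * cos (kk * t) / lamh t) (at t)"
    if t: "0 < t" "t < 1/3" for t
  proof -
    have p: "((\<lambda>t. 1/2 + t) has_real_derivative 1) (at t)" "((\<lambda>t. 1/2 - t) has_real_derivative -1) (at t)"
      by (auto intro!: derivative_eq_intros)
    have i: "1/2 + t \<in> {1/6<..<5/6}" "1/2 - t \<in> {1/6<..<5/6}" using t by auto
    have "gg (1/2 + t) / lamh t * 1 - gg (1/2 - t) / lamh t * -1 = sqrt 2 * cos (kk * t) / lamh t"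
      "ff (1/2 + t) / lamh t * 1 - ff (1/2 - t) / lamh t * -1 = sqrt 2 * cos (kk * t) / lamh t"
      unfolding refl ff_gg_half[symmetric] by (simp_all add: add_divide_distrib)
    then show "(A has_real_derivative sqrt 2 * cos (kk * t) / lamh t) (at t)" "(B has_real_derivative sqrt 2 * cos (kk * t) / lamh t) (at t)"
      using DERIV_diff[OF DERIV_chain2[OF D1[OF i(1)] p(1)] DERIV_chain2[OF D1[OF i(2)] p(2)]]
        DERIV_diff[OF DERIV_chain2[OF D2[OF i(1)] p(1)] DERIV_chain2[OF D2[OF i(2)] p(2)]]
      unfolding lam A_def[abs_def] B_def[abs_def] by simp_all
  qed
  have lpos: "lamh t > 0" if "0 \<le> t" "t \<le> 1/3" for t
  proof -
    have "t\<^sup>2 \<le> (1/3)\<^sup>2" using that by (intro power_mono) auto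
    then show ?thesis by (simp add: lamh_def power2_eq_square)
  qed
  have A0: "A 0 = 0" "B 0 = 0" by (simp_all add: A_def B_def)
  have AB: "A t = B t" if "0 \<le> t" "t \<le> 1/3" for t
  proof (cases "t = 0")
    case False
    then have t0: "0 < t" using that by simp
    have "continuous_on {0..t} (\<lambda>t. A t - B t)"
      by (intro continuous_on_diff continuous_on_subset[OF cAB(1)] continuous_on_subset[OF cAB(2)]) (use that in auto)
    moreover have "((\<lambda>t. A t - B t) has_real_derivative 0) (at r)" if r: "0 < r" "r < t" for r
      using DERIV_diff[OF dAB(1) dAB(2), of r] r \<open>t \<le> 1/3\<close> by simp
    ultimately have "A t - B t = A 0 - B 0" by (rule DERIV_isconst_end[OF t0])
    then show ?thesis using A0 by simp
  qed (use A0 in simp)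
  have pos: "A 0 < A (1/9)"
  proof (rule DERIV_pos_imp_increasing_open[where f = A and a = 0 and b = "1/9"])
    show "continuous_on {0..1/9} A" by (rule continuous_on_subset[OF cAB(1)]) auto
    fix t :: real assume t: "0 < t" "t < 1/9"
    then show "\<exists>y. (A has_real_derivative y) (at t) \<and> 0 < y"
      using dAB(1)[of t] cos_signs(1)[OF t] lpos[of t] by (intro exI[of _ "sqrt 2 * cos (kk * t) / lamh t"]) auto
  qed simp
  \<comment> \<open>Replacing \<open>1 / lamh\<close> by its value at the zero \<open>1/9\<close> of the cosine increases the integral.\<close>
  define C where "C = sqrt 2 / lamh (1/9)"
  have Cp: "C > 0" using lpos[of "1/9"] by (simp add: C_def)
  define h where "h t = A t - C * (sin (kk * t) / kk)" for t
  have "h (1/3) \<le> h 0"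
  proof (rule DERIV_nonpos_imp_decreasing_open[where f = h and a = 0 and b = "1/3"])
    show "continuous_on {0..1/3} h" unfolding h_def[abs_def] using kk_pos by (intro continuous_intros cAB) auto
    fix t :: real assume t: "0 < t" "t < 1/3"
    have "(h has_real_derivative sqrt 2 * cos (kk * t) / lamh t - C * cos (kk * t)) (at t)"
      unfolding h_def[abs_def] using kk_pos by (auto intro!: derivative_eq_intros dAB t)
    moreover have "sqrt 2 * cos (kk * t) / lamh t - C * cos (kk * t) = sqrt 2 * (cos (kk * t) * (1 / lamh t - 1 / lamh (1/9)))"
      by (simp add: C_def algebra_simps)
    moreover have "cos (kk * t) * (1 / lamh t - 1 / lamh (1/9)) \<le> 0"
    proof (cases "t < 1/9")
      case True
      have "t\<^sup>2 \<le> (1/9)\<^sup>2" using True t by (intro power_mono) auto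
      then have "1 / lamh t \<le> 1 / lamh (1/9)" using lpos[of "1/9"] by (intro divide_left_mono mult_pos_pos lpos) (use t in \<open>auto simp: lamh_def\<close>)
      then show ?thesis using cos_signs(1)[of t] True t by (intro mult_nonneg_nonpos) auto
    next
      case False
      have "(1/9)\<^sup>2 \<le> t\<^sup>2" using False t by (intro power_mono) auto
      then have "1 / lamh (1/9) \<le> 1 / lamh t" using lpos[of t] by (intro divide_left_mono mult_pos_pos lpos) (use t in \<open>auto simp: lamh_def\<close>)
      then show ?thesis using cos_signs(2)[of t] False t by (intro mult_nonpos_nonneg) auto
    qed
    ultimately show "\<exists>y. (h has_real_derivative y) (at t) \<and> y \<le> 0"
      by (intro exI[of _ "sqrt 2 * cos (kk * t) / lamh t - C * cos (kk * t)"]) (auto simp: mult_le_0_iff)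
  qed simp
  moreover have "sin (kk * (1/3)) = -1"
  proof -
    have e: "kk * (1/3) = pi + pi / 2" by (simp add: kk_def)
    show ?thesis unfolding e sin_add by simp
  qed
  ultimately have "A (1/3) \<le> - (C / kk)" using A0 by (simp add: h_def)
  moreover have "C / kk > 0" using Cp kk_pos by simp
  ultimately have neg: "A (1/3) < 0" by linarith
  have "\<exists>t. 1/9 \<le> t \<and> t \<le> 1/3 \<and> A t = 0"
    by (rule IVT2') (use pos A0 neg continuous_on_subset[OF cAB(1)] in auto)
  then obtain \<tau> where \<tau>: "1/9 \<le> \<tau>" "\<tau> \<le> 1/3" "A \<tau> = 0" by blast
  show thesis
  proof (rule that[OF _ _ D1 D2])
    show "0 < \<tau>" using \<tau> by simp
    show "\<tau> < 1/3" using \<tau> neg by (cases "\<tau> = 1/3") auto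
    show "\<Gamma>1 (1/2 - \<tau>) = \<Gamma>1 (1/2 + \<tau>)" using \<tau> by (simp add: A_def)
    show "\<Gamma>2 (1/2 - \<tau>) = \<Gamma>2 (1/2 + \<tau>)" using \<tau> AB[of \<tau>] by (simp add: B_def)
  qed
qed

section \<open>Fourier coefficients on the torus\<close>

text \<open>
  Points with \<open>\<bar>w\<^sub>1\<bar> = \<bar>w\<^sub>2\<bar> = 1\<close>, by their angles; \<open>scale_pt s\<close> will move them to the torus \<open>ss = s\<close>.
\<close>

definition torus_pt :: "real \<times> real \<Rightarrow> real^4" where
  "torus_pt t = axis 1 (cos (fst t)) + axis 2 (sin (fst t)) + axis 3 (cos (snd t)) + axis 4 (sin (snd t))"

abbreviation tbox :: "(real \<times> real) set" where "tbox \<equiv> cbox (0, 0) (2 * pi, 2 * pi)"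

definition mode :: "int \<Rightarrow> int \<Rightarrow> real \<times> real \<Rightarrow> complex" where
  "mode m n t = cis (- (of_int m * fst t + of_int n * snd t))"

lemma continuous_torus_pt: "continuous_on A torus_pt"
proof -
  have ax: "continuous_on A (\<lambda>t. axis i (f t) :: real^4)" if "continuous_on A f" for f :: "real \<times> real \<Rightarrow> real" and i
    by (rule continuous_on_compose2[OF linear_continuous_on[of "axis i :: real \<Rightarrow> real^4"] that])
       (auto intro!: linearI linear_conv_bounded_linear[THEN iffD1] simp: vec_eq_iff axis_def)
  show ?thesis unfolding torus_pt_def[abs_def] by (intro continuous_on_add ax continuous_intros)
qed

lemma continuous_mode: "continuous_on A (mode m n)"
  unfolding mode_def[abs_def] cis_conv_exp by (intro continuous_intros)

text \<open>
  Functions on the torus are given on its image in \<open>\<real>\<^sup>4\<close>, where polynomials in the coordinates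
  approximate them.
\<close>

definition fourier_zero :: "(real^4 \<Rightarrow> complex) \<Rightarrow> bool" where
  "fourier_zero D \<longleftrightarrow> continuous_on (torus_pt ` tbox) D \<and>
     (\<forall>m n. integral tbox (\<lambda>t. D (torus_pt t) * mode m n t) = 0)"

lemma continuous_on_torus: "continuous_on (torus_pt ` tbox) D \<Longrightarrow> continuous_on tbox (\<lambda>t. D (torus_pt t))"
  by (rule continuous_on_compose2[OF _ continuous_torus_pt]) auto

lemma integrable_torus: "continuous_on (torus_pt ` tbox) D \<Longrightarrow> (\<lambda>t. D (torus_pt t) * mode m n t) integrable_on tbox"
  by (intro integrable_continuous continuous_on_mult continuous_on_torus continuous_mode)

lemma fourier_zero_combine:
  assumes "fourier_zero D" "fourier_zero E" shows "fourier_zero (\<lambda>x. c * D x + d * E x)"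
  unfolding fourier_zero_def
proof (intro conjI allI)
  have c: "continuous_on (torus_pt ` tbox) D" "continuous_on (torus_pt ` tbox) E"
    using assms by (auto simp: fourier_zero_def)
  then show "continuous_on (torus_pt ` tbox) (\<lambda>x. c * D x + d * E x)" by (intro continuous_intros)
  fix m n
  have "integral tbox (\<lambda>t. (c * D (torus_pt t) + d * E (torus_pt t)) * mode m n t) =
     integral tbox (\<lambda>t. c * (D (torus_pt t) * mode m n t) + d * (E (torus_pt t) * mode m n t))"
    by (rule integral_cong) (simp add: algebra_simps)
  also have "\<dots> = c * integral tbox (\<lambda>t. D (torus_pt t) * mode m n t) + d * integral tbox (\<lambda>t. E (torus_pt t) * mode m n t)"
    by (subst integral_add) (auto intro!: integrable_on_mult_right integrable_torus c)
  also have "\<dots> = 0" using assms by (simp add: fourier_zero_def)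
  finally show "integral tbox (\<lambda>t. (c * D (torus_pt t) + d * E (torus_pt t)) * mode m n t) = 0" .
qed

lemma torus_pt_nth: "torus_pt t $ 1 = cos (fst t)" "torus_pt t $ 2 = sin (fst t)" "torus_pt t $ 3 = cos (snd t)" "torus_pt t $ 4 = sin (snd t)"
  by (simp_all add: torus_pt_def axis_def)

text \<open>
  A coordinate is a combination of two exponentials, so it shifts the Fourier indices.
\<close>

lemma fourier_zero_coord:
  assumes D: "fourier_zero D" shows "fourier_zero (\<lambda>x. of_real (x $ i) * D x)"
  unfolding fourier_zero_def
proof (intro conjI allI)
  have c: "continuous_on (torus_pt ` tbox) D" using D by (auto simp: fourier_zero_def)
  then show "continuous_on (torus_pt ` tbox) (\<lambda>x. of_real (x $ i) * D x)" by (intro continuous_intros)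
  fix m n
  have zero: "integral tbox (\<lambda>t. c * (D (torus_pt t) * mode m' n' t) + d * (D (torus_pt t) * mode m'' n'' t)) = 0" for c d m' n' m'' n''
    using D by (subst integral_add) (auto intro!: integrable_on_mult_right integrable_torus c simp: fourier_zero_def)
  have cs: "complex_of_real (cos r) * cis q = (1/2) * cis (r + q) + (1/2) * cis (q - r)"
    "complex_of_real (sin r) * cis q = (- \<i>/2) * cis (r + q) + (\<i>/2) * cis (q - r)" for r q
    by (simp_all add: complex_eq_iff cos_add sin_add cos_diff sin_diff field_simps)
  have sh: "u + - (of_int m * u + of_int n * v) = - (of_int (m - 1) * u + of_int n * v)"
    "- (of_int m * u + of_int n * v) - u = - (of_int (m + 1) * u + of_int n * v)"
    "v + - (of_int m * u + of_int n * v) = - (of_int m * u + of_int (n - 1) * v)"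
    "- (of_int m * u + of_int n * v) - v = - (of_int m * u + of_int (n + 1) * v)" for u v :: real
    by (simp_all add: algebra_simps)
  have "\<exists>c d m' n' m'' n''. \<forall>t. of_real (torus_pt t $ i) * mode m n t = c * mode m' n' t + d * mode m'' n'' t"
  proof -
    consider "i = 1" | "i = 2" | "i = 3" | "i = 4" using exhaust_4 by blast
    then show ?thesis
    proof cases
      case 1
      have "of_real (torus_pt t $ i) * mode m n t = (1/2) * mode (m - 1) n t + (1/2) * mode (m + 1) n t" for t
        unfolding 1 torus_pt_nth mode_def cs sh ..
      then show ?thesis by blast
    next
      case 2
      have "of_real (torus_pt t $ i) * mode m n t = (- \<i>/2) * mode (m - 1) n t + (\<i>/2) * mode (m + 1) n t" for t
        unfolding 2 torus_pt_nth mode_def cs sh ..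
      then show ?thesis by blast
    next
      case 3
      have "of_real (torus_pt t $ i) * mode m n t = (1/2) * mode m (n - 1) t + (1/2) * mode m (n + 1) t" for t
        unfolding 3 torus_pt_nth mode_def cs sh ..
      then show ?thesis by blast
    next
      case 4
      have "of_real (torus_pt t $ i) * mode m n t = (- \<i>/2) * mode m (n - 1) t + (\<i>/2) * mode m (n + 1) t" for t
        unfolding 4 torus_pt_nth mode_def cs sh ..
      then show ?thesis by blast
    qed
  qed
  then obtain c d m' n' m'' n'' where k: "\<And>t. of_real (torus_pt t $ i) * mode m n t = c * mode m' n' t + d * mode m'' n'' t" by blast
  have "of_real (torus_pt t $ i) * D (torus_pt t) * mode m n t = c * (D (torus_pt t) * mode m' n' t) + d * (D (torus_pt t) * mode m'' n'' t)" for t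
  proof -
    have "of_real (torus_pt t $ i) * D (torus_pt t) * mode m n t = D (torus_pt t) * (of_real (torus_pt t $ i) * mode m n t)" by simp
    then show ?thesis unfolding k by (simp add: algebra_simps)
  qed
  then show "integral tbox (\<lambda>t. of_real (torus_pt t $ i) * D (torus_pt t) * mode m n t) = 0"
    using zero by simp
qed

lemma fourier_zero_polynomial:
  assumes "real_polynomial_function p" shows "fourier_zero D \<Longrightarrow> fourier_zero (\<lambda>x. of_real (p x) * D x)"
  using assms
proof (induction p arbitrary: D rule: real_polynomial_function.induct)
  case (linear p)
  define a where "a j = p (axis j 1)" for j
  have e: "p x = (\<Sum>j\<in>UNIV. x $ j * a j)" for x :: "real^4"
  proof -
    note l = bounded_linear.linear[OF linear(1)]
    have "(\<Sum>j\<in>UNIV. (x $ j) *\<^sub>R axis j 1) = x" using basis_expansion[of x] by (simp add: scalar_mult_eq_scaleR)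
    then have "p x = p (\<Sum>j\<in>UNIV. (x $ j) *\<^sub>R axis j 1)" by simp
    also have "\<dots> = (\<Sum>j\<in>UNIV. x $ j * a j)" unfolding linear_sum[OF l] linear_scale[OF l] a_def by simp
    finally show ?thesis .
  qed
  have "fourier_zero (\<lambda>x. 1 * (of_real (a 1) * (of_real (x $ 1) * D x) + of_real (a 2) * (of_real (x $ 2) * D x))
     + 1 * (of_real (a 3) * (of_real (x $ 3) * D x) + of_real (a 4) * (of_real (x $ 4) * D x)))"
    by (intro fourier_zero_combine fourier_zero_coord linear(2))
  then show ?case by (simp add: e sum_4 algebra_simps)
next
  case (const c)
  then show ?case using fourier_zero_combine[of D D "of_real c" 0] by simp
next
  case (add f g)
  have "fourier_zero (\<lambda>x. 1 * (of_real (f x) * D x) + 1 * (of_real (g x) * D x))"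
    by (intro fourier_zero_combine add)
  then show ?case by (simp add: algebra_simps)
next
  case (mult f g)
  then show ?case using mult.IH(1)[OF mult.IH(2)[OF mult.prems]] by (simp add: algebra_simps)
qed

text \<open>
  By the preceding lemma \<open>D\<close> is orthogonal to all polynomials; by the theorem of Stone and Weierstrass it
  is orthogonal to its own real and imaginary part, so the integral of \<open>\<bar>D\<bar>\<^sup>2\<close> is zero.
\<close>

lemma fourier_zero_imp_zero:
  assumes D: "fourier_zero D" and t: "t \<in> tbox" shows "D (torus_pt t) = 0"
proof -
  let ?T = "torus_pt ` tbox"
  have c: "continuous_on ?T D" using D by (auto simp: fourier_zero_def)
  have compact: "compact ?T" by (intro compact_continuous_image continuous_torus_pt compact_cbox)
  have I0: "integral tbox (\<lambda>t. of_real (p (torus_pt t)) * D (torus_pt t)) = 0" if "real_polynomial_function p" for p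
    using fourier_zero_polynomial[OF that D] by (auto simp: fourier_zero_def mode_def dest!: spec[of _ "0::int"])
  have cD: "continuous_on tbox (\<lambda>t. D (torus_pt t))" by (rule continuous_on_torus[OF c])
  have R0: "integral tbox (\<lambda>t. of_real (r (torus_pt t)) * D (torus_pt t)) = 0" if r: "continuous_on ?T r" for r :: "real^4 \<Rightarrow> real"
  proof -
    obtain Mx where Mx: "\<And>t. t \<in> tbox \<Longrightarrow> norm (D (torus_pt t)) \<le> Mx" "Mx > 0"
    proof -
      obtain b where "b > 0" "\<And>z. z \<in> (\<lambda>t. D (torus_pt t)) ` tbox \<Longrightarrow> norm z \<le> b"
        using compact_imp_bounded[OF compact_continuous_image[OF cD compact_cbox]] unfolding bounded_pos by blast
      then show thesis by (intro that[of b]) blast+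
    qed
    have cr: "continuous_on tbox (\<lambda>t. r (torus_pt t))"
      by (rule continuous_on_compose2[OF r continuous_torus_pt]) auto
    define A where "A = Mx * measure lborel tbox"
    have le: "norm (integral tbox (\<lambda>t. of_real (r (torus_pt t)) * D (torus_pt t))) \<le> e * A" if e: "e > 0" for e
    proof -
      obtain g where g: "real_polynomial_function g" "\<And>x. x \<in> ?T \<Longrightarrow> \<bar>r x - g x\<bar> < e"
        using Stone_Weierstrass_real_polynomial_function[OF compact r e] by blast
      have cg: "continuous_on tbox (\<lambda>t. g (torus_pt t))"
        by (rule continuous_on_compose2[OF continuous_on_polymonial_function continuous_torus_pt])
           (use g(1) in \<open>auto simp: real_polynomial_function_eq\<close>)
      have "integral tbox (\<lambda>t. of_real (r (torus_pt t)) * D (torus_pt t)) =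
        integral tbox (\<lambda>t. of_real (r (torus_pt t)) * D (torus_pt t)) - integral tbox (\<lambda>t. of_real (g (torus_pt t)) * D (torus_pt t))"
        using I0[OF g(1)] by simp
      also have "\<dots> = integral tbox (\<lambda>t. of_real (r (torus_pt t)) * D (torus_pt t) - of_real (g (torus_pt t)) * D (torus_pt t))"
        by (rule integral_diff[symmetric]) (intro integrable_continuous continuous_intros cr cg cD)+
      finally have E: "integral tbox (\<lambda>t. of_real (r (torus_pt t)) * D (torus_pt t)) =
        integral tbox (\<lambda>t. of_real (r (torus_pt t)) * D (torus_pt t) - of_real (g (torus_pt t)) * D (torus_pt t))" .
      have "norm (integral tbox (\<lambda>t. of_real (r (torus_pt t)) * D (torus_pt t) - of_real (g (torus_pt t)) * D (torus_pt t))) \<le> (e * Mx) * measure lborel tbox"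
      proof (rule integrable_bound)
        show "(\<lambda>t. of_real (r (torus_pt t)) * D (torus_pt t) - of_real (g (torus_pt t)) * D (torus_pt t)) integrable_on tbox"
          by (intro integrable_continuous continuous_intros cr cg cD)
        fix t assume t: "t \<in> tbox"
        have "norm (of_real (r (torus_pt t)) * D (torus_pt t) - of_real (g (torus_pt t)) * D (torus_pt t)) =
           \<bar>r (torus_pt t) - g (torus_pt t)\<bar> * norm (D (torus_pt t))"
          by (simp add: left_diff_distrib[symmetric] norm_mult flip: of_real_diff)
        also have "\<dots> \<le> e * Mx" using g(2)[of "torus_pt t"] Mx(1)[OF t] t e by (intro mult_mono) (auto intro: less_imp_le)
        finally show "norm (of_real (r (torus_pt t)) * D (torus_pt t) - of_real (g (torus_pt t)) * D (torus_pt t)) \<le> e * Mx" .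
      qed (use e Mx in simp)
      then show ?thesis unfolding E A_def by (simp add: mult.assoc)
    qed
    have "norm (integral tbox (\<lambda>t. of_real (r (torus_pt t)) * D (torus_pt t))) \<le> 0 + e" if "e > 0" for e
    proof -
      have A: "A \<ge> 0" using Mx by (simp add: A_def)
      have "e / (A + 1) * A \<le> e" using that A by (simp add: field_simps)
      then show ?thesis using le[of "e / (A + 1)"] that A by simp
    qed
    then have "norm (integral tbox (\<lambda>t. of_real (r (torus_pt t)) * D (torus_pt t))) \<le> 0" by (rule field_le_epsilon)
    then show ?thesis by simp
  qed
  have cRe: "continuous_on ?T (\<lambda>x. Re (D x))" "continuous_on ?T (\<lambda>x. Im (D x))" by (intro continuous_on_Re continuous_on_Im c)+
  define q where "q t = (cmod (D (torus_pt t)))\<^sup>2" for t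
  have cq: "continuous_on tbox q" unfolding q_def by (intro continuous_intros cD)
  have iq: "q integrable_on tbox" by (rule integrable_continuous[OF cq])
  have "integral tbox (\<lambda>t. of_real (Re (D (torus_pt t))) * D (torus_pt t)) - \<i> * integral tbox (\<lambda>t. of_real (Im (D (torus_pt t))) * D (torus_pt t)) = 0"
    using R0[OF cRe(1)] R0[OF cRe(2)] by simp
  moreover have "integral tbox (\<lambda>t. of_real (Re (D (torus_pt t))) * D (torus_pt t)) - \<i> * integral tbox (\<lambda>t. of_real (Im (D (torus_pt t))) * D (torus_pt t))
     = integral tbox (\<lambda>t. of_real (Re (D (torus_pt t))) * D (torus_pt t) - \<i> * (of_real (Im (D (torus_pt t))) * D (torus_pt t)))"
    by (subst integral_diff) (auto intro!: integrable_continuous continuous_intros cD)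
  moreover have "of_real (Re z) * z - \<i> * (of_real (Im z) * z) = complex_of_real ((cmod z)\<^sup>2)" for z
    by (simp add: complex_eq_iff cmod_power2) (simp add: power2_eq_square)
  ultimately have "integral tbox (\<lambda>t. complex_of_real (q t)) = 0" by (simp add: q_def)
  moreover have "integral tbox (complex_of_real \<circ> q) = of_real (integral tbox q)"
    by (rule integral_linear[OF iq bounded_linear_of_real])
  ultimately have "integral tbox q = 0" by (simp add: o_def)
  then have "(q has_integral 0) tbox" using iq integrable_integral by metis
  then have "q t = 0"
  proof (rule has_integral_0_cbox_imp_0[OF cq, rotated])
    show "box (0, 0) (2 * pi, 2 * pi) \<noteq> ({} :: (real \<times> real) set)"
      using pi_gt_zero by (auto simp: box_ne_empty Basis_prod_def)
  qed (use t in \<open>auto simp: q_def\<close>)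
  then show ?thesis by (simp add: q_def)
qed

section \<open>Inequivalence to the standard structure\<close>

definition rad1 :: "real^4 \<Rightarrow> real^4" where "rad1 p = axis 1 (p $ 1) + axis 2 (p $ 2)"
definition rad2 :: "real^4 \<Rightarrow> real^4" where "rad2 p = axis 3 (p $ 3) + axis 4 (p $ 4)"

definition scale_pt :: "real \<Rightarrow> real^4 \<Rightarrow> real^4" where
  "scale_pt s p = sqrt s *\<^sub>R rad1 p + sqrt (1 - s) *\<^sub>R rad2 p"

lemma rad_nth [simp]: "rad1 p $ 1 = p $ 1" "rad1 p $ 2 = p $ 2" "rad1 p $ 3 = 0" "rad1 p $ 4 = 0"
  "rad2 p $ 1 = 0" "rad2 p $ 2 = 0" "rad2 p $ 3 = p $ 3" "rad2 p $ 4 = p $ 4"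
  by (simp_all add: rad1_def rad2_def axis_def)

lemma scale_pt_nth: "scale_pt s p $ 1 = sqrt s * p $ 1" "scale_pt s p $ 2 = sqrt s * p $ 2"
  "scale_pt s p $ 3 = sqrt (1 - s) * p $ 3" "scale_pt s p $ 4 = sqrt (1 - s) * p $ 4"
  by (simp_all add: scale_pt_def)

lemma vec4_eqI: "x $ 1 = y $ 1 \<Longrightarrow> x $ 2 = y $ 2 \<Longrightarrow> x $ 3 = y $ 3 \<Longrightarrow> x $ 4 = y $ 4 \<Longrightarrow> x = (y :: 'a^4)"
  by (simp add: vec_eq_iff forall_4)

lemma scale_pt_S3:
  assumes "0 \<le> s" "s \<le> 1" shows "scale_pt s (torus_pt t) \<in> S3" "ss (scale_pt s (torus_pt t)) = s"
proof -
  show 1: "ss (scale_pt s (torus_pt t)) = s"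
    using assms by (simp add: ss_def scale_pt_nth torus_pt_nth power_mult_distrib flip: distrib_left)
  have "(scale_pt s (torus_pt t) $ 3)\<^sup>2 + (scale_pt s (torus_pt t) $ 4)\<^sup>2 = 1 - s"
    using assms by (simp add: scale_pt_nth torus_pt_nth power_mult_distrib flip: distrib_left)
  then have "scale_pt s (torus_pt t) \<bullet> scale_pt s (torus_pt t) = 1"
    using 1 by (simp add: inner_vec_def sum_4 ss_def power2_eq_square)
  then show "scale_pt s (torus_pt t) \<in> S3" by (simp add: norm_eq_sqrt_inner)
qed

text \<open>
  The field \<open>(1 - s) rad1 - s rad2\<close> is \<open>2 s (1 - s) \<partial>\<^sub>s\<close>, where \<open>\<partial>\<^sub>s\<close> is the velocity of \<open>scale_pt s\<close>.
\<close>

lemma W0_on_torus: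
  assumes p: "p \<in> S3"
  shows "(w1 p * w2 p) *s W0 p = cvec ((1 - ss p) *\<^sub>R rad1 p - ss p *\<^sub>R rad2 p) - \<i> *s cvec (gg (ss p) *\<^sub>R rot1 p - ff (ss p) *\<^sub>R rot2 p)"
    (is "?L = ?R")
proof -
  have eqI: "u = v" if "pairing dw1 u = pairing dw1 v" "pairing (cnjv dw1) u = pairing (cnjv dw1) v"
    "pairing dw2 u = pairing dw2 v" "pairing (cnjv dw2) u = pairing (cnjv dw2) v" for u v
  proof -
    have e: "pairing dw1 z = z $ 1 + \<i> * z $ 2" "pairing (cnjv dw1) z = z $ 1 - \<i> * z $ 2"
      "pairing dw2 z = z $ 3 + \<i> * z $ 4" "pairing (cnjv dw2) z = z $ 3 - \<i> * z $ 4" for z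
      by (simp_all add: pairing_def sum_4 dw1_def dw2_def axis_def)
    have h: "a = c \<and> b = d" if "a + \<i> * b = c + \<i> * d" "a - \<i> * b = c - \<i> * d" for a b c d :: complex
    proof -
      have "(a + \<i> * b) + (a - \<i> * b) = (c + \<i> * d) + (c - \<i> * d)" unfolding that ..
      then have "2 * a = 2 * c" by simp
      then have "a = c" by simp
      then show ?thesis using that(1) by simp
    qed
    show ?thesis using h[of "u $ 1" "u $ 2"] h[of "u $ 3" "u $ 4"] that unfolding e by (intro vec4_eqI) blast+
  qed
  have r: "pairing dw1 (cvec (rad1 p)) = w1 p" "pairing (cnjv dw1) (cvec (rad1 p)) = cnj (w1 p)"
    "pairing dw2 (cvec (rad1 p)) = 0" "pairing (cnjv dw2) (cvec (rad1 p)) = 0"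
    "pairing dw1 (cvec (rad2 p)) = 0" "pairing (cnjv dw1) (cvec (rad2 p)) = 0"
    "pairing dw2 (cvec (rad2 p)) = w2 p" "pairing (cnjv dw2) (cvec (rad2 p)) = cnj (w2 p)"
    by (simp_all add: pairing_def sum_4 dw1_def dw2_def axis_def w_eq)
  have m: "cvec (x - y) = cvec x - cvec y" for x y :: "real^4" by (simp add: vec_eq_iff)
  show ?thesis
  proof (rule point_relations[OF p])
    fix a a' b b' s t f g F G C K M N P Q :: complex
    assume q: "w1 p = a" "cnj a = a'" "w2 p = b" "cnj b = b'" "cnj a' = a" "cnj b' = b"
      "of_real (fF (ss p)) = F" "of_real (fG (ss p)) = G" "of_real (fM (ss p)) = M" "of_real (fN (ss p)) = N"
      "of_real (ff (ss p)) = f" "of_real (gg (ss p)) = g" "of_real (ss p) = s" 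
      and e: "s = a * a'" "t = b * b'" "s + t = 1" "F = 1 - t * N" "G = 1 - s * M" "f = s * F" "g = t * G"
    have t: "of_real (1 - ss p) = t" using e(3) q by (simp add: algebra_simps)
    have ii: "\<i> * (u * (\<i> * v)) = - (u * v)" for u v
    proof -
      have "\<i> * (u * (\<i> * v)) = (\<i> * \<i>) * (u * v)" by (simp only: mult_ac)
      then show ?thesis by simp
    qed
    have i: "\<i> * (g * (\<i> * a)) = - g * a" "\<i> * (g * (- (\<i> * a'))) = g * a'"
      "\<i> * (f * (\<i> * b)) = - f * b" "\<i> * (f * (- (\<i> * b'))) = f * b'" by (simp_all add: ii)
    have 1: "a * b * (b' * (1 + G)) = t * a - (- g * a)" "a * b * (b' * (a' * a' * M)) = t * a' - g * a'"
       "a * b * (- a' * (1 + F)) = - (s * b) + (- f * b)" "a * b * (- a' * (b' * b' * N)) = - (s * b') + f * b'"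
      using e(1,2,4-7) by algebra+
    show ?thesis
      by (rule eqI; simp only: pairing_simps m cvec_lin cvec_rot r components_W0 pairing_dual pairing_dual' q t; 
          simp only: mult_1_right mult_zero_right diff_0 diff_0_right add_0 add_0_right i right_diff_distrib; use 1 i in \<open>simp add: algebra_simps\<close>)
  qed
qed

lemma mode_deriv:
  "((\<lambda>a. mode m n (a, b)) has_vector_derivative (- \<i> * of_int m) * mode m n (a, b)) (at a within A)"
  "((\<lambda>b. mode m n (a, b)) has_vector_derivative (- \<i> * of_int n) * mode m n (a, b)) (at b within A)"
proof -
  have e: "mode m n (a, b) = exp ((- \<i> * of_int m) * of_real a + (- \<i> * of_int n) * of_real b)" for a b
    by (simp add: mode_def cis_conv_exp algebra_simps)
  have "((\<lambda>z. exp (c * z + d)) has_field_derivative c * exp (c * of_real a + d)) (at (of_real a))" for c d :: complex and a :: real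
    by (auto intro!: derivative_eq_intros)
  note h = has_vector_derivative_real_field[OF this]
  show "((\<lambda>a. mode m n (a, b)) has_vector_derivative (- \<i> * of_int m) * mode m n (a, b)) (at a within A)"
    unfolding e by (rule h)
  show "((\<lambda>b. mode m n (a, b)) has_vector_derivative (- \<i> * of_int n) * mode m n (a, b)) (at b within A)"
    unfolding e using h[of "- \<i> * of_int n" "(- \<i> * of_int m) * of_real a" b A] by (simp add: add.commute)
qed

lemma mode_periodic: "mode m n (2 * pi, b) = mode m n (0, b)" "mode m n (a, 2 * pi) = mode m n (a, 0)"
proof -
  have p: "cis (x - 2 * pi * of_int k) = cis x" for x and k :: int
    using cis_multiple_2pi[of "of_int k"] by (simp flip: cis_divide)
  have "- (of_int m * (2 * pi) + of_int n * b) = - (of_int m * 0 + of_int n * b) - 2 * pi * of_int m"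
    "- (of_int m * a + of_int n * (2 * pi)) = - (of_int m * a + of_int n * 0) - 2 * pi * of_int n" by simp_all
  then show "mode m n (2 * pi, b) = mode m n (0, b)" "mode m n (a, 2 * pi) = mode m n (a, 0)"
    unfolding mode_def fst_conv snd_conv by (simp_all only: p)
qed

text \<open>
  Integrating the equation \<open>W0 F = 0\<close> against \<open>mode m n\<close>, with integration by parts in the angles, gives
  \<open>c' = (n ff - m gg) / (2 s (1 - s)) * c\<close> for the Fourier coefficient \<open>c\<close> of \<open>F\<close> on the torus
  \<open>ss = s\<close>. Hence \<open>c exp (m \<Gamma>1 - n \<Gamma>2)\<close> is constant, and the coefficients on the two tori are equal.
\<close>

lemma annihilated_agree:
  assumes F: "smooth_S3 F S3" and ann: "\<And>p. p \<in> S3 \<Longrightarrow> dirD F p (W0 p) = 0"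
    and \<tau>: "0 < \<tau>" "\<tau> < 1/3"
    and G1: "\<And>s. s \<in> {1/6<..<5/6} \<Longrightarrow> (\<Gamma>1 has_real_derivative gg s / (2 * (s * (1 - s)))) (at s)"
    and G2: "\<And>s. s \<in> {1/6<..<5/6} \<Longrightarrow> (\<Gamma>2 has_real_derivative ff s / (2 * (s * (1 - s)))) (at s)"
    and loop: "\<Gamma>1 (1/2 - \<tau>) = \<Gamma>1 (1/2 + \<tau>)" "\<Gamma>2 (1/2 - \<tau>) = \<Gamma>2 (1/2 + \<tau>)"
    and t: "t \<in> tbox"
  shows "F (scale_pt (1/2 + \<tau>) (torus_pt t)) = F (scale_pt (1/2 - \<tau>) (torus_pt t))"
proof -
  define E where "E x = F (sgn x)" for x
  define DE where "DE y v = frechet_derivative E (at y) v" for y v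
  let ?U = "{1/6<..<5/6::real}"
  let ?pt = "\<lambda>s t. scale_pt s (torus_pt t)"
  have cone: "ray_cone S3 = - {0}" by (auto simp: norm_sgn)
  have sE: "smooth_on E (- {0})" using F unfolding smooth_S3_def E_def[abs_def] cone .
  have EF: "E p = F p" if "p \<in> S3" for p using that by (simp add: E_def)
  have dE: "(E has_derivative DE y) (at y)" if "y \<noteq> 0" for y
    using smooth_on_has_derivative[OF sE, of y] that by (simp add: DE_def[abs_def])
  have linE: "linear (DE y)" if "y \<noteq> 0" for y
    using has_derivative_bounded_linear[OF dE[OF that]] bounded_linear.linear by blast
  have cE: "continuous_on (- {0}) E" by (rule smooth_on_continuous[OF sE])
  have cDE: "continuous_on (- {0}) (\<lambda>y. DE y v)" for v
    unfolding DE_def by (rule smooth_on_continuous[OF smooth_on_frechet[OF sE]])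
  have DE_sum: "DE y v = (\<Sum>j\<in>UNIV. of_real (v $ j) * DE y (axis j 1))" if "y \<noteq> 0" for y v
  proof -
    have "(\<Sum>j\<in>UNIV. (v $ j) *\<^sub>R axis j 1) = v" using basis_expansion[of v] by (simp add: scalar_mult_eq_scaleR)
    then have "DE y v = DE y (\<Sum>j\<in>UNIV. (v $ j) *\<^sub>R axis j 1)" by simp
    also have "\<dots> = (\<Sum>j\<in>UNIV. of_real (v $ j) * DE y (axis j 1))"
      unfolding linear_sum[OF linE[OF that]] linear_scale[OF linE[OF that]] by (simp add: scaleR_conv_of_real)
    finally show ?thesis .
  qed
  have dirD_DE: "dirD F p (cvec v) = DE p v" if "p \<in> S3" for p v
  proof -
    have "dirD F p (cvec v) = (\<Sum>j\<in>UNIV. of_real (v $ j) * DE p (axis j 1))"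
      by (simp add: dirD_def DE_def E_def[abs_def])
    also have "\<dots> = DE p v" by (rule DE_sum[OF in_S3(2)[OF that], symmetric])
    finally show ?thesis .
  qed
  have pS: "?pt s t \<in> S3" "?pt s t \<noteq> 0" if "s \<in> ?U" for s t
    using scale_pt_S3(1)[of s t] that in_S3(2)[of "?pt s t"] by auto
  \<comment> \<open>The velocity of the family of tori, \<open>\<partial>\<^sub>s\<close>.\<close>
  define vs where "vs s p = (1 / (2 * s)) *\<^sub>R rad1 p - (1 / (2 * (1 - s))) *\<^sub>R rad2 p" for s p
  have key: "2 * (s * (1 - s)) * DE (?pt s t) (vs s (?pt s t)) =
      \<i> * (of_real (gg s) * DE (?pt s t) (rot1 (?pt s t)) - of_real (ff s) * DE (?pt s t) (rot2 (?pt s t)))"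
    if s: "s \<in> ?U" for s t
  proof -
    let ?p = "?pt s t"
    have p: "?p \<in> S3" "?p \<noteq> 0" using pS[OF s] by auto
    have ssp: "ss ?p = s" using scale_pt_S3(2)[of s t] s by auto
    have "dirD F ?p ((w1 ?p * w2 ?p) *s W0 ?p) = 0" using ann[OF p(1)] by (simp add: dirD_lin)
    moreover have "(w1 ?p * w2 ?p) *s W0 ?p = cvec ((1 - s) *\<^sub>R rad1 ?p - s *\<^sub>R rad2 ?p) - \<i> *s cvec (gg s *\<^sub>R rot1 ?p - ff s *\<^sub>R rot2 ?p)"
      using W0_on_torus[OF p(1)] by (simp only: ssp)
    ultimately have 1: "dirD F ?p (cvec ((1 - s) *\<^sub>R rad1 ?p - s *\<^sub>R rad2 ?p) - \<i> *s cvec (gg s *\<^sub>R rot1 ?p - ff s *\<^sub>R rot2 ?p)) = 0"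
      by (simp only:)
    have "dirD F ?p (u - \<i> *s v) = dirD F ?p u - \<i> * dirD F ?p v" for u v
      by (simp add: dirD_def sum_subtractf sum_distrib_left algebra_simps)
    from 1[unfolded this dirD_DE[OF p(1)]]
    have 0: "DE ?p ((1 - s) *\<^sub>R rad1 ?p - s *\<^sub>R rad2 ?p) - \<i> * DE ?p (gg s *\<^sub>R rot1 ?p - ff s *\<^sub>R rot2 ?p) = 0" .
    note l = linE[OF p(2)]
    have "(1 - s) *\<^sub>R rad1 ?p - s *\<^sub>R rad2 ?p = (2 * (s * (1 - s))) *\<^sub>R vs s ?p"
    proof -
      have "2 * (u * v) * (1 / (2 * u)) = v" "2 * (v * u) * (1 / (2 * u)) = v" if "u \<noteq> 0" for u v :: real using that by simp_all
      from this(1)[of s "1 - s"] this(2)[of "1 - s" s]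
      have "2 * (s * (1 - s)) * (1 / (2 * s)) = 1 - s" "2 * (s * (1 - s)) * (1 / (2 * (1 - s))) = s" using s by auto
      then show ?thesis unfolding vs_def scaleR_diff_right scaleR_scaleR by simp
    qed
    then have "DE ?p ((1 - s) *\<^sub>R rad1 ?p - s *\<^sub>R rad2 ?p) = of_real (2 * (s * (1 - s))) * DE ?p (vs s ?p)"
      by (simp only: linear_scale[OF l] scaleR_conv_of_real[where 'a=complex])
    moreover have "DE ?p (gg s *\<^sub>R rot1 ?p - ff s *\<^sub>R rot2 ?p) = of_real (gg s) * DE ?p (rot1 ?p) - of_real (ff s) * DE ?p (rot2 ?p)"
      by (simp only: linear_diff[OF l] linear_scale[OF l] scaleR_conv_of_real[where 'a=complex])
    ultimately show ?thesis using 0 by simp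
  qed
  have blr: "bounded_linear rad1" "bounded_linear rad2" "bounded_linear rot1" "bounded_linear rot2"
    by (rule linear_conv_bounded_linear[THEN iffD1], auto intro!: linearI vec4_eqI simp: rad1_def rad2_def rot1_def rot2_def axis_def algebra_simps)+
  have cpt: "continuous_on A (\<lambda>z. ?pt (f z) (g z))" if "continuous_on A f" "continuous_on A g"
    for A :: "'z::topological_space set" and f g
    unfolding scale_pt_def
    by (intro continuous_intros that bounded_linear.continuous_on[OF blr(1)] bounded_linear.continuous_on[OF blr(2)]
        continuous_on_compose2[OF continuous_torus_pt[of UNIV]]) auto
  have cDEv: "continuous_on A (\<lambda>z. DE (y z) (v z))" if "continuous_on A y" "continuous_on A v" "\<And>z. z \<in> A \<Longrightarrow> y z \<noteq> 0"
    for A :: "'z::topological_space set" and y v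
  proof -
    have "continuous_on A (\<lambda>z. \<Sum>j\<in>UNIV. complex_of_real (v z $ j) * DE (y z) (axis j 1))"
      by (intro continuous_intros that continuous_on_compose2[OF cDE]) (use that(3) in auto)
    then show ?thesis by (rule continuous_on_eq) (rule DE_sum[OF that(3), symmetric])
  qed
  have cEpt: "continuous_on A (\<lambda>t. E (?pt s t))" if "s \<in> ?U" for A s
    by (rule continuous_on_compose2[OF cE]) (use pS[OF that] in \<open>auto intro!: cpt continuous_intros\<close>)
  have der_s: "((\<lambda>s. E (?pt s t)) has_vector_derivative DE (?pt s t) (vs s (?pt s t))) (at s within ?U)" if s: "s \<in> ?U" for s t
  proof -
    have "((\<lambda>s. ?pt s t) has_derivative (\<lambda>h. h *\<^sub>R vs s (?pt s t))) (at s within ?U)"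
    proof -
      have s': "0 < s" "0 < 1 - s" using s by auto
      have d1: "(sqrt has_real_derivative inverse (sqrt s) / 2) (at s within ?U)"
        using DERIV_real_sqrt[OF s'(1)] by (rule has_field_derivative_at_within)
      have d2: "((\<lambda>s. sqrt (1 - s)) has_real_derivative inverse (sqrt (1 - s)) / 2 * -1) (at s within ?U)"
        by (rule DERIV_chain2[where f = sqrt and g = "\<lambda>s. 1 - s", OF DERIV_real_sqrt[OF s'(2)]]) (auto intro!: derivative_eq_intros)
      have "((\<lambda>s. ?pt s t) has_vector_derivative
         (inverse (sqrt s) / 2) *\<^sub>R rad1 (torus_pt t) + (inverse (sqrt (1 - s)) / 2 * -1) *\<^sub>R rad2 (torus_pt t)) (at s within ?U)"
        unfolding scale_pt_def
        using has_vector_derivative_add[OF has_vector_derivative_scaleR[OF d1 has_vector_derivative_const]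
            has_vector_derivative_scaleR[OF d2 has_vector_derivative_const]] by simp
      moreover have "(inverse (sqrt s) / 2) *\<^sub>R rad1 (torus_pt t) + (inverse (sqrt (1 - s)) / 2 * -1) *\<^sub>R rad2 (torus_pt t) = vs s (?pt s t)"
      proof -
        have q: "inverse (sqrt r) / 2 = 1 / (2 * r) * sqrt r" if "r > 0" for r
          using that by (simp add: field_simps)
        show ?thesis unfolding q[OF s'(1)] q[OF s'(2)]
          by (intro vec4_eqI) (simp_all add: vs_def scale_pt_nth)
      qed
      ultimately show ?thesis by (simp add: has_vector_derivative_def)
    qed
    from has_derivative_compose[OF this dE[OF pS(2)[OF s]]]
    show ?thesis by (simp add: has_vector_derivative_def linear_scale[OF linE[OF pS(2)[OF s]]])
  qed
  have der_a: "((\<lambda>a. E (?pt s (a, b))) has_vector_derivative DE (?pt s (a, b)) (rot1 (?pt s (a, b)))) (at a within A)"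
    and der_b: "((\<lambda>b. E (?pt s (a, b))) has_vector_derivative DE (?pt s (a, b)) (rot2 (?pt s (a, b)))) (at b within A)"
    if s: "s \<in> ?U" for s a b A
  proof -
    have ax: "((\<lambda>a. axis i (f a) :: real^4) has_derivative (\<lambda>h. axis i (h * f'))) (at a within A)"
      if "(f has_real_derivative f') (at a within A)" for f f' a i
    proof -
      have "bounded_linear (axis i :: real \<Rightarrow> real^4)"
        by (rule linear_conv_bounded_linear[THEN iffD1]) (auto intro!: linearI simp: vec_eq_iff axis_def)
      from bounded_linear.has_derivative[OF this that[unfolded has_field_derivative_def]]
      show ?thesis by (simp add: mult.commute)
    qed
    have sc: "((\<lambda>a. ?pt s (a, b)) has_derivative (\<lambda>h. h *\<^sub>R rot1 (?pt s (a, b)))) (at a within A)"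
    proof -
      have "((\<lambda>a. axis 1 (sqrt s * cos a) + axis 2 (sqrt s * sin a) + sqrt (1 - s) *\<^sub>R rad2 (torus_pt (0, b))) has_derivative
         (\<lambda>h. axis 1 (h * (sqrt s * - sin a)) + axis 2 (h * (sqrt s * cos a)) + 0)) (at a within A)"
        by (intro has_derivative_add ax has_derivative_const) (auto intro!: derivative_eq_intros)
      moreover have "?pt s (a, b) = axis 1 (sqrt s * cos a) + axis 2 (sqrt s * sin a) + sqrt (1 - s) *\<^sub>R rad2 (torus_pt (0, b))" for a
        by (intro vec4_eqI) (simp_all add: scale_pt_nth torus_pt_nth axis_def)
      moreover have "axis 1 (h * (sqrt s * - sin a)) + axis 2 (h * (sqrt s * cos a)) + 0 = h *\<^sub>R rot1 (?pt s (a, b))" for h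
        by (intro vec4_eqI) (simp_all add: rot1_def scale_pt_nth torus_pt_nth axis_def)
      ultimately show ?thesis by simp
    qed
    from has_derivative_compose[OF this dE[OF pS(2)[OF s]]]
    show "((\<lambda>a. E (?pt s (a, b))) has_vector_derivative DE (?pt s (a, b)) (rot1 (?pt s (a, b)))) (at a within A)"
      by (simp add: has_vector_derivative_def linear_scale[OF linE[OF pS(2)[OF s]]])
    have sc2: "((\<lambda>b. ?pt s (a, b)) has_derivative (\<lambda>h. h *\<^sub>R rot2 (?pt s (a, b)))) (at b within A)"
    proof -
      have "((\<lambda>b. axis 3 (sqrt (1 - s) * cos b) + axis 4 (sqrt (1 - s) * sin b) + sqrt s *\<^sub>R rad1 (torus_pt (a, 0))) has_derivative
         (\<lambda>h. axis 3 (h * (sqrt (1 - s) * - sin b)) + axis 4 (h * (sqrt (1 - s) * cos b)) + 0)) (at b within A)"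
        by (intro has_derivative_add ax has_derivative_const) (auto intro!: derivative_eq_intros)
      moreover have "?pt s (a, b) = axis 3 (sqrt (1 - s) * cos b) + axis 4 (sqrt (1 - s) * sin b) + sqrt s *\<^sub>R rad1 (torus_pt (a, 0))" for b
        by (intro vec4_eqI) (simp_all add: scale_pt_nth torus_pt_nth axis_def)
      moreover have "axis 3 (h * (sqrt (1 - s) * - sin b)) + axis 4 (h * (sqrt (1 - s) * cos b)) + 0 = h *\<^sub>R rot2 (?pt s (a, b))" for h
        by (intro vec4_eqI) (simp_all add: rot2_def scale_pt_nth torus_pt_nth axis_def)
      ultimately show ?thesis by simp
    qed
    from has_derivative_compose[OF this dE[OF pS(2)[OF s]]]
    show "((\<lambda>b. E (?pt s (a, b))) has_vector_derivative DE (?pt s (a, b)) (rot2 (?pt s (a, b)))) (at b within A)"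
      by (simp add: has_vector_derivative_def linear_scale[OF linE[OF pS(2)[OF s]]])
  qed
  have crot: "continuous_on A (\<lambda>t. DE (?pt s t) (rot1 (?pt s t)))" "continuous_on A (\<lambda>t. DE (?pt s t) (rot2 (?pt s t)))"
    if s: "s \<in> ?U" for A s
    by (intro cDEv cpt continuous_intros bounded_linear.continuous_on[OF blr(3)] bounded_linear.continuous_on[OF blr(4)] pS(2)[OF s])+
  define c where "c m n s = integral tbox (\<lambda>t. E (?pt s t) * mode m n t)" for m n s
  have ibp: "integral tbox (\<lambda>t. DE (?pt s t) (rot1 (?pt s t)) * mode m n t) = \<i> * of_int m * c m n s"
    "integral tbox (\<lambda>t. DE (?pt s t) (rot2 (?pt s t)) * mode m n t) = \<i> * of_int n * c m n s" if s: "s \<in> ?U" for m n s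
  proof -
    have i0: "(\<lambda>t. E (?pt s t) * mode m n t) integrable_on tbox"
      by (intro integrable_continuous continuous_on_mult cEpt[OF s] continuous_mode)
    have i1: "(\<lambda>t. DE (?pt s t) (rot1 (?pt s t)) * mode m n t) integrable_on tbox"
      "(\<lambda>t. DE (?pt s t) (rot2 (?pt s t)) * mode m n t) integrable_on tbox"
      by (intro integrable_continuous continuous_on_mult crot[OF s] continuous_mode)+
    \<comment> \<open>Derivatives of a periodic function in the two angles, whose integrals over a period vanish.\<close>
    define h1 where "h1 t = DE (?pt s t) (rot1 (?pt s t)) * mode m n t - (\<i> * of_int m) * (E (?pt s t) * mode m n t)" for t
    define h2 where "h2 t = DE (?pt s t) (rot2 (?pt s t)) * mode m n t - (\<i> * of_int n) * (E (?pt s t) * mode m n t)" for t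
    have ch: "continuous_on tbox h1" "continuous_on tbox h2" unfolding h1_def[abs_def] h2_def[abs_def]
      by (intro continuous_intros continuous_on_mult crot[OF s] cEpt[OF s] continuous_mode)+
    have per: "?pt s (2 * pi, b) = ?pt s (0, b)" "?pt s (a, 2 * pi) = ?pt s (a, 0)" for a b
      by (simp_all add: torus_pt_def)
    have z1: "integral (cbox 0 (2 * pi)) (\<lambda>a. h1 (a, b)) = 0" for b
    proof -
      have "((\<lambda>a. E (?pt s (a, b)) * mode m n (a, b)) has_vector_derivative h1 (a, b)) (at a within {0..2 * pi})" for a
        using has_vector_derivative_mult[OF der_a[OF s] mode_deriv(1)[of m n b a "{0..2 * pi}"]]
        by (simp add: h1_def algebra_simps)
      then have "((\<lambda>a. h1 (a, b)) has_integral (E (?pt s (2 * pi, b)) * mode m n (2 * pi, b) - E (?pt s (0, b)) * mode m n (0, b))) {0..2 * pi}"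
        by (intro fundamental_theorem_of_calculus) auto
      then show ?thesis unfolding per mode_periodic by (simp add: integral_unique)
    qed
    have z2: "integral (cbox 0 (2 * pi)) (\<lambda>b. h2 (a, b)) = 0" for a
    proof -
      have "((\<lambda>b. E (?pt s (a, b)) * mode m n (a, b)) has_vector_derivative h2 (a, b)) (at b within {0..2 * pi})" for b
        using has_vector_derivative_mult[OF der_b[OF s] mode_deriv(2)[of m n a b "{0..2 * pi}"]]
        by (simp add: h2_def algebra_simps)
      then have "((\<lambda>b. h2 (a, b)) has_integral (E (?pt s (a, 2 * pi)) * mode m n (a, 2 * pi) - E (?pt s (a, 0)) * mode m n (a, 0))) {0..2 * pi}"
        by (intro fundamental_theorem_of_calculus) auto
      then show ?thesis unfolding per mode_periodic by (simp add: integral_unique)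
    qed
    have "integral tbox h2 = 0" unfolding integral_prod_continuous[OF ch(2)] z2 by simp
    moreover have "integral tbox h1 = 0"
    proof -
      have "integral tbox h1 = integral (cbox 0 (2 * pi)) (\<lambda>a. integral (cbox 0 (2 * pi)) (\<lambda>b. h1 (a, b)))"
        by (rule integral_prod_continuous[OF ch(1)])
      also have "\<dots> = integral (cbox 0 (2 * pi)) (\<lambda>b. integral (cbox 0 (2 * pi)) (\<lambda>a. h1 (a, b)))"
        by (rule integral_swap_continuous) (use ch(1) in simp)
      also have "\<dots> = 0" unfolding z1 by simp
      finally show ?thesis .
    qed
    moreover have "integral tbox h1 = integral tbox (\<lambda>t. DE (?pt s t) (rot1 (?pt s t)) * mode m n t) - \<i> * of_int m * c m n s"
      unfolding h1_def c_def by (subst integral_diff[OF i1(1) integrable_on_mult_right[OF i0]]) simp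
    moreover have "integral tbox h2 = integral tbox (\<lambda>t. DE (?pt s t) (rot2 (?pt s t)) * mode m n t) - \<i> * of_int n * c m n s"
      unfolding h2_def c_def by (subst integral_diff[OF i1(2) integrable_on_mult_right[OF i0]]) simp
    ultimately show "integral tbox (\<lambda>t. DE (?pt s t) (rot1 (?pt s t)) * mode m n t) = \<i> * of_int m * c m n s"
      "integral tbox (\<lambda>t. DE (?pt s t) (rot2 (?pt s t)) * mode m n t) = \<i> * of_int n * c m n s" by simp_all
  qed
  have dc: "(c m n has_vector_derivative of_real ((- of_int m * gg s + of_int n * ff s) / (2 * (s * (1 - s)))) * c m n s) (at s within ?U)"
    if s: "s \<in> ?U" for m n s
  proof -
    have "(c m n has_vector_derivative integral tbox (\<lambda>t. DE (?pt s t) (vs s (?pt s t)) * mode m n t)) (at s within ?U)"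
      unfolding c_def[abs_def]
    proof (rule leibniz_rule_vector_derivative)
      fix r t assume r: "r \<in> ?U"
      show "((\<lambda>s. E (?pt s t) * mode m n t) has_vector_derivative DE (?pt r t) (vs r (?pt r t)) * mode m n t) (at r within ?U)"
        using has_vector_derivative_mult[OF der_s[OF r] has_vector_derivative_const[of "mode m n t"]] by simp
      show "(\<lambda>t. E (?pt r t) * mode m n t) integrable_on tbox"
        by (intro integrable_continuous continuous_on_mult cEpt[OF r] continuous_mode)
    next
      have "continuous_on (?U \<times> tbox) (\<lambda>z. DE (?pt (fst z) (snd z)) (vs (fst z) (?pt (fst z) (snd z))))"
      proof (rule cDEv)
        show "continuous_on (?U \<times> tbox) (\<lambda>z. ?pt (fst z) (snd z))" by (intro cpt continuous_intros)
        show "continuous_on (?U \<times> tbox) (\<lambda>z. vs (fst z) (?pt (fst z) (snd z)))"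
          unfolding vs_def
          by (intro continuous_intros cpt bounded_linear.continuous_on[OF blr(1)] bounded_linear.continuous_on[OF blr(2)]) auto
      qed (use pS in auto)
      then show "continuous_on (?U \<times> tbox) (\<lambda>(s, t). DE (?pt s t) (vs s (?pt s t)) * mode m n t)"
        unfolding case_prod_beta
        by (intro continuous_on_mult continuous_on_compose2[OF continuous_mode[of UNIV]] continuous_intros) auto
    qed (use s in auto)
    moreover have "integral tbox (\<lambda>t. DE (?pt s t) (vs s (?pt s t)) * mode m n t) =
       of_real ((- of_int m * gg s + of_int n * ff s) / (2 * (s * (1 - s)))) * c m n s"
    proof -
      define l where "l = complex_of_real (2 * (s * (1 - s)))"
      have l: "l \<noteq> 0" using s by (auto simp: l_def)
      have e: "DE (?pt s t) (vs s (?pt s t)) * mode m n t =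
        (\<i> * of_real (gg s) / l) * (DE (?pt s t) (rot1 (?pt s t)) * mode m n t) + (- \<i> * of_real (ff s) / l) * (DE (?pt s t) (rot2 (?pt s t)) * mode m n t)" for t
      proof -
        have "l * DE (?pt s t) (vs s (?pt s t)) = \<i> * (of_real (gg s) * DE (?pt s t) (rot1 (?pt s t)) - of_real (ff s) * DE (?pt s t) (rot2 (?pt s t)))"
          using key[OF s, of t] unfolding l_def of_real_mult of_real_diff of_real_1 of_real_numeral .
        then have "DE (?pt s t) (vs s (?pt s t)) = \<i> * (of_real (gg s) * DE (?pt s t) (rot1 (?pt s t)) - of_real (ff s) * DE (?pt s t) (rot2 (?pt s t))) / l"
          using l by (simp add: nonzero_eq_divide_eq mult.commute)
        then show ?thesis using l by (simp only:) (simp add: divide_simps algebra_simps)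
      qed
      have i1: "(\<lambda>t. DE (?pt s t) (rot1 (?pt s t)) * mode m n t) integrable_on tbox"
        "(\<lambda>t. DE (?pt s t) (rot2 (?pt s t)) * mode m n t) integrable_on tbox"
        by (intro integrable_continuous continuous_on_mult crot[OF s] continuous_mode)+
      have "integral tbox (\<lambda>t. DE (?pt s t) (vs s (?pt s t)) * mode m n t) =
        (\<i> * of_real (gg s) / l) * (\<i> * of_int m * c m n s) + (- \<i> * of_real (ff s) / l) * (\<i> * of_int n * c m n s)"
        unfolding e integral_add[OF integrable_on_mult_right[OF i1(1)] integrable_on_mult_right[OF i1(2)]] integral_mult_right ibp[OF s] ..
      also have "\<dots> = of_real (- of_int m * gg s + of_int n * ff s) / l * c m n s"
        using l by (simp add: divide_simps) (simp add: algebra_simps)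
      finally show ?thesis by (simp add: l_def)
    qed
    ultimately show ?thesis by simp
  qed
  have ceq: "c m n (1/2 + \<tau>) = c m n (1/2 - \<tau>)" for m n
  proof -
    define \<psi> where "\<psi> s = c m n s * of_real (exp (of_int m * \<Gamma>1 s - of_int n * \<Gamma>2 s))" for s
    have "(\<psi> has_vector_derivative 0) (at s within ?U)" if s: "s \<in> ?U" for s
    proof -
      define k where "k = (of_int m * gg s - of_int n * ff s) / (2 * (s * (1 - s)))"
      have "((\<lambda>s. exp (of_int m * \<Gamma>1 s - of_int n * \<Gamma>2 s)) has_real_derivative exp (of_int m * \<Gamma>1 s - of_int n * \<Gamma>2 s) * k) (at s within ?U)"
        by (rule has_field_derivative_at_within)
           (auto intro!: derivative_eq_intros G1[OF s] G2[OF s] simp: k_def diff_divide_distrib mult.commute)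
      then have "((\<lambda>s. complex_of_real (exp (of_int m * \<Gamma>1 s - of_int n * \<Gamma>2 s))) has_vector_derivative of_real (exp (of_int m * \<Gamma>1 s - of_int n * \<Gamma>2 s) * k)) (at s within ?U)"
        by (intro has_vector_derivative_of_real) (simp add: has_real_derivative_iff_has_vector_derivative)
      from has_vector_derivative_mult[OF dc[OF s] this]
      have "(\<psi> has_vector_derivative c m n s * of_real (exp (of_int m * \<Gamma>1 s - of_int n * \<Gamma>2 s) * k) +
         of_real ((- of_int m * gg s + of_int n * ff s) / (2 * (s * (1 - s)))) * c m n s * of_real (exp (of_int m * \<Gamma>1 s - of_int n * \<Gamma>2 s))) (at s within ?U)"
        unfolding \<psi>_def[abs_def] .
      moreover have K: "(- of_int m * gg s + of_int n * ff s) / (2 * (s * (1 - s))) = - k"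
        unfolding k_def minus_divide_left by simp
      ultimately show ?thesis unfolding K by simp
    qed
    then obtain q where q: "\<And>s. s \<in> ?U \<Longrightarrow> \<psi> s = q"
      using has_vector_derivative_zero_constant[of ?U \<psi>] by auto
    have "\<psi> (1/2 + \<tau>) = \<psi> (1/2 - \<tau>)" using q[of "1/2 + \<tau>"] q[of "1/2 - \<tau>"] \<tau> by auto
    then show ?thesis unfolding \<psi>_def loop by simp
  qed
  have U: "1/2 + \<tau> \<in> ?U" "1/2 - \<tau> \<in> ?U" using \<tau> by auto
  have csc: "continuous_on A (\<lambda>x. E (scale_pt s x))" if "s \<in> ?U" "A \<subseteq> torus_pt ` tbox" for A s
  proof (rule continuous_on_compose2[OF cE])
    show "continuous_on A (scale_pt s)" unfolding scale_pt_def[abs_def]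
      by (intro continuous_intros bounded_linear.continuous_on[OF blr(1)] bounded_linear.continuous_on[OF blr(2)])
    show "scale_pt s ` A \<subseteq> - {0}" using pS(2)[OF that(1)] that(2) by auto
  qed
  have "fourier_zero (\<lambda>x. E (scale_pt (1/2 + \<tau>) x) - E (scale_pt (1/2 - \<tau>) x))"
    unfolding fourier_zero_def
  proof (intro conjI allI)
    show "continuous_on (torus_pt ` tbox) (\<lambda>x. E (scale_pt (1/2 + \<tau>) x) - E (scale_pt (1/2 - \<tau>) x))"
      by (intro continuous_on_diff csc U order_refl)
    fix m n
    have i: "(\<lambda>t. E (?pt s t) * mode m n t) integrable_on tbox" if "s \<in> ?U" for s
      by (intro integrable_continuous continuous_on_mult cEpt[OF that] continuous_mode)
    have "integral tbox (\<lambda>t. (E (?pt (1/2 + \<tau>) t) - E (?pt (1/2 - \<tau>) t)) * mode m n t) = c m n (1/2 + \<tau>) - c m n (1/2 - \<tau>)"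
      unfolding c_def left_diff_distrib by (rule integral_diff[OF i[OF U(1)] i[OF U(2)]])
    then show "integral tbox (\<lambda>t. (E (?pt (1/2 + \<tau>) t) - E (?pt (1/2 - \<tau>) t)) * mode m n t) = 0" using ceq by simp
  qed
  from fourier_zero_imp_zero[OF this t]
  show ?thesis using EF[OF pS(1)[OF U(1)]] EF[OF pS(1)[OF U(2)]] by simp
qed

text \<open>
  The standard structure annihilates the conjugate coordinates, which separate points. Composed with an
  equivalence they would be annihilated by \<open>H0\<close> and still separate points, contrary to
  \<open>annihilated_agree\<close>.
\<close>

lemma H0_not_standard: "\<not> CR_equivalent H0 std_CR"
proof
  assume "CR_equivalent H0 std_CR"
  then obtain \<phi> where d: "diffeo_S3 \<phi>" and H: "\<And>p. p \<in> S3 \<Longrightarrow> dirD_vec (\<lambda>x. cvec (\<phi> x)) p ` H0 p = std_CR (\<phi> p)"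
    by (auto simp: CR_equivalent_def)
  have s\<phi>: "smooth_S3 \<phi> S3" using d by (simp add: diffeo_S3_def)
  obtain \<psi> where \<psi>: "\<And>p. p \<in> S3 \<Longrightarrow> \<psi> (\<phi> p) = p" using d unfolding diffeo_S3_def by blast
  have co: "smooth_S3 (\<lambda>x. complex_of_real (\<phi> x $ i)) S3" for i
    by (rule smooth_S3_bounded_linear[OF open_S3_UNIV bounded_linear_coord s\<phi>])
  have dco: "diffS (\<lambda>x. complex_of_real (\<phi> x $ i)) p" if "p \<in> S3" for i p by (rule smooth_S3_diffS[OF co that that])
  define F1 where "F1 x = complex_of_real (\<phi> x $ 1) + (- \<i>) * of_real (\<phi> x $ 2)" for x
  define F2 where "F2 x = complex_of_real (\<phi> x $ 3) + (- \<i>) * of_real (\<phi> x $ 4)" for x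
  have sF: "smooth_S3 F1 S3" "smooth_S3 F2 S3" unfolding F1_def[abs_def] F2_def[abs_def]
    by (intro smooth_S3_add smooth_S3_mult smooth_S3_const co open_S3_UNIV)+
  have ann: "dirD F1 p (W0 p) = 0" "dirD F2 p (W0 p) = 0" if p: "p \<in> S3" for p
  proof -
    let ?V = "dirD_vec (\<lambda>x. cvec (\<phi> x)) p (W0 p)"
    have "?V \<in> std_CR (\<phi> p)" using H[OF p] by (auto simp: H0_def vec.span_base)
    then obtain k where k: "?V = k *s (cnj (w2 (\<phi> p)) *s del_w1 - cnj (w1 (\<phi> p)) *s del_w2)"
      by (auto simp: std_CR_def vec.span_singleton)
    have z: "pairing (cnjv dw1) ?V = 0" "pairing (cnjv dw2) ?V = 0" unfolding k by (simp_all add: pairing_simps)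
    have V: "?V $ i = dirD (\<lambda>x. complex_of_real (\<phi> x $ i)) p (W0 p)" for i by (simp add: dirD_vec_def)
    have e: "pairing (cnjv dw1) v = v $ 1 + (- \<i>) * v $ 2" "pairing (cnjv dw2) v = v $ 3 + (- \<i>) * v $ 4" for v
      by (simp_all add: pairing_def sum_4 dw1_def dw2_def axis_def)
    have md: "diffS (\<lambda>x. (- \<i>) * complex_of_real (\<phi> x $ i)) p" for i by (intro diffS_mult diffS_const dco p)
    show "dirD F1 p (W0 p) = 0" "dirD F2 p (W0 p) = 0"
      using z unfolding e V F1_def[abs_def] F2_def[abs_def] dirD_add[OF dco[OF p] md] dirD_cmult[OF dco[OF p]] .
  qed
  show False
  proof (rule ex_loop)
    fix \<tau> \<Gamma>1 \<Gamma>2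
    assume a: "0 < \<tau>" "\<tau> < 1/3"
      "\<And>s. s \<in> {1/6<..<5/6} \<Longrightarrow> (\<Gamma>1 has_real_derivative gg s / (2 * (s * (1 - s)))) (at s)"
      "\<And>s. s \<in> {1/6<..<5/6} \<Longrightarrow> (\<Gamma>2 has_real_derivative ff s / (2 * (s * (1 - s)))) (at s)"
      "\<Gamma>1 (1/2 - \<tau>) = \<Gamma>1 (1/2 + \<tau>)" "\<Gamma>2 (1/2 - \<tau>) = \<Gamma>2 (1/2 + \<tau>)"
    define p q where "p = scale_pt (1/2 + \<tau>) (torus_pt (0, 0))" "q = scale_pt (1/2 - \<tau>) (torus_pt (0, 0))"
    note pq = this
    have t: "(0, 0) \<in> tbox" by (simp add: cbox_Pair_eq)
    have F: "F1 p = F1 q" "F2 p = F2 q"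
      unfolding pq by (rule annihilated_agree[OF sF(1) ann(1) a t] annihilated_agree[OF sF(2) ann(2) a t]; assumption)+
    have r: "0 \<le> 1/2 + \<tau>" "1/2 + \<tau> \<le> 1" "0 \<le> 1/2 - \<tau>" "1/2 - \<tau> \<le> 1" using a(1,2) by linarith+
    have S: "p \<in> S3" "q \<in> S3" "ss p = 1/2 + \<tau>" "ss q = 1/2 - \<tau>"
      unfolding pq by (rule scale_pt_S3[OF r(1,2)] scale_pt_S3[OF r(3,4)])+
    have "\<phi> p = \<phi> q"
    proof (rule vec4_eqI)
      show "\<phi> p $ 1 = \<phi> q $ 1" using arg_cong[OF F(1), of Re] by (simp add: F1_def)
      show "\<phi> p $ 2 = \<phi> q $ 2" using arg_cong[OF F(1), of Im] by (simp add: F1_def)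
      show "\<phi> p $ 3 = \<phi> q $ 3" using arg_cong[OF F(2), of Re] by (simp add: F2_def)
      show "\<phi> p $ 4 = \<phi> q $ 4" using arg_cong[OF F(2), of Im] by (simp add: F2_def)
    qed
    then have "p = q" by (metis \<psi> S(1,2))
    then have "1/2 + \<tau> = 1/2 - \<tau>" using S(3,4) by metis
    then show False using a(1) by simp
  qed
qed

theorem theorem1p1:
  shows "\<exists>H. CR_structure H \<and> \<not> CR_equivalent H std_CR \<and>
    (\<exists>\<theta>. associated_contact_form H \<theta> \<and> Levi_positive H \<theta> \<and>
      (\<exists>u :: nat \<Rightarrow> real^4 \<Rightarrow> real.
         (\<forall>k. CR_Yamabe_solution H \<theta> (u k)) \<and>
         filterlim (\<lambda>k. SUP p\<in>S3. u k p) at_top sequentially))"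
proof -
  have "\<exists>u. CR_Yamabe_solution H0 theta0 u \<and> real k \<le> (SUP p\<in>S3. u p)" for k
  proof -
    obtain \<beta> I X X1 X2 where \<beta>: "\<beta> \<ge> kk * (real k)\<^sup>2" "\<beta> > 0"
      and X: "open I" "{0..1} \<subseteq> I" "smooth_on X I" "X 0 = 1" "radial_solution \<beta> I X X1 X2"
      using ex_radial_solutions by blast
    define u where "u p = sqrt (\<beta> / kk) * X (ss p)" for p
    have sol: "CR_Yamabe_solution H0 theta0 u"
      unfolding u_def[abs_def] by (rule CR_Yamabe_of_radial_solution[OF \<beta>(2) X(2,3,1,5)])
    \<comment> \<open>A point of the circle \<open>w\<^sub>1 = 0\<close>, where \<open>X\<close> is evaluated at \<open>0\<close>.\<close>
    define e :: "real^4" where "e = axis 3 1"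
    have e: "e \<in> S3" "ss e = 0" by (simp_all add: e_def ss_def axis_def norm_eq_sqrt_inner inner_vec_def sum_4)
    have "continuous_on S3 (\<lambda>x. u (sgn x))"
      by (rule continuous_on_subset[OF smooth_on_continuous])
         (use sol in \<open>auto simp: CR_Yamabe_solution_def smooth_S3_def norm_sgn\<close>)
    then have "continuous_on S3 u" by (rule continuous_on_eq) simp
    then have "bdd_above (u ` S3)"
      by (intro bounded_imp_bdd_above compact_imp_bounded compact_continuous_image compact_sphere)
    then have "u e \<le> (SUP p\<in>S3. u p)" using e by (intro cSUP_upper)
    moreover have "real k \<le> u e"
    proof -
      have "(real k)\<^sup>2 \<le> \<beta> / kk" using \<beta> kk_pos by (simp add: pos_le_divide_eq mult.commute)
      then show ?thesis unfolding u_def e(2) X(4) by (simp add: real_le_rsqrt)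
    qed
    ultimately show ?thesis using sol by (intro exI[of _ u]) linarith
  qed
  then obtain u :: "nat \<Rightarrow> real^4 \<Rightarrow> real" where u: "\<And>k. CR_Yamabe_solution H0 theta0 (u k)" "\<And>k. real k \<le> (SUP p\<in>S3. u k p)"
    by metis
  have "filterlim (\<lambda>k. SUP p\<in>S3. u k p) at_top sequentially"
    by (rule filterlim_at_top_mono[OF filterlim_real_sequentially]) (simp add: u)
  then show ?thesis
    using CR_structure_H0 H0_not_standard associated_theta0 Levi_positive_theta0 u(1) by blast
qed

end
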